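(* Let $d\ge2$. (1) Let $p\in[1,2)\cup\left(2+\frac1{d-1},\infty\right]$. Then there is no constant $C<\infty$, independent of $R$, such that $$\|\mathcal{F}_\sigma u\|_{L^p(\mathbb{R}^{2d})}\le C\,\|L_{\mathcal{F}_\sigma u}\|_{\mathcal{S}_p}$$ holds for all $R\ge1$, all $z_0\in\mathbb{R}^{2d}$ and all $u\in\mathcal{E}'(\mathbb{R}^{2d})$ with $\operatorname{supp}u\subset\overline{B(z_0,R)}$. (2) Let $p\in\left[1,2-\frac1d\right)\cup(2,\infty]$. Then there is no constant $C<\infty$, independent of $R$, such that $$\|L_{\mathcal{F}_\sigma u}\|_{\mathcal{S}_p}\le C\,\|\mathcal{F}_\sigma u\|_{L^p(\mathbb{R}^{2d})}$$ holds for all $R\ge1$, all $z_0\in\mathbb{R}^{2d}$ and all $u\in\mathcal{E}'(\mathbb{R}^{2d})$ with $\operatorname{supp}u\subset\overline{B(z_0,R)}$.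
   Context: Inequalities are read in $[0,\infty]$. Symplectic Fourier transform: for $z=(x,\xi),\,w=(y,\eta)\in\mathbb{R}^{d}\times\mathbb{R}^d$ let $\sigma(w,z)=\eta\cdot x-y\cdot\xi$ and, for $F\in\mathcal{S}(\mathbb{R}^{2d})$ (Schwartz space), $\mathcal{F}_\sigma F(w)=(2\pi)^{-d}\int_{\mathbb{R}^{2d}}F(z)e^{-i\sigma(w,z)}\,dz$. It extends to tempered distributions by $\langle\mathcal{F}_\sigma u,\varphi\rangle=\langle u,(\mathcal{F}_\sigma\varphi)(-\,\cdot)\rangle$, and $\mathcal{F}_\sigma^2=\mathrm{Id}$. $\mathcal{E}'$ denotes compactly supported distributions; if $u\in\mathcal{E}'$, then $\mathcal{F}_\sigma u$ is a smooth function. Integrated Schrödinger representation: $[\rho(x,\xi)g](t)=e^{-\frac i2x\cdot\xi}e^{it\cdot\xi}g(t-x)$ for $g\in L^2(\mathbb{R}^d)$, and $\rho(F)=(2\pi)^{-d}\int_{\mathbb{R}^{2d}}F(z)\rho(z)\,dz$ for $F\in L^1(\mathbb{R}^{2d})$. For $u\in\mathcal{S}'(\mathbb{R}^{2d})$, $\rho(u):\mathcal{S}(\mathbb{R}^d)\to\mathcal{S}'(\mathbb{R}^d)$ is the continuous operator with Schwartz kernel $k_u(t,x)=(2\pi)^{-d}(\mathcal{F}_2u)\left(t-x,-\frac{t+x}2\right)$, where $\mathcal{F}_2u(y,\eta)=\int_{\mathbb{R}^d} u(y,\xi)e^{-i\eta\cdot\xi}\,d\xi$ in the sense of distributions; that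 is, $\langle\rho(u)\psi,\phi\rangle=\langle k_u,\phi\otimes\psi\rangle$ with bilinear pairings. Weyl operator: $L_a=\rho(\mathcal{F}_\sigma a)$ for $a\in\mathcal{S}'(\mathbb{R}^{2d})$; hence $L_{\mathcal{F}_\sigma u}=\rho(u)$. Schatten classes: $\mathcal{S}_p$, $1\le p<\infty$, is the Schatten class of compact operators on $L^2(\mathbb{R}^d)$ with $\|A\|_{\mathcal{S}_p}=(\sum_j s_j(A)^p)^{1/p}$, where the $s_j(A)$ are the singular values; $\mathcal{S}_\infty$ is the space of all bounded operators on $L^2(\mathbb{R}^d)$ with the operator norm. For an operator that does not extend to an element of $\mathcal{S}_p$, put $\|A\|_{\mathcal{S}_p}=\infty$. *)

theory Defs
  imports "HOL-Analysis.Analysis" "HOL-Probability.Essential_Supremum"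
begin

section \<open>Schwartz functions and tempered distributions\<close>

text \<open>The multi-index derivatives are indexed by lists of basis vectors (with repetitions).\<close>

fun iter_deriv :: "'a::euclidean_space list \<Rightarrow> ('a \<Rightarrow> complex) \<Rightarrow> 'a \<Rightarrow> complex" where
  "iter_deriv [] f = f"
| "iter_deriv (v # vs) f = (\<lambda>x. frechet_derivative (iter_deriv vs f) (at x) v)"

definition smooth :: "('a::euclidean_space \<Rightarrow> complex) \<Rightarrow> bool" where
  "smooth f \<longleftrightarrow> (\<forall>vs \<in> lists Basis. \<forall>x. iter_deriv vs f differentiable (at x))"

definition schwartz :: "('a::euclidean_space \<Rightarrow> complex) set" where
  "schwartz = {f. smooth f \<and>
     (\<forall>N. \<forall>vs \<in> lists Basis. bounded (range (\<lambda>x. (1 + norm x) ^ N *\<^sub>R iter_deriv vs f x)))}"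

definition schwartz_norm :: "nat \<Rightarrow> ('a::euclidean_space \<Rightarrow> complex) \<Rightarrow> real" where
  "schwartz_norm N f =
     (SUP (vs, x) \<in> {vs \<in> lists Basis. length vs \<le> N} \<times> UNIV.
        (1 + norm x) ^ N * cmod (iter_deriv vs f x))"

text \<open>Distributions are functions on all of \<open>'a \<Rightarrow> complex\<close>, but only their values on
  \<^const>\<open>schwartz\<close> are meaningful and ever used; \<open>u \<phi>\<close> is the bilinear pairing. The seminorms
  \<^const>\<open>schwartz_norm\<close> are increasing in \<open>N\<close>, so one of them suffices for continuity.\<close>

definition tempered :: "(('a::euclidean_space \<Rightarrow> complex) \<Rightarrow> complex) \<Rightarrow> bool" where
  "tempered u \<longleftrightarrow>
     (\<forall>\<phi> \<in> schwartz. \<forall>\<psi> \<in> schwartz. u (\<lambda>x. \<phi> x + \<psi> x) = u \<phi> + u \<psi>) \<and>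
     (\<forall>\<phi> \<in> schwartz. \<forall>c. u (\<lambda>x. c * \<phi> x) = c * u \<phi>) \<and>
     (\<exists>C N. \<forall>\<phi> \<in> schwartz. cmod (u \<phi>) \<le> C * schwartz_norm N \<phi>)"

definition test_functions :: "'a::euclidean_space set \<Rightarrow> ('a \<Rightarrow> complex) set" where
  "test_functions U =
     {\<phi>. smooth \<phi> \<and> compact (closure {x. \<phi> x \<noteq> 0}) \<and> closure {x. \<phi> x \<noteq> 0} \<subseteq> U}"

definition dist_supp :: "(('a::euclidean_space \<Rightarrow> complex) \<Rightarrow> complex) \<Rightarrow> 'a set" where
  "dist_supp u = - \<Union>{U. open U \<and> (\<forall>\<phi> \<in> test_functions U. u \<phi> = 0)}"

text \<open>A compactly supported distribution extends uniquely to a tempered one; it is identified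
  with this extension.\<close>

definition compactly_supported_dist :: "(('a::euclidean_space \<Rightarrow> complex) \<Rightarrow> complex) \<Rightarrow> bool" where
  "compactly_supported_dist u \<longleftrightarrow> tempered u \<and> compact (dist_supp u)"

definition represents ::
    "('a::euclidean_space \<Rightarrow> complex) \<Rightarrow> (('a \<Rightarrow> complex) \<Rightarrow> complex) \<Rightarrow> bool" where
  "represents F u \<longleftrightarrow>
     (\<forall>\<phi> \<in> schwartz. integrable lborel (\<lambda>z. F z * \<phi> z) \<and> u \<phi> = (LINT z|lborel. F z * \<phi> z))"


section \<open>The symplectic Fourier transform\<close>

type_synonym 'd phase_space = "(real^'d) \<times> (real^'d)"

definition sympl :: "'d::finite phase_space \<Rightarrow> 'd phase_space \<Rightarrow> real" where
  "sympl w z = snd w \<bullet> fst z - fst w \<bullet> snd z"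

definition sympl_fourier ::
    "('d::finite phase_space \<Rightarrow> complex) \<Rightarrow> 'd phase_space \<Rightarrow> complex" where
  "sympl_fourier F w =
     (LINT z|lborel. F z * exp (- \<i> * of_real (sympl w z))) / of_real ((2 * pi) ^ CARD('d))"

definition sympl_fourier_dist ::
    "(('d::finite phase_space \<Rightarrow> complex) \<Rightarrow> complex) \<Rightarrow> ('d phase_space \<Rightarrow> complex) \<Rightarrow> complex" where
  "sympl_fourier_dist u \<phi> = u (\<lambda>w. sympl_fourier \<phi> (- w))"

text \<open>For compactly supported \<open>u\<close>, the distribution \<^term>\<open>sympl_fourier_dist u\<close> is given by a
  unique smooth function.\<close>

definition sympl_fourier_fun ::
    "(('d::finite phase_space \<Rightarrow> complex) \<Rightarrow> complex) \<Rightarrow> 'd phase_space \<Rightarrow> complex" where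
  "sympl_fourier_fun u = (THE F. smooth F \<and> represents F (sympl_fourier_dist u))"


section \<open>The integrated Schroedinger representation and Weyl operators\<close>

definition fourier2 ::
    "('d::finite phase_space \<Rightarrow> complex) \<Rightarrow> 'd phase_space \<Rightarrow> complex" where
  "fourier2 F = (\<lambda>(y, \<eta>). LINT \<xi>|lborel. F (y, \<xi>) * exp (- \<i> * of_real (\<eta> \<bullet> \<xi>)))"

definition fourier2_dist ::
    "(('d::finite phase_space \<Rightarrow> complex) \<Rightarrow> complex) \<Rightarrow> ('d phase_space \<Rightarrow> complex) \<Rightarrow> complex" where
  "fourier2_dist u \<Phi> = u (fourier2 \<Phi>)"

text \<open>The distribution \<open>(2 * pi) ^ (- d) * (F2 u) (t - x, - (t + x) / 2)\<close> in \<open>(t, x)\<close>, where \<open>F2\<close> is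
  \<^const>\<open>fourier2_dist\<close>. The substitution \<open>(y, \<eta>) = (t - x, - (t + x) / 2)\<close> has Jacobian of absolute
  value 1 and inverse \<open>(t, x) = (y / 2 - \<eta>, - y / 2 - \<eta>)\<close>.\<close>

definition schroedinger_kernel ::
    "(('d::finite phase_space \<Rightarrow> complex) \<Rightarrow> complex) \<Rightarrow> ((real^'d) \<times> (real^'d) \<Rightarrow> complex) \<Rightarrow> complex" where
  "schroedinger_kernel u \<Phi> =
     fourier2_dist u (\<lambda>(y, \<eta>). \<Phi> ((1/2) *\<^sub>R y - \<eta>, - (1/2) *\<^sub>R y - \<eta>)) / of_real ((2 * pi) ^ CARD('d))"

text \<open>\<open>rho u \<psi> \<phi>\<close> is the pairing of the tempered distribution \<open>rho u \<psi>\<close> with \<open>\<phi>\<close>.\<close>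

definition rho ::
    "(('d::finite phase_space \<Rightarrow> complex) \<Rightarrow> complex) \<Rightarrow>
     (real^'d \<Rightarrow> complex) \<Rightarrow> (real^'d \<Rightarrow> complex) \<Rightarrow> complex" where
  "rho u \<psi> \<phi> = schroedinger_kernel u (\<lambda>(t, x). \<phi> t * \<psi> x)"

definition weyl ::
    "(('d::finite phase_space \<Rightarrow> complex) \<Rightarrow> complex) \<Rightarrow>
     (real^'d \<Rightarrow> complex) \<Rightarrow> (real^'d \<Rightarrow> complex) \<Rightarrow> complex" where
  "weyl a = rho (sympl_fourier_dist a)"


section \<open>Lebesgue norms\<close>

definition epowr :: "ennreal \<Rightarrow> real \<Rightarrow> ennreal" where
  "epowr x r = (if x = top then top else ennreal (enn2real x powr r))"

definition Lp_norm :: "ennreal \<Rightarrow> ('a::euclidean_space \<Rightarrow> complex) \<Rightarrow> ennreal" where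
  "Lp_norm p F =
     (if p = top then esssup lborel (\<lambda>z. ennreal (cmod (F z)))
      else epowr (\<integral>\<^sup>+ z. ennreal (cmod (F z) powr enn2real p) \<partial>lborel) (1 / enn2real p))"


section \<open>Operators on \<open>L\<^sup>2\<close> and Schatten norms\<close>

text \<open>Elements of \<open>L\<^sup>2\<close> are represented by functions; operators act on representatives and
  are linear, and equal to one another, up to null sets.\<close>

definition L2 :: "('a::euclidean_space \<Rightarrow> complex) set" where
  "L2 = {f. f \<in> borel_measurable lborel \<and> integrable lborel (\<lambda>x. (cmod (f x))\<^sup>2)}"

definition L2_inner :: "('a::euclidean_space \<Rightarrow> complex) \<Rightarrow> ('a \<Rightarrow> complex) \<Rightarrow> complex" where
  "L2_inner f g = (LINT x|lborel. f x * cnj (g x))"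

definition L2_norm :: "('a::euclidean_space \<Rightarrow> complex) \<Rightarrow> real" where
  "L2_norm f = sqrt (LINT x|lborel. (cmod (f x))\<^sup>2)"

type_synonym 'a operator = "('a \<Rightarrow> complex) \<Rightarrow> ('a \<Rightarrow> complex)"

definition L2_bounded_op :: "'a::euclidean_space operator \<Rightarrow> bool" where
  "L2_bounded_op A \<longleftrightarrow>
     (\<forall>f \<in> L2. A f \<in> L2) \<and>
     (\<forall>f \<in> L2. \<forall>g \<in> L2. AE x in lborel. A (\<lambda>x. f x + g x) x = A f x + A g x) \<and>
     (\<forall>f \<in> L2. \<forall>c. AE x in lborel. A (\<lambda>x. c * f x) x = c * A f x) \<and>
     (\<exists>C. \<forall>f \<in> L2. L2_norm (A f) \<le> C * L2_norm f)"

definition L2_op_norm :: "'a::euclidean_space operator \<Rightarrow> ennreal" where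
  "L2_op_norm A = (SUP f \<in> {f \<in> L2. L2_norm f \<le> 1}. ennreal (L2_norm (A f)))"

definition L2_compact_op :: "'a::euclidean_space operator \<Rightarrow> bool" where
  "L2_compact_op A \<longleftrightarrow> L2_bounded_op A \<and>
     (\<forall>f. (\<forall>n::nat. f n \<in> L2 \<and> L2_norm (f n) \<le> 1) \<longrightarrow>
        (\<exists>g \<in> L2. \<exists>r. strict_mono r \<and> (\<lambda>n. L2_norm (\<lambda>x. A (f (r n)) x - g x)) \<longlonglongrightarrow> 0))"

definition L2_adjoint :: "'a::euclidean_space operator \<Rightarrow> 'a operator" where
  "L2_adjoint A =
     (SOME B. L2_bounded_op B \<and> (\<forall>f \<in> L2. \<forall>g \<in> L2. L2_inner (A f) g = L2_inner f (B g)))"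

text \<open>The singular values of \<open>A\<close> are the square roots \<open>s\<close> of the eigenvalues of \<open>A* A\<close>; the
  multiplicity of \<open>s\<close> is the (Hilbert space) dimension of the eigenspace, computed modulo null
  sets as the largest size of an orthonormal family.\<close>

definition singular_space :: "'a::euclidean_space operator \<Rightarrow> real \<Rightarrow> ('a \<Rightarrow> complex) set" where
  "singular_space A s =
     {f \<in> L2. AE x in lborel. L2_adjoint A (A f) x = of_real (s\<^sup>2) * f x}"

definition singular_mult :: "'a::euclidean_space operator \<Rightarrow> real \<Rightarrow> ennreal" where
  "singular_mult A s =
     (SUP n \<in> {n::nat. \<exists>e. (\<forall>i<n. e i \<in> singular_space A s) \<and>
                  (\<forall>i<n. \<forall>j<n. L2_inner (e i) (e j) = (if i = j then 1 else 0))}. of_nat n)"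

definition schatten_norm :: "ennreal \<Rightarrow> 'a::euclidean_space operator \<Rightarrow> ennreal" where
  "schatten_norm p A =
     (if p = top then (if L2_bounded_op A then L2_op_norm A else top)
      else if L2_compact_op A
        then epowr (\<Sum>\<^sub>\<infinity>s\<in>{0<..}. singular_mult A s * ennreal (s powr enn2real p)) (1 / enn2real p)
      else top)"

text \<open>An operator \<open>T\<close> from \<^const>\<open>schwartz\<close> to tempered distributions, given by the pairings
  \<open>T \<psi> \<phi>\<close>, has at most one bounded extension to \<open>L\<^sup>2\<close> (up to null sets), so the infimum runs over
  equal values; it is \<open>top\<close> if there is no such extension.\<close>

definition extends_to :: "(('a::euclidean_space \<Rightarrow> complex) \<Rightarrow> ('a \<Rightarrow> complex) \<Rightarrow> complex) \<Rightarrow>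
    'a operator \<Rightarrow> bool" where
  "extends_to T A \<longleftrightarrow> L2_bounded_op A \<and>
     (\<forall>\<psi> \<in> schwartz. \<forall>\<phi> \<in> schwartz. T \<psi> \<phi> = (LINT x|lborel. A \<psi> x * \<phi> x))"

definition schatten_norm_ext ::
    "ennreal \<Rightarrow> (('a::euclidean_space \<Rightarrow> complex) \<Rightarrow> ('a \<Rightarrow> complex) \<Rightarrow> complex) \<Rightarrow> ennreal" where
  "schatten_norm_ext p T = (INF A \<in> {A. extends_to T A}. schatten_norm p A)"

end

theory Submission
  imports Defs "HOL-Real_Asymp.Real_Asymp" "HOL-Probability.Probability" "HOL-Complex_Analysis.Great_Picard"
begin

text \<open>Let \<open>\<tau>\<close> be a product of tents and \<open>T\<close> its Fourier transform, a product of squared sinc functions.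
  The counterexamples are \<open>u(y, \<xi>) = \<tau>(y/R) \<tau>(\<xi>) exp(- i \<theta> y\<cdot>\<xi>)\<close> for \<open>\<theta> = 0\<close> and \<open>\<theta> = 1/2\<close>. Up to the
  factor \<open>(2\<pi>)\<^sup>-\<^sup>d\<close>, the operator has the kernel \<open>\<tau>((t - x)/R) T((t + x)/2 - \<theta>(t - x))\<close> and the symbol is
  \<open>\<integral> \<tau>(y/R) T(\<theta>y - x) exp(- i \<eta>\<cdot>y) dy\<close>.

  For \<open>\<theta> = 0\<close> the symbol is \<open>T(x) R\<^sup>d T(R\<eta>)\<close>, with \<open>L\<^sup>p\<close> norm of order \<open>R\<close> to the power \<open>d - d/p\<close>. The
  operator is bounded uniformly in \<open>R\<close> by Schur's test, its squared Hilbert--Schmidt norm is at most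
  \<open>R\<^sup>d\<close>, and it moves about \<open>R\<^sup>d\<close> disjoint unit cubes to functions whose norms are bounded below; so its
  \<open>S\<^sub>p\<close> norm has order \<open>R\<close> to the power \<open>d/p\<close>. This rules out (1) for \<open>p > 2\<close> and (2) for \<open>p < 2\<close>.

  For \<open>\<theta> = 1/2\<close> the kernel \<open>\<tau>((t - x)/R) T(x)\<close> is nearly of rank one, and all \<open>S\<^sub>p\<close> norms have order
  \<open>R\<close> to the power \<open>d/2\<close>, while the symbol is bounded and lives on a set of measure \<open>R\<^sup>d\<close>, so that its
  \<open>L\<^sup>p\<close> norm has order \<open>R\<close> to the power \<open>d/p\<close>. This rules out (1) for \<open>p < 2\<close> and (2) for \<open>p > 2\<close>.\<close>

subsection \<open>Fourier integrals\<close>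

text \<open>Tents are preferred to smooth cutoffs because everything about them is explicit:
  \<open>tau\<close> and \<open>Tau\<close> are nonnegative, so the kernels show no cancellation;
  \<open>Tau\<close> is integrable, so inversion applies; and \<open>tau\<close> is a convolution of
  two cubes, which later factors an operator. The slope \<theta> = 1/2 is the one for which (t +
  x)/2 - \<theta>(t - x) does not depend on t.

  Three obstacles shape the rest. The operator is built by letting the symplectic transform act
  twice on a test function, so its square must be the identity on the functions that arise there,
  and integrability and continuity are what is proved about them. The norm of an operator given by
  pairings is an infimum over extensions, so a lower bound must hold for each of them. Finally,
  Schatten norms are defined through eigenspaces of A* A, so a lower bound needs actual singular
  vectors. They are extracted one at a time by compactness, as long as the energy of A on an
  orthonormal family is too large for those already found.\<close>

lemma norm_exp_minus_i [simp]: "norm (exp (- (\<i> * complex_of_real t))) = 1"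
  using norm_exp_i_times[of "- t"] by simp

section \<open>Integrals of products over the coordinates\<close>

lemma
  fixes f :: "'a::euclidean_space \<Rightarrow> real \<Rightarrow> 'c::{real_normed_field,banach,second_countable_topology}"
  assumes int: "\<And>b. b \<in> Basis \<Longrightarrow> integrable lborel (f b)"
  shows integrable_lborel_prod: "integrable lborel (\<lambda>x::'a. \<Prod>b\<in>Basis. f b (x \<bullet> b))"
    and integral_lborel_prod: "(LINT x|lborel. (\<Prod>b\<in>Basis. f b (x \<bullet> b))) = (\<Prod>b\<in>Basis. LINT t|lborel. f b t)"
proof -
  interpret product_sigma_finite "\<lambda>_::'a. lborel :: real measure" by standard
  have [measurable]: "f b \<in> borel_measurable borel" if "b \<in> Basis" for b
    using int[OF that] by (auto simp: integrable_iff_bounded)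
  have m: "(\<lambda>x::'a. \<Prod>b\<in>Basis. f b (x \<bullet> b)) \<in> borel_measurable borel"
    by measurable
  have eq: "(\<Prod>b\<in>Basis. f b ((\<Sum>c\<in>Basis. x c *\<^sub>R c) \<bullet> b)) = (\<Prod>b\<in>Basis. f b (x b))" for x :: "'a \<Rightarrow> real"
    by (intro prod.cong) auto
  have mm: "(\<lambda>f. \<Sum>b\<in>Basis. f b *\<^sub>R b) \<in> (\<Pi>\<^sub>M b\<in>Basis. lborel) \<rightarrow>\<^sub>M (borel :: 'a measure)"
    by measurable
  show "integrable lborel (\<lambda>x::'a. \<Prod>b\<in>Basis. f b (x \<bullet> b))"
    apply (subst lborel_eq)
    apply (subst integrable_distr_eq[OF mm])
    using m apply simp
    unfolding eq by (intro product_integrable_prod int) auto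
  show "(LINT x|lborel. (\<Prod>b\<in>Basis. f b (x \<bullet> b))) = (\<Prod>b\<in>Basis. LINT t|lborel. f b t)"
    apply (subst lborel_eq)
    apply (subst integral_distr[OF mm])
    using m apply simp
    unfolding eq by (intro product_integral_prod int) auto
qed

text \<open>A product over coordinates instead of a power of 1 + norm: the reciprocal is then a
  tensor product with the explicit integral \<open>pi ^ DIM('a)\<close>. The same weight serves for
  Schwartz decay, for Fubini with ambiguity functions, and for balancing the Hilbert--Schmidt
  factors at \<theta> = 1/2.\<close>

definition cauchy_weight :: "'a::euclidean_space \<Rightarrow> real" where
  "cauchy_weight x = (\<Prod>b\<in>Basis. 1 + (x \<bullet> b)\<^sup>2)"

lemma cauchy_weight_ge_1: "1 \<le> cauchy_weight x"
  unfolding cauchy_weight_def by (intro prod_ge_1) auto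

lemma cauchy_weight_pos [simp]: "0 < cauchy_weight x" "cauchy_weight x \<noteq> 0" "0 \<le> cauchy_weight x"
  using cauchy_weight_ge_1[of x] by auto

lemma continuous_on_cauchy_weight [continuous_intros]:
  "continuous_on S f \<Longrightarrow> continuous_on S (\<lambda>x. cauchy_weight (f x))"
  unfolding cauchy_weight_def by (intro continuous_intros)

lemma measurable_cauchy_weight [measurable]: "cauchy_weight \<in> borel_measurable borel"
  by (intro borel_measurable_continuous_onI continuous_intros)

lemma cauchy_weight_le: "cauchy_weight x \<le> (1 + norm x) ^ (2 * DIM('a))" for x :: "'a::euclidean_space"
proof -
  have "cauchy_weight x \<le> (\<Prod>b\<in>(Basis::'a set). (1 + norm x) ^ 2)"
    unfolding cauchy_weight_def
  proof (intro prod_mono conjI)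
    fix b :: 'a assume b: "b \<in> Basis"
    have "(x \<bullet> b)\<^sup>2 \<le> (norm x)\<^sup>2"
      using Basis_le_norm[OF b, of x] by (metis abs_ge_zero power2_abs power_mono)
    then show "1 + (x \<bullet> b)\<^sup>2 \<le> (1 + norm x)\<^sup>2"
      using norm_ge_zero[of x] unfolding power2_sum power_one by linarith
  qed (auto intro: add_nonneg_nonneg)
  then show ?thesis by (simp add: power_mult)
qed

lemma integrable_inverse_square:
  "integrable lborel (\<lambda>x::real. 1 / (1 + x\<^sup>2))" "(LINT x|lborel. 1 / (1 + x\<^sup>2)) = pi"
  using integrable_inverse_1_plus_square LBINT_inverse_1_plus_square
  by (simp_all add: set_integrable_def set_lebesgue_integral_def interval_lebesgue_integral_def einterval_def inverse_eq_divide)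

lemma integrable_inverse_cauchy_weight: "integrable lborel (\<lambda>x::'a::euclidean_space. 1 / cauchy_weight x)"
  and integral_inverse_cauchy_weight: "(LINT x|lborel. 1 / cauchy_weight (x::'a)) = pi ^ DIM('a)"
  using integrable_lborel_prod[of "\<lambda>_::'a. \<lambda>x::real. 1 / (1 + x\<^sup>2)"]
    integral_lborel_prod[of "\<lambda>_::'a. \<lambda>x::real. 1 / (1 + x\<^sup>2)"] integrable_inverse_square
  by (simp_all add: cauchy_weight_def prod_dividef)

section \<open>Affine substitutions\<close>

lemma distr_lborel_affine:
  fixes t :: "'a::euclidean_space"
  assumes c: "c \<noteq> 0"
  shows "distr lborel borel (\<lambda>x. t + c *\<^sub>R x) = density lborel (\<lambda>_. ennreal (1 / \<bar>c\<bar> ^ DIM('a)))"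
proof -
  have "density lborel (\<lambda>_. ennreal (1 / \<bar>c\<bar> ^ DIM('a))) =
      density (density (distr lborel borel (\<lambda>x. t + c *\<^sub>R x)) (\<lambda>_. ennreal (\<bar>c\<bar> ^ DIM('a)))) (\<lambda>_. ennreal (1 / \<bar>c\<bar> ^ DIM('a)))"
    using lborel_affine[OF c, of t] by simp
  also have "\<dots> = density (distr lborel borel (\<lambda>x. t + c *\<^sub>R x)) (\<lambda>_. 1)"
    using c by (subst density_density_eq) (auto simp: ennreal_mult'[symmetric] simp del: ennreal_power)
  finally show ?thesis
    by (simp add: density_1)
qed

lemma nn_integral_affine:
  fixes t :: "'a::euclidean_space"
  assumes "c \<noteq> 0" and f [measurable]: "f \<in> borel_measurable borel"
  shows "(\<integral>\<^sup>+x. f (t + c *\<^sub>R x) \<partial>lborel) = ennreal (1 / \<bar>c\<bar> ^ DIM('a)) * (\<integral>\<^sup>+x. f x \<partial>lborel)"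
proof -
  have "(\<integral>\<^sup>+x. f (t + c *\<^sub>R x) \<partial>lborel) = (\<integral>\<^sup>+x. f x \<partial>distr lborel borel (\<lambda>x. t + c *\<^sub>R x))"
    by (subst nn_integral_distr) auto
  then show ?thesis
    by (simp add: distr_lborel_affine[OF assms(1)] nn_integral_density nn_integral_cmult)
qed

lemma integrable_affine:
  fixes t :: "'a::euclidean_space" and f :: "'a \<Rightarrow> 'b::{banach,second_countable_topology}"
  assumes c: "c \<noteq> 0"
  shows "integrable lborel (\<lambda>x. f (t + c *\<^sub>R x)) \<longleftrightarrow> integrable lborel f"
proof -
  have *: "integrable lborel (\<lambda>x. f (t + c *\<^sub>R x))" if f: "integrable lborel f" and c: "c \<noteq> 0" for f :: "'a \<Rightarrow> 'b" and t c
  proof -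
    have [measurable]: "f \<in> borel_measurable borel"
      using f by (auto simp: integrable_iff_bounded)
    show ?thesis
      using f unfolding integrable_iff_bounded
      by (subst nn_integral_affine[OF c, of "\<lambda>x. ennreal (norm (f x))"]) (auto simp: ennreal_mult_less_top)
  qed
  show ?thesis
    using *[of f c t] *[of "\<lambda>x. f (t + c *\<^sub>R x)" "1 / c" "- (1/c) *\<^sub>R t"] c
    by (auto simp: algebra_simps)
qed

lemma integral_affine:
  fixes t :: "'a::euclidean_space" and f :: "'a \<Rightarrow> 'b::{banach,second_countable_topology}"
  assumes c: "c \<noteq> 0"
  shows "(LINT x|lborel. f (t + c *\<^sub>R x)) = (LINT x|lborel. f x) /\<^sub>R \<bar>c\<bar> ^ DIM('a)"
proof (cases "integrable lborel f")
  case True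
  then have [measurable]: "f \<in> borel_measurable borel"
    by (auto simp: integrable_iff_bounded)
  have "(LINT x|lborel. f (t + c *\<^sub>R x)) = (LINT x|distr lborel borel (\<lambda>x. t + c *\<^sub>R x). f x)"
    by (subst integral_distr) auto
  then show ?thesis
    by (simp add: distr_lborel_affine[OF c] integral_density divide_inverse)
next
  case False
  then show ?thesis
    using integrable_affine[OF c, of f t] by (simp add: not_integrable_integral_eq)
qed

lemma
  fixes f :: "'a::euclidean_space \<Rightarrow> 'b::{banach,second_countable_topology}"
  shows integral_lborel_translate: "(LINT x|lborel. f (x + t)) = (LINT x|lborel. f x)"
    and integral_lborel_reflect: "(LINT x|lborel. f (t - x)) = (LINT x|lborel. f x)"
    and integrable_lborel_translate: "integrable lborel (\<lambda>x. f (x + t)) \<longleftrightarrow> integrable lborel f"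
  using integral_affine[of 1 f t] integral_affine[of "-1" f t]
    integrable_affine[of 1 f t] integrable_affine[of "-1" f t]
  by (simp_all add: add.commute)

lemma
  fixes f :: "'a::euclidean_space \<Rightarrow> ennreal"
  assumes "f \<in> borel_measurable borel"
  shows nn_integral_lborel_translate: "(\<integral>\<^sup>+x. f (x + t) \<partial>lborel) = (\<integral>\<^sup>+x. f x \<partial>lborel)"
    and nn_integral_lborel_reflect: "(\<integral>\<^sup>+x. f (t - x) \<partial>lborel) = (\<integral>\<^sup>+x. f x \<partial>lborel)"
  using nn_integral_affine[of 1 f t] nn_integral_affine[of "-1" f t] assms
  by (simp_all add: add.commute)

section \<open>The Fourier transform of Gaussians\<close>

definition FT :: "('a::euclidean_space \<Rightarrow> complex) \<Rightarrow> 'a \<Rightarrow> complex" where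
  "FT f w = (LINT x|lborel. f x * exp (- (\<i> * complex_of_real (w \<bullet> x))))"

lemma integrable_mult_exp_i:
  assumes "integrable M f" "g \<in> borel_measurable M"
  shows "integrable M (\<lambda>x. f x * exp (- (\<i> * complex_of_real (g x))))"
    and "integrable M (\<lambda>x. f x * exp (\<i> * complex_of_real (g x)))"
  using assms by (auto intro!: Bochner_Integration.integrable_bound[OF assms(1)] simp: norm_mult)

text \<open>The transform of the Gaussian is the characteristic function of the standard normal
  distribution. The parameter \<open>s\<close> enters by the substitution x -> s x, which is why
  that function is evaluated at \<open>- (w / s)\<close>.\<close>

lemma gaussian_1d:
  fixes s :: real assumes s: "0 < s"
  shows "integrable lborel (\<lambda>x::real. complex_of_real (exp (- (s * x)\<^sup>2 / 2)))"
    and "(LINT x|lborel. complex_of_real (exp (- (s * x)\<^sup>2 / 2)) * exp (- (\<i> * complex_of_real (w * x))))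
      = complex_of_real (sqrt (2 * pi) / s * exp (- (w / s)\<^sup>2 / 2))"
proof -
  have eq: "exp (- x\<^sup>2 / 2) = sqrt (2 * pi) * std_normal_density x" for x
    by (simp add: normal_density_def)
  have i0: "integrable lborel (\<lambda>x::real. complex_of_real (exp (- x\<^sup>2 / 2)))"
    unfolding eq by simp
  show 1: "integrable lborel (\<lambda>x::real. complex_of_real (exp (- (s * x)\<^sup>2 / 2)))"
    using lborel_integrable_real_affine[OF i0, of s 0] s by simp
  have "(LINT x|lborel. complex_of_real (exp (- x\<^sup>2 / 2)) * exp (\<i> * complex_of_real (t * x)))
      = complex_of_real (sqrt (2 * pi) * exp (- t\<^sup>2 / 2))" for t
  proof -
    have "char std_normal_distribution t = (LINT x|lborel. std_normal_density x *\<^sub>R exp (\<i> * complex_of_real (t * x)))"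
      unfolding char_def by (subst integral_density) (auto simp: exp_Euler cis_conv_exp)
    then have "(LINT x|lborel. std_normal_density x *\<^sub>R exp (\<i> * complex_of_real (t * x))) = complex_of_real (exp (- t\<^sup>2 / 2))"
      by (simp add: char_std_normal_distribution)
    then have "complex_of_real (sqrt (2 * pi)) * (LINT x|lborel. std_normal_density x *\<^sub>R exp (\<i> * complex_of_real (t * x))) = complex_of_real (sqrt (2 * pi) * exp (- t\<^sup>2 / 2))"
      by simp
    then show ?thesis
      unfolding eq by (simp add: scaleR_conv_of_real mult.assoc flip: integral_mult_right_zero)
  qed
  from this[of "- (w / s)"] show "(LINT x|lborel. complex_of_real (exp (- (s * x)\<^sup>2 / 2)) * exp (- (\<i> * complex_of_real (w * x))))
      = complex_of_real (sqrt (2 * pi) / s * exp (- (w / s)\<^sup>2 / 2))"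
    using s by (subst (asm) lborel_integral_real_affine[where c=s and t=0]) (auto simp: scaleR_conv_of_real field_simps)
qed

lemma gaussian_FT:
  fixes w :: "'a::euclidean_space"
  assumes s: "0 < s"
  shows "integrable lborel (\<lambda>x::'a. complex_of_real (exp (- (norm (s *\<^sub>R x))\<^sup>2 / 2)))"
    and "FT (\<lambda>x. complex_of_real (exp (- (norm (s *\<^sub>R x))\<^sup>2 / 2))) w
      = complex_of_real ((sqrt (2 * pi) / s) ^ DIM('a) * exp (- (norm (w /\<^sub>R s))\<^sup>2 / 2))"
proof -
  have n: "(norm x)\<^sup>2 = (\<Sum>b\<in>Basis. (x \<bullet> b)\<^sup>2)" for x :: 'a
    unfolding power2_norm_eq_inner by (subst euclidean_inner) (simp add: power2_eq_square)
  have e: "exp (- (norm x)\<^sup>2 / 2) = (\<Prod>b\<in>Basis. exp (- (x \<bullet> b)\<^sup>2 / 2))" for x :: 'a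
    unfolding n by (subst exp_sum[symmetric]) (auto simp: sum_negf sum_divide_distrib)
  have eq: "complex_of_real (exp (- (norm (s *\<^sub>R x))\<^sup>2 / 2)) =
    (\<Prod>b\<in>Basis. complex_of_real (exp (- (s * (x \<bullet> b))\<^sup>2 / 2)))" for x :: 'a
    unfolding e by simp
  have eq2: "exp (- (\<i> * complex_of_real (w \<bullet> x))) = (\<Prod>b\<in>Basis. exp (- (\<i> * complex_of_real ((w \<bullet> b) * (x \<bullet> b)))))" for x
    by (subst euclidean_inner) (simp add: sum_distrib_left exp_sum flip: sum_negf)
  show "integrable lborel (\<lambda>x::'a. complex_of_real (exp (- (norm (s *\<^sub>R x))\<^sup>2 / 2)))"
    unfolding eq using integrable_lborel_prod[of "\<lambda>_::'a. \<lambda>x. complex_of_real (exp (- (s * x)\<^sup>2 / 2))"] gaussian_1d(1)[OF s]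
    by simp
  have "FT (\<lambda>x. complex_of_real (exp (- (norm (s *\<^sub>R x))\<^sup>2 / 2))) w =
    (LINT x|lborel. (\<Prod>b\<in>Basis. complex_of_real (exp (- (s * (x \<bullet> b))\<^sup>2 / 2)) * exp (- (\<i> * complex_of_real ((w \<bullet> b) * (x \<bullet> b))))))"
    unfolding FT_def eq eq2 prod.distrib ..
  also have "\<dots> = (\<Prod>b\<in>Basis. complex_of_real (sqrt (2 * pi) / s * exp (- ((w \<bullet> b) / s)\<^sup>2 / 2)))"
    by (subst integral_lborel_prod[of "\<lambda>b x. complex_of_real (exp (- (s * x)\<^sup>2 / 2)) * exp (- (\<i> * complex_of_real ((w \<bullet> b) * x)))"])
       (auto simp only: gaussian_1d(2)[OF s] intro!: integrable_mult_exp_i gaussian_1d(1) s, measurable)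
  also have "\<dots> = complex_of_real ((sqrt (2 * pi) / s) ^ DIM('a) * (\<Prod>b\<in>Basis. exp (- ((w \<bullet> b) / s)\<^sup>2 / 2)))"
    by (simp only: of_real_prod[symmetric] prod.distrib prod_constant)
  also have "(\<Prod>b\<in>Basis. exp (- ((w \<bullet> b) / s)\<^sup>2 / 2)) = exp (- (norm (w /\<^sub>R s))\<^sup>2 / 2)"
  proof -
    have "(w /\<^sub>R s) \<bullet> b = (w \<bullet> b) / s" for b
      by (simp add: inverse_eq_divide)
    then show ?thesis
      by (simp only: e)
  qed
  finally show "FT (\<lambda>x. complex_of_real (exp (- (norm (s *\<^sub>R x))\<^sup>2 / 2))) w
      = complex_of_real ((sqrt (2 * pi) / s) ^ DIM('a) * exp (- (norm (w /\<^sub>R s))\<^sup>2 / 2))" .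
qed

lemma
  fixes f :: "'c \<Rightarrow> 'a::euclidean_space \<times> 'b::euclidean_space"
  assumes f [measurable]: "f \<in> borel_measurable M"
  shows borel_measurable_fst_comp [measurable (raw)]: "(\<lambda>x. fst (f x)) \<in> borel_measurable M"
    and borel_measurable_snd_comp [measurable (raw)]: "(\<lambda>x. snd (f x)) \<in> borel_measurable M"
  by (auto intro!: measurable_compose[OF f] borel_measurable_continuous_onI continuous_intros)

lemma integrable_mult_pair:
  fixes f :: "'a::euclidean_space \<Rightarrow> complex" and g :: "'b::euclidean_space \<Rightarrow> complex"
  assumes f: "integrable lborel f" and g: "integrable lborel g"
  shows "integrable (lborel \<Otimes>\<^sub>M lborel) (\<lambda>(x, y). f x * g y)"
proof (rule lborel_pair.Fubini_integrable)
  have [measurable]: "f \<in> borel_measurable borel" "g \<in> borel_measurable borel"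
    using f g by (auto simp: integrable_iff_bounded)
  show "(\<lambda>(x, y). f x * g y) \<in> borel_measurable (lborel \<Otimes>\<^sub>M lborel)"
    by measurable
qed (use f g in \<open>auto simp: norm_mult\<close>)

text \<open>The Fourier transform of \<open>gauss_cutoff n\<close>, so its mass is
  \<open>(2 * pi) ^ DIM('a)\<close> rather than 1, and the approximate identity below reproduces f
  up to this factor. \<open>Suc n\<close> keeps the width finite at n = 0.\<close>

definition gauss_kernel :: "nat \<Rightarrow> 'a::euclidean_space \<Rightarrow> real" where
  "gauss_kernel n x = (sqrt (2 * pi) * real (Suc n)) ^ DIM('a) * exp (- (norm (real (Suc n) *\<^sub>R x))\<^sup>2 / 2)"

lemma measurable_gauss_kernel [measurable]: "gauss_kernel n \<in> borel_measurable borel"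
  unfolding gauss_kernel_def by measurable

lemma gauss_kernel_nonneg: "0 \<le> gauss_kernel n x"
  unfolding gauss_kernel_def by (intro mult_nonneg_nonneg) auto

lemma has_integral_gauss: 
  "integrable lborel (\<lambda>x::'a::euclidean_space. exp (- (norm x)\<^sup>2 / 2))"
  "(LINT x|lborel. exp (- (norm (x::'a))\<^sup>2 / 2)) = sqrt (2 * pi) ^ DIM('a)"
proof -
  have *: "integrable lborel (\<lambda>x::'a. complex_of_real (exp (- (norm x)\<^sup>2 / 2)))"
    using gaussian_FT(1)[of 1] by simp
  then show "integrable lborel (\<lambda>x::'a. exp (- (norm x)\<^sup>2 / 2))"
    by (simp only: complex_of_real_integrable_eq)
  have "complex_of_real (LINT x|lborel. exp (- (norm (x::'a))\<^sup>2 / 2)) = complex_of_real (sqrt (2 * pi) ^ DIM('a))"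
    using gaussian_FT(2)[of 1 "0::'a"] unfolding FT_def by (simp flip: integral_complex_of_real)
  then show "(LINT x|lborel. exp (- (norm (x::'a))\<^sup>2 / 2)) = sqrt (2 * pi) ^ DIM('a)"
    by (simp only: of_real_eq_iff)
qed

lemma sqrt_2pi_power: "sqrt (2 * pi) ^ n * sqrt (2 * pi) ^ n = (2 * pi) ^ n"
proof -
  have "(sqrt (2 * pi) * sqrt (2 * pi)) ^ n = (2 * pi) ^ n" by simp
  then show ?thesis by (simp only: power_mult_distrib[of "sqrt (2 * pi)"])
qed

lemma integrable_gauss_kernel: "integrable lborel (gauss_kernel n :: 'a::euclidean_space \<Rightarrow> real)"
  and integral_gauss_kernel: "(LINT x|lborel. gauss_kernel n (x::'a)) = (2 * pi) ^ DIM('a)"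
proof -
  let ?g = "\<lambda>x::'a. exp (- (norm x)\<^sup>2 / 2)"
  have eq: "gauss_kernel n x = (sqrt (2 * pi) * real (Suc n)) ^ DIM('a) * ?g (0 + real (Suc n) *\<^sub>R x)" for x :: 'a
    by (simp add: gauss_kernel_def)
  have "integrable lborel (\<lambda>x. ?g (0 + real (Suc n) *\<^sub>R x))"
    by (subst integrable_affine) (use has_integral_gauss(1) in auto)
  then show "integrable lborel (gauss_kernel n :: 'a \<Rightarrow> real)"
    unfolding eq[abs_def] by simp
  have "(LINT x|lborel. ?g (0 + real (Suc n) *\<^sub>R x)) = sqrt (2 * pi) ^ DIM('a) /\<^sub>R real (Suc n) ^ DIM('a)"
    using has_integral_gauss(2) by (subst integral_affine) auto
  moreover have "(sqrt (2 * pi) * real (Suc n)) ^ DIM('a) * (sqrt (2 * pi) ^ DIM('a) /\<^sub>R real (Suc n) ^ DIM('a)) = (2 * pi) ^ DIM('a)"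
    unfolding sqrt_2pi_power[symmetric] power_mult_distrib[of "sqrt (2 * pi)"] by (simp del: of_nat_Suc)
  ultimately show "(LINT x|lborel. gauss_kernel n (x::'a)) = (2 * pi) ^ DIM('a)"
    unfolding eq integral_mult_right_zero by (simp only:)
qed

text \<open>Away from z the function may be unbounded, so it is split at a ball on which continuity
  bounds it by \<open>K\<close>. The near part is handled by rescaling the Gaussian and dominated
  convergence. For the far part integrability is enough, because the kernel tends to 0 uniformly
  outside the ball.\<close>

lemma gauss_kernel_approximates:
  fixes f :: "'a::euclidean_space \<Rightarrow> complex"
  assumes f: "integrable lborel f" and cont: "isCont f z"
  shows "(\<lambda>n. LINT x|lborel. f x * complex_of_real (gauss_kernel n (x - z))) \<longlonglongrightarrow> complex_of_real ((2 * pi) ^ DIM('a)) * f z"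
proof -
  have [measurable]: "f \<in> borel_measurable borel"
    using f by (auto simp: integrable_iff_bounded)
  obtain d where d: "d > 0" "\<And>x. dist x z < d \<Longrightarrow> dist (f x) (f z) < 1"
    using cont unfolding continuous_at_eps_delta by (metis zero_less_one)
  define K where "K = norm (f z) + 1"
  have K: "norm (f x) \<le> K" if "x \<in> ball z d" for x
    using d(2)[of x] that norm_triangle_ineq2[of "f x" "f z"] unfolding K_def by (auto simp: dist_norm norm_minus_commute)
  have K0: "K \<ge> 0" by (simp add: K_def)
  define f1 where "f1 = (\<lambda>x. indicator (ball z d) x *\<^sub>R f x)"
  define f2 where "f2 = (\<lambda>x. indicator (- ball z d) x *\<^sub>R f x)"
  have [measurable]: "f1 \<in> borel_measurable borel" "f2 \<in> borel_measurable borel"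
    unfolding f1_def f2_def by (auto intro!: borel_measurable_scaleR borel_measurable_indicator)
  let ?k = "\<lambda>n x. complex_of_real (gauss_kernel n (x - z))"
  have kb: "gauss_kernel n y \<le> (sqrt (2 * pi) * real (Suc n)) ^ DIM('a)" for n and y :: 'a
    unfolding gauss_kernel_def by (intro mult_left_le) auto
  have ik: "integrable lborel (\<lambda>x. g x * ?k n x)" if "integrable lborel g" for n g
  proof (rule Bochner_Integration.integrable_bound[OF integrable_mult_left[OF that, of "complex_of_real ((sqrt (2 * pi) * real (Suc n)) ^ DIM('a))"]])
    show "AE x in lborel. norm (g x * ?k n x) \<le> norm (g x * complex_of_real ((sqrt (2 * pi) * real (Suc n)) ^ DIM('a)))"
      using kb[of n]
      by (intro AE_I2) (auto simp: norm_mult abs_of_nonneg[OF gauss_kernel_nonneg] simp del: of_real_power of_real_mult of_nat_Suc intro!: mult_left_mono)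
  qed (use that in \<open>auto simp: integrable_iff_bounded\<close>)
  have f1i: "integrable lborel f1" and f2i: "integrable lborel f2"
    using f unfolding f1_def f2_def by (auto intro!: integrable_mult_indicator)
  have split: "(LINT x|lborel. f x * ?k n x) = (LINT x|lborel. f1 x * ?k n x) + (LINT x|lborel. f2 x * ?k n x)" for n
    unfolding Bochner_Integration.integral_add[OF ik[OF f1i] ik[OF f2i], symmetric]
    by (intro Bochner_Integration.integral_cong) (auto simp: f1_def f2_def indicator_def)
  have lim1: "(\<lambda>n. LINT x|lborel. f1 x * ?k n x) \<longlonglongrightarrow> complex_of_real ((2 * pi) ^ DIM('a)) * f z"
  proof -
    \<comment> \<open>What remains of \<open>gauss_kernel\<close> after the Jacobian of x = z + v /
      Suc n has absorbed the power of Suc n.\<close>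
    let ?g = "\<lambda>v::'a. complex_of_real (sqrt (2 * pi) ^ DIM('a) * exp (- (norm v)\<^sup>2 / 2))"
    have eq: "(LINT x|lborel. f1 x * ?k n x) = (LINT v|lborel. f1 (z + (1 / real (Suc n)) *\<^sub>R v) * ?g v)" for n
    proof -
      have "(LINT v|lborel. f1 (z + (1 / real (Suc n)) *\<^sub>R v) * ?k n (z + (1 / real (Suc n)) *\<^sub>R v)) = (LINT x|lborel. f1 x * ?k n x) /\<^sub>R (1 / real (Suc n)) ^ DIM('a)"
        by (subst integral_affine[where f="\<lambda>x. f1 x * ?k n x"]) auto
      moreover have "?k n (z + (1 / real (Suc n)) *\<^sub>R v) = complex_of_real (real (Suc n) ^ DIM('a)) * ?g v" for v
        by (simp add: gauss_kernel_def power_mult_distrib del: of_nat_Suc)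
      ultimately have "complex_of_real (real (Suc n) ^ DIM('a)) * (LINT v|lborel. f1 (z + (1 / real (Suc n)) *\<^sub>R v) * ?g v)
          = complex_of_real (real (Suc n) ^ DIM('a)) * (LINT x|lborel. f1 x * ?k n x)"
        by (simp add: scaleR_conv_of_real power_divide mult.left_commute del: of_nat_Suc)
      then show ?thesis
        by (subst (asm) mult_left_cancel) (auto simp del: of_nat_Suc)
    qed
    have gi: "integrable lborel ?g"
      using has_integral_gauss(1) by (auto simp del: of_real_mult)
    have "(\<lambda>n. LINT v|lborel. f1 (z + (1 / real (Suc n)) *\<^sub>R v) * ?g v) \<longlonglongrightarrow> (LINT v|lborel. f z * ?g v)"
    proof (rule integral_dominated_convergence[where w="\<lambda>v. K * norm (?g v)"])
      show "AE x in lborel. (\<lambda>n. f1 (z + (1 / real (Suc n)) *\<^sub>R x) * ?g x) \<longlonglongrightarrow> f z * ?g x"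
      proof (intro AE_I2 tendsto_mult tendsto_const)
        fix v :: 'a
        have lz: "(\<lambda>n. z + (1 / real (Suc n)) *\<^sub>R v) \<longlonglongrightarrow> z + 0 *\<^sub>R v"
          by (intro tendsto_intros LIMSEQ_Suc[OF lim_inverse_n'])
        then have "(\<lambda>n. f (z + (1 / real (Suc n)) *\<^sub>R v)) \<longlonglongrightarrow> f z"
          using isCont_tendsto_compose[OF cont] by simp
        moreover have "\<forall>\<^sub>F n in sequentially. f (z + (1 / real (Suc n)) *\<^sub>R v) = f1 (z + (1 / real (Suc n)) *\<^sub>R v)"
        proof -
          have "\<forall>\<^sub>F n in sequentially. z + (1 / real (Suc n)) *\<^sub>R v \<in> ball z d"
            using lz d(1) by (intro topological_tendstoD) auto
          then show ?thesis by eventually_elim (simp add: f1_def)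
        qed
        ultimately show "(\<lambda>n. f1 (z + (1 / real (Suc n)) *\<^sub>R v)) \<longlonglongrightarrow> f z"
          by (rule Lim_transform_eventually)
      qed
      show "AE x in lborel. norm (f1 (z + (1 / real (Suc n)) *\<^sub>R x) * ?g x) \<le> K * norm (?g x)" for n
        using K K0 by (intro AE_I2) (auto simp: norm_mult f1_def indicator_def simp del: of_real_mult intro!: mult_right_mono)
    qed (use gi in auto)
    moreover have "(LINT v|lborel. ?g v) = complex_of_real ((2 * pi) ^ DIM('a))"
      unfolding integral_complex_of_real using has_integral_gauss(2)[where 'a='a] sqrt_2pi_power[of "DIM('a)"]
      by (simp del: of_real_mult of_real_power)
    ultimately show ?thesis
      unfolding eq by (simp add: mult.commute del: of_real_mult)
  qed
  have lim2: "(\<lambda>n. LINT x|lborel. f2 x * ?k n x) \<longlonglongrightarrow> 0"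
  proof (rule Lim_null_comparison)
    let ?b = "\<lambda>n. (sqrt (2 * pi) * real (Suc n)) ^ DIM('a) * exp (- (real (Suc n) * d)\<^sup>2 / 2)"
    show "\<forall>\<^sub>F n in sequentially. norm (LINT x|lborel. f2 x * ?k n x) \<le> (LINT x|lborel. norm (f x)) * ?b n"
    proof (intro always_eventually allI)
      fix n
      have "norm (LINT x|lborel. f2 x * ?k n x) \<le> (LINT x|lborel. norm (f x) * ?b n)"
      proof (rule Bochner_Integration.integral_norm_bound_integral)
        fix x
        show "norm (f2 x * ?k n x) \<le> norm (f x) * ?b n"
        proof (cases "x \<in> ball z d")
          case True
          then show ?thesis by (simp add: f2_def)
        next
          case False
          then have "d \<le> norm (x - z)" by (simp add: dist_norm norm_minus_commute)
          then have "(real (Suc n) * d)\<^sup>2 \<le> (norm (real (Suc n) *\<^sub>R (x - z)))\<^sup>2"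
            using d(1) by (intro power_mono) (auto intro!: mult_left_mono simp del: of_nat_Suc)
          then have "gauss_kernel n (x - z) \<le> ?b n"
            unfolding gauss_kernel_def by (intro mult_left_mono) auto
          then show ?thesis
            using False gauss_kernel_nonneg[of n "x - z"] by (auto simp: f2_def norm_mult intro!: mult_left_mono)
        qed
      qed (use f f2i ik in auto)
      then show "norm (LINT x|lborel. f2 x * ?k n x) \<le> (LINT x|lborel. norm (f x)) * ?b n" by simp
    qed
    have "?b \<longlonglongrightarrow> 0" using d(1) by real_asymp
    then show "(\<lambda>n. (LINT x|lborel. norm (f x)) * ?b n) \<longlonglongrightarrow> 0"
      by (rule tendsto_mult_right_zero)
  qed
  show ?thesis
    unfolding split using tendsto_add[OF lim1 lim2] by simp
qed

definition gauss_cutoff :: "nat \<Rightarrow> 'a::euclidean_space \<Rightarrow> real" where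
  "gauss_cutoff n w = exp (- (norm (w /\<^sub>R real (Suc n)))\<^sup>2 / 2)"

lemma measurable_gauss_cutoff [measurable]: "gauss_cutoff n \<in> borel_measurable borel"
  unfolding gauss_cutoff_def by measurable

lemma gauss_cutoff_bounds [simp]: "0 \<le> gauss_cutoff n w" "gauss_cutoff n w \<le> 1"
  by (auto simp: gauss_cutoff_def)

lemma FT_gauss_cutoff:
  "FT (\<lambda>w. complex_of_real (gauss_cutoff n w)) x = complex_of_real (gauss_kernel n x)"
  and integrable_gauss_cutoff: "integrable lborel (\<lambda>w::'a::euclidean_space. complex_of_real (gauss_cutoff n w))"
  using gaussian_FT(2)[of "inverse (real (Suc n))" x] gaussian_FT(1)[of "inverse (real (Suc n))", where 'a='a]
  by (simp_all add: gauss_cutoff_def gauss_kernel_def divide_inverse[of _ "inverse (real (Suc n))"] del: of_nat_Suc)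

lemma gauss_cutoff_tendsto: "(\<lambda>n. gauss_cutoff n w) \<longlonglongrightarrow> 1"
proof -
  have "(\<lambda>n. exp (- (norm (inverse (real (Suc n)) *\<^sub>R w))\<^sup>2 / 2)) \<longlonglongrightarrow> exp (- (norm (0 *\<^sub>R w))\<^sup>2 / 2)"
    by (intro tendsto_intros LIMSEQ_inverse_real_of_nat) simp
  then show ?thesis by (simp add: gauss_cutoff_def)
qed

section \<open>Inversion and the Plancherel inequality\<close>

lemma FT_bound:
  assumes "integrable lborel f"
  shows "norm (FT f w) \<le> (LINT x|lborel. norm (f x))"
  unfolding FT_def
  using integrable_mult_exp_i(1)[OF assms, of "\<lambda>x. w \<bullet> x"] assms
  by (intro Bochner_Integration.integral_norm_bound_integral) (auto simp: norm_mult)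

lemma measurable_FT:
  assumes [measurable]: "f \<in> borel_measurable borel"
  shows "FT f \<in> borel_measurable (borel :: 'a::euclidean_space measure)"
  unfolding FT_def by measurable

text \<open>The double integral behind the inversion formula does not converge absolutely. A
  Gaussian cutoff in w makes it do so; Fubini then turns the cutoff integral \<open>?J n\<close>
  into an average of f against the transform of the cutoff, and the two evaluations of its limit are
  compared.\<close>

theorem FT_inversion:
  fixes f :: "'a::euclidean_space \<Rightarrow> complex"
  assumes f: "integrable lborel f" and ft: "integrable lborel (FT f)" and cont: "isCont f z"
  shows "(LINT w|lborel. FT f w * exp (\<i> * complex_of_real (z \<bullet> w))) = complex_of_real ((2 * pi) ^ DIM('a)) * f z"
proof -
  have [measurable]: "f \<in> borel_measurable borel" "FT f \<in> borel_measurable borel"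
    using f ft by (auto simp: integrable_iff_bounded)
  let ?g = "\<lambda>n w. complex_of_real (gauss_cutoff n w)"
  let ?J = "\<lambda>n. LINT w|lborel. (FT f w * exp (\<i> * complex_of_real (z \<bullet> w))) * ?g n w"
  have 1: "?J \<longlonglongrightarrow> (LINT w|lborel. FT f w * exp (\<i> * complex_of_real (z \<bullet> w)))"
  proof (rule integral_dominated_convergence[where w="\<lambda>w. norm (FT f w)"])
    show "AE x in lborel. (\<lambda>n. FT f x * exp (\<i> * complex_of_real (z \<bullet> x)) * ?g n x) \<longlonglongrightarrow> FT f x * exp (\<i> * complex_of_real (z \<bullet> x))"
    proof (intro AE_I2)
      fix x :: 'a
      show "(\<lambda>n. FT f x * exp (\<i> * complex_of_real (z \<bullet> x)) * ?g n x) \<longlonglongrightarrow> FT f x * exp (\<i> * complex_of_real (z \<bullet> x))"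
        using tendsto_mult_left[OF tendsto_of_real[OF gauss_cutoff_tendsto[of x]], of "FT f x * exp (\<i> * complex_of_real (z \<bullet> x))"]
        by simp
    qed
    show "AE x in lborel. norm (FT f x * exp (\<i> * complex_of_real (z \<bullet> x)) * ?g n x) \<le> norm (FT f x)" for n
      by (intro AE_I2) (auto simp: norm_mult intro!: mult_left_le)
  qed (use ft in auto)
  have 2: "?J n = (LINT x|lborel. f x * complex_of_real (gauss_kernel n (x - z)))" for n
  proof -
    let ?H = "\<lambda>(w, x). (?g n w * f x) * exp (\<i> * complex_of_real (z \<bullet> w - w \<bullet> x))"
    have e: "exp (\<i> * complex_of_real (z \<bullet> w)) * exp (- (\<i> * complex_of_real (w \<bullet> x))) = exp (\<i> * complex_of_real (z \<bullet> w - w \<bullet> x))" for w x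
      by (subst exp_add[symmetric]) (simp add: right_diff_distrib)
    have e2: "exp (\<i> * complex_of_real (z \<bullet> w - w \<bullet> x)) = exp (- (\<i> * complex_of_real ((x - z) \<bullet> w)))" for w x
      by (simp add: algebra_simps inner_commute)
    have H: "integrable (lborel \<Otimes>\<^sub>M lborel) ?H"
      using integrable_mult_exp_i(2)[OF integrable_mult_pair[OF integrable_gauss_cutoff[of n] f], of "\<lambda>(w, x). z \<bullet> w - w \<bullet> x"]
      by (simp add: split_beta')
    have "?J n = (LINT w|lborel. LINT x|lborel. ?H (w, x))"
      unfolding FT_def by (auto intro!: Bochner_Integration.integral_cong simp del: of_real_diff simp: e[symmetric] mult_ac simp flip: integral_mult_right_zero integral_mult_left_zero)
    also have "\<dots> = (LINT x|lborel. LINT w|lborel. ?H (w, x))"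
      using lborel_pair.Fubini_integral[of "\<lambda>w x. ?H (w, x)"] H by simp
    also have "\<dots> = (LINT x|lborel. f x * FT (?g n) (x - z))"
      unfolding FT_def by (auto intro!: Bochner_Integration.integral_cong simp del: of_real_diff simp: e2 mult_ac simp flip: integral_mult_right_zero)
    finally show ?thesis
      by (simp add: FT_gauss_cutoff)
  qed
  show ?thesis
    using LIMSEQ_unique[OF 1] gauss_kernel_approximates[OF f cont] unfolding 2 by blast
qed

text \<open>Expanding the square gives a double integral over (x, y) with phase w . (x - y). After a
  Gaussian cutoff the w-integral becomes \<open>gauss_kernel n (x - y)\<close>, whose mass in either
  variable is (2 pi)^d; this is the constant of the bound.\<close>

theorem FT_L2_bound:
  fixes f :: "'a::euclidean_space \<Rightarrow> complex"
  assumes f: "integrable lborel f" and f2: "integrable lborel (\<lambda>x. (norm (f x))\<^sup>2)"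
  shows "(\<integral>\<^sup>+w. ennreal ((norm (FT f w))\<^sup>2) \<partial>lborel) \<le> ennreal ((2 * pi) ^ DIM('a) * (LINT x|lborel. (norm (f x))\<^sup>2))"
proof -
  have [measurable]: "f \<in> borel_measurable borel"
    using f by (auto simp: integrable_iff_bounded)
  have [measurable]: "FT f \<in> borel_measurable borel" by (rule measurable_FT) simp
  let ?e = "\<lambda>n (w::'a). gauss_cutoff n w"
  let ?g = "\<lambda>n (w::'a). complex_of_real (?e n w)"
  define B where "B = (2 * pi) ^ DIM('a) * (LINT x|lborel. (norm (f x))\<^sup>2)"
  let ?F = "\<lambda>p. f (fst p) * cnj (f (snd p))"
  have F: "integrable lborel ?F"
    using integrable_mult_pair[OF f integrable_cnj[OF f]] by (simp add: lborel_prod split_beta')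
  have sq: "complex_of_real ((norm (FT f w))\<^sup>2) = (LINT p|lborel. ?F p * exp (- (\<i> * complex_of_real (w \<bullet> (fst p - snd p)))))" for w
  proof -
    let ?G = "\<lambda>p. (f (fst p) * exp (- (\<i> * complex_of_real (w \<bullet> fst p)))) * cnj (f (snd p) * exp (- (\<i> * complex_of_real (w \<bullet> snd p))))"
    have ie: "integrable lborel (\<lambda>x. f x * exp (- (\<i> * complex_of_real (w \<bullet> x))))"
      by (intro integrable_mult_exp_i f) auto
    from lborel_pair.integral_fst[OF integrable_mult_pair[OF ie integrable_cnj[OF ie]]]
    have "(LINT p|lborel. ?G p) = FT f w * cnj (FT f w)"
      unfolding FT_def lborel_prod integral_mult_right_zero integral_mult_left_zero Bochner_Integration.integral_cnj split_beta' by simp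
    moreover have "?G p = ?F p * exp (- (\<i> * complex_of_real (w \<bullet> (fst p - snd p))))" for p
      by (simp add: exp_cnj inner_diff_right right_diff_distrib exp_diff exp_minus divide_inverse mult_ac)
    ultimately show ?thesis
      by (simp only: complex_norm_square)
  qed
  have bd: "(\<integral>\<^sup>+w. ennreal ((norm (FT f w))\<^sup>2 * ?e n w) \<partial>lborel) \<le> ennreal B" for n
  proof -
    let ?H = "\<lambda>(w, p). (?g n w * ?F p) * exp (- (\<i> * complex_of_real (w \<bullet> (fst p - snd p))))"
    have H: "integrable (lborel \<Otimes>\<^sub>M lborel) ?H"
      using integrable_mult_exp_i(1)[OF integrable_mult_pair[OF integrable_gauss_cutoff[of n] F], of "\<lambda>(w, p). w \<bullet> (fst p - snd p)"]
      by (simp add: split_beta' measurable_lborel1)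
    have "(LINT w|lborel. complex_of_real ((norm (FT f w))\<^sup>2 * ?e n w)) = (LINT w|lborel. LINT p|lborel. ?H (w, p))"
      by (auto intro!: Bochner_Integration.integral_cong simp del: of_real_power simp: sq mult_ac simp flip: integral_mult_right_zero integral_mult_left_zero)
    also have "\<dots> = (LINT p|lborel. LINT w|lborel. ?H (w, p))"
      using lborel_pair.Fubini_integral[of "\<lambda>w p. ?H (w, p)"] H by simp
    also have "\<dots> = (LINT p|lborel. ?F p * FT (?g n) (fst p - snd p))"
      unfolding FT_def by (auto intro!: Bochner_Integration.integral_cong simp: inner_commute mult_ac simp flip: integral_mult_right_zero)
    finally have eq: "complex_of_real (LINT w|lborel. (norm (FT f w))\<^sup>2 * ?e n w) = (LINT p|lborel. ?F p * complex_of_real (gauss_kernel n (fst p - snd p)))"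
      by (simp add: FT_gauss_cutoff flip: integral_complex_of_real)
    have ei: "integrable lborel (?e n)"
      using integrable_gauss_cutoff[of n, where 'a='a] by (simp only: complex_of_real_integrable_eq)
    have ii: "integrable lborel (\<lambda>w. (norm (FT f w))\<^sup>2 * ?e n w)"
    proof (rule Bochner_Integration.integrable_bound[OF integrable_mult_right[OF ei, of "(LINT x|lborel. norm (f x))\<^sup>2"]])
      show "AE x in lborel. norm ((norm (FT f x))\<^sup>2 * ?e n x) \<le> norm ((LINT x|lborel. norm (f x))\<^sup>2 * ?e n x)"
        by (intro AE_I2) (auto intro!: mult_right_mono power_mono FT_bound f simp: abs_mult)
    qed auto
    let ?k = "\<lambda>p. gauss_kernel n (fst p - snd p :: 'a)"
    have "ennreal (LINT w|lborel. (norm (FT f w))\<^sup>2 * ?e n w) \<le> ennreal (norm (LINT p|lborel. ?F p * complex_of_real (?k p)))"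
      unfolding eq[symmetric] by (intro ennreal_leI) simp
    also have "\<dots> \<le> (\<integral>\<^sup>+p. ennreal (norm (?F p * complex_of_real (?k p))) \<partial>lborel)"
      using integral_norm_bound_ennreal[of lborel "\<lambda>p. ?F p * complex_of_real (?k p)"] not_integrable_integral_eq[of lborel "\<lambda>p. ?F p * complex_of_real (?k p)"]
      by (cases "integrable lborel (\<lambda>p. ?F p * complex_of_real (?k p))") auto
    \<comment> \<open>The inequality ab \<le> a^2/2 + b^2/2 decouples the two variables, and the
      kernel integrates to the same constant in each of them.\<close>
    also have "\<dots> \<le> (\<integral>\<^sup>+p. ennreal (1/2 * (norm (f (fst p)))\<^sup>2 * ?k p) + ennreal (1/2 * (norm (f (snd p)))\<^sup>2 * ?k p) \<partial>lborel)"
    proof (rule nn_integral_mono)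
      fix p :: "'a \<times> 'a"
      have "norm (f (fst p)) * norm (f (snd p)) \<le> 1/2 * (norm (f (fst p)))\<^sup>2 + 1/2 * (norm (f (snd p)))\<^sup>2"
        using sum_squares_bound[of "norm (f (fst p))" "norm (f (snd p))"] by (simp add: power2_eq_square)
      then have "norm (f (fst p)) * norm (f (snd p)) * ?k p \<le> (1/2 * (norm (f (fst p)))\<^sup>2 + 1/2 * (norm (f (snd p)))\<^sup>2) * ?k p"
        by (rule mult_right_mono) (rule gauss_kernel_nonneg)
      then show "ennreal (norm (?F p * complex_of_real (?k p))) \<le> ennreal (1/2 * (norm (f (fst p)))\<^sup>2 * ?k p) + ennreal (1/2 * (norm (f (snd p)))\<^sup>2 * ?k p)"
        using gauss_kernel_nonneg[of n "fst p - snd p"]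
        by (subst ennreal_plus[symmetric]) (auto simp: norm_mult gauss_kernel_nonneg distrib_right intro!: ennreal_leI simp del: ennreal_plus)
    qed
    also have "\<dots> = (\<integral>\<^sup>+p. ennreal (1/2 * (norm (f (fst p)))\<^sup>2 * ?k p) \<partial>lborel) + (\<integral>\<^sup>+p. ennreal (1/2 * (norm (f (snd p)))\<^sup>2 * ?k p) \<partial>lborel)"
      by (rule nn_integral_add) auto
    also have "(\<integral>\<^sup>+p. ennreal (1/2 * (norm (f (fst p)))\<^sup>2 * ?k p) \<partial>lborel) = ennreal (B / 2)"
    proof -
      have "(\<integral>\<^sup>+p. ennreal (1/2 * (norm (f (fst p)))\<^sup>2 * ?k p) \<partial>lborel) = (\<integral>\<^sup>+x. \<integral>\<^sup>+y. ennreal (1/2 * (norm (f x))\<^sup>2) * ennreal (gauss_kernel n (x - y)) \<partial>lborel \<partial>lborel)"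
        unfolding lborel_prod[symmetric] by (subst lborel.nn_integral_fst[symmetric]) (auto simp: ennreal_mult[symmetric] gauss_kernel_nonneg)
      also have "\<dots> = (\<integral>\<^sup>+x. ennreal (1/2 * (norm (f x))\<^sup>2) * (\<integral>\<^sup>+y. ennreal (gauss_kernel n (x - y)) \<partial>lborel) \<partial>lborel)"
        by (simp add: nn_integral_cmult)
      also have "\<dots> = (\<integral>\<^sup>+x. ennreal (1/2 * (norm (f x))\<^sup>2) * ennreal ((2 * pi) ^ DIM('a)) \<partial>lborel)"
        using nn_integral_lborel_reflect[of "\<lambda>y. ennreal (gauss_kernel n (y::'a))"]
        by (simp add: nn_integral_eq_integral integrable_gauss_kernel gauss_kernel_nonneg integral_gauss_kernel)
      also have "\<dots> = ennreal (LINT x|lborel. 1/2 * (norm (f x))\<^sup>2) * ennreal ((2 * pi) ^ DIM('a))"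
        using f2 by (subst nn_integral_multc, simp, subst nn_integral_eq_integral) auto
      also have "\<dots> = ennreal (B / 2)"
        by (subst ennreal_mult[symmetric]) (auto simp: B_def)
      finally show ?thesis .
    qed
    also have "(\<integral>\<^sup>+p. ennreal (1/2 * (norm (f (snd p)))\<^sup>2 * ?k p) \<partial>lborel) = ennreal (B / 2)"
    proof -
      have "(\<integral>\<^sup>+p. ennreal (1/2 * (norm (f (snd p)))\<^sup>2 * ?k p) \<partial>lborel) = (\<integral>\<^sup>+y. \<integral>\<^sup>+x. ennreal (1/2 * (norm (f y))\<^sup>2) * ennreal (gauss_kernel n (x - y)) \<partial>lborel \<partial>lborel)"
        unfolding lborel_prod[symmetric] by (subst lborel_pair.nn_integral_snd[symmetric]) (auto simp: ennreal_mult[symmetric] gauss_kernel_nonneg)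
      also have "\<dots> = (\<integral>\<^sup>+y. ennreal (1/2 * (norm (f y))\<^sup>2) * (\<integral>\<^sup>+x. ennreal (gauss_kernel n (x - y)) \<partial>lborel) \<partial>lborel)"
        by (simp add: nn_integral_cmult)
      also have "\<dots> = (\<integral>\<^sup>+x. ennreal (1/2 * (norm (f x))\<^sup>2) * ennreal ((2 * pi) ^ DIM('a)) \<partial>lborel)"
        using nn_integral_lborel_translate[of "\<lambda>y. ennreal (gauss_kernel n (y::'a))" "- y" for y]
        by (simp add: nn_integral_eq_integral integrable_gauss_kernel gauss_kernel_nonneg integral_gauss_kernel)
      also have "\<dots> = ennreal (LINT x|lborel. 1/2 * (norm (f x))\<^sup>2) * ennreal ((2 * pi) ^ DIM('a))"
        using f2 by (subst nn_integral_multc, simp, subst nn_integral_eq_integral) auto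
      also have "\<dots> = ennreal (B / 2)"
        by (subst ennreal_mult[symmetric]) (auto simp: B_def)
      finally show ?thesis .
    qed
    also have "ennreal (B / 2) + ennreal (B / 2) = ennreal B"
      by (subst ennreal_plus[symmetric]) (auto simp: B_def)
    finally show ?thesis
      by (subst nn_integral_eq_integral[OF ii]) auto
  qed
  \<comment> \<open>Fatou removes the cutoff.\<close>
  have "(\<integral>\<^sup>+w. ennreal ((norm (FT f w))\<^sup>2) \<partial>lborel) = (\<integral>\<^sup>+w. liminf (\<lambda>n. ennreal ((norm (FT f w))\<^sup>2 * ?e n w)) \<partial>lborel)"
  proof (rule nn_integral_cong)
    fix w :: 'a
    have "(\<lambda>n. ennreal ((norm (FT f w))\<^sup>2 * ?e n w)) \<longlonglongrightarrow> ennreal ((norm (FT f w))\<^sup>2 * 1)"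
      by (intro tendsto_ennrealI tendsto_mult tendsto_const gauss_cutoff_tendsto)
    then show "ennreal ((norm (FT f w))\<^sup>2) = liminf (\<lambda>n. ennreal ((norm (FT f w))\<^sup>2 * ?e n w))"
      using lim_imp_Liminf[OF trivial_limit_sequentially] by (metis mult.right_neutral)
  qed
  also have "\<dots> \<le> liminf (\<lambda>n. \<integral>\<^sup>+w. ennreal ((norm (FT f w))\<^sup>2 * ?e n w) \<partial>lborel)"
    by (intro nn_integral_liminf) auto
  also have "\<dots> \<le> ennreal B"
    by (intro order_trans[OF Liminf_le_Limsup Limsup_bounded] always_eventually allI bd) simp
  finally show ?thesis unfolding B_def .
qed

subsection \<open>Schwartz functions\<close>

lemma iter_deriv_append: "iter_deriv (vs @ ws) f = iter_deriv vs (iter_deriv ws f)"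
  by (induction vs) auto

lemma schwartz_decay:
  assumes "f \<in> schwartz"
  obtains C where "0 \<le> C" "\<And>x. (1 + norm x) ^ N * cmod (f x) \<le> C"
proof -
  have "[] \<in> lists (Basis :: 'a set)" by simp
  then have "bounded (range (\<lambda>x. (1 + norm x) ^ N *\<^sub>R iter_deriv [] f x))"
    using assms unfolding schwartz_def by blast
  then obtain C where C: "\<And>x. norm ((1 + norm x) ^ N *\<^sub>R f x) \<le> C"
    by (auto simp: bounded_iff)
  have C': "(1 + norm x) ^ N * cmod (f x) \<le> C" for x
    using C[of x] by (simp add: abs_of_nonneg)
  moreover have "0 \<le> C"
    using norm_ge_zero order_trans C by blast
  ultimately show ?thesis using that by blast
qed

lemma schwartz_differentiable:
  assumes "f \<in> schwartz"
  shows "f differentiable (at x)"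
proof -
  have "[] \<in> lists (Basis :: 'a set)" by simp
  then have "iter_deriv [] f differentiable (at x)"
    using assms unfolding schwartz_def smooth_def by blast
  then show ?thesis by simp
qed

text \<open>\<open>iter_deriv\<close> applies the last entry of its list first, so differentiating
  beforehand appends to the list.\<close>

lemma schwartz_deriv:
  assumes f: "f \<in> schwartz" and b: "b \<in> Basis"
  shows "(\<lambda>x. frechet_derivative f (at x) b) \<in> schwartz"
proof -
  have eq: "iter_deriv vs (\<lambda>x. frechet_derivative f (at x) b) = iter_deriv (vs @ [b]) f" for vs
    by (simp add: iter_deriv_append)
  have "vs @ [b] \<in> lists Basis" if "vs \<in> lists Basis" for vs
    using that b by simp
  then show ?thesis
    using f unfolding schwartz_def smooth_def mem_Collect_eq eq by blast
qed

lemma schwartz_continuous: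
  assumes "f \<in> schwartz" shows "continuous_on UNIV f"
  using differentiable_imp_continuous_within[OF schwartz_differentiable[OF assms]]
  by (intro continuous_at_imp_continuous_on) blast

lemma schwartz_measurable:
  assumes "f \<in> schwartz" shows "f \<in> borel_measurable borel"
  using schwartz_continuous[OF assms] by (rule borel_measurable_continuous_onI)

lemma schwartz_bound_cauchy:
  fixes f :: "'a::euclidean_space \<Rightarrow> complex"
  assumes "f \<in> schwartz"
  obtains C where "0 \<le> C" "\<And>x. (1 + norm x) ^ N * cmod (f x) \<le> C / cauchy_weight x"
proof -
  obtain C where C: "0 \<le> C" "\<And>x. (1 + norm x) ^ (N + 2 * DIM('a)) * cmod (f x) \<le> C"
    using schwartz_decay[OF assms] by blast
  have "(1 + norm x) ^ N * cmod (f x) \<le> C / cauchy_weight x" for x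
  proof -
    have "(1 + norm x) ^ N * cmod (f x) * cauchy_weight x \<le> (1 + norm x) ^ N * cmod (f x) * (1 + norm x) ^ (2 * DIM('a))"
      by (intro mult_left_mono cauchy_weight_le) auto
    also have "\<dots> \<le> C" using C(2)[of x] by (simp add: power_add mult_ac)
    finally show ?thesis by (simp add: field_simps)
  qed
  then show ?thesis using C(1) that by blast
qed

lemma schwartz_integrable_moment:
  fixes f :: "'a::euclidean_space \<Rightarrow> complex"
  assumes f: "f \<in> schwartz"
  shows "integrable lborel (\<lambda>x. (1 + norm x) ^ N * cmod (f x))"
proof -
  obtain C where C: "0 \<le> C" "\<And>x. (1 + norm x) ^ N * cmod (f x) \<le> C / cauchy_weight x"
    using schwartz_bound_cauchy[OF f] by blast
  have [measurable]: "f \<in> borel_measurable borel" by (rule schwartz_measurable[OF f])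
  show ?thesis
    by (rule Bochner_Integration.integrable_bound[OF integrable_mult_right[OF integrable_inverse_cauchy_weight, of C]])
       (use C in auto)
qed

lemma schwartz_integrable:
  assumes f: "f \<in> schwartz"
  shows "integrable lborel f"
  using schwartz_integrable_moment[OF f, of 0] schwartz_measurable[OF f]
  by (simp add: integrable_norm_iff)

lemma schwartz_bounded:
  assumes "f \<in> schwartz"
  obtains C where "0 \<le> C" "\<And>x. cmod (f x) \<le> C"
proof -
  obtain C where "0 \<le> C" "\<And>x. (1 + norm x) ^ 0 * cmod (f x) \<le> C"
    using schwartz_decay[OF assms] by blast
  then show ?thesis using that[of C] by simp
qed

lemma schwartz_L2:
  assumes f: "f \<in> schwartz" shows "f \<in> L2"
proof -
  have [measurable]: "f \<in> borel_measurable borel" by (rule schwartz_measurable[OF f])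
  obtain C where C: "0 \<le> C" "\<And>x. cmod (f x) \<le> C"
    using schwartz_bounded[OF f] by blast
  have "integrable lborel (\<lambda>x. (cmod (f x))\<^sup>2)"
    by (rule Bochner_Integration.integrable_bound[OF integrable_mult_right[OF integrable_norm[OF schwartz_integrable[OF f]], of C]])
       (use C in \<open>auto simp: power2_eq_square intro!: mult_right_mono order_trans[OF _ abs_ge_self]\<close>)
  then show ?thesis by (simp add: L2_def)
qed

text \<open>Integrating G' along a unit segment in direction b gives G (x + b) - G x, and
  translation invariance makes the integral of this difference vanish. This yields integration by
  parts without any limit at infinity.\<close>

lemma integral_derivative_eq_0:
  fixes G G' :: "'a::euclidean_space \<Rightarrow> complex"
  assumes G: "integrable lborel G" and G': "integrable lborel G'"
    and cont: "continuous_on UNIV G'"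
    and der: "\<And>x. (G has_derivative D x) (at x)" "\<And>x. D x b = G' x"
  shows "(LINT x|lborel. G' x) = 0"
proof -
  have [measurable]: "G' \<in> borel_measurable borel"
    using cont by (rule borel_measurable_continuous_onI)
  have ftc: "(LINT s|lborel. indicator {0..1::real} s *\<^sub>R G' (x + s *\<^sub>R b)) = G (x + b) - G x" for x
  proof -
    have "(LINT s|lborel. indicator {0..1::real} s *\<^sub>R G' (x + s *\<^sub>R b)) = G (x + 1 *\<^sub>R b) - G (x + 0 *\<^sub>R b)"
    proof (rule integral_FTC_atLeastAtMost)
      fix s :: real
      have lin: "linear (D y)" for y
        using der(1)[of y] by (meson has_derivative_linear)
      have "((\<lambda>s. G (x + s *\<^sub>R b)) has_derivative (\<lambda>t. D (x + s *\<^sub>R b) (t *\<^sub>R b))) (at s within {0..1})"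
        by (rule has_derivative_compose[where f="\<lambda>s. x + s *\<^sub>R b" and g=G]) (auto intro!: derivative_eq_intros der(1))
      then show "((\<lambda>s. G (x + s *\<^sub>R b)) has_vector_derivative G' (x + s *\<^sub>R b)) (at s within {0..1})"
        unfolding has_vector_derivative_def using linear_scale[OF lin] der(2) by simp
    next
      show "continuous_on {0..1} (\<lambda>s. G' (x + s *\<^sub>R b))"
        by (intro continuous_on_compose2[OF cont] continuous_intros) auto
    qed simp
    then show ?thesis by simp
  qed
  let ?H = "\<lambda>(s::real, x). indicator {0..1::real} s *\<^sub>R G' (x + s *\<^sub>R b)"
  have H: "integrable (lborel \<Otimes>\<^sub>M lborel) ?H"
  proof (rule lborel_pair.Fubini_integrable)
    show "AE s in lborel. integrable lborel (\<lambda>x. ?H (s, x))"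
      using G' by (auto simp: integrable_lborel_translate)
    have "(LINT x|lborel. norm (?H (s, x))) = indicator {0..1} s *\<^sub>R (LINT x|lborel. norm (G' x))" for s
      using integral_lborel_translate[of "\<lambda>x. norm (G' x)" "s *\<^sub>R b"] by simp
    then show "integrable lborel (\<lambda>s. LINT x|lborel. norm (?H (s, x)))"
      by (simp only:) simp
  qed measurable
  have "0 = (LINT x|lborel. G (x + b)) - (LINT x|lborel. G x)"
    by (simp add: integral_lborel_translate)
  also have "\<dots> = (LINT x|lborel. G (x + b) - G x)"
    using G by (simp add: integrable_lborel_translate)
  also have "\<dots> = (LINT x|lborel. LINT s|lborel. ?H (s, x))"
    by (simp add: ftc)
  also have "\<dots> = (LINT s|lborel. LINT x|lborel. ?H (s, x))"
    using lborel_pair.Fubini_integral[of "\<lambda>s x. ?H (s, x)"] H by simp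
  also have "\<dots> = (LINT s|lborel. indicator {0..1::real} s *\<^sub>R (LINT x|lborel. G' x))"
    using integral_lborel_translate[of G'] by simp
  also have "\<dots> = (LINT x|lborel. G' x)"
    by simp
  finally show ?thesis by simp
qed

text \<open>An ambiguity function. Its rapid decay justifies the Fourier inversion behind the kernel formula
  for \<^const>\<open>weyl\<close>.\<close>

definition amb :: "real \<Rightarrow> real \<Rightarrow> ('a::euclidean_space \<Rightarrow> complex) \<Rightarrow> ('a \<Rightarrow> complex) \<Rightarrow> 'a \<Rightarrow> 'a \<Rightarrow> 'a \<Rightarrow> complex" where
  "amb a b \<phi> \<psi> p q \<xi> = FT (\<lambda>z. \<phi> (p + a *\<^sub>R z) * \<psi> (q + b *\<^sub>R z)) \<xi>"

lemma amb_integrable: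
  fixes \<phi> \<psi> :: "'a::euclidean_space \<Rightarrow> complex"
  assumes \<phi>: "\<phi> \<in> schwartz" and \<psi>: "\<psi> \<in> schwartz" and a: "a \<noteq> 0"
  shows "integrable lborel (\<lambda>z. \<phi> (p + a *\<^sub>R z) * \<psi> (q + b *\<^sub>R z))"
proof -
  have [measurable]: "\<phi> \<in> borel_measurable borel" "\<psi> \<in> borel_measurable borel"
    using \<phi> \<psi> schwartz_measurable by auto
  obtain C where C: "0 \<le> C" "\<And>x. cmod (\<psi> x) \<le> C"
    using schwartz_bounded[OF \<psi>] by blast
  have "integrable lborel (\<lambda>z. \<phi> (p + a *\<^sub>R z))"
    using integrable_affine[OF a, of \<phi> p] schwartz_integrable[OF \<phi>] by simp
  then show ?thesis
    by (rule Bochner_Integration.integrable_bound[OF integrable_mult_right[of "complex_of_real C"]])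
       (use C in \<open>auto simp: norm_mult mult.commute[of C] intro!: mult_left_mono AE_I2\<close>)
qed

text \<open>The vector b p - a q equals b (p + a z) - a (q + b z) for every z, so when it is long,
  one of the two Schwartz factors is evaluated far out. The weight is thus split between an L1
  moment of \<phi> and a supremum of \<psi>, uniformly in the frequency.\<close>

lemma amb_bound:
  fixes \<phi> \<psi> :: "'a::euclidean_space \<Rightarrow> complex"
  assumes \<phi>: "\<phi> \<in> schwartz" and \<psi>: "\<psi> \<in> schwartz" and a: "a \<noteq> 0"
  shows "\<exists>C. \<forall>p q \<xi>. cmod (amb a b \<phi> \<psi> p q \<xi>) * (1 + norm (b *\<^sub>R p - a *\<^sub>R q)) ^ N \<le> C"
proof -
  have [measurable]: "\<phi> \<in> borel_measurable borel" "\<psi> \<in> borel_measurable borel"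
    using \<phi> \<psi> schwartz_measurable by auto
  obtain C where C: "0 \<le> C" "\<And>x. (1 + norm x) ^ N * cmod (\<psi> x) \<le> C"
    using schwartz_decay[OF \<psi>] by blast
  let ?f = "\<lambda>x. (1 + norm x) ^ N * cmod (\<phi> x)"
  let ?K = "(1 + \<bar>a\<bar> + \<bar>b\<bar>) ^ N"
  have "cmod (amb a b \<phi> \<psi> p q \<xi>) * (1 + norm (b *\<^sub>R p - a *\<^sub>R q)) ^ N \<le> ?K * C * ((LINT x|lborel. ?f x) / \<bar>a\<bar> ^ DIM('a))" for p q \<xi>
  proof -
    let ?W = "(1 + norm (b *\<^sub>R p - a *\<^sub>R q)) ^ N"
    let ?g = "\<lambda>z. \<phi> (p + a *\<^sub>R z) * \<psi> (q + b *\<^sub>R z)"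
    have pt: "cmod (?g z) * ?W \<le> ?K * C * ?f (p + a *\<^sub>R z)" for z
    proof -
      let ?u = "norm (p + a *\<^sub>R z)" and ?v = "norm (q + b *\<^sub>R z)"
      have "b *\<^sub>R p - a *\<^sub>R q = b *\<^sub>R (p + a *\<^sub>R z) - a *\<^sub>R (q + b *\<^sub>R z)"
        by (simp add: algebra_simps)
      then have "norm (b *\<^sub>R p - a *\<^sub>R q) \<le> \<bar>b\<bar> * ?u + \<bar>a\<bar> * ?v"
        by (metis norm_scaleR norm_triangle_ineq4)
      also have "1 + (\<bar>b\<bar> * ?u + \<bar>a\<bar> * ?v) \<le> (1 + \<bar>a\<bar> + \<bar>b\<bar>) * (1 + ?u) * (1 + ?v)"
        by (simp add: algebra_simps)
      finally have "?W \<le> ((1 + \<bar>a\<bar> + \<bar>b\<bar>) * (1 + ?u) * (1 + ?v)) ^ N"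
        by (intro power_mono) auto
      then have "cmod (?g z) * ?W \<le> cmod (?g z) * ((1 + \<bar>a\<bar> + \<bar>b\<bar>) * (1 + ?u) * (1 + ?v)) ^ N"
        by (rule mult_left_mono) simp
      also have "\<dots> = ?K * ?f (p + a *\<^sub>R z) * ((1 + ?v) ^ N * cmod (\<psi> (q + b *\<^sub>R z)))"
        by (simp add: power_mult_distrib norm_mult)
      also have "\<dots> \<le> ?K * ?f (p + a *\<^sub>R z) * C"
        by (intro mult_left_mono C) auto
      finally show ?thesis by (simp add: mult_ac)
    qed
    have "cmod (amb a b \<phi> \<psi> p q \<xi>) * ?W \<le> (LINT z|lborel. cmod (?g z)) * ?W"
      unfolding amb_def by (intro mult_right_mono FT_bound amb_integrable assms) auto
    also have "\<dots> = (LINT z|lborel. cmod (?g z) * ?W)"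
      by simp
    also have "\<dots> \<le> (LINT z|lborel. ?K * C * ?f (p + a *\<^sub>R z))"
    proof (rule integral_mono)
      show "integrable lborel (\<lambda>z. cmod (?g z) * ?W)"
        by (intro integrable_mult_left integrable_norm amb_integrable assms)
      show "integrable lborel (\<lambda>z. ?K * C * ?f (p + a *\<^sub>R z))"
        using integrable_affine[OF a, of ?f p] schwartz_integrable_moment[OF \<phi>] by (intro integrable_mult_right) auto
    qed (rule pt)
    also have "\<dots> = ?K * C * ((LINT x|lborel. ?f x) / \<bar>a\<bar> ^ DIM('a))"
      using integral_affine[OF a, of ?f p] by (simp add: divide_inverse_commute)
    finally show ?thesis .
  qed
  then show ?thesis by blast
qed

text \<open>Integration by parts in z: differentiating the exponential in direction e produces the
  factor on the left, and the chain rule in the two arguments produces a and b on the right.\<close>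

lemma amb_derivative:
  fixes \<phi> \<psi> :: "'a::euclidean_space \<Rightarrow> complex"
  assumes \<phi>: "\<phi> \<in> schwartz" and \<psi>: "\<psi> \<in> schwartz" and a: "a \<noteq> 0" and e: "e \<in> Basis"
  shows "\<i> * complex_of_real (\<xi> \<bullet> e) * amb a b \<phi> \<psi> p q \<xi> =
    complex_of_real a * amb a b (\<lambda>x. frechet_derivative \<phi> (at x) e) \<psi> p q \<xi> +
    complex_of_real b * amb a b \<phi> (\<lambda>x. frechet_derivative \<psi> (at x) e) p q \<xi>"
proof -
  let ?E = "\<lambda>z. exp (- (\<i> * complex_of_real (\<xi> \<bullet> z)))"
  let ?\<phi> = "\<lambda>x. frechet_derivative \<phi> (at x) e" and ?\<psi> = "\<lambda>x. frechet_derivative \<psi> (at x) e"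
  let ?G = "\<lambda>z. \<phi> (p + a *\<^sub>R z) * \<psi> (q + b *\<^sub>R z) * ?E z"
  let ?A = "\<lambda>z. ?\<phi> (p + a *\<^sub>R z) * \<psi> (q + b *\<^sub>R z) * ?E z"
  let ?B = "\<lambda>z. \<phi> (p + a *\<^sub>R z) * ?\<psi> (q + b *\<^sub>R z) * ?E z"
  let ?G' = "\<lambda>z. complex_of_real a * ?A z + complex_of_real b * ?B z - \<i> * complex_of_real (\<xi> \<bullet> e) * ?G z"
  note [continuous_intros] = continuous_on_compose2[OF schwartz_continuous[OF \<phi>]] continuous_on_compose2[OF schwartz_continuous[OF \<psi>]]
    continuous_on_compose2[OF schwartz_continuous[OF schwartz_deriv[OF \<phi> e]]] continuous_on_compose2[OF schwartz_continuous[OF schwartz_deriv[OF \<psi> e]]]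
  have i: "integrable lborel ?G" "integrable lborel ?A" "integrable lborel ?B"
    by (intro integrable_mult_exp_i amb_integrable schwartz_deriv assms; simp)+
  have "(LINT z|lborel. ?G' z) = 0"
  proof (rule integral_derivative_eq_0)
    show "integrable lborel ?G" by (rule i)
    show "integrable lborel ?G'"
      by (intro Bochner_Integration.integrable_diff Bochner_Integration.integrable_add integrable_mult_right i)
    show "continuous_on UNIV ?G'"
      by (intro continuous_intros) auto
    let ?D\<phi> = "\<lambda>x. frechet_derivative \<phi> (at x)" and ?D\<psi> = "\<lambda>x. frechet_derivative \<psi> (at x)"
    let ?D = "\<lambda>z v. (\<phi> (p + a *\<^sub>R z) * ?D\<psi> (q + b *\<^sub>R z) (b *\<^sub>R v) + ?D\<phi> (p + a *\<^sub>R z) (a *\<^sub>R v) * \<psi> (q + b *\<^sub>R z)) * ?E z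
        + - (\<phi> (p + a *\<^sub>R z) * \<psi> (q + b *\<^sub>R z) * ?E z * (\<i> * complex_of_real (\<xi> \<bullet> v)))"
    have d\<phi>: "(\<phi> has_derivative ?D\<phi> x) (at x)" and d\<psi>: "(\<psi> has_derivative ?D\<psi> x) (at x)" for x
      using schwartz_differentiable[OF \<phi>] schwartz_differentiable[OF \<psi>] frechet_derivative_works by blast+
    have "((\<lambda>z. \<phi> (p + a *\<^sub>R z)) has_derivative (\<lambda>v. ?D\<phi> (p + a *\<^sub>R z) (a *\<^sub>R v))) (at z)" for z
      by (rule has_derivative_compose[where f="\<lambda>z. p + a *\<^sub>R z" and g=\<phi>]) (auto intro!: derivative_eq_intros d\<phi>)
    moreover have "((\<lambda>z. \<psi> (q + b *\<^sub>R z)) has_derivative (\<lambda>v. ?D\<psi> (q + b *\<^sub>R z) (b *\<^sub>R v))) (at z)" for z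
      by (rule has_derivative_compose[where f="\<lambda>z. q + b *\<^sub>R z" and g=\<psi>]) (auto intro!: derivative_eq_intros d\<psi>)
    moreover have "(?E has_derivative (\<lambda>v. - (?E z * (\<i> * complex_of_real (\<xi> \<bullet> v))))) (at z)" for z
    proof -
      have "((\<lambda>z. - (\<i> * complex_of_real (\<xi> \<bullet> z))) has_derivative (\<lambda>v. - (\<i> * complex_of_real (\<xi> \<bullet> v)))) (at z)"
        by (auto intro!: derivative_eq_intros)
      from has_derivative_compose[OF this DERIV_exp[THEN has_field_derivative_imp_has_derivative]]
      show ?thesis by simp
    qed
    ultimately show "(?G has_derivative ?D z) (at z)" for z
      by (auto intro!: derivative_eq_intros simp: algebra_simps)
    show "?D z e = ?G' z" for z
      using linear_scale[OF has_derivative_linear[OF d\<phi>]] linear_scale[OF has_derivative_linear[OF d\<psi>]]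
      by (simp add: scaleR_conv_of_real algebra_simps)
  qed
  moreover have "(LINT z|lborel. ?G' z) = complex_of_real a * (LINT z|lborel. ?A z) + complex_of_real b * (LINT z|lborel. ?B z) - \<i> * complex_of_real (\<xi> \<bullet> e) * (LINT z|lborel. ?G z)"
    by (simp only: Bochner_Integration.integral_diff Bochner_Integration.integral_add integral_mult_right_zero
        Bochner_Integration.integrable_add integrable_mult_right i)
  ultimately show ?thesis
    unfolding amb_def FT_def by simp
qed

text \<open>Each coordinate costs two integrations by parts and gains a factor that is quadratic in
  the frequency. These steps replace \<phi> and \<psi> by derivatives, so the induction over the
  coordinates must be general in both functions.\<close>

lemma amb_decay:
  fixes \<phi> \<psi> :: "'a::euclidean_space \<Rightarrow> complex"
  assumes "finite I" "I \<subseteq> Basis" and a: "a \<noteq> 0" and "\<phi> \<in> schwartz" "\<psi> \<in> schwartz"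
  shows "\<exists>C. \<forall>p q \<xi>. cmod (amb a b \<phi> \<psi> p q \<xi>) * (\<Prod>i\<in>I. 1 + (\<xi> \<bullet> i)\<^sup>2) * (1 + norm (b *\<^sub>R p - a *\<^sub>R q)) ^ N \<le> C"
  using assms(1,2,4,5)
proof (induction I arbitrary: \<phi> \<psi> rule: finite_induct)
  case empty
  then show ?case using amb_bound[OF _ _ a] by simp
next
  case (insert e I)
  have e: "e \<in> Basis" and I: "I \<subseteq> Basis" using insert.prems by auto
  let ?d = "\<lambda>f x. frechet_derivative f (at x) e"
  have s: "?d \<phi> \<in> schwartz" "?d \<psi> \<in> schwartz" "?d (?d \<phi>) \<in> schwartz" "?d (?d \<psi>) \<in> schwartz"
    using insert.prems e by (auto intro!: schwartz_deriv)
  let ?P = "\<lambda>\<xi>. \<Prod>i\<in>I. 1 + (\<xi> \<bullet> i)\<^sup>2" and ?W = "\<lambda>p q. (1 + norm (b *\<^sub>R p - a *\<^sub>R q)) ^ N"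
  obtain C0 where C0: "\<And>p q \<xi>. cmod (amb a b \<phi> \<psi> p q \<xi>) * ?P \<xi> * ?W p q \<le> C0"
    using insert.IH[OF I insert.prems(2,3)] by blast
  obtain C1 where C1: "\<And>p q \<xi>. cmod (amb a b (?d (?d \<phi>)) \<psi> p q \<xi>) * ?P \<xi> * ?W p q \<le> C1"
    using insert.IH[OF I s(3) insert.prems(3)] by blast
  obtain C2 where C2: "\<And>p q \<xi>. cmod (amb a b (?d \<phi>) (?d \<psi>) p q \<xi>) * ?P \<xi> * ?W p q \<le> C2"
    using insert.IH[OF I s(1,2)] by blast
  obtain C3 where C3: "\<And>p q \<xi>. cmod (amb a b \<phi> (?d (?d \<psi>)) p q \<xi>) * ?P \<xi> * ?W p q \<le> C3"
    using insert.IH[OF I insert.prems(2) s(4)] by blast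
  have "cmod (amb a b \<phi> \<psi> p q \<xi>) * (\<Prod>i\<in>insert e I. 1 + (\<xi> \<bullet> i)\<^sup>2) * ?W p q \<le> C0 + a\<^sup>2 * C1 + 2 * \<bar>a * b\<bar> * C2 + b\<^sup>2 * C3" for p q \<xi>
  proof -
    let ?A = "\<lambda>f g. amb a b f g p q \<xi>" and ?w = "?P \<xi> * ?W p q"
    let ?t = "\<i> * complex_of_real (\<xi> \<bullet> e)"
    have w: "0 \<le> ?w"
      by (intro mult_nonneg_nonneg prod_nonneg) (auto intro: add_nonneg_nonneg)
    have "?t * (?t * ?A \<phi> \<psi>) = ?t * (a * ?A (?d \<phi>) \<psi> + b * ?A \<phi> (?d \<psi>))"
      using amb_derivative[OF insert.prems(2,3) a e, of \<xi> b p q] by (simp add: mult.assoc)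
    also have "\<dots> = a * (?t * ?A (?d \<phi>) \<psi>) + b * (?t * ?A \<phi> (?d \<psi>))"
      by (simp add: algebra_simps)
    also have "\<dots> = a * (a * ?A (?d (?d \<phi>)) \<psi> + b * ?A (?d \<phi>) (?d \<psi>)) + b * (a * ?A (?d \<phi>) (?d \<psi>) + b * ?A \<phi> (?d (?d \<psi>)))"
      using amb_derivative[OF s(1) insert.prems(3) a e, of \<xi> b p q] amb_derivative[OF insert.prems(2) s(2) a e, of \<xi> b p q] by (simp add: mult.assoc)
    also have "\<dots> = a\<^sup>2 * ?A (?d (?d \<phi>)) \<psi> + 2 * (a * b) * ?A (?d \<phi>) (?d \<psi>) + b\<^sup>2 * ?A \<phi> (?d (?d \<psi>))"
      by (simp add: algebra_simps power2_eq_square)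
    finally have eq: "?t * (?t * ?A \<phi> \<psi>) = \<dots>" .
    have "(\<xi> \<bullet> e)\<^sup>2 * cmod (?A \<phi> \<psi>) = cmod (?t * (?t * ?A \<phi> \<psi>))"
      by (simp add: norm_mult power2_eq_square)
    also have "\<dots> \<le> a\<^sup>2 * cmod (?A (?d (?d \<phi>)) \<psi>) + 2 * \<bar>a * b\<bar> * cmod (?A (?d \<phi>) (?d \<psi>)) + b\<^sup>2 * cmod (?A \<phi> (?d (?d \<psi>)))"
      unfolding eq by (intro order_trans[OF norm_triangle_ineq] add_mono) (auto simp: norm_mult norm_power abs_mult)
    finally have "(1 + (\<xi> \<bullet> e)\<^sup>2) * cmod (?A \<phi> \<psi>) * ?w \<le> (cmod (?A \<phi> \<psi>) + (a\<^sup>2 * cmod (?A (?d (?d \<phi>)) \<psi>) + 2 * \<bar>a * b\<bar> * cmod (?A (?d \<phi>) (?d \<psi>)) + b\<^sup>2 * cmod (?A \<phi> (?d (?d \<psi>))))) * ?w"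
      by (intro mult_right_mono w) (simp add: distrib_right)
    also have "\<dots> = cmod (?A \<phi> \<psi>) * ?w + a\<^sup>2 * (cmod (?A (?d (?d \<phi>)) \<psi>) * ?w) + 2 * \<bar>a * b\<bar> * (cmod (?A (?d \<phi>) (?d \<psi>)) * ?w) + b\<^sup>2 * (cmod (?A \<phi> (?d (?d \<psi>))) * ?w)"
      by (simp add: distrib_right mult.assoc)
    also have "\<dots> \<le> C0 + a\<^sup>2 * C1 + 2 * \<bar>a * b\<bar> * C2 + b\<^sup>2 * C3"
      using C0 C1 C2 C3 by (intro add_mono mult_left_mono) (auto simp: mult.assoc)
    finally show ?thesis
      using insert.hyps by (simp add: mult_ac)
  qed
  then show ?case by blast
qed

lemma amb_cauchy_decay:
  fixes \<phi> \<psi> :: "'a::euclidean_space \<Rightarrow> complex"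
  assumes a: "a \<noteq> 0" and "\<phi> \<in> schwartz" "\<psi> \<in> schwartz"
  obtains C where "\<And>p q \<xi>. cmod (amb a b \<phi> \<psi> p q \<xi>) \<le> C * (1 / cauchy_weight (b *\<^sub>R p - a *\<^sub>R q)) * (1 / cauchy_weight \<xi>)"
proof -
  obtain C where C: "\<And>p q \<xi>. cmod (amb a b \<phi> \<psi> p q \<xi>) * cauchy_weight \<xi> * (1 + norm (b *\<^sub>R p - a *\<^sub>R q)) ^ (2 * DIM('a)) \<le> C"
    using amb_decay[OF finite_Basis subset_refl assms, of b "2 * DIM('a)"] unfolding cauchy_weight_def by blast
  have "cmod (amb a b \<phi> \<psi> p q \<xi>) \<le> C * (1 / cauchy_weight (b *\<^sub>R p - a *\<^sub>R q)) * (1 / cauchy_weight \<xi>)" for p q \<xi>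
  proof -
    have "cmod (amb a b \<phi> \<psi> p q \<xi>) * cauchy_weight \<xi> * cauchy_weight (b *\<^sub>R p - a *\<^sub>R q) \<le> C"
      by (rule order_trans[OF mult_left_mono[OF cauchy_weight_le] C]) simp
    then show ?thesis by (simp add: field_simps)
  qed
  then show ?thesis using that by blast
qed

subsection \<open>Density of the Schwartz functions in \<open>L\<^sup>2\<close>\<close>

text \<open>A class closed under differentiation and of polynomial growth. Every iterated derivative
  of \<open>bump\<close> is such a function times \<open>bump\<close>, which is how the bumps are
  recognised as Schwartz functions.\<close>

inductive poly_fun :: "('a::euclidean_space \<Rightarrow> complex) \<Rightarrow> bool" where
  poly_fun_const: "poly_fun (\<lambda>x. c)"
| poly_fun_coord: "poly_fun (\<lambda>x. complex_of_real (x \<bullet> v))"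
| poly_fun_add: "poly_fun p \<Longrightarrow> poly_fun q \<Longrightarrow> poly_fun (\<lambda>x. p x + q x)"
| poly_fun_mult: "poly_fun p \<Longrightarrow> poly_fun q \<Longrightarrow> poly_fun (\<lambda>x. p x * q x)"

lemma poly_fun_sum: "finite I \<Longrightarrow> (\<And>i. i \<in> I \<Longrightarrow> poly_fun (p i)) \<Longrightarrow> poly_fun (\<lambda>x. \<Sum>i\<in>I. p i x)"
  by (induction I rule: finite_induct) (auto intro: poly_fun.intros)

lemma poly_fun_power: "poly_fun p \<Longrightarrow> poly_fun (\<lambda>x. p x ^ n)"
  by (induction n) (auto intro: poly_fun.intros)

lemma poly_fun_has_derivative:
  "poly_fun p \<Longrightarrow> \<exists>D. (\<forall>x. (p has_derivative D x) (at x)) \<and> (\<forall>v. poly_fun (\<lambda>x. D x v))"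
proof (induction rule: poly_fun.induct)
  case (poly_fun_const c)
  then show ?case
    by (intro exI[of _ "\<lambda>_ _. 0"]) (auto intro: poly_fun.intros)
next
  case (poly_fun_coord v)
  then show ?case
    by (intro exI[of _ "\<lambda>_ w. complex_of_real (w \<bullet> v)"]) (auto intro: poly_fun.intros intro!: derivative_eq_intros)
next
  case (poly_fun_add p q)
  then obtain D E where "\<forall>x. (p has_derivative D x) (at x)" "\<forall>v. poly_fun (\<lambda>x. D x v)"
    "\<forall>x. (q has_derivative E x) (at x)" "\<forall>v. poly_fun (\<lambda>x. E x v)" by blast
  then show ?case
    by (intro exI[of _ "\<lambda>x v. D x v + E x v"]) (auto intro: poly_fun.intros intro!: has_derivative_add)
next
  case (poly_fun_mult p q)
  then obtain D E where "\<forall>x. (p has_derivative D x) (at x)" "\<forall>v. poly_fun (\<lambda>x. D x v)"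
    "\<forall>x. (q has_derivative E x) (at x)" "\<forall>v. poly_fun (\<lambda>x. E x v)" by blast
  then show ?case using poly_fun_mult.hyps
    by (intro exI[of _ "\<lambda>x v. p x * E x v + D x v * q x"]) (auto intro!: has_derivative_mult poly_fun.intros)
qed

lemma poly_fun_growth:
  "poly_fun p \<Longrightarrow> \<exists>C N. 0 \<le> C \<and> (\<forall>x. cmod (p x) \<le> C * (1 + norm x) ^ N)"
proof (induction rule: poly_fun.induct)
  case (poly_fun_const c)
  then show ?case by (intro exI[of _ "cmod c"] exI[of _ 0]) auto
next
  case (poly_fun_coord v)
  have "cmod (complex_of_real (x \<bullet> v)) \<le> norm v * (1 + norm x) ^ 1" for x
    using Cauchy_Schwarz_ineq2[of x v] by (simp add: algebra_simps) (smt (verit) norm_ge_zero)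
  then show ?case by (intro exI[of _ "norm v"] exI[of _ 1]) auto
next
  case (poly_fun_add p q)
  then obtain C N D M where C: "0 \<le> C" "\<And>x. cmod (p x) \<le> C * (1 + norm x) ^ N"
    and D: "0 \<le> D" "\<And>x. cmod (q x) \<le> D * (1 + norm x) ^ M" by blast
  have "cmod (p x + q x) \<le> (C + D) * (1 + norm x) ^ (N + M)" for x
  proof -
    have "C * (1 + norm x) ^ N \<le> C * (1 + norm x) ^ (N + M)" "D * (1 + norm x) ^ M \<le> D * (1 + norm x) ^ (N + M)"
      using C D by (auto intro!: mult_left_mono power_increasing)
    then show ?thesis
      using C(2)[of x] D(2)[of x] norm_triangle_ineq[of "p x" "q x"] by (simp add: distrib_right)
  qed
  then show ?case using C D by (intro exI[of _ "C + D"] exI[of _ "N + M"]) auto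
next
  case (poly_fun_mult p q)
  then obtain C N D M where C: "0 \<le> C" "\<And>x. cmod (p x) \<le> C * (1 + norm x) ^ N"
    and D: "0 \<le> D" "\<And>x. cmod (q x) \<le> D * (1 + norm x) ^ M" by blast
  have "cmod (p x * q x) \<le> (C * D) * (1 + norm x) ^ (N + M)" for x
    using mult_mono[OF C(2)[of x] D(2)[of x]] C by (simp add: norm_mult power_add mult_ac)
  then show ?case using C D by (intro exI[of _ "C * D"] exI[of _ "N + M"]) auto
qed

text \<open>As \<open>m\<close> tends to infinity, these functions approach the indicator of the box with centre \<open>c\<close>
  and half side lengths \<open>r\<close>; for \<open>m = 1\<close> they are Gaussians.\<close>

definition bump :: "nat \<Rightarrow> 'a::euclidean_space \<Rightarrow> 'a \<Rightarrow> 'a \<Rightarrow> real" where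
  "bump m c r x = exp (- (\<Sum>b\<in>Basis. ((x - c) \<bullet> b / (r \<bullet> b)) ^ (2 * m)))"

lemma bump_bounds: "0 < bump m c r x" "bump m c r x \<le> 1"
  unfolding bump_def by (auto intro!: sum_nonneg)

lemma bump_eq_exp_poly:
  obtains Q where "poly_fun Q" "\<And>x. complex_of_real (bump m c r x) = exp (- Q x)"
proof
  show "poly_fun (\<lambda>x. \<Sum>b\<in>Basis. (complex_of_real (1 / (r \<bullet> b)) * (complex_of_real (x \<bullet> b) + complex_of_real (- (c \<bullet> b)))) ^ (2 * m))"
    by (intro poly_fun_sum poly_fun_power poly_fun_mult poly_fun_add poly_fun_const poly_fun_coord) auto
  show "complex_of_real (bump m c r x) = exp (- (\<Sum>b\<in>Basis. (complex_of_real (1 / (r \<bullet> b)) * (complex_of_real (x \<bullet> b) + complex_of_real (- (c \<bullet> b)))) ^ (2 * m)))" for x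
    by (simp add: bump_def exp_of_real[symmetric] inner_diff_left diff_divide_distrib algebra_simps)
qed

lemma has_derivative_exp_minus:
  fixes Q :: "'a::real_normed_vector \<Rightarrow> complex"
  assumes "(Q has_derivative D) (at x)"
  shows "((\<lambda>x. exp (- Q x)) has_derivative (\<lambda>w. exp (- Q x) * (- D w))) (at x)"
  using has_derivative_compose[OF has_derivative_minus[OF assms] DERIV_exp[THEN has_field_derivative_imp_has_derivative]] by simp

lemma iter_deriv_bump:
  "\<exists>p. poly_fun p \<and> iter_deriv vs (\<lambda>x. complex_of_real (bump m c r x)) = (\<lambda>x. p x * complex_of_real (bump m c r x))"
proof (induction vs)
  case Nil
  then show ?case by (intro exI[of _ "\<lambda>_. 1"]) (auto intro: poly_fun.intros)
next
  case (Cons v vs)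
  then obtain p where p: "poly_fun p" "iter_deriv vs (\<lambda>x. complex_of_real (bump m c r x)) = (\<lambda>x. p x * complex_of_real (bump m c r x))"
    by blast
  obtain Q where Q: "poly_fun Q" and eq: "\<And>x. complex_of_real (bump m c r x) = exp (- Q x)"
    using bump_eq_exp_poly by blast
  obtain D E where D: "\<And>x. (p has_derivative D x) (at x)" "\<And>v. poly_fun (\<lambda>x. D x v)"
    and E: "\<And>x. (Q has_derivative E x) (at x)" "\<And>v. poly_fun (\<lambda>x. E x v)"
    using poly_fun_has_derivative[OF p(1)] poly_fun_has_derivative[OF Q] by blast
  have d: "((\<lambda>x. p x * exp (- Q x)) has_derivative (\<lambda>w. p x * (- E x w * exp (- Q x)) + D x w * exp (- Q x))) (at x)" for x
    using has_derivative_mult[OF D(1) has_derivative_exp_minus[OF E(1)]] by (simp add: mult.commute)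
  have "iter_deriv (v # vs) (\<lambda>x. complex_of_real (bump m c r x)) = (\<lambda>x. (p x * (- 1 * E x v) + D x v) * complex_of_real (bump m c r x))"
    unfolding iter_deriv.simps p(2) unfolding eq
    by (rule ext) (simp add: frechet_derivative_at[OF d, symmetric] algebra_simps)
  moreover have "poly_fun (\<lambda>x. p x * (- 1 * E x v) + D x v)"
    by (intro poly_fun_mult poly_fun_add poly_fun_const p D E)
  ultimately show ?case by blast
qed

lemma power_le_exp:
  fixes \<rho> :: real
  assumes "0 < \<rho>"
  shows "\<exists>C\<ge>0. \<forall>y\<ge>0. (1 + y) ^ N \<le> C * exp (y / \<rho>)"
proof -
  \<comment> \<open>Chosen so that (N + 1) / k = 1 / \<rho>. The exponent N + 1 in place of N keeps
    k positive when N = 0.\<close>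
  define k where "k = real (Suc N) * \<rho>"
  have k: "k > 0" using assms by (simp add: k_def)
  have "(1 + y) ^ N \<le> (1 + k) ^ Suc N * exp (y / \<rho>)" if y: "y \<ge> 0" for y
  proof -
    have "1 + y \<le> (1 + k) * (1 + y / k)"
      using k y by (simp add: field_simps)
    also have "\<dots> \<le> (1 + k) * exp (y / k)"
      using k exp_ge_add_one_self[of "y / k"] by (intro mult_left_mono) auto
    finally have "(1 + y) ^ Suc N \<le> ((1 + k) * exp (y / k)) ^ Suc N"
      using y by (intro power_mono) auto
    also have "\<dots> = (1 + k) ^ Suc N * exp (real (Suc N) * (y / k))"
      by (simp only: power_mult_distrib exp_of_nat_mult)
    also have "real (Suc N) * (y / k) = y / \<rho>"
      by (simp add: k_def del: of_nat_Suc)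
    finally have "(1 + y) ^ Suc N \<le> (1 + k) ^ Suc N * exp (y / \<rho>)" .
    moreover have "(1 + y) ^ N \<le> (1 + y) ^ Suc N"
      using y by (intro power_increasing) auto
    ultimately show ?thesis by linarith
  qed
  then show ?thesis using k by (intro exI[of _ "(1 + k) ^ Suc N"]) auto
qed

lemma abs_minus_1_le_even_power:
  fixes s :: real
  assumes "0 < m" shows "\<bar>s\<bar> - 1 \<le> s ^ (2 * m)"
proof (cases "\<bar>s\<bar> \<le> 1")
  case True
  moreover have "0 \<le> s ^ (2 * m)" by (rule zero_le_even_power) simp
  ultimately show ?thesis by linarith
next
  case False
  then have "\<bar>s\<bar> ^ 1 \<le> \<bar>s\<bar> ^ (2 * m)"
    using assms by (intro power_increasing) auto
  then show ?thesis by (simp add: power_even_abs)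
qed

text \<open>By |s| - 1 \<le> s^(2m) the exponent grows at least linearly in the l1 norm of x - c,
  and exponential decay beats every power.\<close>

lemma bump_decay:
  fixes c r :: "'a::euclidean_space"
  assumes r: "\<And>b. b \<in> Basis \<Longrightarrow> 0 < r \<bullet> b" and m: "0 < m"
  shows "\<exists>C\<ge>0. \<forall>x. (1 + norm x) ^ N * bump m c r x \<le> C"
proof -
  have r0: "norm r > 0"
  proof -
    obtain b :: 'a where "b \<in> Basis" using nonempty_Basis by blast
    then show ?thesis using r by force
  qed
  define K where "K = norm c / norm r + real DIM('a)"
  have B: "bump m c r x \<le> exp K * exp (- (norm x / norm r))" for x
  proof -
    have "norm (x - c) / norm r - real DIM('a) \<le> (\<Sum>b\<in>Basis. \<bar>(x - c) \<bullet> b\<bar> / norm r - 1)"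
      using norm_le_l1[of "x - c"] r0 by (simp add: sum_subtractf sum_divide_distrib[symmetric] divide_right_mono)
    also have "\<dots> \<le> (\<Sum>b\<in>Basis. ((x - c) \<bullet> b / (r \<bullet> b)) ^ (2 * m))"
    proof (rule sum_mono)
      fix b :: 'a assume b: "b \<in> Basis"
      let ?s = "(x - c) \<bullet> b / (r \<bullet> b)"
      have "\<bar>(x - c) \<bullet> b\<bar> / norm r \<le> \<bar>?s\<bar>"
        using r[OF b] Basis_le_norm[OF b, of r] r0 by (auto simp: abs_divide intro!: divide_left_mono)
      also have "\<bar>?s\<bar> - 1 \<le> ?s ^ (2 * m)"
        by (rule abs_minus_1_le_even_power[OF m])
      finally show "\<bar>(x - c) \<bullet> b\<bar> / norm r - 1 \<le> ?s ^ (2 * m)" by simp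
    qed
    finally have "norm (x - c) / norm r - real DIM('a) \<le> (\<Sum>b\<in>Basis. ((x - c) \<bullet> b / (r \<bullet> b)) ^ (2 * m))" .
    moreover have "norm x / norm r \<le> norm (x - c) / norm r + norm c / norm r"
      using norm_triangle_sub[of x c] r0 by (simp add: add_divide_distrib[symmetric] divide_right_mono add.commute)
    ultimately show ?thesis
      unfolding bump_def K_def exp_add[symmetric] by simp
  qed
  obtain C where C: "C \<ge> 0" "\<And>y. y \<ge> 0 \<Longrightarrow> (1 + y) ^ N \<le> C * exp (y / norm r)"
    using power_le_exp[OF r0] by blast
  have "(1 + norm x) ^ N * bump m c r x \<le> C * exp K" for x
  proof -
    have "(1 + norm x) ^ N * bump m c r x \<le> (C * exp (norm x / norm r)) * (exp K * exp (- (norm x / norm r)))"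
      using C bump_bounds[of m c r x] by (intro mult_mono C B) auto
    then show ?thesis by (simp add: exp_minus field_simps)
  qed
  then show ?thesis using C(1) by (intro exI[of _ "C * exp K"]) auto
qed

lemma bump_schwartz:
  assumes r: "\<And>b. b \<in> Basis \<Longrightarrow> 0 < r \<bullet> b" and m: "0 < m"
  shows "(\<lambda>x. complex_of_real (bump m c r x)) \<in> schwartz"
  unfolding schwartz_def smooth_def mem_Collect_eq
proof (intro conjI ballI allI)
  fix vs :: "'a list" and x
  obtain p where p: "poly_fun p" "iter_deriv vs (\<lambda>x. complex_of_real (bump m c r x)) = (\<lambda>x. p x * complex_of_real (bump m c r x))"
    using iter_deriv_bump by blast
  have b: "(\<lambda>x. complex_of_real (bump m c r x)) differentiable (at x)"
  proof -
    obtain Q where Q: "poly_fun Q" and eq: "\<And>x. complex_of_real (bump m c r x) = exp (- Q x)"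
      using bump_eq_exp_poly by blast
    then show ?thesis
      unfolding eq differentiable_def using poly_fun_has_derivative[OF Q] has_derivative_exp_minus by blast
  qed
  show "iter_deriv vs (\<lambda>x. complex_of_real (bump m c r x)) differentiable (at x)"
    unfolding p(2) using poly_fun_has_derivative[OF p(1)] b
    by (intro differentiable_mult) (auto simp: differentiable_def)
next
  fix N :: nat and vs :: "'a list"
  obtain p where p: "poly_fun p" "iter_deriv vs (\<lambda>x. complex_of_real (bump m c r x)) = (\<lambda>x. p x * complex_of_real (bump m c r x))"
    using iter_deriv_bump by blast
  obtain C M where C: "0 \<le> C" "\<And>x. cmod (p x) \<le> C * (1 + norm x) ^ M"
    using poly_fun_growth[OF p(1)] by blast
  obtain D where D: "D \<ge> 0" "\<And>x. (1 + norm x) ^ (N + M) * bump m c r x \<le> D"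
    using bump_decay[OF r m] by blast
  show "bounded (range (\<lambda>x. (1 + norm x) ^ N *\<^sub>R iter_deriv vs (\<lambda>x. complex_of_real (bump m c r x)) x))"
  proof (rule boundedI, safe)
    fix x
    have "norm ((1 + norm x) ^ N *\<^sub>R iter_deriv vs (\<lambda>x. complex_of_real (bump m c r x)) x) = (1 + norm x) ^ N * cmod (p x) * bump m c r x"
      unfolding p(2) using bump_bounds[of m c r x] by (simp add: norm_mult abs_of_nonneg)
    also have "\<dots> \<le> (1 + norm x) ^ N * (C * (1 + norm x) ^ M) * bump m c r x"
      using bump_bounds[of m c r x] by (intro mult_right_mono mult_left_mono C) auto
    also have "\<dots> = C * ((1 + norm x) ^ (N + M) * bump m c r x)"
      by (simp add: power_add mult_ac)
    also have "\<dots> \<le> C * D" by (intro mult_left_mono D C)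
    finally show "norm ((1 + norm x) ^ N *\<^sub>R iter_deriv vs (\<lambda>x. complex_of_real (bump m c r x)) x) \<le> C * D" .
  qed
qed

text \<open>The faces of the box are excluded: there some coordinates contribute exactly 1 for every
  m, and the limit is a power of exp (-1).\<close>

lemma bump_tendsto:
  fixes c r :: "'a::euclidean_space"
  assumes r: "\<And>b. b \<in> Basis \<Longrightarrow> 0 < r \<bullet> b" and x: "x \<notin> cbox (c - r) (c + r) - box (c - r) (c + r)"
  shows "(\<lambda>m. bump (Suc m) c r x) \<longlonglongrightarrow> indicator (box (c - r) (c + r)) x"
proof (cases "x \<in> box (c - r) (c + r)")
  case True
  have "(\<lambda>m. ((x - c) \<bullet> b / (r \<bullet> b)) ^ (2 * Suc m)) \<longlonglongrightarrow> 0" if b: "b \<in> Basis" for b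
  proof -
    have "\<bar>(x - c) \<bullet> b / (r \<bullet> b)\<bar> < 1"
      using True r[OF b] b by (auto simp: box_def abs_divide inner_diff_left inner_add_left abs_less_iff)
    then have "(\<lambda>m. (((x - c) \<bullet> b / (r \<bullet> b))\<^sup>2) ^ Suc m) \<longlonglongrightarrow> 0"
      by (intro LIMSEQ_Suc LIMSEQ_power_zero) (simp add: abs_square_less_1)
    then show ?thesis by (simp only: power_mult)
  qed
  then have "(\<lambda>m. bump (Suc m) c r x) \<longlonglongrightarrow> exp (- (\<Sum>b\<in>(Basis::'a set). 0))"
    unfolding bump_def by (intro tendsto_intros)
  then show ?thesis using True by simp
next
  case False
  then obtain b where b: "b \<in> Basis" "\<not> (\<bar>(x - c) \<bullet> b\<bar> \<le> r \<bullet> b)"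
    using x by (auto simp: cbox_def inner_diff_left inner_add_left abs_le_iff algebra_simps)
  let ?s = "(x - c) \<bullet> b / (r \<bullet> b)"
  have s: "1 < ?s\<^sup>2"
    using b r[OF b(1)] by (subst abs_square_less_1[symmetric] not_le[symmetric]) (auto simp: abs_square_le_1 abs_divide)
  have le: "bump (Suc m) c r x \<le> exp (- ((?s\<^sup>2) ^ Suc m))" for m
  proof -
    have "?s ^ (2 * Suc m) \<le> (\<Sum>b\<in>Basis. ((x - c) \<bullet> b / (r \<bullet> b)) ^ (2 * Suc m))"
      by (rule member_le_sum[OF b(1)]) (auto simp del: power_Suc mult_Suc_right)
    then show ?thesis unfolding bump_def by (simp only: power_mult exp_le_cancel_iff neg_le_iff_le)
  qed
  have "(\<lambda>m. exp (- (u ^ Suc m))) \<longlonglongrightarrow> 0" if "1 < u" for u :: real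
    using that by real_asymp
  from this[OF s] have "(\<lambda>m. exp (- ((?s\<^sup>2) ^ Suc m))) \<longlonglongrightarrow> 0" .
  then have "(\<lambda>m. bump (Suc m) c r x) \<longlonglongrightarrow> 0"
    by (rule Lim_null_comparison[rotated]) (use le bump_bounds(1)[of _ c r x] in \<open>auto intro!: always_eventually simp: abs_of_pos\<close>)
  then show ?thesis using False by simp
qed

text \<open>Since s^2 - 1 \<le> s^(2m + 2) for every s, one Gaussian dominates the whole sequence in
  m; the exponential factor collects the ones from all coordinates.\<close>

lemma bump_le: "bump (Suc m) c r x \<le> exp (real DIM('a)) * bump 1 c r x" for x :: "'a::euclidean_space"
proof -
  have "(\<Sum>b\<in>Basis. ((x - c) \<bullet> b / (r \<bullet> b)) ^ (2 * 1) - 1) \<le> (\<Sum>b\<in>Basis. ((x - c) \<bullet> b / (r \<bullet> b)) ^ (2 * Suc m))"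
  proof (rule sum_mono)
    fix b :: 'a
    let ?s = "(x - c) \<bullet> b / (r \<bullet> b)"
    show "?s ^ (2 * 1) - 1 \<le> ?s ^ (2 * Suc m)"
    proof (cases "?s\<^sup>2 \<le> 1")
      case True
      moreover have "0 \<le> ?s ^ (2 * Suc m)" by (rule zero_le_even_power) simp
      moreover have "?s ^ (2 * 1) = ?s\<^sup>2" by simp
      ultimately show ?thesis by linarith
    next
      case False
      then have "(?s\<^sup>2) ^ 1 \<le> (?s\<^sup>2) ^ Suc m"
        by (intro power_increasing) auto
      then show ?thesis by (simp only: power_mult)
    qed
  qed
  then show ?thesis
    unfolding bump_def exp_add[symmetric] by (simp add: sum_subtractf del: power_Suc mult_Suc_right)
qed

section \<open>Square-integrable functions as a vector space\<close>

lemma L2_I: "f \<in> borel_measurable borel \<Longrightarrow> integrable lborel (\<lambda>x. (cmod (f x))\<^sup>2) \<Longrightarrow> f \<in> L2"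
  by (simp add: L2_def)

lemma L2_measurable: "f \<in> L2 \<Longrightarrow> f \<in> borel_measurable borel"
  by (simp add: L2_def)

lemma L2_square_integrable: "f \<in> L2 \<Longrightarrow> integrable lborel (\<lambda>x. (cmod (f x))\<^sup>2)"
  by (simp add: L2_def)

lemma L2_dominated:
  assumes "integrable lborel g" "f \<in> borel_measurable borel" "AE x in lborel. (cmod (f x))\<^sup>2 \<le> g x"
  shows "f \<in> L2"
proof (rule L2_I)
  show "integrable lborel (\<lambda>x. (cmod (f x))\<^sup>2)"
    by (rule Bochner_Integration.integrable_bound[OF assms(1)]) (use assms(2,3) in auto)
qed fact

lemma L2_add: assumes f: "f \<in> L2" and g: "g \<in> L2" shows "(\<lambda>x. f x + g x) \<in> L2"
proof (rule L2_dominated)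
  show "integrable lborel (\<lambda>x. 2 * (cmod (f x))\<^sup>2 + 2 * (cmod (g x))\<^sup>2)"
    using L2_square_integrable[OF f] L2_square_integrable[OF g] by auto
  have "(cmod (f x + g x))\<^sup>2 \<le> 2 * (cmod (f x))\<^sup>2 + 2 * (cmod (g x))\<^sup>2" for x
  proof -
    have "(cmod (f x + g x))\<^sup>2 \<le> (cmod (f x) + cmod (g x))\<^sup>2"
      by (intro power_mono norm_triangle_ineq) auto
    also have "\<dots> \<le> 2 * (cmod (f x))\<^sup>2 + 2 * (cmod (g x))\<^sup>2"
      using sum_squares_bound[of "cmod (f x)" "cmod (g x)"] by (simp add: power2_sum)
    finally show ?thesis .
  qed
  then show "AE x in lborel. (cmod (f x + g x))\<^sup>2 \<le> 2 * (cmod (f x))\<^sup>2 + 2 * (cmod (g x))\<^sup>2" by simp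
qed (use L2_measurable[OF f] L2_measurable[OF g] in measurable)

lemma L2_cmult: assumes f: "f \<in> L2" shows "(\<lambda>x. c * f x) \<in> L2"
proof (rule L2_I)
  show "integrable lborel (\<lambda>x. (cmod (c * f x))\<^sup>2)"
    using L2_square_integrable[OF f] by (simp add: norm_mult power_mult_distrib)
qed (use L2_measurable[OF f] in measurable)

lemma L2_zero: "(\<lambda>x. 0) \<in> L2"
  by (rule L2_I) auto

lemma L2_diff: "f \<in> L2 \<Longrightarrow> g \<in> L2 \<Longrightarrow> (\<lambda>x. f x - g x) \<in> L2"
  using L2_add[of f "\<lambda>x. -1 * g x"] L2_cmult[of g "-1"] by simp

lemma borel_measurable_cnj [measurable (raw)]:
  "f \<in> borel_measurable M \<Longrightarrow> (\<lambda>x. cnj (f x)) \<in> borel_measurable M"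
  by (erule measurable_compose) (intro borel_measurable_continuous_onI continuous_intros)

lemma L2_cnj: assumes f: "f \<in> L2" shows "(\<lambda>x. cnj (f x)) \<in> L2"
  using L2_square_integrable[OF f] L2_measurable[OF f] by (intro L2_I) auto

lemma L2_sum: "finite I \<Longrightarrow> (\<And>i. i \<in> I \<Longrightarrow> f i \<in> L2) \<Longrightarrow> (\<lambda>x. \<Sum>i\<in>I. f i x) \<in> L2"
  by (induction I rule: finite_induct) (auto intro: L2_add L2_zero)

lemma L2_mult_integrable:
  assumes f: "f \<in> L2" and g: "g \<in> L2" shows "integrable lborel (\<lambda>x. f x * g x)"
proof (rule Bochner_Integration.integrable_bound)
  show "integrable lborel (\<lambda>x. (cmod (f x))\<^sup>2 + (cmod (g x))\<^sup>2)"
    using L2_square_integrable[OF f] L2_square_integrable[OF g] by auto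
  have "cmod (f x * g x) \<le> (cmod (f x))\<^sup>2 + (cmod (g x))\<^sup>2" for x
  proof -
    have "2 * (cmod (f x) * cmod (g x)) \<le> (cmod (f x))\<^sup>2 + (cmod (g x))\<^sup>2"
      using sum_squares_bound[of "cmod (f x)" "cmod (g x)"] by (simp add: mult.assoc)
    moreover have "0 \<le> cmod (f x) * cmod (g x)" by simp
    ultimately show ?thesis unfolding norm_mult by linarith
  qed
  then show "AE x in lborel. cmod (f x * g x) \<le> norm ((cmod (f x))\<^sup>2 + (cmod (g x))\<^sup>2)"
    by (intro AE_I2) (auto intro: order_trans[OF _ abs_ge_self])
qed (use L2_measurable[OF f] L2_measurable[OF g] in measurable)

lemma indicator_L2:
  assumes [measurable]: "A \<in> sets borel" and fin: "emeasure lborel A < \<infinity>"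
  shows "(\<lambda>x. indicator A x :: complex) \<in> L2"
proof (rule L2_I)
  have "(cmod (indicator A x :: complex))\<^sup>2 = indicator A x" for x
    by (simp add: indicator_def)
  then show "integrable lborel (\<lambda>x. (cmod (indicator A x :: complex))\<^sup>2)"
    using fin by simp
qed simp

text \<open>Density in the form of an induction rule, which avoids classes modulo null sets. The
  property spreads from bumps to boxes, by a \<pi>-\<lambda> argument to bounded Borel sets, then to
  simple functions and to all of \<open>L2\<close>.\<close>

theorem schwartz_dense_L2:
  fixes P :: "('a::euclidean_space \<Rightarrow> complex) \<Rightarrow> bool"
  assumes S: "\<And>f. f \<in> schwartz \<Longrightarrow> P f"
    and add: "\<And>f g. f \<in> L2 \<Longrightarrow> g \<in> L2 \<Longrightarrow> P f \<Longrightarrow> P g \<Longrightarrow> P (\<lambda>x. f x + g x)"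
    and cmult: "\<And>f c. f \<in> L2 \<Longrightarrow> P f \<Longrightarrow> P (\<lambda>x. c * f x)"
    and lim: "\<And>F f. (\<And>n. F n \<in> L2) \<Longrightarrow> f \<in> L2 \<Longrightarrow> (\<And>n. P (F n)) \<Longrightarrow>
      (\<lambda>n. LINT x|lborel. (cmod (F n x - f x))\<^sup>2) \<longlonglongrightarrow> 0 \<Longrightarrow> P f"
    and f: "f \<in> L2"
  shows "P f"
proof -
  \<comment> \<open>All limits below are pointwise almost everywhere with a square-integrable
    majorant G. Here they are converted, once and for all, into the mean-square limits that
    \<open>lim\<close> demands.\<close>
  have dom: "P f" if F: "\<And>n::nat. F n \<in> L2" "\<And>n. P (F n)" and G: "integrable lborel (\<lambda>x. (G x)\<^sup>2)" 
    and b: "\<And>n x. cmod (F n x) \<le> G x" and fm [measurable]: "f \<in> borel_measurable borel"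
    and l: "AE x in lborel. (\<lambda>n. F n x) \<longlonglongrightarrow> f x" for F f and G :: "'a \<Rightarrow> real"
  proof -
    have [measurable]: "F n \<in> borel_measurable borel" for n using F(1) L2_measurable by blast
    have fb: "AE x in lborel. cmod (f x) \<le> G x"
      using l
    proof eventually_elim
      case (elim x)
      show ?case by (rule LIMSEQ_le_const2[OF tendsto_norm[OF elim]]) (use b in auto)
    qed
    have G0: "0 \<le> G x" for x using b[of 0 x] norm_ge_zero order_trans by blast
    have fL: "f \<in> L2"
    proof (rule L2_dominated[OF G fm])
      show "AE x in lborel. (cmod (f x))\<^sup>2 \<le> (G x)\<^sup>2"
        using fb by eventually_elim (auto intro!: power_mono)
    qed
    have "(\<lambda>n. LINT x|lborel. (cmod (F n x - f x))\<^sup>2) \<longlonglongrightarrow> (LINT x|(lborel :: 'a measure). 0)"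
    proof (rule integral_dominated_convergence[where w="\<lambda>x. 4 * (G x)\<^sup>2"])
      show "AE x in lborel. (\<lambda>n. (cmod (F n x - f x))\<^sup>2) \<longlonglongrightarrow> 0"
        using l
      proof eventually_elim
        case (elim x)
        have "(\<lambda>n. (cmod (F n x - f x))\<^sup>2) \<longlonglongrightarrow> (cmod (f x - f x))\<^sup>2"
          by (intro tendsto_intros elim)
        then show ?case by simp
      qed
      show "AE x in lborel. norm ((cmod (F n x - f x))\<^sup>2) \<le> 4 * (G x)\<^sup>2" for n
        using fb
      proof eventually_elim
        case (elim x)
        have "cmod (F n x - f x) \<le> 2 * G x"
          using norm_triangle_ineq4[of "F n x" "f x"] b[of n x] elim by simp
        then have "(cmod (F n x - f x))\<^sup>2 \<le> (2 * G x)\<^sup>2" by (intro power_mono) auto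
        then show ?case by (simp add: power_mult_distrib)
      qed
    qed (use G in auto)
    then show ?thesis using lim[OF F(1) fL F(2)] by simp
  qed
  have zero: "P (\<lambda>x. 0)"
  proof -
    have s: "(\<lambda>x. complex_of_real (bump 1 0 (One :: 'a) x)) \<in> schwartz" by (rule bump_schwartz) auto
    show ?thesis using cmult[OF schwartz_L2[OF s] S[OF s], of 0] by simp
  qed
  have box: "P (\<lambda>x. indicator (box a b) x)" for a b :: 'a
  proof (cases "box a b = {}")
    case True
    then show ?thesis using zero by simp
  next
    case False
    define c where "c = (1/2) *\<^sub>R (a + b)"
    define r where "r = (1/2) *\<^sub>R (b - a)"
    have ab: "a = c - r" "b = c + r"
      by (auto simp: c_def r_def algebra_simps simp flip: scaleR_add_left)
    have r: "\<And>b. b \<in> Basis \<Longrightarrow> 0 < r \<bullet> b"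
      using False by (auto simp: box_eq_empty not_le r_def inner_diff_left)
    have s: "(\<lambda>x. complex_of_real (bump (Suc m) c r x)) \<in> schwartz" for m
      by (rule bump_schwartz[OF r]) auto
    show ?thesis
    proof (rule dom[of "\<lambda>m x. complex_of_real (bump (Suc m) c r x)" "\<lambda>x. exp (real DIM('a)) * bump 1 c r x"])
      show "(\<lambda>x. complex_of_real (bump (Suc n) c r x)) \<in> L2" "P (\<lambda>x. complex_of_real (bump (Suc n) c r x))" for n
        using s S schwartz_L2 by auto
      show "integrable lborel (\<lambda>x. (exp (real DIM('a)) * bump 1 c r x)\<^sup>2)"
        using L2_square_integrable[OF schwartz_L2[OF s[of 0]]] by (simp add: power_mult_distrib)
      show "cmod (complex_of_real (bump (Suc n) c r x)) \<le> exp (real DIM('a)) * bump 1 c r x" for n x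
        using bump_le[of n c r x] bump_bounds(1)[of "Suc n" c r x] by simp
      have "AE x in lborel. x \<notin> cbox (c - r) (c + r) - box (c - r) (c + r)"
        using null_sets_cbox_Diff_box by (rule AE_not_in)
      then show "AE x in lborel. (\<lambda>n. complex_of_real (bump (Suc n) c r x)) \<longlonglongrightarrow> indicator (box a b) x"
      proof eventually_elim
        case (elim x)
        have "(\<lambda>n. complex_of_real (bump (Suc n) c r x)) \<longlonglongrightarrow> complex_of_real (indicator (box (c - r) (c + r)) x)"
          by (intro tendsto_of_real bump_tendsto r elim)
        then show ?case by (cases "x \<in> box (c - r) (c + r)") (simp_all add: ab)
      qed
    qed auto
  qed
  \<comment> \<open>Windows of finite measure: complements in the \<pi>-\<lambda> argument are taken
    inside \<open>Z n\<close>, so that all indicators stay in \<open>L2\<close>.\<close>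
  define Z :: "nat \<Rightarrow> 'a set" where "Z n = box (- (real n *\<^sub>R One)) (real n *\<^sub>R One)" for n
  have Zm [measurable]: "Z n \<in> sets borel" for n by (simp add: Z_def)
  have Zf: "emeasure lborel (Z n) < \<infinity>" for n
    unfolding Z_def by (simp add: emeasure_bounded_finite)
  have iL: "(\<lambda>x. indicator (E \<inter> Z n) x) \<in> L2" if "E \<in> sets borel" for E n
    using that emeasure_mono[of "E \<inter> Z n" "Z n" lborel] Zf[of n]
    by (intro indicator_L2) (auto simp: less_top[symmetric] top_unique)
  have ind: "P (\<lambda>x. indicator (E \<inter> Z n) x)" if E: "E \<in> sets borel" for E n
  proof -
    let ?G = "range (\<lambda>(a, b). box a b :: 'a set)"
    have eq: "sets borel = sigma_sets UNIV ?G"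
      unfolding borel_eq_box by (rule sets_measure_of) simp
    have "Int_stable ?G"
      unfolding Int_stable_def by (auto simp: box_Int_box)
    moreover have "?G \<subseteq> Pow UNIV" by simp
    moreover have "E \<in> sigma_sets UNIV ?G" using E eq by simp
    ultimately show ?thesis
    proof (induction rule: sigma_sets_induct_disjoint)
      case (basic A)
      then obtain a b where "A \<inter> Z n = box a b" unfolding Z_def by (auto simp: box_Int_box)
      then show ?case using box by simp
    next
      case empty
      then show ?case using zero by simp
    next
      case (compl A)
      have A: "A \<in> sets borel" using compl eq by simp
      have "P (\<lambda>x. indicator (UNIV \<inter> Z n) x + (-1) * indicator (A \<inter> Z n) x)"
        using compl by (intro add iL L2_cmult cmult A) (auto simp: Z_def box)
      moreover have "(\<lambda>x. indicator (UNIV \<inter> Z n) x + (-1) * indicator (A \<inter> Z n) x) = (\<lambda>x. indicator ((UNIV - A) \<inter> Z n) x :: complex)"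
        by (auto simp: indicator_def)
      ultimately show ?case by simp
    next
      case (union A)
      have A: "A i \<in> sets borel" for i using union(2) eq by auto
      let ?F = "\<lambda>k x. \<Sum>i<k. indicator (A i \<inter> Z n) x :: complex"
      have PF: "P (?F k)" for k
      proof (induction k)
        case (Suc k)
        have "P (\<lambda>x. ?F k x + indicator (A k \<inter> Z n) x)"
          by (intro add Suc union(3) L2_sum iL A) auto
        then show ?case by simp
      qed (use zero in simp)
      have Feq: "?F k x = indicator ((\<Union>i<k. A i) \<inter> Z n) x" for k x
      proof -
        have "indicator ((\<Union>i<k. A i \<inter> Z n)) x = (\<Sum>i<k. indicator (A i \<inter> Z n) x :: complex)"
          using union(1) by (intro indicator_UN_disjoint) (auto simp: disjoint_family_on_def)
        then show ?thesis by (simp add: Int_UN_distrib2)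
      qed
      show ?case
      proof (rule dom[of ?F "\<lambda>x. indicator (Z n) x"])
        show "?F k \<in> L2" for k by (intro L2_sum iL A) auto
        show "P (?F k)" for k by (rule PF)
        show "integrable lborel (\<lambda>x. (indicator (Z n) x :: real)\<^sup>2)"
          
        proof -
          have "(indicator (Z n) x :: real)\<^sup>2 = indicator (Z n) x" for x by (simp add: indicator_def)
          then show ?thesis using Zf[of n] by simp
        qed
        show "cmod (?F k x) \<le> indicator (Z n) x" for k x
          unfolding Feq by (auto simp: indicator_def)
        show "AE x in lborel. (\<lambda>k. ?F k x) \<longlonglongrightarrow> indicator (\<Union> (range A) \<inter> Z n) x"
        proof (intro AE_I2)
          fix x
          show "(\<lambda>k. ?F k x) \<longlonglongrightarrow> indicator (\<Union> (range A) \<inter> Z n) x"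
            unfolding Feq
          proof (cases "x \<in> \<Union> (range A) \<inter> Z n")
            case True
            then obtain i where "x \<in> A i" "x \<in> Z n" by auto
            then have "\<forall>\<^sub>F k in sequentially. (1::complex) = indicator ((\<Union>i<k. A i) \<inter> Z n) x"
              by (intro eventually_sequentiallyI[of "Suc i"]) (auto simp: indicator_def intro!: bexI[of _ i])
            with True show "(\<lambda>k. indicator ((\<Union>i<k. A i) \<inter> Z n) x :: complex) \<longlonglongrightarrow> indicator (\<Union> (range A) \<inter> Z n) x"
              by (auto intro!: Lim_transform_eventually[OF tendsto_const])
          qed (auto simp: indicator_def)
        qed
        show "(\<lambda>x. indicator (\<Union> (range A) \<inter> Z n) x :: complex) \<in> borel_measurable borel"
          using A by measurable
      qed
    qed
  qed
  have fm [measurable]: "f \<in> borel_measurable lborel" using L2_measurable[OF f] by simp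
  obtain s where s: "\<And>i. simple_function lborel (s i)" "\<And>x. (\<lambda>i. s i x) \<longlonglongrightarrow> f x" "\<And>i x. cmod (s i x) \<le> 2 * cmod (f x)"
    using borel_measurable_implies_sequence_metric[OF fm, of 0] by (auto simp: dist_norm)
  \<comment> \<open>Each simple function is cut to \<open>Z i\<close>, since indicators have been
    treated inside such windows only. The windows exhaust the space as i grows.\<close>
  let ?F = "\<lambda>i x. \<Sum>y\<in>range (s i). y * indicator (s i -` {y} \<inter> Z i) x"
  have fin: "finite (range (s i))" for i
    using simple_functionD(1)[OF s(1)[of i]] by simp
  have sm: "s i -` {y} \<in> sets borel" for i y
    using simple_functionD(2)[OF s(1)[of i], of "{y}"] by simp
  have Fterm: "(\<lambda>x. \<Sum>y\<in>J. y * indicator (s i -` {y} \<inter> Z i) x) \<in> L2" if "finite J" for i J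
    using that by (intro L2_sum L2_cmult iL sm) auto
  have PF: "P (\<lambda>x. \<Sum>y\<in>J. y * indicator (s i -` {y} \<inter> Z i) x)" if "finite J" for i J
    using that
  proof (induction J rule: finite_induct)
    case (insert y J)
    have "P (\<lambda>x. y * indicator (s i -` {y} \<inter> Z i) x + (\<Sum>y\<in>J. y * indicator (s i -` {y} \<inter> Z i) x))"
      by (intro add L2_cmult cmult iL sm ind Fterm insert)
    then show ?case by (simp only: sum.insert[OF insert.hyps])
  qed (use zero in simp)
  have Feq: "?F i x = indicator (Z i) x * s i x" for i x
  proof -
    have "?F i x = (\<Sum>y\<in>range (s i). if y = s i x then indicator (Z i) x * y else 0)"
      by (intro sum.cong) (auto simp: indicator_def)
    then show ?thesis using fin[of i] by simp
  qed
  show ?thesis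
  proof (rule dom[of ?F "\<lambda>x. 2 * cmod (f x)"])
    show "?F i \<in> L2" "P (?F i)" for i
      using Fterm[OF fin] PF[OF fin] by auto
    show "integrable lborel (\<lambda>x. (2 * cmod (f x))\<^sup>2)"
      using L2_square_integrable[OF f] by (simp add: power_mult_distrib)
    show "cmod (?F i x) \<le> 2 * cmod (f x)" for i x
      unfolding Feq using s(3)[of i x] by (auto simp: indicator_def)
    show "AE x in lborel. (\<lambda>i. ?F i x) \<longlonglongrightarrow> f x"
    proof (intro AE_I2)
      fix x
      have "\<forall>\<^sub>F i in sequentially. s i x = ?F i x"
      proof -
        obtain N where N: "norm x < real N" using reals_Archimedean2 by blast
        have "x \<in> Z i" if "i \<ge> N" for i
        proof -
          have "\<bar>x \<bullet> b\<bar> < real i" if b: "b \<in> Basis" for b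
            using Basis_le_norm[OF b, of x] N \<open>i \<ge> N\<close> by (smt (verit) of_nat_mono)
          then show ?thesis unfolding Z_def by (auto simp: box_def abs_less_iff) (smt (verit))
        qed
        then show ?thesis
          unfolding Feq by (intro eventually_sequentiallyI[of N]) auto
      qed
      then show "(\<lambda>i. ?F i x) \<longlonglongrightarrow> f x"
        by (rule Lim_transform_eventually[OF s(2)])
    qed
  qed (use fm in simp)
qed

subsection \<open>Compactly supported functions as distributions\<close>

definition int_dist :: "('a::euclidean_space \<Rightarrow> complex) \<Rightarrow> ('a \<Rightarrow> complex) \<Rightarrow> complex" where
  "int_dist h \<phi> = (LINT z|lborel. h z * \<phi> z)"

text \<open>Continuity is as much as the tents offer. It is enough for a smooth transform, because
  compact support makes all moments finite.\<close>

definition cts_supported :: "real \<Rightarrow> ('a::euclidean_space \<Rightarrow> complex) \<Rightarrow> bool" where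
  "cts_supported \<rho> h \<longleftrightarrow> continuous_on UNIV h \<and> (\<forall>z. \<rho> < norm z \<longrightarrow> h z = 0)"

lemma cts_supported_measurable: "cts_supported \<rho> h \<Longrightarrow> h \<in> borel_measurable borel"
  unfolding cts_supported_def using borel_measurable_continuous_onI by blast

lemma cts_supported_integrable:
  assumes "cts_supported \<rho> h" shows "integrable lborel h"
proof -
  have "integrable lborel (\<lambda>x. indicator (cball 0 \<rho>) x *\<^sub>R h x)"
    using assms unfolding cts_supported_def
    by (intro borel_integrable_compact compact_cball) (auto intro: continuous_on_subset)
  also have "(\<lambda>x. indicator (cball 0 \<rho>) x *\<^sub>R h x) = h"
    using assms by (auto simp: cts_supported_def indicator_def fun_eq_iff)
  finally show ?thesis .
qed

lemma cts_supported_mult: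
  assumes "cts_supported \<rho> h" "continuous_on UNIV g" shows "cts_supported \<rho> (\<lambda>x. h x * g x)"
  using assms unfolding cts_supported_def by (auto intro!: continuous_intros)

lemma cts_supported_bounded:
  assumes "cts_supported \<rho> h" obtains C where "0 \<le> C" "\<And>x. cmod (h x) \<le> C"
proof -
  have "compact (h ` cball 0 \<rho>)"
    using assms unfolding cts_supported_def
    by (intro compact_continuous_image compact_cball) (auto intro: continuous_on_subset)
  then obtain C where C: "\<And>x. x \<in> cball 0 \<rho> \<Longrightarrow> cmod (h x) \<le> C"
    using compact_imp_bounded bounded_iff by (metis imageI)
  have "cmod (h x) \<le> max 0 C" for x
    using C[of x] assms unfolding cts_supported_def by (cases "norm x \<le> \<rho>") (auto simp: not_le)
  then show ?thesis using that[of "max 0 C"] by simp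
qed

lemma integrable_mult_bounded:
  fixes f g :: "'a \<Rightarrow> complex"
  assumes f: "integrable M f" and g: "g \<in> borel_measurable M" and b: "\<And>x. cmod (g x) \<le> C"
  shows "integrable M (\<lambda>x. f x * g x)"
  by (rule Bochner_Integration.integrable_bound[OF integrable_mult_right[OF integrable_norm[OF f], of C]])
     (use f g b order_trans[OF norm_ge_zero b] in \<open>auto simp: norm_mult mult.commute[of C] abs_mult intro!: mult_left_mono AE_I2 order_trans[OF _ abs_ge_self]\<close>)

lemma int_dist_integrable:
  assumes h: "integrable lborel h" and \<phi>: "\<phi> \<in> schwartz"
  shows "integrable lborel (\<lambda>z. h z * \<phi> z)"
proof -
  obtain C where "\<And>x. cmod (\<phi> x) \<le> C" using schwartz_bounded[OF \<phi>] by blast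
  then show ?thesis
    using h schwartz_measurable[OF \<phi>] by (intro integrable_mult_bounded) auto
qed

lemma tempered_int_dist:
  assumes h: "integrable lborel h"
  shows "tempered (int_dist h)"
  unfolding tempered_def
proof (intro conjI ballI allI)
  fix \<phi> \<psi> :: "'a \<Rightarrow> complex" assume "\<phi> \<in> schwartz" "\<psi> \<in> schwartz"
  then show "int_dist h (\<lambda>x. \<phi> x + \<psi> x) = int_dist h \<phi> + int_dist h \<psi>"
    unfolding int_dist_def distrib_left by (intro Bochner_Integration.integral_add int_dist_integrable h)
next
  fix \<phi> :: "'a \<Rightarrow> complex" and c
  show "int_dist h (\<lambda>x. c * \<phi> x) = c * int_dist h \<phi>"
    by (simp add: int_dist_def mult.left_commute)
next
  have "cmod (int_dist h \<phi>) \<le> (LINT z|lborel. cmod (h z)) * schwartz_norm 0 \<phi>" if \<phi>: "\<phi> \<in> schwartz" for \<phi>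
  proof -
    obtain C where C: "\<And>x. cmod (\<phi> x) \<le> C" using schwartz_bounded[OF \<phi>] by blast
    have b: "cmod (\<phi> x) \<le> schwartz_norm 0 \<phi>" for x
    proof -
      let ?A = "{vs \<in> lists Basis. length vs \<le> 0} \<times> (UNIV :: 'a set)"
      let ?f = "\<lambda>(vs, x). (1 + norm x) ^ 0 * cmod (iter_deriv vs \<phi> x)"
      have "?f ([], x) \<le> Sup (?f ` ?A)"
        by (intro cSUP_upper bdd_aboveI[of _ C]) (auto simp: C)
      then show ?thesis by (simp add: schwartz_norm_def)
    qed
    have "cmod (int_dist h \<phi>) \<le> (LINT z|lborel. cmod (h z) * schwartz_norm 0 \<phi>)"
      unfolding int_dist_def
      by (rule Bochner_Integration.integral_norm_bound_integral)
         (use h \<phi> b in \<open>auto intro!: int_dist_integrable mult_left_mono simp: norm_mult\<close>)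
    then show ?thesis by simp
  qed
  then show "\<exists>C N. \<forall>\<phi>\<in>schwartz. cmod (int_dist h \<phi>) \<le> C * schwartz_norm N \<phi>" by blast
qed

lemma dist_supp_int_dist:
  assumes h: "\<And>z. \<rho> < norm z \<Longrightarrow> h z = 0"
  shows "dist_supp (int_dist h) \<subseteq> cball 0 \<rho>"
proof -
  have "int_dist h \<phi> = 0" if "\<phi> \<in> test_functions (- cball 0 \<rho>)" for \<phi>
  proof -
    have "h z * \<phi> z = 0" for z
    proof (cases "\<phi> z = 0")
      case False
      then have "z \<in> closure {x. \<phi> x \<noteq> 0}" using closure_subset[of "{x. \<phi> x \<noteq> 0}"] by auto
      then have "z \<notin> cball 0 \<rho>" using that unfolding test_functions_def by blast
      then show ?thesis using h by (simp add: not_le)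
    qed simp
    show ?thesis unfolding int_dist_def by (simp only: \<open>\<And>z. h z * \<phi> z = 0\<close> Bochner_Integration.integral_zero)
  qed
  then have "- cball 0 \<rho> \<subseteq> \<Union>{U. open U \<and> (\<forall>\<phi> \<in> test_functions U. int_dist h \<phi> = 0)}"
    by (intro Union_upper) (auto simp: open_Compl)
  then show ?thesis unfolding dist_supp_def by blast
qed

lemma compactly_supported_int_dist:
  assumes h: "cts_supported \<rho> h"
  shows "compactly_supported_dist (int_dist h)"
proof -
  have sub: "dist_supp (int_dist h) \<subseteq> cball 0 \<rho>"
    using h by (intro dist_supp_int_dist) (auto simp: cts_supported_def)
  have "closed (dist_supp (int_dist h))"
    unfolding dist_supp_def by (intro closed_Compl open_Union) auto
  then have "compact (dist_supp (int_dist h))"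
    using sub bounded_subset[OF bounded_cball] by (simp add: compact_eq_bounded_closed)
  then show ?thesis
    unfolding compactly_supported_dist_def using tempered_int_dist[OF cts_supported_integrable[OF h]] by simp
qed

section \<open>The symplectic transform of a compactly supported function\<close>

lemma exp_i_approx: "cmod (exp (- (\<i> * complex_of_real t)) - 1 + \<i> * complex_of_real t) \<le> t\<^sup>2"
proof -
  have "cmod (iexp (- t) - (\<Sum>k\<le>1. (\<i> * complex_of_real (- t)) ^ k / fact k)) \<le> \<bar>- t\<bar> ^ Suc 1 / fact (Suc 1)"
    by (rule iexp_approx1)
  then have "cmod (exp (- (\<i> * complex_of_real t)) - 1 + \<i> * complex_of_real t) \<le> t\<^sup>2 / 2"
    by (simp add: algebra_simps power2_eq_square)
  then show ?thesis by (smt (verit) zero_le_power2 field_sum_of_halves)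
qed

lemma sympl_add_left: "sympl (w + w') z = sympl w z + sympl w' z"
  and sympl_scaleR_left: "sympl (c *\<^sub>R w) z = c * sympl w z"
  by (simp_all add: sympl_def inner_add_left right_diff_distrib)

lemma sympl_minus: "sympl (- w) z = sympl z w"
  and sympl_diff_left: "sympl (w - w') z = sympl w z - sympl w' z"
  by (simp_all add: sympl_def inner_diff_left inner_diff_right inner_commute)

lemma sympl_bound: "\<bar>sympl w z\<bar> \<le> 2 * norm w * norm z"
proof -
  have "\<bar>sympl w z\<bar> \<le> norm (snd w) * norm (fst z) + norm (fst w) * norm (snd z)"
    unfolding sympl_def using Cauchy_Schwarz_ineq2[of "snd w" "fst z"] Cauchy_Schwarz_ineq2[of "fst w" "snd z"] by linarith
  also have "\<dots> \<le> norm w * norm z + norm w * norm z"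
    using norm_fst_le[of "fst w" "snd w"] norm_snd_le[of "snd w" "fst w"] norm_fst_le[of "fst z" "snd z"] norm_snd_le[of "snd z" "fst z"]
    by (intro add_mono mult_mono) auto
  finally show ?thesis by simp
qed

lemma continuous_on_sympl [continuous_intros]:
  "continuous_on S f \<Longrightarrow> continuous_on S g \<Longrightarrow> continuous_on S (\<lambda>x. sympl (f x) (g x))"
  unfolding sympl_def by (intro continuous_intros)

lemma measurable_sympl [measurable (raw)]:
  "f \<in> borel_measurable M \<Longrightarrow> g \<in> borel_measurable M \<Longrightarrow> (\<lambda>x. sympl (f x) (g x)) \<in> borel_measurable M"
  unfolding sympl_def
  by (intro borel_measurable_diff borel_measurable_inner borel_measurable_fst_comp borel_measurable_snd_comp)

definition sympl_int :: "('d::finite phase_space \<Rightarrow> complex) \<Rightarrow> 'd phase_space \<Rightarrow> complex" where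
  "sympl_int h w = (LINT z|lborel. h z * exp (- (\<i> * complex_of_real (sympl w z))))"

lemma sympl_fourier_eq: "sympl_fourier h w = sympl_int h w / of_real ((2 * pi) ^ CARD('d))"
  for h :: "'d::finite phase_space \<Rightarrow> complex"
  by (simp add: sympl_fourier_def sympl_int_def)

text \<open>Differentiation under the integral: the remainder is quadratic by
  \<open>exp_i_approx\<close>, and the 4 in the second moment \<open>M\<close> is the square of the
  constant in \<open>sympl_bound\<close>. The derivative is again \<open>sympl_int\<close> of a
  function of the same class, so the argument iterates and gives smoothness.\<close>

lemma has_derivative_sympl_int:
  fixes h :: "'d::finite phase_space \<Rightarrow> complex"
  assumes h: "cts_supported \<rho> h"
  shows "(sympl_int h has_derivative (\<lambda>v. sympl_int (\<lambda>z. h z * (- (\<i> * complex_of_real (sympl v z)))) w)) (at w)"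
proof (rule has_derivativeI_sandwich[where e=1])
  let ?D = "\<lambda>v. sympl_int (\<lambda>z. h z * (- (\<i> * complex_of_real (sympl v z)))) w"
  let ?E = "\<lambda>w z. exp (- (\<i> * complex_of_real (sympl w z)))"
  have i: "integrable lborel (\<lambda>z. h z * g z * ?E w z)" if "continuous_on UNIV g" for w g
    by (intro cts_supported_integrable[of \<rho>] cts_supported_mult h that continuous_intros)
  have i1: "integrable lborel (\<lambda>z. h z * ?E w z)" for w
    by (intro cts_supported_integrable[of \<rho>] cts_supported_mult h continuous_intros)
  have iD: "integrable lborel (\<lambda>z. h z * (- (\<i> * complex_of_real (sympl v z))) * ?E w z)" for v w
    by (rule i) (intro continuous_intros)
  show "bounded_linear ?D"
  proof (subst linear_conv_bounded_linear[symmetric], rule linearI)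
    fix a b :: "'d phase_space" and c
    show "?D (a + b) = ?D a + ?D b"
      unfolding sympl_int_def Bochner_Integration.integral_add[OF iD iD, symmetric]
      by (intro Bochner_Integration.integral_cong refl) (simp only: sympl_add_left of_real_add, simp add: algebra_simps)
    show "?D (c *\<^sub>R a) = c *\<^sub>R ?D a"
      unfolding sympl_int_def integral_scaleR_right[symmetric]
      by (intro Bochner_Integration.integral_cong) (auto simp: sympl_scaleR_left scaleR_conv_of_real)
  qed
  define M where "M = (LINT z|lborel. cmod (h z) * (4 * (norm z)\<^sup>2))"
  have iM: "integrable lborel (\<lambda>z. cmod (h z) * (4 * (norm z)\<^sup>2))"
  proof -
    have "integrable lborel (\<lambda>z. h z * complex_of_real (4 * (norm z)\<^sup>2))"
      by (intro cts_supported_integrable[of \<rho>] cts_supported_mult h continuous_intros)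
    from integrable_norm[OF this] show ?thesis by (simp add: norm_mult norm_power)
  qed
  show "norm (sympl_int h y - sympl_int h w - ?D (y - w)) / norm (y - w) \<le> M * norm (y - w)" if "y \<noteq> w" for y
  proof -
    let ?v = "y - w"
    have "sympl_int h y - sympl_int h w - ?D ?v
      = (LINT z|lborel. h z * ?E y z - h z * ?E w z - h z * (- (\<i> * complex_of_real (sympl ?v z))) * ?E w z)"
      unfolding sympl_int_def by (simp only: Bochner_Integration.integral_diff Bochner_Integration.integrable_diff i1 iD)
    also have "\<dots> = (LINT z|lborel. h z * ?E w z * (?E ?v z - 1 + \<i> * complex_of_real (sympl ?v z)))"
    proof (intro Bochner_Integration.integral_cong refl)
      fix z
      have "?E y z = ?E w z * ?E ?v z"
        by (simp add: exp_add[symmetric] sympl_diff_left algebra_simps)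
      then show "h z * ?E y z - h z * ?E w z - h z * (- (\<i> * complex_of_real (sympl ?v z))) * ?E w z = h z * ?E w z * (?E ?v z - 1 + \<i> * complex_of_real (sympl ?v z))"
        by (simp add: algebra_simps)
    qed
    also have "cmod \<dots> \<le> (LINT z|lborel. cmod (h z) * (4 * (norm z)\<^sup>2) * (norm ?v)\<^sup>2)"
    proof (rule Bochner_Integration.integral_norm_bound_integral)
      have "integrable lborel (\<lambda>z. h z * (?E ?v z - 1 + \<i> * complex_of_real (sympl ?v z)) * ?E w z)"
        by (rule i) (intro continuous_intros)
      then show "integrable lborel (\<lambda>z. h z * ?E w z * (?E ?v z - 1 + \<i> * complex_of_real (sympl ?v z)))"
        by (simp add: mult_ac)
      fix z
      have "cmod (?E ?v z - 1 + \<i> * complex_of_real (sympl ?v z)) \<le> (sympl ?v z)\<^sup>2"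
        by (rule exp_i_approx)
      also have "\<dots> \<le> (2 * norm ?v * norm z)\<^sup>2"
        using sympl_bound[of ?v z] power_mono[of "\<bar>sympl ?v z\<bar>" _ 2] by simp
      finally have "cmod (h z) * cmod (?E ?v z - 1 + \<i> * complex_of_real (sympl ?v z)) \<le> cmod (h z) * (2 * norm ?v * norm z)\<^sup>2"
        by (rule mult_left_mono) simp
      then show "cmod (h z * ?E w z * (?E ?v z - 1 + \<i> * complex_of_real (sympl ?v z))) \<le> cmod (h z) * (4 * (norm z)\<^sup>2) * (norm ?v)\<^sup>2"
        by (simp add: norm_mult power_mult_distrib mult_ac)
    qed (use iM in simp)
    also have "\<dots> = M * (norm ?v)\<^sup>2" by (simp add: M_def)
    finally show ?thesis using that by (simp add: field_simps power2_eq_square)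
  qed
  have "((\<lambda>y. M * norm (y - w)) \<longlongrightarrow> M * norm (w - w)) (at w)"
    by (intro tendsto_intros)
  then show "((\<lambda>y. M * norm (y - w)) \<longlongrightarrow> 0) (at w)" by simp
qed auto

lemma smooth_sympl_fourier:
  fixes h :: "'d::finite phase_space \<Rightarrow> complex"
  assumes h: "cts_supported \<rho> h"
  shows "smooth (sympl_fourier h)"
proof -
  have "\<exists>g. cts_supported \<rho> g \<and> iter_deriv vs (sympl_fourier h) = sympl_int g" for vs
  proof (induction vs)
    case Nil
    let ?c = "complex_of_real ((2 * pi) ^ CARD('d))"
    have "cts_supported \<rho> (\<lambda>z. h z * (1 / ?c))"
      by (intro cts_supported_mult h continuous_intros)
    moreover have "sympl_fourier h = sympl_int (\<lambda>z. h z * (1 / ?c))"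
      by (rule ext) (simp add: sympl_fourier_eq sympl_int_def mult.assoc[symmetric] flip: integral_divide_zero)
    ultimately show ?case by auto
  next
    case (Cons v vs)
    then obtain g where g: "cts_supported \<rho> g" "iter_deriv vs (sympl_fourier h) = sympl_int g" by blast
    have "cts_supported \<rho> (\<lambda>z. g z * (- (\<i> * complex_of_real (sympl v z))))"
      by (intro cts_supported_mult g continuous_intros)
    moreover have "iter_deriv (v # vs) (sympl_fourier h) = sympl_int (\<lambda>z. g z * (- (\<i> * complex_of_real (sympl v z))))"
      by (rule ext) (simp add: g(2) frechet_derivative_at[OF has_derivative_sympl_int[OF g(1)], symmetric])
    ultimately show ?case by blast
  qed
  note deriv = this
  show ?thesis
    unfolding smooth_def
  proof (intro ballI allI)
    fix vs :: "'d phase_space list" and x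
    obtain g where "cts_supported \<rho> g" "iter_deriv vs (sympl_fourier h) = sympl_int g"
      using deriv by blast
    then show "iter_deriv vs (sympl_fourier h) differentiable (at x)"
      using has_derivative_sympl_int[of \<rho> g x] by (auto simp: differentiable_def)
  qed
qed

lemma sympl_fourier_bound:
  fixes h :: "'d::finite phase_space \<Rightarrow> complex"
  assumes h: "integrable lborel h"
  shows "cmod (sympl_fourier h w) \<le> (LINT z|lborel. cmod (h z)) / (2 * pi) ^ CARD('d)"
proof -
  have "cmod (sympl_int h w) \<le> (LINT z|lborel. cmod (h z))"
    unfolding sympl_int_def
    using integrable_mult_exp_i(1)[OF h, of "\<lambda>z. sympl w z"] h
    by (intro Bochner_Integration.integral_norm_bound_integral) (auto simp: norm_mult)
  then show ?thesis by (simp add: sympl_fourier_eq norm_divide norm_mult norm_power divide_right_mono)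
qed

lemma smooth_continuous: "smooth f \<Longrightarrow> continuous_on UNIV f"
proof -
  assume f: "smooth f"
  have "[] \<in> lists (Basis :: 'a set)" by simp
  then have "iter_deriv [] f differentiable (at x)" for x
    using f unfolding smooth_def by blast
  then show ?thesis
    using differentiable_imp_continuous_within by (intro continuous_at_imp_continuous_on) fastforce
qed

lemma measurable_sympl_fourier:
  assumes [measurable]: "h \<in> borel_measurable borel" shows "sympl_fourier h \<in> borel_measurable borel"
  unfolding sympl_fourier_def[abs_def] by measurable

text \<open>Fubini. The reflection in the definition of \<open>sympl_fourier_dist\<close> is
  absorbed by the identity \<sigma>(-w, z) = \<sigma>(z, w).\<close>

lemma represents_sympl_fourier:
  fixes h :: "'d::finite phase_space \<Rightarrow> complex"
  assumes h: "integrable lborel h"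
  shows "represents (sympl_fourier h) (sympl_fourier_dist (int_dist h))"
  unfolding represents_def
proof (intro ballI conjI)
  fix \<phi> :: "'d phase_space \<Rightarrow> complex" assume \<phi>: "\<phi> \<in> schwartz"
  have i\<phi>: "integrable lborel \<phi>" by (rule schwartz_integrable[OF \<phi>])
  have [measurable]: "h \<in> borel_measurable borel" using h by (auto simp: integrable_iff_bounded)
  show "integrable lborel (\<lambda>z. sympl_fourier h z * \<phi> z)"
    using integrable_mult_bounded[OF i\<phi> _ sympl_fourier_bound[OF h]] measurable_sympl_fourier[of h]
    by (simp add: mult.commute)
  let ?c = "complex_of_real ((2 * pi) ^ CARD('d))"
  let ?H = "\<lambda>(w, z). (h w * \<phi> z) * exp (- (\<i> * complex_of_real (sympl z w)))"
  have H: "integrable (lborel \<Otimes>\<^sub>M lborel) ?H"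
    using integrable_mult_exp_i(1)[OF integrable_mult_pair[OF h i\<phi>], of "\<lambda>(w, z). sympl z w"]
    by (simp add: split_beta' measurable_lborel1)
  have "sympl_fourier_dist (int_dist h) \<phi> = (LINT w|lborel. LINT z|lborel. ?H (w, z)) / ?c"
    unfolding sympl_fourier_dist_def int_dist_def sympl_fourier_eq sympl_int_def sympl_minus
    by (simp add: mult_ac flip: integral_mult_right_zero integral_divide_zero)
  also have "(LINT w|lborel. LINT z|lborel. ?H (w, z)) = (LINT z|lborel. LINT w|lborel. ?H (w, z))"
    using lborel_pair.Fubini_integral[of "\<lambda>w z. ?H (w, z)"] H by simp
  also have "\<dots> / ?c = (LINT z|lborel. sympl_fourier h z * \<phi> z)"
    unfolding sympl_fourier_eq sympl_int_def
    by (simp add: mult_ac flip: integral_mult_right_zero integral_mult_left_zero integral_divide_zero)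
  finally show "sympl_fourier_dist (int_dist h) \<phi> = (LINT z|lborel. sympl_fourier h z * \<phi> z)" .
qed

lemma bump_gaussian:
  fixes c :: "'a::euclidean_space"
  assumes "0 < s"
  shows "bump 1 c ((sqrt 2 / s) *\<^sub>R One) x = exp (- (norm (s *\<^sub>R (x - c)))\<^sup>2 / 2)"
proof -
  have sq: "(u / (sqrt 2 / s)) ^ (2 * 1) = (s * u) * (s * u) / 2" for u
    using assms by (simp add: power_divide power_mult_distrib) (simp add: power2_eq_square)
  have "(norm (s *\<^sub>R (x - c)))\<^sup>2 / 2 = (\<Sum>b\<in>Basis. ((x - c) \<bullet> b / ((sqrt 2 / s) *\<^sub>R One \<bullet> b)) ^ (2 * 1))"
    unfolding power2_norm_eq_inner euclidean_inner[of "s *\<^sub>R (x - c)" "s *\<^sub>R (x - c)"] sum_divide_distrib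
  proof (intro sum.cong refl)
    fix b :: 'a assume "b \<in> Basis"
    then have One: "One \<bullet> b = (1::real)" 
      using inner_sum_left_Basis[of b "\<lambda>_. 1 :: real"] by (simp only: scaleR_one)
    show "s *\<^sub>R (x - c) \<bullet> b * (s *\<^sub>R (x - c) \<bullet> b) / 2 = ((x - c) \<bullet> b / ((sqrt 2 / s) *\<^sub>R One \<bullet> b)) ^ (2 * 1)"
      using sq[of "(x - c) \<bullet> b"] by (simp only: inner_scaleR_left One mult_1_right)
  qed
  then show ?thesis unfolding bump_def by simp
qed

text \<open>Gaussians centred at a point recover a continuous function there. The difference D is
  known to be integrable only against Schwartz functions, so it is first multiplied by a fixed
  Gaussian, and the approximate identity is applied to the product.\<close>

lemma represents_unique:
  fixes F G :: "'a::euclidean_space \<Rightarrow> complex"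
  assumes F: "continuous_on UNIV F" "represents F v" and G: "continuous_on UNIV G" "represents G v"
  shows "F = G"
proof
  fix z0 :: 'a
  define D where "D = (\<lambda>z. F z - G z)"
  have zero: "integrable lborel (\<lambda>z. D z * \<phi> z)" "(LINT z|lborel. D z * \<phi> z) = 0" if \<phi>: "\<phi> \<in> schwartz" for \<phi>
  proof -
    have i: "integrable lborel (\<lambda>z. F z * \<phi> z)" "integrable lborel (\<lambda>z. G z * \<phi> z)"
      "v \<phi> = (LINT z|lborel. F z * \<phi> z)" "v \<phi> = (LINT z|lborel. G z * \<phi> z)"
      using F(2) G(2) \<phi> unfolding represents_def by auto
    show "integrable lborel (\<lambda>z. D z * \<phi> z)"
      using i(1,2) by (simp add: D_def left_diff_distrib)
    show "(LINT z|lborel. D z * \<phi> z) = 0"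
      unfolding D_def left_diff_distrib Bochner_Integration.integral_diff[OF i(1,2)] using i(3,4) by simp
  qed
  let ?g = "\<lambda>s z. complex_of_real (bump 1 z0 ((sqrt 2 / s) *\<^sub>R One) z)"
  have S: "?g s \<in> schwartz" if "0 < s" for s
    using that by (intro bump_schwartz) auto
  let ?f = "\<lambda>z. D z * ?g 1 z"
  have f: "integrable lborel ?f" by (rule zero(1)[OF S[OF zero_less_one]])
  have cont: "isCont ?f z0"
  proof -
    have "continuous_on UNIV ?f"
      unfolding D_def using F(1) G(1) schwartz_continuous[OF S[of 1]] by (intro continuous_intros) auto
    then show ?thesis by (simp add: continuous_on_eq_continuous_at)
  qed
  have "(LINT z|lborel. ?f z * complex_of_real (gauss_kernel n (z - z0))) = 0" for n
  proof -
    \<comment> \<open>The product of the fixed Gaussian with the one of scale Suc n is again a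
      Gaussian, whose squared scale is the sum of the two.\<close>
    let ?s = "sqrt (1 + (real (Suc n))\<^sup>2)"
    have s: "?s > 0" by (simp add: add_pos_nonneg)
    have "?f z * complex_of_real (gauss_kernel n (z - z0)) = complex_of_real ((sqrt (2 * pi) * real (Suc n)) ^ DIM('a)) * (D z * ?g ?s z)" for z
    proof -
      have "bump 1 z0 ((sqrt 2 / 1) *\<^sub>R One) z * exp (- (norm (real (Suc n) *\<^sub>R (z - z0)))\<^sup>2 / 2) = bump 1 z0 ((sqrt 2 / ?s) *\<^sub>R One) z"
        unfolding bump_gaussian[OF s] bump_gaussian[OF zero_less_one] exp_add[symmetric] exp_inj_iff norm_scaleR power_mult_distrib
        by (simp add: field_simps del: of_nat_Suc)
      note e = this[symmetric]
      show ?thesis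
        unfolding gauss_kernel_def e by (simp only: of_real_mult mult_ac)
    qed
    note eq = this
    show ?thesis
      unfolding eq integral_mult_right_zero zero(2)[OF S[OF s]] by simp
  qed
  with gauss_kernel_approximates[OF f cont] have "(\<lambda>n::nat. 0) \<longlonglongrightarrow> complex_of_real ((2 * pi) ^ DIM('a)) * ?f z0"
    by (simp only:)
  then have "complex_of_real ((2 * pi) ^ DIM('a)) * ?f z0 = 0"
    by (simp only: LIMSEQ_const_iff)
  then have "D z0 = 0" using bump_bounds(1)[of 1 z0 _ z0] by (auto simp: less_le)
  then show "F z0 = G z0" by (simp add: D_def)
qed

theorem sympl_fourier_fun_int_dist:
  fixes h :: "'d::finite phase_space \<Rightarrow> complex"
  assumes h: "cts_supported \<rho> h"
  shows "sympl_fourier_fun (int_dist h) = sympl_fourier h"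
  unfolding sympl_fourier_fun_def
  using smooth_sympl_fourier[OF h] represents_sympl_fourier[OF cts_supported_integrable[OF h]]
    represents_unique smooth_continuous
  by (intro the_equality) blast+

subsection \<open>The kernel of the Weyl operator\<close>

text \<open>Turns the symplectic form into the Euclidean inner product: \<sigma>(-w, z) is the inner
  product of \<open>rot w\<close> with z. The symplectic transform thereby reduces to
  \<open>FT\<close> on the doubled space.\<close>

definition rot :: "'a \<times> 'a \<Rightarrow> 'a::euclidean_space \<times> 'a" where
  "rot z = (- snd z, fst z)"

lemma measurable_rot [measurable]: "rot \<in> borel_measurable borel"
  unfolding rot_def[abs_def] by (intro borel_measurable_continuous_onI continuous_intros)

lemma distr_rot: "distr lborel borel rot = (lborel :: ('a::euclidean_space \<times> 'a) measure)"
proof (rule measure_eqI)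
  fix A :: "('a \<times> 'a) set" assume "A \<in> sets (distr lborel borel rot)"
  then have A [measurable]: "A \<in> sets borel" by simp
  let ?i = "indicator A :: _ \<Rightarrow> ennreal"
  have iA: "?i \<in> borel_measurable (lborel \<Otimes>\<^sub>M lborel)"
    unfolding lborel_prod by simp
  have irA: "(\<lambda>z. ?i (rot z)) \<in> borel_measurable (lborel \<Otimes>\<^sub>M lborel)"
    unfolding lborel_prod by (simp add: measurable_compose[OF measurable_rot])
  have sec: "(\<lambda>y. ?i (y, x)) \<in> borel_measurable borel" for x
    by (rule measurable_compose[OF _ borel_measurable_indicator[OF A]]) (intro borel_measurable_continuous_onI continuous_intros)
  have "emeasure (distr lborel borel rot) A = (\<integral>\<^sup>+z. ?i (rot z) \<partial>lborel)"
    by (subst nn_integral_indicator[symmetric], simp, subst nn_integral_distr) auto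
  also have "\<dots> = (\<integral>\<^sup>+x. \<integral>\<^sup>+y. ?i (rot (x, y)) \<partial>lborel \<partial>lborel)"
    using lborel.nn_integral_fst[OF irA] by (simp add: lborel_prod)
  also have "\<dots> = (\<integral>\<^sup>+x. \<integral>\<^sup>+y. ?i (y, x) \<partial>lborel \<partial>lborel)"
    using nn_integral_lborel_reflect[OF sec, of 0] by (simp add: rot_def)
  also have "\<dots> = (\<integral>\<^sup>+z. ?i z \<partial>lborel)"
    using lborel_pair.nn_integral_snd[OF iA] by (simp add: lborel_prod)
  finally show "emeasure (distr lborel borel rot) A = emeasure lborel A" by simp
qed simp

lemma
  fixes f :: "'a::euclidean_space \<times> 'a \<Rightarrow> complex"
  assumes [measurable]: "f \<in> borel_measurable borel"
  shows integral_rot: "(LINT z|lborel. f (rot z)) = (LINT z|lborel. f z)"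
    and integrable_rot: "integrable lborel (\<lambda>z. f (rot z)) \<longleftrightarrow> integrable lborel f"
  using integral_distr[of rot lborel borel f] integrable_distr_eq[of rot lborel borel f]
  by (simp_all add: distr_rot)

text \<open>The map through which \<open>sympl_fourier_dist\<close> acts on test functions. Since
  \<open>weyl\<close> brings in one more symplectic transform, it occurs twice in the kernel
  formula.\<close>

definition sft :: "('d::finite phase_space \<Rightarrow> complex) \<Rightarrow> 'd phase_space \<Rightarrow> complex" where
  "sft F w = sympl_fourier F (- w)"

lemma sft_eq_FT: "sft F w = FT F (rot w) / of_real ((2 * pi) ^ CARD('d))"
  for F :: "'d::finite phase_space \<Rightarrow> complex"
  unfolding sft_def sympl_fourier_eq sympl_int_def FT_def
  by (simp add: rot_def sympl_def inner_prod_def inner_commute algebra_simps)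

text \<open>Because \<open>rot\<close> is antisymmetric for the inner product, the second transform
  carries the phase of the inverse one. The constants match since the phase space has dimension
  2d.\<close>

lemma sft_involution:
  fixes F :: "'d::finite phase_space \<Rightarrow> complex"
  assumes F: "integrable lborel F" "isCont F w" and s: "integrable lborel (sft F)"
  shows "sft (sft F) w = F w"
proof -
  let ?c = "complex_of_real ((2 * pi) ^ CARD('d))"
  have [measurable]: "F \<in> borel_measurable borel" using F by (auto simp: integrable_iff_bounded)
  have [measurable]: "FT F \<in> borel_measurable borel" by (rule measurable_FT) simp
  have c: "?c \<noteq> 0" by simp
  have "integrable lborel (\<lambda>z. sft F z * ?c)" using s by simp
  also have "(\<lambda>z. sft F z * ?c) = (\<lambda>z. FT F (rot z))"
    by (simp add: sft_eq_FT)
  finally have ft: "integrable lborel (FT F)"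
    by (simp add: integrable_rot)
  let ?g = "\<lambda>v. FT F v * exp (\<i> * complex_of_real (w \<bullet> v))"
  have "sft (sft F) w = (LINT z|lborel. ?g (rot z)) / ?c / ?c"
    unfolding sft_def[of "sft F"] sympl_fourier_eq sympl_int_def unfolding sft_eq_FT
    by (simp add: sympl_def rot_def inner_prod_def inner_commute algebra_simps flip: integral_divide_zero)
  also have "(LINT z|lborel. ?g (rot z)) = (LINT z|lborel. ?g z)"
    by (rule integral_rot) measurable
  also have "\<dots> = complex_of_real ((2 * pi) ^ DIM('d phase_space)) * F w"
    by (rule FT_inversion[OF F(1) ft F(2)])
  also have "complex_of_real ((2 * pi) ^ DIM('d phase_space)) = ?c * ?c"
    by (simp add: power_add)
  finally show ?thesis using c by simp
qed

section \<open>Continuity and integrability of ambiguity functions\<close>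

lemma amb_measurable:
  assumes "\<phi> \<in> schwartz" "\<psi> \<in> schwartz"
    and [measurable]: "p \<in> borel_measurable borel" "q \<in> borel_measurable borel" "r \<in> borel_measurable borel"
  shows "(\<lambda>z. amb a b \<phi> \<psi> (p z) (q z) (r z)) \<in> borel_measurable borel"
proof -
  have [measurable]: "\<phi> \<in> borel_measurable borel" "\<psi> \<in> borel_measurable borel"
    using assms schwartz_measurable by auto
  show ?thesis unfolding amb_def FT_def by measurable
qed

text \<open>The substitution z -> z - p / a frees the first factor from the parameters, so that it
  can serve as a majorant when p, q and the frequency vary.\<close>

lemma amb_shift:
  fixes \<phi> \<psi> :: "'a::euclidean_space \<Rightarrow> complex"
  assumes a: "a \<noteq> 0"
  shows "amb a b \<phi> \<psi> p q \<xi> = (LINT z|lborel. \<phi> (a *\<^sub>R z) * \<psi> (q - (b / a) *\<^sub>R p + b *\<^sub>R z) * exp (- (\<i> * complex_of_real (\<xi> \<bullet> (z - (1 / a) *\<^sub>R p)))))"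
  unfolding amb_def FT_def
  by (subst integral_lborel_translate[of _ "- (1 / a) *\<^sub>R p", symmetric]) (use a in \<open>simp add: algebra_simps\<close>)

lemma amb_continuous:
  fixes \<phi> \<psi> :: "'a::euclidean_space \<Rightarrow> complex"
  assumes \<phi>: "\<phi> \<in> schwartz" and \<psi>: "\<psi> \<in> schwartz" and a: "a \<noteq> 0"
    and p: "p \<longlonglongrightarrow> p0" and q: "q \<longlonglongrightarrow> q0" and r: "r \<longlonglongrightarrow> r0"
  shows "(\<lambda>n. amb a b \<phi> \<psi> (p n) (q n) (r n)) \<longlonglongrightarrow> amb a b \<phi> \<psi> p0 q0 r0"
proof -
  have [measurable]: "\<phi> \<in> borel_measurable borel" "\<psi> \<in> borel_measurable borel"
    using \<phi> \<psi> schwartz_measurable by auto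
  obtain C where C: "0 \<le> C" "\<And>x. cmod (\<psi> x) \<le> C" using schwartz_bounded[OF \<psi>] by blast
  have c\<psi>: "isCont \<psi> x" for x
    using schwartz_continuous[OF \<psi>] by (simp add: continuous_on_eq_continuous_at)
  show ?thesis
    unfolding amb_shift[OF a]
  proof (rule integral_dominated_convergence[where w="\<lambda>z. C * cmod (\<phi> (a *\<^sub>R z))"])
    show "integrable lborel (\<lambda>z. C * cmod (\<phi> (a *\<^sub>R z)))"
      using integrable_affine[OF a, of \<phi> 0] schwartz_integrable[OF \<phi>] by auto
    show "AE x in lborel. (\<lambda>n. \<phi> (a *\<^sub>R x) * \<psi> (q n - (b / a) *\<^sub>R p n + b *\<^sub>R x) * exp (- (\<i> * complex_of_real (r n \<bullet> (x - (1 / a) *\<^sub>R p n)))))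
       \<longlonglongrightarrow> \<phi> (a *\<^sub>R x) * \<psi> (q0 - (b / a) *\<^sub>R p0 + b *\<^sub>R x) * exp (- (\<i> * complex_of_real (r0 \<bullet> (x - (1 / a) *\<^sub>R p0))))"
      by (intro AE_I2 tendsto_mult tendsto_const isCont_tendsto_compose[OF c\<psi>] tendsto_exp tendsto_minus tendsto_of_real tendsto_inner tendsto_diff tendsto_add tendsto_scaleR p q r)
    show "AE x in lborel. norm (\<phi> (a *\<^sub>R x) * \<psi> (q n - (b / a) *\<^sub>R p n + b *\<^sub>R x) * exp (- (\<i> * complex_of_real (r n \<bullet> (x - (1 / a) *\<^sub>R p n))))) \<le> C * cmod (\<phi> (a *\<^sub>R x))" for n
      using C by (intro AE_I2) (simp add: norm_mult mult.commute[of C] mult_left_mono)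
  qed measurable
qed

text \<open>The hypotheses on \<open>cauchy_weight\<close> hold when b p - a q and r are plus or
  minus the identity, as in both applications below.\<close>

lemma amb_pair_integrable:
  fixes \<phi> \<psi> :: "'a::euclidean_space \<Rightarrow> complex" and p q r :: "'a \<Rightarrow> 'a"
  assumes \<phi>: "\<phi> \<in> schwartz" and \<psi>: "\<psi> \<in> schwartz" and a: "a \<noteq> 0"
    and f: "\<And>x. cauchy_weight (b *\<^sub>R p x - a *\<^sub>R q x) = cauchy_weight x"
    and r: "\<And>y. cauchy_weight (r y) = cauchy_weight y"
    and [measurable]: "p \<in> borel_measurable borel" "q \<in> borel_measurable borel" "r \<in> borel_measurable borel"
  shows "integrable (lborel \<Otimes>\<^sub>M lborel) (\<lambda>(x, y). amb a b \<phi> \<psi> (p x) (q x) (r y))"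
proof -
  obtain C where C: "\<And>p q \<xi>. cmod (amb a b \<phi> \<psi> p q \<xi>) \<le> C * (1 / cauchy_weight (b *\<^sub>R p - a *\<^sub>R q)) * (1 / cauchy_weight \<xi>)"
    using amb_cauchy_decay[OF a \<phi> \<psi>] by blast
  have i: "integrable lborel (\<lambda>x::'a. complex_of_real (1 / cauchy_weight x))"
    using integrable_inverse_cauchy_weight by (rule integrable_of_real)
  have m: "(\<lambda>z. amb a b \<phi> \<psi> (p (fst z)) (q (fst z)) (r (snd z))) \<in> borel_measurable (borel :: ('a \<times> 'a) measure)"
    by (intro amb_measurable \<phi> \<psi>) measurable
  show ?thesis
  proof (rule Bochner_Integration.integrable_bound[OF integrable_mult_right[OF integrable_mult_pair[OF i i], of "complex_of_real C"]])
    show "AE z in lborel \<Otimes>\<^sub>M lborel. cmod (case z of (x, y) \<Rightarrow> amb a b \<phi> \<psi> (p x) (q x) (r y))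
        \<le> cmod (complex_of_real C * (case z of (x, y) \<Rightarrow> complex_of_real (1 / cauchy_weight x) * complex_of_real (1 / cauchy_weight y)))"
    proof (intro AE_I2, clarify)
      fix x y :: 'a
      have "cmod (amb a b \<phi> \<psi> (p x) (q x) (r y)) \<le> C * (1 / cauchy_weight x) * (1 / cauchy_weight y)"
        using C[of "p x" "q x" "r y"] unfolding f r .
      also have "\<dots> \<le> \<bar>C\<bar> * (1 / cauchy_weight x) * (1 / cauchy_weight y)"
        by (intro mult_right_mono) auto
      finally show "cmod (amb a b \<phi> \<psi> (p x) (q x) (r y)) \<le> cmod (complex_of_real C * (complex_of_real (1 / cauchy_weight x) * complex_of_real (1 / cauchy_weight y)))"
        by (simp add: norm_mult norm_divide mult.assoc)
    qed
  qed (use m in \<open>simp add: lborel_prod split_beta'\<close>)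
qed

lemma cauchy_weight_minus: "cauchy_weight (- x) = cauchy_weight x"
  by (simp add: cauchy_weight_def)

lemma half_plus: "(1 / 2) *\<^sub>R y + (1 / 2) *\<^sub>R y = y" for y :: "'a::real_vector"
  by (simp flip: scaleR_add_left)

lemma half_minus: "- ((1 / 2) *\<^sub>R y) - (1 / 2) *\<^sub>R y = - y" for y :: "'a::real_vector"
  unfolding minus_add_distrib[symmetric] diff_conv_add_uminus half_plus ..

text \<open>\<Theta> is the partial Fourier transform of \<phi>(t) \<psi>(x) in sheared coordinates,
  which is what the kernel of \<open>rho\<close> pairs with. Inversion requires
  \<open>sft \<Theta>\<close> to be integrable. Computed explicitly, it is again an ambiguity
  function, with slopes 1/2 and -1/2, so the same decay estimate covers it.\<close>

lemma sft_sft_amb: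
  fixes \<phi> \<psi> :: "real^'d::finite \<Rightarrow> complex"
  assumes \<phi>: "\<phi> \<in> schwartz" and \<psi>: "\<psi> \<in> schwartz"
  defines "\<Theta> \<equiv> \<lambda>z. amb (-1) (-1) \<phi> \<psi> ((1/2) *\<^sub>R fst z) (- (1/2) *\<^sub>R fst z) (snd z)"
  shows "sft (sft \<Theta>) = \<Theta>" "integrable lborel \<Theta>"
proof -
  have i\<Theta>: "integrable (lborel \<Otimes>\<^sub>M lborel) (\<lambda>(y, \<xi>). \<Theta> (y, \<xi>))"
  proof -
    have "-1 *\<^sub>R ((1/2) *\<^sub>R x) - -1 *\<^sub>R (- (1/2) *\<^sub>R x) = - x" for x :: "real^'d"
      using half_minus[of x] by simp
    then have "integrable (lborel \<Otimes>\<^sub>M lborel) (\<lambda>(x, y). amb (-1) (-1) \<phi> \<psi> ((1/2) *\<^sub>R x) (- (1/2) *\<^sub>R x) y)"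
      by (intro amb_pair_integrable[OF \<phi> \<psi>]) (simp_all only: cauchy_weight_minus, auto)
    then show ?thesis by (simp only: \<Theta>_def fst_conv snd_conv)
  qed
  then show i: "integrable lborel \<Theta>" by (simp add: lborel_prod)
  have cont: "isCont \<Theta> z" for z
  proof (rule continuous_at_sequentiallyI)
    fix u assume u: "u \<longlonglongrightarrow> z"
    show "(\<lambda>n. \<Theta> (u n)) \<longlonglongrightarrow> \<Theta> z"
      unfolding \<Theta>_def by (intro amb_continuous \<phi> \<psi> tendsto_intros u) auto
  qed
  have s: "sft \<Theta> (x, \<eta>) = amb (1/2) (-(1/2)) \<phi> \<psi> x x (- \<eta>)" for x \<eta>
  proof -
    let ?c = "complex_of_real ((2 * pi) ^ CARD('d))"
    let ?g = "\<lambda>y z. \<phi> ((1/2) *\<^sub>R y + -1 *\<^sub>R z) * \<psi> (- (1/2) *\<^sub>R y + -1 *\<^sub>R z)"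
    have FTg: "\<Theta> (y, \<xi>) = FT (?g y) \<xi>" for y \<xi>
      unfolding \<Theta>_def amb_def by simp
    have ig: "integrable lborel (?g y)" for y by (rule amb_integrable[OF \<phi> \<psi>]) simp
    have iFT: "integrable lborel (FT (?g y))" for y
    proof -
      obtain C where C: "\<And>p q \<xi>. cmod (amb (-1) (-1) \<phi> \<psi> p q \<xi>) \<le> C * (1 / cauchy_weight (-1 *\<^sub>R p - -1 *\<^sub>R q)) * (1 / cauchy_weight \<xi>)"
        using amb_cauchy_decay[OF _ \<phi> \<psi>, of "-1" "-1"] by auto
      have [measurable]: "\<phi> \<in> borel_measurable borel" "\<psi> \<in> borel_measurable borel"
        using \<phi> \<psi> schwartz_measurable by auto
      have m: "FT (?g y) \<in> borel_measurable borel"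
        by (intro measurable_FT) measurable
      let ?K = "C * (1 / cauchy_weight (-1 *\<^sub>R ((1/2) *\<^sub>R y) - -1 *\<^sub>R (- (1/2) *\<^sub>R y)))"
      have b: "cmod (FT (?g y) \<xi>) \<le> ?K * (1 / cauchy_weight \<xi>)" for \<xi>
        using C[of "(1/2) *\<^sub>R y" "- (1/2) *\<^sub>R y" \<xi>] unfolding amb_def .
      show ?thesis
      proof (rule Bochner_Integration.integrable_bound[OF integrable_mult_right[OF integrable_inverse_cauchy_weight, of ?K]])
        show "AE \<xi> in lborel. norm (FT (?g y) \<xi>) \<le> norm (?K * (1 / cauchy_weight \<xi>))"
          unfolding real_norm_def by (intro AE_I2 order_trans[OF b abs_ge_self])
      qed (use m in simp)
    qed
    have cg: "isCont (?g y) z" for y z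
    proof -
      have "continuous_on UNIV (?g y)"
        by (intro continuous_intros continuous_on_compose2[OF schwartz_continuous[OF \<phi>]] continuous_on_compose2[OF schwartz_continuous[OF \<psi>]]) auto
      then show ?thesis by (simp add: continuous_on_eq_continuous_at)
    qed
    \<comment> \<open>The \<xi>-integral undoes the Fourier transform that defines \<Theta> and
      evaluates its integrand at -x.\<close>
    have inv: "(LINT \<xi>|lborel. \<Theta> (y, \<xi>) * exp (\<i> * complex_of_real ((- x) \<bullet> \<xi>))) = ?c * ?g y (- x)" for y
      unfolding FTg using FT_inversion[OF ig iFT cg, of y "- x"] by simp
    let ?H = "\<lambda>(y, \<xi>). \<Theta> (y, \<xi>) * exp (\<i> * complex_of_real (\<eta> \<bullet> y - x \<bullet> \<xi>))"
    have H: "integrable (lborel \<Otimes>\<^sub>M lborel) ?H"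
      using integrable_mult_exp_i(2)[OF i\<Theta>, of "\<lambda>(y, \<xi>). \<eta> \<bullet> y - x \<bullet> \<xi>"] by (simp add: split_beta' measurable_lborel1)
    have "sft \<Theta> (x, \<eta>) = (LINT z|lborel. ?H z) / ?c"
      unfolding sft_def sympl_fourier_eq sympl_int_def
      by (simp add: sympl_def split_beta' algebra_simps)
    also have "(LINT z|lborel. ?H z) = (LINT y|lborel. LINT \<xi>|lborel. ?H (y, \<xi>))"
      using lborel_pair.integral_fst[of "\<lambda>y \<xi>. ?H (y, \<xi>)"] H by (simp add: lborel_prod)
    also have "\<dots> = (LINT y|lborel. exp (\<i> * complex_of_real (\<eta> \<bullet> y)) * (LINT \<xi>|lborel. \<Theta> (y, \<xi>) * exp (\<i> * complex_of_real ((- x) \<bullet> \<xi>))))"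
      unfolding integral_mult_right_zero[symmetric]
      by (intro Bochner_Integration.integral_cong refl) (simp add: exp_add[symmetric] algebra_simps)
    also have "\<dots> = (LINT y|lborel. ?c * (?g y (- x) * exp (- (\<i> * complex_of_real (- \<eta> \<bullet> y)))))"
      unfolding inv by (intro Bochner_Integration.integral_cong refl) (simp add: algebra_simps)
    also have "\<dots> = ?c * amb (1/2) (-(1/2)) \<phi> \<psi> x x (- \<eta>)"
      unfolding integral_mult_right_zero amb_def FT_def by (simp add: algebra_simps)
    finally show ?thesis by simp
  qed
  have "integrable (lborel \<Otimes>\<^sub>M lborel) (\<lambda>(x, \<eta>). amb (1/2) (-(1/2)) \<phi> \<psi> x x (- \<eta>))"
  proof (rule amb_pair_integrable[OF \<phi> \<psi>])
    have "- (1/2) *\<^sub>R x - (1/2) *\<^sub>R x = - x" for x :: "real^'d"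
      using half_minus[of x] by simp
    then show "cauchy_weight (- (1/2) *\<^sub>R x - (1/2) *\<^sub>R x) = cauchy_weight x" for x :: "real^'d"
      by (simp only: cauchy_weight_minus)
  qed (auto simp: cauchy_weight_minus)
  then have iS: "integrable lborel (sft \<Theta>)"
    by (simp add: lborel_prod split_beta' flip: s)
  show "sft (sft \<Theta>) = \<Theta>"
    using sft_involution[OF i cont iS] by blast
qed

section \<open>From the distribution to its Schwartz kernel\<close>

definition partial_FT :: "('a::euclidean_space \<times> 'a \<Rightarrow> complex) \<Rightarrow> 'a \<Rightarrow> 'a \<Rightarrow> complex" where
  "partial_FT h y \<eta> = FT (\<lambda>\<xi>. h (y, \<xi>)) \<eta>"

text \<open>Moved to the test function, the two symplectic transforms cancel by
  \<open>sft_sft_amb\<close>. What remains is the pairing of h with \<Theta>, and Fubini moves the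
  \<xi>-transform from the test function onto h.\<close>

theorem weyl_int_dist:
  fixes h :: "'d::finite phase_space \<Rightarrow> complex"
  assumes h: "cts_supported \<rho> h" and \<phi>: "\<phi> \<in> schwartz" and \<psi>: "\<psi> \<in> schwartz"
  shows "weyl (sympl_fourier_dist (int_dist h)) \<psi> \<phi> =
    (LINT t|lborel. (LINT x|lborel. partial_FT h (t - x) (- (1/2) *\<^sub>R (t + x)) / of_real ((2 * pi) ^ CARD('d)) * \<psi> x) * \<phi> t)"
proof -
  let ?c = "complex_of_real ((2 * pi) ^ CARD('d))"
  define \<Theta> where "\<Theta> = (\<lambda>z. amb (-1) (-1) \<phi> \<psi> ((1/2) *\<^sub>R fst z) (- (1/2) *\<^sub>R fst z) (snd z))"
  have \<Theta>: "sft (sft \<Theta>) = \<Theta>" "integrable lborel \<Theta>"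
    unfolding \<Theta>_def by (rule sft_sft_amb[OF \<phi> \<psi>])+
  have f2: "fourier2 (\<lambda>(y, \<eta>). (\<lambda>(t, x). \<phi> t * \<psi> x) ((1/2) *\<^sub>R y - \<eta>, - (1/2) *\<^sub>R y - \<eta>)) = \<Theta>"
    by (auto simp: fun_eq_iff fourier2_def \<Theta>_def amb_def FT_def)
  have "weyl (sympl_fourier_dist (int_dist h)) \<psi> \<phi> = int_dist h (sft (sft \<Theta>)) / ?c"
    unfolding weyl_def rho_def schroedinger_kernel_def fourier2_dist_def f2
    unfolding sympl_fourier_dist_def sft_def ..
  then have w: "weyl (sympl_fourier_dist (int_dist h)) \<psi> \<phi> = int_dist h \<Theta> / ?c"
    unfolding \<Theta>(1) .
  have [measurable]: "h \<in> borel_measurable borel" by (rule cts_supported_measurable[OF h])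
  have [measurable]: "\<phi> \<in> borel_measurable borel" "\<psi> \<in> borel_measurable borel"
    using \<phi> \<psi> schwartz_measurable by auto
  obtain Ch where Ch: "0 \<le> Ch" "\<And>z. cmod (h z) \<le> Ch" using cts_supported_bounded[OF h] by blast
  obtain C\<psi> where C\<psi>: "0 \<le> C\<psi>" "\<And>x. cmod (\<psi> x) \<le> C\<psi>" using schwartz_bounded[OF \<psi>] by blast
  have hy: "cts_supported \<rho> (\<lambda>\<xi>. h (y, \<xi>))" for y
  proof -
    have "norm \<xi> \<le> norm (y, \<xi>)" for \<xi> by (simp add: norm_Pair)
    moreover have "continuous_on UNIV (\<lambda>\<xi>. h (y, \<xi>))"
    proof -
      have "continuous_on UNIV h" using h unfolding cts_supported_def by blast
      then show ?thesis by (rule continuous_on_compose2) (auto intro!: continuous_intros)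
    qed
    ultimately show ?thesis
      using h unfolding cts_supported_def by (auto dest: order.strict_trans2)
  qed
  have ihy: "integrable lborel (\<lambda>\<xi>. h (y, \<xi>))" for y by (rule cts_supported_integrable[OF hy])
  have pm [measurable]: "(\<lambda>z. partial_FT h (p z) (q z)) \<in> borel_measurable M" if [measurable]: "p \<in> borel_measurable M" "q \<in> borel_measurable M" for p q M
  proof -
    have "(\<lambda>z. partial_FT h (fst z) (snd z)) \<in> borel_measurable (borel \<Otimes>\<^sub>M borel)"
      unfolding partial_FT_def FT_def by measurable
    note m = this
    have "(\<lambda>z. (p z, q z)) \<in> M \<rightarrow>\<^sub>M borel \<Otimes>\<^sub>M borel" by measurable
    from measurable_compose[OF this m] show ?thesis by simp
  qed
  let ?g = "\<lambda>y \<zeta>. \<phi> ((1/2) *\<^sub>R y + -1 *\<^sub>R \<zeta>) * \<psi> (- (1/2) *\<^sub>R y + -1 *\<^sub>R \<zeta>)"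
  have ig: "integrable lborel (?g y)" for y by (rule amb_integrable[OF \<phi> \<psi>]) simp
  have inner: "(LINT \<xi>|lborel. h (y, \<xi>) * \<Theta> (y, \<xi>)) = (LINT t|lborel. \<phi> t * \<psi> (t - y) * partial_FT h y ((1/2) *\<^sub>R y - t))" for y
  proof -
    let ?H = "\<lambda>(\<xi>, \<zeta>). (h (y, \<xi>) * ?g y \<zeta>) * exp (- (\<i> * complex_of_real (\<xi> \<bullet> \<zeta>)))"
    have H: "integrable (lborel \<Otimes>\<^sub>M lborel) ?H"
      using integrable_mult_exp_i(1)[OF integrable_mult_pair[OF ihy[of y] ig[of y]], of "\<lambda>(\<xi>, \<zeta>). \<xi> \<bullet> \<zeta>"]
      by (simp add: split_beta' measurable_lborel1)
    have "(LINT \<xi>|lborel. h (y, \<xi>) * \<Theta> (y, \<xi>)) = (LINT \<xi>|lborel. LINT \<zeta>|lborel. ?H (\<xi>, \<zeta>))"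
      unfolding \<Theta>_def amb_def FT_def integral_mult_right_zero[symmetric]
      by (intro Bochner_Integration.integral_cong refl) (simp add: mult.assoc)
    also have "\<dots> = (LINT \<zeta>|lborel. LINT \<xi>|lborel. ?H (\<xi>, \<zeta>))"
      using lborel_pair.Fubini_integral[of "\<lambda>\<xi> \<zeta>. ?H (\<xi>, \<zeta>)"] H by simp
    also have "\<dots> = (LINT \<zeta>|lborel. ?g y \<zeta> * partial_FT h y \<zeta>)"
      unfolding partial_FT_def FT_def integral_mult_right_zero[symmetric]
      by (intro Bochner_Integration.integral_cong refl) (simp add: mult_ac inner_commute)
    also have "\<dots> = (LINT t|lborel. ?g y ((1/2) *\<^sub>R y - t) * partial_FT h y ((1/2) *\<^sub>R y - t))"
      by (rule integral_lborel_reflect[symmetric])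
    also have "\<dots> = (LINT t|lborel. \<phi> t * \<psi> (t - y) * partial_FT h y ((1/2) *\<^sub>R y - t))"
    proof (intro Bochner_Integration.integral_cong refl)
      fix t
      have e: "(1/2) *\<^sub>R y + -1 *\<^sub>R ((1/2) *\<^sub>R y - t) = t" "- (1/2) *\<^sub>R y + -1 *\<^sub>R ((1/2) *\<^sub>R y - t) = t - y"
        using half_minus[of y] by (simp_all add: algebra_simps)
      show "?g y ((1/2) *\<^sub>R y - t) * partial_FT h y ((1/2) *\<^sub>R y - t) = \<phi> t * \<psi> (t - y) * partial_FT h y ((1/2) *\<^sub>R y - t)"
        unfolding e ..
    qed
    finally show ?thesis .
  qed
  obtain C\<Theta> where C\<Theta>: "\<And>z. cmod (\<Theta> z) \<le> C\<Theta>"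
  proof -
    obtain C where "\<And>p q \<xi>. cmod (amb (-1) (-1) \<phi> \<psi> p q \<xi>) * (1 + norm (-1 *\<^sub>R p - -1 *\<^sub>R q)) ^ 0 \<le> C"
      using amb_bound[OF \<phi> \<psi>, of "-1" "-1" 0] by auto
    then show ?thesis using that[of C] by (simp add: \<Theta>_def)
  qed
  have "integrable lborel (\<lambda>z. h z * \<Theta> z)"
    using borel_measurable_integrable[OF \<Theta>(2)] by (rule integrable_mult_bounded[OF cts_supported_integrable[OF h] _ C\<Theta>])
  then have "int_dist h \<Theta> = (LINT y|lborel. LINT \<xi>|lborel. h (y, \<xi>) * \<Theta> (y, \<xi>))"
    unfolding int_dist_def using lborel_pair.integral_fst[of "\<lambda>y \<xi>. h (y, \<xi>) * \<Theta> (y, \<xi>)"] by (simp add: lborel_prod split_beta')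
  also have "\<dots> = (LINT y|lborel. LINT t|lborel. \<phi> t * \<psi> (t - y) * partial_FT h y ((1/2) *\<^sub>R y - t))"
    unfolding inner ..
  also have "\<dots> = (LINT t|lborel. LINT y|lborel. \<phi> t * \<psi> (t - y) * partial_FT h y ((1/2) *\<^sub>R y - t))"
  proof -
    let ?H = "\<lambda>(y, t). \<phi> t * \<psi> (t - y) * partial_FT h y ((1/2) *\<^sub>R y - t)"
    let ?I = "\<lambda>\<xi>. complex_of_real (indicator (cball 0 \<rho>) \<xi>)"
    \<comment> \<open>V bounds the L1 norms of all slices of h and hence their transforms. Together
      with the bounded range of y this dominates the double integral.\<close>
    define V where "V = (LINT \<xi>|(lborel :: (real^'d) measure). Ch * indicator (cball 0 \<rho>) \<xi>)"
    have iI: "integrable lborel (\<lambda>\<xi>::real^'d. Ch * indicator (cball 0 \<rho>) \<xi>)"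
      using emeasure_bounded_finite[of "cball (0::real^'d) \<rho>"] by simp
    have pb: "cmod (partial_FT h y \<eta>) \<le> V * indicator (cball 0 \<rho>) y" for y \<eta>
    proof (cases "norm y \<le> \<rho>")
      case True
      have "cmod (partial_FT h y \<eta>) \<le> (LINT \<xi>|lborel. cmod (h (y, \<xi>)))"
        unfolding partial_FT_def by (rule FT_bound[OF ihy])
      also have "\<dots> \<le> V"
        unfolding V_def
      proof (rule integral_mono)
        show "cmod (h (y, \<xi>)) \<le> Ch * indicator (cball 0 \<rho>) \<xi>" for \<xi>
          using Ch hy[of y] unfolding cts_supported_def by (cases "norm \<xi> \<le> \<rho>") (auto simp: not_le)
      qed (use ihy iI in auto)
      finally show ?thesis using True by simp
    next
      case False
      have "h (y, \<xi>) = 0" for \<xi>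
        using h False norm_fst_le[of y \<xi>] unfolding cts_supported_def by auto
      then show ?thesis using False by (simp add: partial_FT_def FT_def)
    qed
    have "integrable (lborel \<Otimes>\<^sub>M lborel) (\<lambda>(y :: real^'d, t). ?I y * \<phi> t)"
      using emeasure_bounded_finite[of "cball (0::real^'d) \<rho>"]
      by (intro integrable_mult_pair schwartz_integrable[OF \<phi>] integrable_of_real integrable_real_indicator) auto
    from integrable_mult_right[OF this, of "complex_of_real (C\<psi> * V)"]
    have "integrable (lborel \<Otimes>\<^sub>M lborel) ?H"
    proof (rule Bochner_Integration.integrable_bound)
      show "AE z in lborel \<Otimes>\<^sub>M lborel. cmod (?H z) \<le> cmod (complex_of_real (C\<psi> * V) * (case z of (y, t) \<Rightarrow> ?I y * \<phi> t))"
      proof (intro AE_I2, clarify)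
        fix y t :: "real^'d"
        have "cmod (\<psi> (t - y)) * cmod (partial_FT h y ((1/2) *\<^sub>R y - t)) \<le> C\<psi> * (V * indicator (cball 0 \<rho>) y)"
          by (intro mult_mono C\<psi> pb) auto
        then have "cmod (\<phi> t) * (cmod (\<psi> (t - y)) * cmod (partial_FT h y ((1/2) *\<^sub>R y - t))) \<le> cmod (\<phi> t) * (C\<psi> * (V * indicator (cball 0 \<rho>) y))"
          by (rule mult_left_mono) simp
        also have "\<dots> \<le> cmod (\<phi> t) * \<bar>C\<psi> * (V * indicator (cball 0 \<rho>) y)\<bar>"
          by (intro mult_left_mono) auto
        finally show "cmod (\<phi> t * \<psi> (t - y) * partial_FT h y ((1/2) *\<^sub>R y - t)) \<le> cmod (complex_of_real (C\<psi> * V) * (?I y * \<phi> t))"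
          by (simp add: norm_mult abs_mult mult_ac)
      qed
    qed measurable
    then show ?thesis
      using lborel_pair.Fubini_integral[of "\<lambda>y t. ?H (y, t)"] by simp
  qed
  also have "\<dots> = (LINT t|lborel. LINT x|lborel. \<phi> t * \<psi> x * partial_FT h (t - x) (- (1/2) *\<^sub>R (t + x)))"
  proof (rule Bochner_Integration.integral_cong[OF refl])
    fix t :: "real^'d"
    have e: "(1/2) *\<^sub>R (t - x) - t = - (1/2) *\<^sub>R (t + x)" for x
      using half_plus[of t] by (simp add: algebra_simps)
    show "(LINT y|lborel. \<phi> t * \<psi> (t - y) * partial_FT h y ((1/2) *\<^sub>R y - t)) = (LINT x|lborel. \<phi> t * \<psi> x * partial_FT h (t - x) (- (1/2) *\<^sub>R (t + x)))"
      using integral_lborel_reflect[of "\<lambda>y. \<phi> t * \<psi> (t - y) * partial_FT h y ((1/2) *\<^sub>R y - t)" t, symmetric] unfolding e by simp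
  qed
  also have "\<dots> / ?c = (LINT t|lborel. (LINT x|lborel. partial_FT h (t - x) (- (1/2) *\<^sub>R (t + x)) / ?c * \<psi> x) * \<phi> t)"
    unfolding integral_divide_zero[symmetric] integral_mult_left_zero[symmetric]
    by (intro Bochner_Integration.integral_cong refl) (simp add: mult_ac)
  finally show ?thesis unfolding w by simp
qed

subsection \<open>The Hilbert space structure of \<open>L\<^sup>2\<close>\<close>

lemma L2_inner_integrable:
  assumes "f \<in> L2" "g \<in> L2" shows "integrable lborel (\<lambda>x. f x * cnj (g x))"
  by (rule L2_mult_integrable[OF assms(1) L2_cnj[OF assms(2)]])

lemma L2_inner_add_left:
  assumes "f \<in> L2" "g \<in> L2" "h \<in> L2"
  shows "L2_inner (\<lambda>x. f x + g x) h = L2_inner f h + L2_inner g h"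
  unfolding L2_inner_def distrib_right by (intro Bochner_Integration.integral_add L2_inner_integrable assms)

lemma L2_inner_diff_left:
  assumes "f \<in> L2" "g \<in> L2" "h \<in> L2"
  shows "L2_inner (\<lambda>x. f x - g x) h = L2_inner f h - L2_inner g h"
  unfolding L2_inner_def left_diff_distrib by (intro Bochner_Integration.integral_diff L2_inner_integrable assms)

lemma L2_inner_cmult_left: "L2_inner (\<lambda>x. c * f x) h = c * L2_inner f h"
  by (simp add: L2_inner_def mult.assoc)

lemma L2_inner_sum_left:
  assumes "finite I" "\<And>i. i \<in> I \<Longrightarrow> f i \<in> L2" "h \<in> L2"
  shows "L2_inner (\<lambda>x. \<Sum>i\<in>I. c i * f i x) h = (\<Sum>i\<in>I. c i * L2_inner (f i) h)"
  using assms(1,2)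
proof (induction I rule: finite_induct)
  case empty
  then show ?case by (simp add: L2_inner_def)
next
  case (insert i I)
  have "L2_inner (\<lambda>x. c i * f i x + (\<Sum>i\<in>I. c i * f i x)) h = L2_inner (\<lambda>x. c i * f i x) h + L2_inner (\<lambda>x. \<Sum>i\<in>I. c i * f i x) h"
    using insert assms(3) by (intro L2_inner_add_left L2_cmult L2_sum) auto
  then show ?case using insert by (simp add: L2_inner_cmult_left)
qed

lemma L2_inner_commute: "L2_inner g f = cnj (L2_inner f g)"
  unfolding L2_inner_def Bochner_Integration.integral_cnj[symmetric] complex_cnj_mult complex_cnj_cnj
  by (simp only: mult.commute)

lemma L2_inner_cnj: "cnj (L2_inner f g) = L2_inner g f"
  by (rule L2_inner_commute[symmetric])

lemma L2_norm_nonneg [simp]: "0 \<le> L2_norm f"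
  by (simp add: L2_norm_def)

lemma L2_norm_square: "(L2_norm f)\<^sup>2 = (LINT x|lborel. (cmod (f x))\<^sup>2)"
  by (simp add: L2_norm_def)

lemma L2_inner_self: "L2_inner f f = complex_of_real ((L2_norm f)\<^sup>2)"
  unfolding L2_norm_square L2_inner_def complex_norm_square[symmetric] by (rule integral_complex_of_real)

lemma L2_norm_cmult: "L2_norm (\<lambda>x. c * f x) = cmod c * L2_norm f"
  by (simp add: L2_norm_def norm_mult power_mult_distrib real_sqrt_mult)

lemma L2_norm_minus_commute: "L2_norm (\<lambda>x. f x - g x) = L2_norm (\<lambda>x. g x - f x)"
  by (simp add: L2_norm_def norm_minus_commute)

lemma L2_norm_cong_AE:
  assumes "AE x in lborel. f x = g x" "f \<in> L2" "g \<in> L2" shows "L2_norm f = L2_norm g"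
proof -
  have "(LINT x|lborel. (cmod (f x))\<^sup>2) = (LINT x|lborel. (cmod (g x))\<^sup>2)"
    using assms(1) L2_measurable[OF assms(2)] L2_measurable[OF assms(3)] by (intro integral_cong_AE) auto
  then show ?thesis by (simp add: L2_norm_def)
qed

lemma L2_inner_cong_AE:
  assumes "AE x in lborel. f x = g x" "f \<in> L2" "g \<in> L2" "h \<in> L2" shows "L2_inner f h = L2_inner g h"
  unfolding L2_inner_def
  using assms(1) L2_measurable[OF assms(2)] L2_measurable[OF assms(3)] L2_measurable[OF assms(4)]
  by (intro integral_cong_AE) auto

lemma L2_norm_eq_0:
  assumes "f \<in> L2" "L2_norm f = 0" shows "AE x in lborel. f x = 0"
proof -
  have "(LINT x|lborel. (cmod (f x))\<^sup>2) = 0" using assms(2) by (simp add: L2_norm_def)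
  then have "AE x in lborel. (cmod (f x))\<^sup>2 = 0"
    using integral_nonneg_eq_0_iff_AE[OF L2_square_integrable[OF assms(1)]] by simp
  then show ?thesis by simp
qed

lemma L2_pythagoras:
  assumes "f \<in> L2" "g \<in> L2"
  shows "(L2_norm (\<lambda>x. f x - g x))\<^sup>2 = (L2_norm f)\<^sup>2 - 2 * Re (L2_inner f g) + (L2_norm g)\<^sup>2"
proof -
  have fg: "(\<lambda>x. f x - g x) \<in> L2" by (rule L2_diff[OF assms])
  have "L2_inner (\<lambda>x. f x - g x) (\<lambda>x. f x - g x) = L2_inner f (\<lambda>x. f x - g x) - L2_inner g (\<lambda>x. f x - g x)"
    by (rule L2_inner_diff_left[OF assms fg])
  also have "L2_inner f (\<lambda>x. f x - g x) = L2_inner f f - L2_inner f g"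
    by (subst L2_inner_commute) (simp only: L2_inner_diff_left[OF assms assms(1)] complex_cnj_diff L2_inner_cnj)
  also have "L2_inner g (\<lambda>x. f x - g x) = cnj (L2_inner f g) - L2_inner g g"
    by (subst L2_inner_commute) (simp only: L2_inner_diff_left[OF assms assms(2)] complex_cnj_diff L2_inner_cnj)
  finally have "complex_of_real ((L2_norm (\<lambda>x. f x - g x))\<^sup>2) = complex_of_real ((L2_norm f)\<^sup>2) - L2_inner f g - (cnj (L2_inner f g) - complex_of_real ((L2_norm g)\<^sup>2))"
    by (simp only: L2_inner_self)
  then have "Re (complex_of_real ((L2_norm (\<lambda>x. f x - g x))\<^sup>2)) = Re (complex_of_real ((L2_norm f)\<^sup>2) - L2_inner f g - (cnj (L2_inner f g) - complex_of_real ((L2_norm g)\<^sup>2)))"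
    by (simp only:)
  then show ?thesis by simp
qed

section \<open>Orthonormal families and Bessel's inequality\<close>

definition orthonormal :: "'i set \<Rightarrow> ('i \<Rightarrow> 'a::euclidean_space \<Rightarrow> complex) \<Rightarrow> bool" where
  "orthonormal I e \<longleftrightarrow> (\<forall>i\<in>I. e i \<in> L2) \<and> (\<forall>i\<in>I. \<forall>j\<in>I. L2_inner (e i) (e j) = (if i = j then 1 else 0))"

definition orth_proj :: "'i set \<Rightarrow> ('i \<Rightarrow> 'a::euclidean_space \<Rightarrow> complex) \<Rightarrow> ('a \<Rightarrow> complex) \<Rightarrow> 'a \<Rightarrow> complex" where
  "orth_proj I e f = (\<lambda>x. \<Sum>i\<in>I. L2_inner f (e i) * e i x)"

lemma
  assumes I: "finite I" and e: "orthonormal I e" and f: "f \<in> L2"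
  shows orth_proj_L2: "orth_proj I e f \<in> L2"
    and orth_proj_inner: "i \<in> I \<Longrightarrow> L2_inner (orth_proj I e f) (e i) = L2_inner f (e i)"
    and orth_proj_norm: "(L2_norm (orth_proj I e f))\<^sup>2 = (\<Sum>i\<in>I. (cmod (L2_inner f (e i)))\<^sup>2)"
    and orth_proj_norm_diff: "(L2_norm (\<lambda>x. f x - orth_proj I e f x))\<^sup>2 = (L2_norm f)\<^sup>2 - (\<Sum>i\<in>I. (cmod (L2_inner f (e i)))\<^sup>2)"
proof -
  let ?P = "orth_proj I e f"
  have eL: "\<And>i. i \<in> I \<Longrightarrow> e i \<in> L2" using e by (simp add: orthonormal_def)
  show P: "?P \<in> L2" unfolding orth_proj_def using I eL by (intro L2_sum L2_cmult) auto
  have s: "L2_inner ?P h = (\<Sum>i\<in>I. L2_inner f (e i) * L2_inner (e i) h)" if "h \<in> L2" for h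
    unfolding orth_proj_def using I eL that by (intro L2_inner_sum_left) auto
  show in1: "L2_inner ?P (e i) = L2_inner f (e i)" if i: "i \<in> I" for i
  proof -
    have "L2_inner ?P (e i) = (\<Sum>j\<in>I. if j = i then L2_inner f (e j) else 0)"
      unfolding s[OF eL[OF i]] using e i by (intro sum.cong) (auto simp: orthonormal_def)
    then show ?thesis using I i by simp
  qed
  have fP: "L2_inner ?P f = complex_of_real (\<Sum>i\<in>I. (cmod (L2_inner f (e i)))\<^sup>2)"
    unfolding s[OF f] of_real_sum
    by (intro sum.cong refl) (simp add: L2_inner_commute[of "e _" f] complex_norm_square del: of_real_power)
  have "L2_inner ?P ?P = complex_of_real (\<Sum>i\<in>I. (cmod (L2_inner f (e i)))\<^sup>2)"
    unfolding s[OF P] of_real_sum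
  proof (intro sum.cong refl)
    fix i assume i: "i \<in> I"
    have "L2_inner (e i) ?P = cnj (L2_inner f (e i))" using in1[OF i] L2_inner_commute[of "e i" ?P] by simp
    then show "L2_inner f (e i) * L2_inner (e i) ?P = complex_of_real ((cmod (L2_inner f (e i)))\<^sup>2)"
      by (simp add: complex_norm_square del: of_real_power)
  qed
  then show nP: "(L2_norm ?P)\<^sup>2 = (\<Sum>i\<in>I. (cmod (L2_inner f (e i)))\<^sup>2)"
    unfolding L2_inner_self of_real_eq_iff .
  have "Re (L2_inner f ?P) = (\<Sum>i\<in>I. (cmod (L2_inner f (e i)))\<^sup>2)"
    using fP by (subst L2_inner_commute) simp
  then show "(L2_norm (\<lambda>x. f x - ?P x))\<^sup>2 = (L2_norm f)\<^sup>2 - (\<Sum>i\<in>I. (cmod (L2_inner f (e i)))\<^sup>2)"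
    unfolding L2_pythagoras[OF f P] nP by simp
qed

lemma bessel:
  assumes "finite I" "orthonormal I e" "f \<in> L2"
  shows "(\<Sum>i\<in>I. (cmod (L2_inner f (e i)))\<^sup>2) \<le> (L2_norm f)\<^sup>2"
  using orth_proj_norm_diff[OF assms] zero_le_power2[of "L2_norm (\<lambda>x. f x - orth_proj I e f x)"] by linarith

text \<open>Bessel's inequality for the single vector g divided by its norm.\<close>

lemma L2_cauchy_schwarz:
  fixes f g :: "'a::euclidean_space \<Rightarrow> complex"
  assumes f: "f \<in> L2" and g: "g \<in> L2"
  shows "cmod (L2_inner f g) \<le> L2_norm f * L2_norm g"
proof (cases "L2_norm g = 0")
  case True
  then have "AE x in lborel. g x = 0" using L2_norm_eq_0[OF g] by simp
  then have "L2_inner f g = (LINT x|(lborel :: 'a measure). 0)"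
    unfolding L2_inner_def using L2_measurable[OF f] L2_measurable[OF g] by (intro integral_cong_AE) auto
  then show ?thesis by simp
next
  case False
  define c where "c = complex_of_real (1 / L2_norm g)"
  have c: "cmod c = 1 / L2_norm g" by (simp add: c_def norm_divide)
  have "L2_norm (\<lambda>x. c * g x) = 1"
    using False by (simp add: L2_norm_cmult c)
  then have "orthonormal {()} (\<lambda>_ x. c * g x)"
    using L2_cmult[OF g, of c] by (simp add: orthonormal_def L2_inner_self)
  from bessel[OF _ this f] have "(cmod (L2_inner f (\<lambda>x. c * g x)))\<^sup>2 \<le> (L2_norm f)\<^sup>2" by simp
  then have "cmod (L2_inner f (\<lambda>x. c * g x)) \<le> L2_norm f"
    by (rule power2_le_imp_le) simp
  also have "L2_inner f (\<lambda>x. c * g x) = cnj c * L2_inner f g"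
    unfolding L2_inner_commute[of f] L2_inner_cmult_left by simp
  also have "cmod \<dots> = cmod (L2_inner f g) / L2_norm g" by (simp add: norm_mult c)
  finally show ?thesis
    using False L2_norm_nonneg[of g] by (simp add: divide_le_eq less_le)
qed

lemma L2_triangle:
  assumes f: "f \<in> L2" and g: "g \<in> L2"
  shows "L2_norm (\<lambda>x. f x - g x) \<le> L2_norm f + L2_norm g"
proof (rule power2_le_imp_le)
  have "- Re (L2_inner f g) \<le> L2_norm f * L2_norm g"
    using L2_cauchy_schwarz[OF f g] abs_Re_le_cmod[of "L2_inner f g"] by linarith
  then show "(L2_norm (\<lambda>x. f x - g x))\<^sup>2 \<le> (L2_norm f + L2_norm g)\<^sup>2"
    unfolding L2_pythagoras[OF f g] power2_sum by linarith
qed simp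

lemma L2_triangle_add:
  assumes f: "f \<in> L2" and g: "g \<in> L2"
  shows "L2_norm (\<lambda>x. f x + g x) \<le> L2_norm f + L2_norm g"
  using L2_triangle[OF f L2_cmult[OF g, of "-1"]] L2_norm_cmult[of "-1" g] by simp

lemma L2_triangle_dist:
  assumes f: "f \<in> L2" and g: "g \<in> L2" and h: "h \<in> L2"
  shows "L2_norm (\<lambda>x. f x - h x) \<le> L2_norm (\<lambda>x. f x - g x) + L2_norm (\<lambda>x. g x - h x)"
  using L2_triangle_add[OF L2_diff[OF f g] L2_diff[OF g h]] by simp

lemma L2_norm_le_dist:
  assumes f: "f \<in> L2" and g: "g \<in> L2"
  shows "L2_norm f \<le> L2_norm g + L2_norm (\<lambda>x. f x - g x)"
  using L2_triangle_add[OF g L2_diff[OF f g]] by simp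

subsection \<open>Bounded operators\<close>

lemma
  assumes "L2_bounded_op A"
  shows bounded_op_L2: "f \<in> L2 \<Longrightarrow> A f \<in> L2"
    and bounded_op_add: "f \<in> L2 \<Longrightarrow> g \<in> L2 \<Longrightarrow> AE x in lborel. A (\<lambda>x. f x + g x) x = A f x + A g x"
    and bounded_op_cmult: "f \<in> L2 \<Longrightarrow> AE x in lborel. A (\<lambda>x. c * f x) x = c * A f x"
  using assms unfolding L2_bounded_op_def by blast+

lemma bounded_op_bound:
  assumes "L2_bounded_op A"
  obtains C where "0 \<le> C" "\<And>f. f \<in> L2 \<Longrightarrow> L2_norm (A f) \<le> C * L2_norm f"
proof -
  obtain C where C: "\<And>f. f \<in> L2 \<Longrightarrow> L2_norm (A f) \<le> C * L2_norm f"
    using assms unfolding L2_bounded_op_def by blast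
  have "L2_norm (A f) \<le> max 0 C * L2_norm f" if "f \<in> L2" for f
    using C[OF that] mult_right_mono[of C "max 0 C" "L2_norm f"] by simp
  then show ?thesis using that[of "max 0 C"] by simp
qed

lemma bounded_op_diff:
  assumes A: "L2_bounded_op A" and f: "f \<in> L2" and g: "g \<in> L2"
  shows "AE x in lborel. A (\<lambda>x. f x - g x) x = A f x - A g x"
  using bounded_op_add[OF A f L2_cmult[OF g, of "-1"]] bounded_op_cmult[OF A g, of "-1"]
  by eventually_elim simp

lemma bounded_op_norm_diff:
  assumes A: "L2_bounded_op A" and f: "f \<in> L2" and g: "g \<in> L2"
  shows "L2_norm (A (\<lambda>x. f x - g x)) = L2_norm (\<lambda>x. A f x - A g x)"
  using A f g by (intro L2_norm_cong_AE bounded_op_diff bounded_op_L2[OF A] L2_diff)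

lemma bounded_op_norm_cmult:
  assumes A: "L2_bounded_op A" and f: "f \<in> L2"
  shows "L2_norm (A (\<lambda>x. c * f x)) = cmod c * L2_norm (A f)"
  using L2_norm_cong_AE[OF bounded_op_cmult[OF A f, of c] bounded_op_L2[OF A L2_cmult[OF f]] L2_cmult[OF bounded_op_L2[OF A f]]]
  by (simp add: L2_norm_cmult)

text \<open>\<open>L2_adjoint\<close> is a choice, which carries information only once some adjoint
  is known. For kernel operators the conjugate transposed kernel is such a witness, and this
  predicate passes it along.\<close>

definition is_adjoint :: "'a::euclidean_space operator \<Rightarrow> 'a operator \<Rightarrow> bool" where
  "is_adjoint A B \<longleftrightarrow> L2_bounded_op B \<and> (\<forall>f \<in> L2. \<forall>g \<in> L2. L2_inner (A f) g = L2_inner f (B g))"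

lemma is_adjoint_L2_adjoint: "is_adjoint A B \<Longrightarrow> is_adjoint A (L2_adjoint A)"
proof -
  assume B: "is_adjoint A B"
  have "L2_adjoint A = (SOME B. is_adjoint A B)"
    by (simp only: L2_adjoint_def is_adjoint_def)
  then show ?thesis using someI[of "is_adjoint A", OF B] by (simp only:)
qed

lemma is_adjointD:
  assumes "is_adjoint A B" "f \<in> L2" "g \<in> L2"
  shows "L2_inner (A f) g = L2_inner f (B g)" "L2_inner (B g) f = L2_inner g (A f)"
proof -
  show *: "L2_inner (A f) g = L2_inner f (B g)"
    using assms unfolding is_adjoint_def by blast
  show "L2_inner (B g) f = L2_inner g (A f)"
    using arg_cong[OF *, of cnj] by (simp only: L2_inner_cnj)
qed

text \<open>Density is used twice: first in the second argument of the pairing, in order to reach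
  the conjugate of the difference \<open>D\<close> itself, and then in the argument of the
  operators, where boundedness carries the limit.\<close>

theorem extension_unique:
  assumes A: "extends_to T A" and B: "extends_to T B" and f: "f \<in> L2"
  shows "AE x in lborel. A f x = B f x"
  using f
proof (rule schwartz_dense_L2[rotated -1])
  have bA: "L2_bounded_op A" and bB: "L2_bounded_op B" using A B by (auto simp: extends_to_def)
  note AL = bounded_op_L2[OF bA] and BL = bounded_op_L2[OF bB]
  fix \<psi> :: "'a \<Rightarrow> complex" assume \<psi>: "\<psi> \<in> schwartz"
  have \<psi>L: "\<psi> \<in> L2" by (rule schwartz_L2[OF \<psi>])
  define D where "D = (\<lambda>x. A \<psi> x - B \<psi> x)"
  have D: "D \<in> L2" unfolding D_def by (intro L2_diff AL BL \<psi>L)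
  have i: "integrable lborel (\<lambda>x. D x * \<phi> x)" if "\<phi> \<in> L2" for \<phi> by (rule L2_mult_integrable[OF D that])
  have "(LINT x|lborel. D x * cnj (D x)) = 0"
    using L2_cnj[OF D]
  proof (rule schwartz_dense_L2[rotated -1, where P="\<lambda>\<phi>. (LINT x|lborel. D x * \<phi> x) = 0"])
    fix \<phi> :: "'a \<Rightarrow> complex" assume \<phi>: "\<phi> \<in> schwartz"
    have "T \<psi> \<phi> = (LINT x|lborel. A \<psi> x * \<phi> x)" "T \<psi> \<phi> = (LINT x|lborel. B \<psi> x * \<phi> x)"
      using A B \<phi> \<psi> by (auto simp: extends_to_def)
    then show "(LINT x|lborel. D x * \<phi> x) = 0"
      unfolding D_def left_diff_distrib
      by (subst Bochner_Integration.integral_diff) (auto intro!: L2_mult_integrable AL BL \<psi>L schwartz_L2[OF \<phi>])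
  next
    fix f g :: "'a \<Rightarrow> complex" assume "f \<in> L2" "g \<in> L2" "(LINT x|lborel. D x * f x) = 0" "(LINT x|lborel. D x * g x) = 0"
    then show "(LINT x|lborel. D x * (f x + g x)) = 0"
      unfolding distrib_left by (subst Bochner_Integration.integral_add) (auto intro: i)
  next
    fix f :: "'a \<Rightarrow> complex" and c assume "f \<in> L2" "(LINT x|lborel. D x * f x) = 0"
    then show "(LINT x|lborel. D x * (c * f x)) = 0"
      by (simp add: mult.left_commute[of _ c])
  next
    fix F :: "nat \<Rightarrow> 'a \<Rightarrow> complex" and f assume F: "\<And>n. F n \<in> L2" and f: "f \<in> L2" and z: "\<And>n. (LINT x|lborel. D x * F n x) = 0"
      and l: "(\<lambda>n. LINT x|lborel. (cmod (F n x - f x))\<^sup>2) \<longlonglongrightarrow> 0"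
    have l': "(\<lambda>n. L2_norm (\<lambda>x. F n x - f x)) \<longlonglongrightarrow> 0"
      unfolding L2_norm_def using tendsto_real_sqrt[OF l] by simp
    have b: "cmod (LINT x|lborel. D x * f x) \<le> L2_norm D * L2_norm (\<lambda>x. F n x - f x)" for n
    proof -
      have "(LINT x|lborel. D x * (F n x - f x)) = - (LINT x|lborel. D x * f x)"
        unfolding right_diff_distrib using z[of n] by (subst Bochner_Integration.integral_diff) (auto intro: i F f)
      moreover have "(LINT x|lborel. D x * (F n x - f x)) = L2_inner D (\<lambda>x. cnj (F n x - f x))"
        by (simp add: L2_inner_def)
      moreover have "L2_norm (\<lambda>x. cnj (F n x - f x)) = L2_norm (\<lambda>x. F n x - f x)"
        unfolding L2_norm_def complex_mod_cnj ..
      ultimately show ?thesis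
        using L2_cauchy_schwarz[OF D L2_cnj[OF L2_diff[OF F[of n] f]]] by simp
    qed
    have "(\<lambda>n. L2_norm D * L2_norm (\<lambda>x. F n x - f x)) \<longlonglongrightarrow> L2_norm D * 0"
      by (intro tendsto_mult tendsto_const l')
    then have "cmod (LINT x|lborel. D x * f x) \<le> L2_norm D * 0"
      by (rule LIMSEQ_le_const) (use b in auto)
    then show "(LINT x|lborel. D x * f x) = 0" by simp
  qed
  then have "L2_norm D = 0"
    using L2_inner_self[of D] by (simp add: L2_inner_def)
  from L2_norm_eq_0[OF D this] show "AE x in lborel. A \<psi> x = B \<psi> x" by (simp add: D_def)
next
  have bA: "L2_bounded_op A" and bB: "L2_bounded_op B" using A B by (auto simp: extends_to_def)
  fix f g :: "'a \<Rightarrow> complex" assume f: "f \<in> L2" and g: "g \<in> L2" and eq: "AE x in lborel. A f x = B f x" "AE x in lborel. A g x = B g x"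
  show "AE x in lborel. A (\<lambda>x. f x + g x) x = B (\<lambda>x. f x + g x) x"
    using eq bounded_op_add[OF bA f g] bounded_op_add[OF bB f g] by eventually_elim simp
next
  have bA: "L2_bounded_op A" and bB: "L2_bounded_op B" using A B by (auto simp: extends_to_def)
  fix f :: "'a \<Rightarrow> complex" and c assume f: "f \<in> L2" and eq: "AE x in lborel. A f x = B f x"
  show "AE x in lborel. A (\<lambda>x. c * f x) x = B (\<lambda>x. c * f x) x"
    using eq bounded_op_cmult[OF bA f, of c] bounded_op_cmult[OF bB f, of c] by eventually_elim simp
next
  have bA: "L2_bounded_op A" and bB: "L2_bounded_op B" using A B by (auto simp: extends_to_def)
  note AL = bounded_op_L2[OF bA] and BL = bounded_op_L2[OF bB]
  fix F :: "nat \<Rightarrow> 'a \<Rightarrow> complex" and f assume F: "\<And>n. F n \<in> L2" and f: "f \<in> L2" and z: "\<And>n. AE x in lborel. A (F n) x = B (F n) x"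
    and l: "(\<lambda>n. LINT x|lborel. (cmod (F n x - f x))\<^sup>2) \<longlonglongrightarrow> 0"
  have l': "(\<lambda>n. L2_norm (\<lambda>x. F n x - f x)) \<longlonglongrightarrow> 0"
    unfolding L2_norm_def using tendsto_real_sqrt[OF l] by simp
  obtain C where C: "\<And>f. f \<in> L2 \<Longrightarrow> L2_norm (A f) \<le> C * L2_norm f" using bounded_op_bound[OF bA] by blast
  obtain C' where C': "\<And>f. f \<in> L2 \<Longrightarrow> L2_norm (B f) \<le> C' * L2_norm f" using bounded_op_bound[OF bB] by blast
  have b: "L2_norm (\<lambda>x. A f x - B f x) \<le> (C + C') * L2_norm (\<lambda>x. F n x - f x)" for n
  proof -
    have "L2_norm (\<lambda>x. A f x - B f x) \<le> L2_norm (\<lambda>x. A f x - A (F n) x) + L2_norm (\<lambda>x. A (F n) x - B f x)"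
      by (intro L2_triangle_dist AL BL f F)
    also have "L2_norm (\<lambda>x. A f x - A (F n) x) = L2_norm (A (\<lambda>x. F n x - f x))"
      unfolding bounded_op_norm_diff[OF bA F f] by (rule L2_norm_minus_commute)
    also have "\<dots> \<le> C * L2_norm (\<lambda>x. F n x - f x)" by (intro C L2_diff F f)
    also have "L2_norm (\<lambda>x. A (F n) x - B f x) = L2_norm (\<lambda>x. B (F n) x - B f x)"
      using z[of n] by (intro L2_norm_cong_AE L2_diff AL BL F f) auto
    also have "\<dots> = L2_norm (B (\<lambda>x. F n x - f x))"
      by (rule bounded_op_norm_diff[OF bB F f, symmetric])
    also have "\<dots> \<le> C' * L2_norm (\<lambda>x. F n x - f x)" by (intro C' L2_diff F f)
    finally show ?thesis by (simp add: distrib_right)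
  qed
  have "(\<lambda>n. (C + C') * L2_norm (\<lambda>x. F n x - f x)) \<longlonglongrightarrow> (C + C') * 0"
    by (intro tendsto_mult tendsto_const l')
  then have "L2_norm (\<lambda>x. A f x - B f x) \<le> (C + C') * 0"
    by (rule LIMSEQ_le_const) (use b in auto)
  then have "L2_norm (\<lambda>x. A f x - B f x) = 0" using L2_norm_nonneg[of "\<lambda>x. A f x - B f x"] by linarith
  from L2_norm_eq_0[OF L2_diff[OF AL[OF f] BL[OF f]] this] show "AE x in lborel. A f x = B f x" by simp
qed

subsection \<open>Integral operators\<close>

definition kernel_op :: "('a::euclidean_space \<Rightarrow> 'a \<Rightarrow> complex) \<Rightarrow> 'a operator" where
  "kernel_op k f t = (LINT x|lborel. k t x * f x)"

definition hs_square :: "('a::euclidean_space \<Rightarrow> 'a \<Rightarrow> complex) \<Rightarrow> ennreal" where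
  "hs_square k = (\<integral>\<^sup>+t. \<integral>\<^sup>+x. ennreal ((cmod (k t x))\<^sup>2) \<partial>lborel \<partial>lborel)"

lemma kernel_op_measurable:
  fixes k :: "'a::euclidean_space \<Rightarrow> 'a \<Rightarrow> complex"
  assumes [measurable]: "(\<lambda>(t, x). k t x) \<in> borel_measurable (borel \<Otimes>\<^sub>M borel)" "f \<in> borel_measurable borel"
  shows "kernel_op k f \<in> borel_measurable borel"
  unfolding kernel_op_def by measurable

text \<open>Bessel for each row of the kernel, integrated over the rows. Kernels are merely
  measurable here because the cube factors at \<theta> = 1/2 are discontinuous.\<close>

lemma hilbert_schmidt_bessel:
  fixes k :: "'a::euclidean_space \<Rightarrow> 'a \<Rightarrow> complex"
  assumes k [measurable]: "(\<lambda>(t, x). k t x) \<in> borel_measurable (borel \<Otimes>\<^sub>M borel)"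
    and I: "finite I" and e: "orthonormal I e"
  shows "(\<Sum>i\<in>I. \<integral>\<^sup>+t. ennreal ((cmod (kernel_op k (e i) t))\<^sup>2) \<partial>lborel) \<le> hs_square k"
proof -
  have em: "e i \<in> borel_measurable borel" if "i \<in> I" for i
    using e that L2_measurable by (auto simp: orthonormal_def)
  have "(\<Sum>i\<in>I. \<integral>\<^sup>+t. ennreal ((cmod (kernel_op k (e i) t))\<^sup>2) \<partial>lborel) = (\<integral>\<^sup>+t. (\<Sum>i\<in>I. ennreal ((cmod (kernel_op k (e i) t))\<^sup>2)) \<partial>lborel)"
    using kernel_op_measurable[OF k em] by (intro nn_integral_sum[symmetric]) simp
  also have "\<dots> \<le> hs_square k"
    unfolding hs_square_def
  proof (rule nn_integral_mono)
    fix t :: 'a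
    have km [measurable]: "k t \<in> borel_measurable borel" by measurable
    show "(\<Sum>i\<in>I. ennreal ((cmod (kernel_op k (e i) t))\<^sup>2)) \<le> (\<integral>\<^sup>+x. ennreal ((cmod (k t x))\<^sup>2) \<partial>lborel)"
    proof (cases "(\<integral>\<^sup>+x. ennreal ((cmod (k t x))\<^sup>2) \<partial>lborel) < \<infinity>")
      case True
      then have int: "integrable lborel (\<lambda>x. (cmod (k t x))\<^sup>2)"
        by (intro integrableI_bounded) auto
      then have kL: "(\<lambda>x. cnj (k t x)) \<in> L2" by (intro L2_cnj L2_I km)
      have "kernel_op k (e i) t = cnj (L2_inner (\<lambda>x. cnj (k t x)) (e i))" for i
        by (subst L2_inner_commute[symmetric]) (simp add: kernel_op_def L2_inner_def mult.commute)
      then have "(\<Sum>i\<in>I. ennreal ((cmod (kernel_op k (e i) t))\<^sup>2)) = ennreal (\<Sum>i\<in>I. (cmod (L2_inner (\<lambda>x. cnj (k t x)) (e i)))\<^sup>2)"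
        by simp
      also have "\<dots> \<le> ennreal (LINT x|lborel. (cmod (k t x))\<^sup>2)"
        using bessel[OF I e kL] by (intro ennreal_leI) (simp add: L2_norm_square)
      also have "\<dots> = (\<integral>\<^sup>+x. ennreal ((cmod (k t x))\<^sup>2) \<partial>lborel)"
        using int by (intro nn_integral_eq_integral[symmetric]) auto
      finally show ?thesis .
    next
      case False
      then have "(\<integral>\<^sup>+x. ennreal ((cmod (k t x))\<^sup>2) \<partial>lborel) = \<top>" by (simp add: not_less top_unique)
      then show ?thesis by simp
    qed
  qed
  finally show ?thesis .
qed

text \<open>Continuity and the band make the row \<open>k t\<close> depend continuously on t in
  \<open>L2\<close>, and finiteness of \<open>hs_square\<close> makes its norm square integrable.
  Together these give compactness.\<close>

definition band_kernel :: "real \<Rightarrow> ('a::euclidean_space \<Rightarrow> 'a \<Rightarrow> complex) \<Rightarrow> bool" where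
  "band_kernel \<rho> k \<longleftrightarrow> continuous_on UNIV (\<lambda>z. k (fst z) (snd z)) \<and> (\<forall>t x. \<rho> < norm (t - x) \<longrightarrow> k t x = 0) \<and> hs_square k < \<infinity>"

lemma band_kernel_measurable:
  assumes "band_kernel \<rho> k"
  shows "(\<lambda>(t, x). k t x) \<in> borel_measurable (borel \<Otimes>\<^sub>M borel)"
  using assms unfolding band_kernel_def split_beta' borel_prod by (auto intro: borel_measurable_continuous_onI)

lemma band_kernel_L2:
  assumes k: "band_kernel \<rho> k" shows "k t \<in> L2"
proof -
  have c: "continuous_on UNIV (\<lambda>z. k (fst z) (snd z))" using k by (simp add: band_kernel_def)
  have ct: "continuous_on UNIV (k t)"
  proof -
    have "continuous_on UNIV (\<lambda>x. (t, x))" by (intro continuous_intros)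
    from continuous_on_compose2[OF c this] show ?thesis by simp
  qed
  have s: "k t x = indicator (cball t \<rho>) x *\<^sub>R k t x" for x
    using k by (auto simp: band_kernel_def indicator_def dist_norm)
  have "integrable lborel (\<lambda>x. indicator (cball t \<rho>) x *\<^sub>R (cmod (k t x))\<^sup>2)"
    by (intro borel_integrable_compact compact_cball continuous_intros continuous_on_subset[OF ct]) auto
  also have "(\<lambda>x. indicator (cball t \<rho>) x *\<^sub>R (cmod (k t x))\<^sup>2) = (\<lambda>x. (cmod (k t x))\<^sup>2)"
    using k by (auto simp: band_kernel_def indicator_def dist_norm fun_eq_iff)
  finally show ?thesis using ct by (intro L2_I borel_measurable_continuous_onI)
qed

lemma kernel_op_inner: "kernel_op k f t = L2_inner f (\<lambda>x. cnj (k t x))"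
  by (simp add: kernel_op_def L2_inner_def mult.commute)

lemma L2_norm_cnj: "L2_norm (\<lambda>x. cnj (f x)) = L2_norm f"
  by (simp add: L2_norm_def)

lemma kernel_op_pointwise:
  assumes k: "band_kernel \<rho> k" and f: "f \<in> L2"
  shows "cmod (kernel_op k f t) \<le> L2_norm f * L2_norm (k t)"
  unfolding kernel_op_inner
  using L2_cauchy_schwarz[OF f L2_cnj[OF band_kernel_L2[OF k, of t]]] by (simp add: L2_norm_cnj)

lemma band_kernel_norm_integrable:
  assumes k: "band_kernel \<rho> k"
  shows "integrable lborel (\<lambda>t. (L2_norm (k t))\<^sup>2)"
    and "hs_square k = ennreal (LINT t|lborel. (L2_norm (k t))\<^sup>2)"
proof -
  have eq: "(\<integral>\<^sup>+x. ennreal ((cmod (k t x))\<^sup>2) \<partial>lborel) = ennreal ((L2_norm (k t))\<^sup>2)" for t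
    unfolding L2_norm_square using L2_square_integrable[OF band_kernel_L2[OF k]]
    by (intro nn_integral_eq_integral) auto
  then have hs: "hs_square k = (\<integral>\<^sup>+t. ennreal ((L2_norm (k t))\<^sup>2) \<partial>lborel)"
    by (simp add: hs_square_def)
  note [measurable] = band_kernel_measurable[OF k]
  have m: "(\<lambda>t. (L2_norm (k t))\<^sup>2) \<in> borel_measurable lborel"
    unfolding L2_norm_square by measurable
  show "integrable lborel (\<lambda>t. (L2_norm (k t))\<^sup>2)"
    using k hs m by (intro integrableI_bounded) (auto simp: band_kernel_def)
  then show "hs_square k = ennreal (LINT t|lborel. (L2_norm (k t))\<^sup>2)"
    unfolding hs by (intro nn_integral_eq_integral) auto
qed

lemma kernel_op_L2:
  assumes k: "band_kernel \<rho> k" and f: "f \<in> L2"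
  shows "kernel_op k f \<in> L2"
proof (rule L2_dominated)
  show "integrable lborel (\<lambda>t. (L2_norm f)\<^sup>2 * (L2_norm (k t))\<^sup>2)"
    using band_kernel_norm_integrable[OF k] by simp
  show "kernel_op k f \<in> borel_measurable borel"
    by (intro kernel_op_measurable band_kernel_measurable[OF k] L2_measurable[OF f])
  show "AE t in lborel. (cmod (kernel_op k f t))\<^sup>2 \<le> (L2_norm f)\<^sup>2 * (L2_norm (k t))\<^sup>2"
    using power_mono[OF kernel_op_pointwise[OF k f], where n=2] by (simp add: power_mult_distrib)
qed

lemma kernel_op_bounded:
  assumes k: "band_kernel \<rho> k"
  shows "L2_bounded_op (kernel_op k)"
  unfolding L2_bounded_op_def
proof (intro conjI ballI allI exI)
  have i: "integrable lborel (\<lambda>x. k t x * f x)" if "f \<in> L2" for t f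
    by (rule L2_mult_integrable[OF band_kernel_L2[OF k] that])
  show "AE x in lborel. kernel_op k (\<lambda>x. f x + g x) x = kernel_op k f x + kernel_op k g x" if "f \<in> L2" "g \<in> L2" for f g
    unfolding kernel_op_def distrib_left using that by (simp add: i)
  show "AE x in lborel. kernel_op k (\<lambda>x. c * f x) x = c * kernel_op k f x" for f c
    unfolding kernel_op_def by (simp add: mult.left_commute)
  fix f :: "'a \<Rightarrow> complex" assume f: "f \<in> L2"
  show "L2_norm (kernel_op k f) \<le> sqrt (LINT t|lborel. (L2_norm (k t))\<^sup>2) * L2_norm f"
  proof (rule power2_le_imp_le)
    have "(L2_norm (kernel_op k f))\<^sup>2 \<le> (LINT t|lborel. (L2_norm f)\<^sup>2 * (L2_norm (k t))\<^sup>2)"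
      unfolding L2_norm_square[of "kernel_op k f"]
    proof (rule integral_mono)
      show "(cmod (kernel_op k f t))\<^sup>2 \<le> (L2_norm f)\<^sup>2 * (L2_norm (k t))\<^sup>2" for t
        using power_mono[OF kernel_op_pointwise[OF k f], where n=2] by (simp add: power_mult_distrib)
    qed (use L2_square_integrable[OF kernel_op_L2[OF k f]] band_kernel_norm_integrable[OF k] in auto)
    also have "\<dots> = (sqrt (LINT t|lborel. (L2_norm (k t))\<^sup>2) * L2_norm f)\<^sup>2"
      by (simp add: power_mult_distrib integral_nonneg)
    finally show "(L2_norm (kernel_op k f))\<^sup>2 \<le> (sqrt (LINT t|lborel. (L2_norm (k t))\<^sup>2) * L2_norm f)\<^sup>2" .
  qed simp
qed (rule kernel_op_L2[OF k])

lemma hs_square_flip: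
  fixes k :: "'a::euclidean_space \<Rightarrow> 'a \<Rightarrow> complex"
  assumes [measurable]: "(\<lambda>(t, x). k t x) \<in> borel_measurable (borel \<Otimes>\<^sub>M borel)"
  shows "hs_square (\<lambda>x t. cnj (k t x)) = hs_square k"
  unfolding hs_square_def complex_mod_cnj by (rule lborel_pair.Fubini') measurable

lemma band_kernel_adjoint:
  fixes k :: "'a::euclidean_space \<Rightarrow> 'a \<Rightarrow> complex"
  assumes k: "band_kernel \<rho> k"
  shows "band_kernel \<rho> (\<lambda>x t. cnj (k t x))"
  unfolding band_kernel_def
proof (intro conjI allI impI)
  have c: "continuous_on UNIV (\<lambda>z. k (fst z) (snd z))" using k by (simp add: band_kernel_def)
  show "continuous_on UNIV (\<lambda>z. cnj (k (snd z) (fst z)))"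
  proof -
    have "continuous_on UNIV (\<lambda>z::'a \<times> 'a. (snd z, fst z))" by (intro continuous_intros)
    from continuous_on_compose2[OF c this] show ?thesis by (auto intro!: continuous_intros)
  qed
  show "hs_square (\<lambda>x t. cnj (k t x)) < \<infinity>"
    using hs_square_flip[OF band_kernel_measurable[OF k]] k by (simp add: band_kernel_def)
qed (use k in \<open>simp add: band_kernel_def norm_minus_commute\<close>)

lemma band_kernel_pair_L2:
  assumes k: "band_kernel \<rho> k" shows "(\<lambda>z. k (fst z) (snd z)) \<in> L2"
proof (rule L2_I)
  show m: "(\<lambda>z. k (fst z) (snd z)) \<in> borel_measurable borel"
    using k by (auto simp: band_kernel_def intro: borel_measurable_continuous_onI)
  show "integrable lborel (\<lambda>z. (cmod (k (fst z) (snd z)))\<^sup>2)"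
  proof (rule integrableI_bounded)
    have m2: "(\<lambda>z. ennreal ((cmod (k (fst z) (snd z)))\<^sup>2)) \<in> borel_measurable (lborel \<Otimes>\<^sub>M lborel)"
      unfolding lborel_prod using m by measurable
    have "(\<integral>\<^sup>+z. ennreal (norm ((cmod (k (fst z) (snd z)))\<^sup>2)) \<partial>lborel) = hs_square k"
      using lborel.nn_integral_fst[OF m2] by (simp add: hs_square_def lborel_prod)
    then show "(\<integral>\<^sup>+z. ennreal (norm ((cmod (k (fst z) (snd z)))\<^sup>2)) \<partial>lborel) < \<infinity>"
      using k by (simp add: band_kernel_def)
  qed (use m in measurable)
qed

lemma pair_L2:
  assumes "f \<in> L2" "g \<in> L2" shows "(\<lambda>z. f (fst z) * cnj (g (snd z))) \<in> L2"
proof (rule L2_I)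
  have [measurable]: "f \<in> borel_measurable borel" "g \<in> borel_measurable borel" using assms L2_measurable by auto
  show "(\<lambda>z. f (fst z) * cnj (g (snd z))) \<in> borel_measurable borel"
    by (intro borel_measurable_times borel_measurable_cnj measurable_compose[OF borel_measurable_fst_comp] measurable_compose[OF borel_measurable_snd_comp]) auto
  have "integrable (lborel \<Otimes>\<^sub>M lborel) (\<lambda>(x, y). complex_of_real ((cmod (f x))\<^sup>2) * complex_of_real ((cmod (g y))\<^sup>2))"
    using assms by (intro integrable_mult_pair integrable_of_real L2_square_integrable)
  from integrable_norm[OF this] show "integrable lborel (\<lambda>z. (cmod (f (fst z) * cnj (g (snd z))))\<^sup>2)"
    by (simp add: lborel_prod split_beta' norm_mult power_mult_distrib norm_power)
qed

lemma kernel_op_adjoint: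
  assumes k: "band_kernel \<rho> k"
  shows "is_adjoint (kernel_op k) (kernel_op (\<lambda>x t. cnj (k t x)))"
  unfolding is_adjoint_def
proof (intro conjI ballI)
  show "L2_bounded_op (kernel_op (\<lambda>x t. cnj (k t x)))" by (rule kernel_op_bounded[OF band_kernel_adjoint[OF k]])
  fix f g :: "'a \<Rightarrow> complex" assume f: "f \<in> L2" and g: "g \<in> L2"
  let ?H = "\<lambda>(t, x). k t x * f x * cnj (g t)"
  have "integrable lborel (\<lambda>z. k (fst z) (snd z) * (cnj (g (fst z)) * cnj (cnj (f (snd z)))))"
    by (intro L2_mult_integrable band_kernel_pair_L2[OF k] pair_L2[OF L2_cnj[OF g] L2_cnj[OF f]])
  then have H: "integrable (lborel \<Otimes>\<^sub>M lborel) ?H"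
    by (simp add: lborel_prod split_beta' mult_ac)
  have "L2_inner (kernel_op k f) g = (LINT t|lborel. LINT x|lborel. ?H (t, x))"
    by (simp add: L2_inner_def kernel_op_def)
  also have "\<dots> = (LINT x|lborel. LINT t|lborel. ?H (t, x))"
    using lborel_pair.Fubini_integral[of "\<lambda>t x. ?H (t, x)"] H by simp
  also have "\<dots> = L2_inner f (kernel_op (\<lambda>x t. cnj (k t x)) g)"
    unfolding L2_inner_def kernel_op_def Bochner_Integration.integral_cnj[symmetric] integral_mult_right_zero[symmetric]
    by (simp add: mult_ac)
  finally show "L2_inner (kernel_op k f) g = L2_inner f (kernel_op (\<lambda>x t. cnj (k t x)) g)" .
qed

text \<open>For t in a bounded set all rows live in one ball and are bounded there by compactness,
  which provides the majorant.\<close>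

lemma band_kernel_L2_continuous:
  fixes k :: "'a::euclidean_space \<Rightarrow> 'a \<Rightarrow> complex"
  assumes k: "band_kernel \<rho> k" and d: "d \<longlonglongrightarrow> t"
  shows "(\<lambda>n. L2_norm (\<lambda>x. k (d n) x - k t x)) \<longlonglongrightarrow> 0"
proof -
  have c: "continuous_on UNIV (\<lambda>z. k (fst z) (snd z))" using k by (simp add: band_kernel_def)
  have [measurable]: "k s \<in> borel_measurable borel" for s using L2_measurable[OF band_kernel_L2[OF k]] .
  obtain M where M: "\<And>n. norm (d n) \<le> M" using convergent_imp_Bseq[OF convergentI[OF d]] by (auto simp: Bseq_def)
  have Mt: "norm t \<le> M" by (rule LIMSEQ_le_const2[OF tendsto_norm[OF d]]) (use M in auto)
  let ?K = "cball 0 M \<times> cball (0::'a) (M + \<rho>)"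
  have "bounded ((\<lambda>z. k (fst z) (snd z)) ` ?K)"
    by (intro compact_imp_bounded compact_continuous_image compact_Times compact_cball continuous_on_subset[OF c]) auto
  then obtain C where C: "\<And>s x. norm s \<le> M \<Longrightarrow> norm x \<le> M + \<rho> \<Longrightarrow> cmod (k s x) \<le> C"
    unfolding bounded_iff by fastforce
  have C': "cmod (k s x) \<le> \<bar>C\<bar> * indicator (cball 0 (M + \<rho>)) x" if s: "norm s \<le> M" for s x
  proof (cases "norm x \<le> M + \<rho>")
    case True
    then show ?thesis using C[OF s True] by simp
  next
    case False
    then have "\<rho> < norm (s - x)" using s norm_triangle_ineq2[of x s] by (simp add: norm_minus_commute)
    then show ?thesis using k False by (simp add: band_kernel_def)
  qed
  have "(\<lambda>n. LINT x|lborel. (cmod (k (d n) x - k t x))\<^sup>2) \<longlonglongrightarrow> (LINT x|(lborel :: 'a measure). 0)"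
  proof (rule integral_dominated_convergence[where w="\<lambda>x. (2 * \<bar>C\<bar>)\<^sup>2 * indicator (cball 0 (M + \<rho>)) x"])
    show "integrable lborel (\<lambda>x::'a. (2 * \<bar>C\<bar>)\<^sup>2 * indicator (cball 0 (M + \<rho>)) x)"
      using emeasure_bounded_finite[of "cball (0::'a) (M + \<rho>)"] by (intro integrable_mult_right integrable_real_indicator) auto
    show "AE x in lborel. (\<lambda>n. (cmod (k (d n) x - k t x))\<^sup>2) \<longlonglongrightarrow> 0"
    proof (intro AE_I2)
      fix x
      have "isCont (\<lambda>z. k (fst z) (snd z)) (t, x)" using c by (simp add: continuous_on_eq_continuous_at)
      moreover have "(\<lambda>n. (d n, x)) \<longlonglongrightarrow> (t, x)" by (intro tendsto_intros d)
      ultimately have "(\<lambda>n. k (d n) x) \<longlonglongrightarrow> k t x"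
        using isCont_tendsto_compose[of "(t, x)" "\<lambda>z. k (fst z) (snd z)" "\<lambda>n. (d n, x)"] by simp
      then have "(\<lambda>n. (cmod (k (d n) x - k t x))\<^sup>2) \<longlonglongrightarrow> (cmod (k t x - k t x))\<^sup>2" by (intro tendsto_intros)
      then show "(\<lambda>n. (cmod (k (d n) x - k t x))\<^sup>2) \<longlonglongrightarrow> 0" by simp
    qed
    show "AE x in lborel. norm ((cmod (k (d n) x - k t x))\<^sup>2) \<le> (2 * \<bar>C\<bar>)\<^sup>2 * indicator (cball 0 (M + \<rho>)) x" for n
    proof (intro AE_I2)
      fix x
      have "cmod (k (d n) x - k t x) \<le> 2 * \<bar>C\<bar> * indicator (cball 0 (M + \<rho>)) x"
        using norm_triangle_ineq4[of "k (d n) x" "k t x"] C'[OF M, of n x] C'[OF Mt, of x] by linarith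
      then have "(cmod (k (d n) x - k t x))\<^sup>2 \<le> (2 * \<bar>C\<bar> * indicator (cball 0 (M + \<rho>)) x)\<^sup>2" by (intro power_mono) auto
      also have "\<dots> = (2 * \<bar>C\<bar>)\<^sup>2 * indicator (cball 0 (M + \<rho>)) x" by (simp add: indicator_def)
      finally show "norm ((cmod (k (d n) x - k t x))\<^sup>2) \<le> (2 * \<bar>C\<bar>)\<^sup>2 * indicator (cball 0 (M + \<rho>)) x" by simp
    qed
  qed measurable
  then show ?thesis unfolding L2_norm_def using tendsto_real_sqrt by fastforce
qed

text \<open>The images of the unit ball are equicontinuous and dominated by the square-integrable function
  \<open>t \<mapsto> \<parallel>k t\<parallel>\<close>, so that a pointwise convergent subsequence converges in \<open>L\<^sup>2\<close>.\<close>

theorem kernel_op_compact: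
  fixes k :: "'a::euclidean_space \<Rightarrow> 'a \<Rightarrow> complex"
  assumes k: "band_kernel \<rho> k"
  shows "L2_compact_op (kernel_op k)"
  unfolding L2_compact_op_def
proof (intro conjI allI impI)
  show "L2_bounded_op (kernel_op k)" by (rule kernel_op_bounded[OF k])
  fix f :: "nat \<Rightarrow> 'a \<Rightarrow> complex" assume f: "\<forall>n. f n \<in> L2 \<and> L2_norm (f n) \<le> 1"
  define F where "F n t = kernel_op k (f n) t" for n t
  have FL: "F n \<in> L2" for n unfolding F_def using f by (intro kernel_op_L2[OF k]) auto
  have [measurable]: "F n \<in> borel_measurable borel" for n by (rule L2_measurable[OF FL])
  have Fb: "cmod (F n t) \<le> L2_norm (k t)" for n t
    unfolding F_def using kernel_op_pointwise[OF k, of "f n" t] f mult_right_mono[of "L2_norm (f n)" 1 "L2_norm (k t)"] by fastforce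
  have Fd: "cmod (F n s - F n t) \<le> L2_norm (\<lambda>x. k s x - k t x)" for n s t
  proof -
    have fn: "f n \<in> L2" "L2_norm (f n) \<le> 1" using f by auto
    have "F n s - F n t = (LINT x|lborel. (k s x - k t x) * f n x)"
      unfolding F_def kernel_op_def left_diff_distrib
      by (intro Bochner_Integration.integral_diff[symmetric] L2_mult_integrable band_kernel_L2[OF k] fn)
    also have "\<dots> = L2_inner (\<lambda>x. k s x - k t x) (\<lambda>x. cnj (f n x))" by (simp add: L2_inner_def)
    also have "cmod \<dots> \<le> L2_norm (\<lambda>x. k s x - k t x) * L2_norm (\<lambda>x. cnj (f n x))"
      by (intro L2_cauchy_schwarz L2_diff L2_cnj band_kernel_L2[OF k] fn)
    also have "\<dots> \<le> L2_norm (\<lambda>x. k s x - k t x) * 1"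
      unfolding L2_norm_cnj by (intro mult_left_mono fn) simp
    finally show ?thesis by simp
  qed
  obtain D :: "'a set" where D: "countable D" "\<And>X. open X \<Longrightarrow> X \<noteq> {} \<Longrightarrow> \<exists>d\<in>D. d \<in> X"
    using countable_dense_exists[where 'a='a] by blast
  \<comment> \<open>Dividing by 1 + \<parallel>k t\<parallel> gives a bound uniform in t, as the
    diagonal selection over a countable dense set requires. The 1 avoids division by zero.\<close>
  have "norm (F n t / complex_of_real (1 + L2_norm (k t))) \<le> 1" for n t
  proof -
    have p: "0 < 1 + L2_norm (k t)" using L2_norm_nonneg[of "k t"] by linarith
    show ?thesis
      unfolding norm_divide norm_of_real abs_of_pos[OF p] using Fb[of n t] p by (simp add: divide_le_eq_1_pos)
  qed
  then obtain r where r: "strict_mono (r :: nat \<Rightarrow> nat)" and rl: "\<And>t. t \<in> D \<Longrightarrow> \<exists>l. (\<lambda>n. F (r n) t / complex_of_real (1 + L2_norm (k t))) \<longlonglongrightarrow> l"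
    using function_convergent_subsequence[OF D(1), of "\<lambda>n t. F n t / complex_of_real (1 + L2_norm (k t))" 1] by blast
  have conv_D: "Cauchy (\<lambda>n. F (r n) t)" if t: "t \<in> D" for t
  proof -
    obtain l where "(\<lambda>n. F (r n) t / complex_of_real (1 + L2_norm (k t))) \<longlonglongrightarrow> l" using rl[OF t] by blast
    from tendsto_mult_right[OF this, of "complex_of_real (1 + L2_norm (k t))"]
    have "(\<lambda>n. F (r n) t) \<longlonglongrightarrow> l * complex_of_real (1 + L2_norm (k t))"
    proof (rule Lim_transform_eventually)
      have "complex_of_real (1 + L2_norm (k t)) \<noteq> 0"
        using L2_norm_nonneg[of "k t"] unfolding of_real_eq_0_iff by linarith
      then show "\<forall>\<^sub>F n in sequentially. F (r n) t / complex_of_real (1 + L2_norm (k t)) * complex_of_real (1 + L2_norm (k t)) = F (r n) t"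
        by simp
    qed
    then show ?thesis by (rule LIMSEQ_imp_Cauchy)
  qed
  have "\<exists>l. (\<lambda>n. F (r n) t) \<longlonglongrightarrow> l" for t
  proof -
    have "Cauchy (\<lambda>n. F (r n) t)"
    proof (rule metric_CauchyI)
      fix \<epsilon> :: real assume \<epsilon>: "0 < \<epsilon>"
      have "\<exists>s\<in>D. L2_norm (\<lambda>x. k s x - k t x) < \<epsilon> / 3"
      proof -
        have "\<forall>n. \<exists>s\<in>D. dist s t < inverse (real (Suc n))"
        proof
          fix n
          show "\<exists>s\<in>D. dist s t < inverse (real (Suc n))"
            using D(2)[of "ball t (inverse (real (Suc n)))"] by (auto simp: dist_commute simp del: of_nat_Suc)
        qed
        then obtain d where d: "\<And>n. d n \<in> D" "\<And>n. dist (d n) t < inverse (real (Suc n))" by metis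
        have "d \<longlonglongrightarrow> t"
        proof (rule tendstoI)
          fix e :: real assume "e > 0"
          then have "\<forall>\<^sub>F n in sequentially. inverse (real (Suc n)) < e"
            using order_tendstoD(2)[OF LIMSEQ_inverse_real_of_nat] by blast
          then show "\<forall>\<^sub>F n in sequentially. dist (d n) t < e"
            by eventually_elim (use d(2) order.strict_trans in blast)
        qed
        from order_tendstoD(2)[OF band_kernel_L2_continuous[OF k this], of "\<epsilon> / 3"] \<epsilon>
        have "\<forall>\<^sub>F n in sequentially. L2_norm (\<lambda>x. k (d n) x - k t x) < \<epsilon> / 3" by simp
        then obtain n where "L2_norm (\<lambda>x. k (d n) x - k t x) < \<epsilon> / 3"
          using eventually_happens trivial_limit_sequentially by blast
        then show ?thesis using d(1) by blast
      qed
      then obtain s where s: "s \<in> D" "L2_norm (\<lambda>x. k s x - k t x) < \<epsilon> / 3" by blast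
      obtain N where N: "\<And>m n. m \<ge> N \<Longrightarrow> n \<ge> N \<Longrightarrow> dist (F (r m) s) (F (r n) s) < \<epsilon> / 3"
        using metric_CauchyD[OF conv_D[OF s(1)], of "\<epsilon> / 3"] \<epsilon> by auto
      show "\<exists>M. \<forall>m\<ge>M. \<forall>n\<ge>M. dist (F (r m) t) (F (r n) t) < \<epsilon>"
      proof (intro exI allI impI)
        fix m n assume mn: "N \<le> m" "N \<le> n"
        have "dist (F (r m) t) (F (r n) t) \<le> dist (F (r m) t) (F (r m) s) + dist (F (r m) s) (F (r n) s) + dist (F (r n) s) (F (r n) t)"
          using dist_triangle[of "F (r m) t" "F (r n) t" "F (r m) s"] dist_triangle[of "F (r m) s" "F (r n) t" "F (r n) s"] by linarith
        then show "dist (F (r m) t) (F (r n) t) < \<epsilon>"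
          using N[OF mn] Fd[of "r m" s t] Fd[of "r n" s t] s(2) by (simp add: dist_norm norm_minus_commute)
      qed
    qed
    then show ?thesis by (simp add: Cauchy_convergent_iff convergent_def)
  qed
  then obtain g where g: "\<And>t. (\<lambda>n. F (r n) t) \<longlonglongrightarrow> g t" by metis
  have [measurable]: "g \<in> borel_measurable borel"
    by (rule borel_measurable_LIMSEQ_metric[where f="\<lambda>n. F (r n)"]) (use g in auto)
  have gb: "cmod (g t) \<le> L2_norm (k t)" for t
    by (rule LIMSEQ_le_const2[OF tendsto_norm[OF g]]) (use Fb in auto)
  have gL: "g \<in> L2"
    by (rule L2_dominated[OF band_kernel_norm_integrable(1)[OF k]]) (auto intro!: power_mono gb)
  have "(\<lambda>n. LINT t|lborel. (cmod (F (r n) t - g t))\<^sup>2) \<longlonglongrightarrow> (LINT t|(lborel :: 'a measure). 0)"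
  proof (rule integral_dominated_convergence[where w="\<lambda>t. 4 * (L2_norm (k t))\<^sup>2"])
    show "AE t in lborel. (\<lambda>n. (cmod (F (r n) t - g t))\<^sup>2) \<longlonglongrightarrow> 0"
    proof (intro AE_I2)
      fix t
      have "(\<lambda>n. (cmod (F (r n) t - g t))\<^sup>2) \<longlonglongrightarrow> (cmod (g t - g t))\<^sup>2" by (intro tendsto_intros g)
      then show "(\<lambda>n. (cmod (F (r n) t - g t))\<^sup>2) \<longlonglongrightarrow> 0" by simp
    qed
    show "AE t in lborel. norm ((cmod (F (r n) t - g t))\<^sup>2) \<le> 4 * (L2_norm (k t))\<^sup>2" for n
    proof (intro AE_I2)
      fix t
      have "cmod (F (r n) t - g t) \<le> 2 * L2_norm (k t)"
        using norm_triangle_ineq4[of "F (r n) t" "g t"] Fb[of "r n" t] gb[of t] by linarith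
      then have "(cmod (F (r n) t - g t))\<^sup>2 \<le> (2 * L2_norm (k t))\<^sup>2" by (intro power_mono) auto
      then show "norm ((cmod (F (r n) t - g t))\<^sup>2) \<le> 4 * (L2_norm (k t))\<^sup>2" by (simp add: power_mult_distrib)
    qed
  qed (use band_kernel_norm_integrable(1)[OF k] in auto)
  then have "(\<lambda>n. L2_norm (\<lambda>x. F (r n) x - g x)) \<longlonglongrightarrow> 0"
    unfolding L2_norm_def using tendsto_real_sqrt by fastforce
  then show "\<exists>g\<in>L2. \<exists>r. strict_mono r \<and> (\<lambda>n. L2_norm (\<lambda>x. kernel_op k (f (r n)) x - g x)) \<longlonglongrightarrow> 0"
    using gL r unfolding F_def by blast
qed

subsection \<open>Bounds for Schatten norms\<close>

lemma epowr_mono: "x \<le> y \<Longrightarrow> 0 \<le> r \<Longrightarrow> epowr x r \<le> epowr y r"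
  unfolding epowr_def
  by (auto simp: top_unique less_top[symmetric] intro!: ennreal_leI powr_mono2 enn2real_mono)

lemma epowr_ennreal: "0 \<le> x \<Longrightarrow> epowr (ennreal x) r = ennreal (x powr r)"
  by (simp add: epowr_def)

lemma singular_space_L2: "e \<in> singular_space A s \<Longrightarrow> e \<in> L2"
  by (simp add: singular_space_def)

lemma singular_inner:
  assumes A: "L2_bounded_op A" and B: "is_adjoint A B" and e: "e \<in> singular_space A s" and f: "f \<in> L2"
  shows "L2_inner (A e) (A f) = complex_of_real (s\<^sup>2) * L2_inner e f"
proof -
  let ?C = "L2_adjoint A"
  have C: "is_adjoint A ?C" by (rule is_adjoint_L2_adjoint[OF B])
  have bC: "L2_bounded_op ?C" using C by (simp add: is_adjoint_def)
  have eL: "e \<in> L2" by (rule singular_space_L2[OF e])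
  have "L2_inner (A e) (A f) = L2_inner (?C (A e)) f"
    by (rule is_adjointD(2)[OF C f bounded_op_L2[OF A eL], symmetric])
  also have "\<dots> = L2_inner (\<lambda>x. complex_of_real (s\<^sup>2) * e x) f"
    using e by (intro L2_inner_cong_AE bounded_op_L2[OF bC] bounded_op_L2[OF A] eL L2_cmult f) (simp add: singular_space_def)
  finally show ?thesis by (simp add: L2_inner_cmult_left del: of_real_power)
qed

lemma singular_norm:
  assumes A: "L2_bounded_op A" and B: "is_adjoint A B" and e: "e \<in> singular_space A s" and s: "0 \<le> s"
  shows "L2_norm (A e) = s * L2_norm e"
proof -
  have "complex_of_real ((L2_norm (A e))\<^sup>2) = complex_of_real ((s * L2_norm e)\<^sup>2)"
    using singular_inner[OF A B e singular_space_L2[OF e]] unfolding L2_inner_self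
    by (simp only: of_real_mult[symmetric] power_mult_distrib)
  then have "(L2_norm (A e))\<^sup>2 = (s * L2_norm e)\<^sup>2" unfolding of_real_eq_iff .
  then show ?thesis by (rule power2_eq_imp_eq) (use s in simp_all)
qed

text \<open>Moving A* A to either side evaluates the same inner product once with s^2 and once with
  t^2.\<close>

lemma singular_orthogonal:
  assumes A: "L2_bounded_op A" and B: "is_adjoint A B"
    and e: "e \<in> singular_space A s" and f: "f \<in> singular_space A t" and st: "0 < s" "0 < t" "s \<noteq> t"
  shows "L2_inner e f = 0"
proof -
  have 1: "L2_inner (A e) (A f) = complex_of_real (s\<^sup>2) * L2_inner e f"
    by (rule singular_inner[OF A B e singular_space_L2[OF f]])
  have "L2_inner (A f) (A e) = complex_of_real (t\<^sup>2) * L2_inner f e"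
    by (rule singular_inner[OF A B f singular_space_L2[OF e]])
  from arg_cong[OF this, of cnj] have 2: "L2_inner (A e) (A f) = complex_of_real (t\<^sup>2) * L2_inner e f"
    by (simp only: complex_cnj_mult L2_inner_cnj complex_cnj_complex_of_real)
  have "complex_of_real (s\<^sup>2) \<noteq> complex_of_real (t\<^sup>2)"
    unfolding of_real_eq_iff using st by (simp add: power2_eq_iff_nonneg)
  then show ?thesis using 1 2 by auto
qed

lemma orthonormal_norm: "orthonormal I e \<Longrightarrow> i \<in> I \<Longrightarrow> L2_norm (e i) = 1"
proof -
  assume "orthonormal I e" "i \<in> I"
  then have "complex_of_real ((L2_norm (e i))\<^sup>2) = complex_of_real 1"
    unfolding L2_inner_self[symmetric] by (simp add: orthonormal_def)
  then have "(L2_norm (e i))\<^sup>2 = 1" unfolding of_real_eq_iff .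
  then show ?thesis using L2_norm_nonneg[of "e i"] by (auto simp: power2_eq_1_iff)
qed

lemma singular_mult_attained:
  assumes "\<And>n e. orthonormal {..<n} e \<Longrightarrow> (\<And>i. i < n \<Longrightarrow> e i \<in> singular_space A s) \<Longrightarrow> real n \<le> K"
  obtains n e where "singular_mult A s = of_nat n" "orthonormal {..<n} e" "\<And>i. i < n \<Longrightarrow> e i \<in> singular_space A s"
proof -
  define S where "S = {n::nat. \<exists>e. (\<forall>i<n. e i \<in> singular_space A s) \<and> (\<forall>i<n. \<forall>j<n. L2_inner (e i) (e j) = (if i = j then 1 else 0))}"
  have on: "\<exists>e. orthonormal {..<n} e \<and> (\<forall>i<n. e i \<in> singular_space A s)" if "n \<in> S" for n
    using that singular_space_L2 unfolding S_def orthonormal_def by blast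
  have "n \<le> nat \<lceil>K\<rceil>" if "n \<in> S" for n
    using on[OF that] assms by (meson le_nat_iff of_nat_le_iff real_nat_ceiling_ge order_trans)
  then have fin: "finite S" by (meson finite_nat_set_iff_bounded_le)
  have ne: "0 \<in> S" by (simp add: S_def)
  have "singular_mult A s = (SUP n\<in>S. of_nat n)" by (simp add: singular_mult_def S_def)
  also have "\<dots> = of_nat (Max S)"
  proof (rule antisym)
    show "(SUP n\<in>S. of_nat n :: ennreal) \<le> of_nat (Max S)"
      by (rule SUP_least) (use fin Max_ge in auto)
    show "of_nat (Max S) \<le> (SUP n\<in>S. of_nat n :: ennreal)"
      by (rule SUP_upper) (use fin ne Max_in in auto)
  qed
  finally have "singular_mult A s = of_nat (Max S)" .
  moreover have "Max S \<in> S" using fin ne Max_in by blast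
  ultimately show ?thesis using on that by blast
qed

text \<open>The infinite sum over singular values is the supremum of its finite partial sums. Each
  of these is a sum over one orthonormal family of singular vectors, indexed by the value and by a
  number within its eigenspace; hence the index type \<open>real \<times> nat\<close>.\<close>

theorem schatten_norm_le:
  fixes A :: "'a::euclidean_space operator"
  assumes A: "L2_compact_op A" and B: "is_adjoint A B" and r: "0 < r"
    and K: "\<And>(I :: (real \<times> nat) set) e \<sigma>. finite I \<Longrightarrow> orthonormal I e \<Longrightarrow>
      (\<And>i. i \<in> I \<Longrightarrow> 0 < \<sigma> i \<and> e i \<in> singular_space A (\<sigma> i)) \<Longrightarrow> (\<Sum>i\<in>I. \<sigma> i powr r) \<le> K"
  shows "schatten_norm (ennreal r) A \<le> ennreal (K powr (1 / r))"
proof -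
  have K0: "0 \<le> K" using K[of "{}" "\<lambda>_. undefined" "\<lambda>_. 1"] by (simp add: orthonormal_def)
  have bA: "L2_bounded_op A" using A by (simp add: L2_compact_op_def)
  have "\<exists>n e. singular_mult A s = of_nat n \<and> orthonormal {..<n} e \<and> (\<forall>i<n. e i \<in> singular_space A s)" if s: "0 < s" for s
  proof -
    have "real n \<le> K / s powr r" if e: "orthonormal {..<n} e" "\<And>i. i < n \<Longrightarrow> e i \<in> singular_space A s" for n e
    proof -
      \<comment> \<open>The hypothesis, applied to a single eigenspace, bounds its dimension, so
        that the multiplicity is a maximum and not merely a supremum.\<close>
      have "(\<Sum>i\<in>{s} \<times> {..<n}. s powr r) \<le> K"
        by (rule K[where e="\<lambda>i. e (snd i)" and \<sigma>="\<lambda>_. s"]) (use e s in \<open>auto simp: orthonormal_def\<close>)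
      then show ?thesis using s by (simp add: field_simps)
    qed
    then show ?thesis using singular_mult_attained[of A s "K / s powr r"] by metis
  qed
  then obtain N E where N: "\<And>s. 0 < s \<Longrightarrow> singular_mult A s = of_nat (N s)"
    and E: "\<And>s. 0 < s \<Longrightarrow> orthonormal {..<N s} (E s)" "\<And>s i. 0 < s \<Longrightarrow> i < N s \<Longrightarrow> E s i \<in> singular_space A s"
    by metis
  have fin: "(\<Sum>s\<in>F. singular_mult A s * ennreal (s powr r)) \<le> ennreal K" if F: "finite F" "F \<subseteq> {0<..}" for F
  proof -
    let ?I = "Sigma F (\<lambda>s. {..<N s})"
    have pos: "0 < s" if "s \<in> F" for s using F that by auto
    have "(\<Sum>i\<in>?I. (fst i) powr r) \<le> K"
    proof (rule K[where e="\<lambda>i. E (fst i) (snd i)"])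
      show "orthonormal ?I (\<lambda>i. E (fst i) (snd i))"
        unfolding orthonormal_def
      proof (intro conjI ballI)
        fix i assume "i \<in> ?I"
        then have "0 < fst i" "snd i < N (fst i)" using pos by auto
        then show "E (fst i) (snd i) \<in> L2" by (intro singular_space_L2[OF E(2)])
      next
        fix i j assume ij: "i \<in> ?I" "j \<in> ?I"
        obtain s a t b where eq: "i = (s, a)" "j = (t, b)" by (cases i, cases j)
        have st: "0 < s" "0 < t" "a < N s" "b < N t" using ij pos by (auto simp: eq)
        show "L2_inner (E (fst i) (snd i)) (E (fst j) (snd j)) = (if i = j then 1 else 0)"
        proof (cases "s = t")
          case True
          then show ?thesis using E(1)[OF st(1)] st unfolding orthonormal_def eq by simp
        next
          case False
          then have "L2_inner (E s a) (E t b) = 0"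
            using st by (intro singular_orthogonal[OF bA B E(2) E(2)])
          then show ?thesis using False by (simp add: eq)
        qed
      qed
      show "0 < fst i \<and> E (fst i) (snd i) \<in> singular_space A (fst i)" if "i \<in> ?I" for i
      proof -
        have "0 < fst i" "snd i < N (fst i)" using that pos by auto
        then show ?thesis using E(2) by blast
      qed
    qed (use F in auto)
    also have "(\<Sum>i\<in>?I. (fst i) powr r) = (\<Sum>s\<in>F. \<Sum>i<N s. s powr r)"
      using sum.Sigma[of F "\<lambda>s. {..<N s}" "\<lambda>s _. s powr r"] F by (simp add: split_beta')
    also have "\<dots> = (\<Sum>s\<in>F. real (N s) * s powr r)" by simp
    finally have "ennreal (\<Sum>s\<in>F. real (N s) * s powr r) \<le> ennreal K" by (rule ennreal_leI)
    moreover have "(\<Sum>s\<in>F. singular_mult A s * ennreal (s powr r)) = (\<Sum>s\<in>F. ennreal (real (N s) * s powr r))"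
      using N pos by (intro sum.cong refl) (simp add: ennreal_mult ennreal_of_nat_eq_real_of_nat)
    ultimately show ?thesis by simp
  qed
  have "(\<Sum>\<^sub>\<infinity>s\<in>{0<..}. singular_mult A s * ennreal (s powr r)) \<le> ennreal K"
    by (subst nonneg_infsum_complete) (auto intro!: SUP_least fin)
  then have "epowr (\<Sum>\<^sub>\<infinity>s\<in>{0<..}. singular_mult A s * ennreal (s powr r)) (1 / r) \<le> epowr (ennreal K) (1 / r)"
    using r by (intro epowr_mono) auto
  then show ?thesis
    using A r K0 by (simp add: schatten_norm_def epowr_ennreal)
qed

text \<open>Vectors with the same \<sigma> are grouped, and each group shows that the multiplicity
  of its value is at least its size. Operators that are not compact have norm \<open>top\<close> by
  definition.\<close>

theorem schatten_norm_ge: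
  fixes A :: "'a::euclidean_space operator" and e :: "nat \<Rightarrow> 'a \<Rightarrow> complex"
  assumes e: "orthonormal {..<n} e" and \<sigma>: "\<And>i. i < n \<Longrightarrow> e i \<in> singular_space A (\<sigma> i)" "\<And>i. i < n \<Longrightarrow> \<delta> < \<sigma> i"
    and \<delta>: "0 \<le> \<delta>" and r: "0 < r"
  shows "ennreal ((real n * \<delta> powr r) powr (1 / r)) \<le> schatten_norm (ennreal r) A"
proof -
  let ?F = "\<sigma> ` {..<n}"
  let ?J = "\<lambda>s. {i. i < n \<and> \<sigma> i = s}"
  have mult: "of_nat (card (?J s)) \<le> singular_mult A s" for s
  proof -
    obtain h where h: "bij_betw h {0..<card (?J s)} (?J s)"
      using ex_bij_betw_nat_finite[of "?J s"] by auto
    have hJ: "h i \<in> ?J s" if "i < card (?J s)" for i using bij_betwE[OF h] that by auto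
    have hi: "h i = h j \<longleftrightarrow> i = j" if "i < card (?J s)" "j < card (?J s)" for i j
      using bij_betw_imp_inj_on[OF h] that by (auto dest: inj_onD)
    have "\<exists>e. (\<forall>i<card (?J s). e i \<in> singular_space A s) \<and> (\<forall>i<card (?J s). \<forall>j<card (?J s). L2_inner (e i) (e j) = (if i = j then 1 else 0))"
    proof (intro exI[of _ "e \<circ> h"] conjI allI impI)
      fix i assume i: "i < card (?J s)"
      then show "(e \<circ> h) i \<in> singular_space A s" using hJ[OF i] \<sigma>(1)[of "h i"] by auto
      fix j assume j: "j < card (?J s)"
      show "L2_inner ((e \<circ> h) i) ((e \<circ> h) j) = (if i = j then 1 else 0)"
        using e hJ[OF i] hJ[OF j] hi[OF i j] by (simp add: orthonormal_def)
    qed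
    then show ?thesis unfolding singular_mult_def by (intro SUP_upper) simp
  qed
  have F: "finite ?F" "?F \<subseteq> {0<..}" using \<sigma>(2) \<delta> by force+
  have "ennreal (real n * \<delta> powr r) = ennreal (\<Sum>i<n. \<delta> powr r)" by simp
  also have "\<dots> \<le> ennreal (\<Sum>i<n. \<sigma> i powr r)"
    using \<sigma>(2) \<delta> r by (intro ennreal_leI sum_mono powr_mono2) (auto intro: less_imp_le)
  also have "(\<Sum>i<n. \<sigma> i powr r) = (\<Sum>s\<in>?F. \<Sum>i\<in>{i\<in>{..<n}. \<sigma> i = s}. \<sigma> i powr r)"
    by (rule sum.image_gen) simp
  also have "\<dots> = (\<Sum>s\<in>?F. real (card (?J s)) * s powr r)"
    by (intro sum.cong refl) simp
  also have "ennreal \<dots> = (\<Sum>s\<in>?F. of_nat (card (?J s)) * ennreal (s powr r))"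
    by (subst sum_ennreal[symmetric]) (auto simp: ennreal_mult ennreal_of_nat_eq_real_of_nat)
  also have "\<dots> \<le> (\<Sum>s\<in>?F. singular_mult A s * ennreal (s powr r))"
    by (intro sum_mono mult_right_mono mult) auto
  also have "\<dots> \<le> (\<Sum>\<^sub>\<infinity>s\<in>{0<..}. singular_mult A s * ennreal (s powr r))"
    using F by (subst nonneg_infsum_complete) (auto intro!: SUP_upper)
  finally have "epowr (ennreal (real n * \<delta> powr r)) (1 / r) \<le> epowr (\<Sum>\<^sub>\<infinity>s\<in>{0<..}. singular_mult A s * ennreal (s powr r)) (1 / r)"
    using r by (intro epowr_mono) auto
  then show ?thesis
    using r by (simp add: schatten_norm_def epowr_ennreal)
qed

text \<open>On the orthogonal complement of finitely many singular vectors a compact operator attains its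
  norm, and a maximizing vector is again singular.\<close>

lemma next_singular_vector:
  fixes A :: "'a::euclidean_space operator"
  assumes A: "L2_compact_op A" and B: "is_adjoint A B"
    and e: "\<And>i. i \<in> I \<Longrightarrow> e i \<in> singular_space A (\<sigma> i)"
    and f0: "f0 \<in> L2" "L2_norm f0 \<le> 1" "\<And>i. i \<in> I \<Longrightarrow> L2_inner f0 (e i) = 0" and \<delta>: "0 \<le> \<delta>" "\<delta> < L2_norm (A f0)"
  obtains g \<mu> where "\<delta> < \<mu>" "g \<in> singular_space A \<mu>" "L2_norm g = 1" "\<And>i. i \<in> I \<Longrightarrow> L2_inner g (e i) = 0"
proof -
  have bA: "L2_bounded_op A" using A by (simp add: L2_compact_op_def)
  note AL = bounded_op_L2[OF bA]
  define C where "C = L2_adjoint A"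
  have C: "is_adjoint A C" unfolding C_def by (rule is_adjoint_L2_adjoint[OF B])
  have bC: "L2_bounded_op C" using C by (simp add: is_adjoint_def)
  note CL = bounded_op_L2[OF bC]
  have eL: "e i \<in> L2" if "i \<in> I" for i using e[OF that] by (rule singular_space_L2)
  define W where "W = {f \<in> L2. \<forall>i\<in>I. L2_inner f (e i) = 0}"
  define W1 where "W1 = {f \<in> W. L2_norm f \<le> 1}"
  define \<mu> where "\<mu> = (SUP f\<in>W1. L2_norm (A f))"
  obtain K where K: "0 \<le> K" "\<And>f. f \<in> L2 \<Longrightarrow> L2_norm (A f) \<le> K * L2_norm f" using bounded_op_bound[OF bA] by blast
  obtain K' where K': "0 \<le> K'" "\<And>f. f \<in> L2 \<Longrightarrow> L2_norm (C f) \<le> K' * L2_norm f" using bounded_op_bound[OF bC] by blast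
  have bdd: "bdd_above ((\<lambda>f. L2_norm (A f)) ` W1)"
  proof (rule bdd_aboveI2)
    fix f assume "f \<in> W1"
    then have "f \<in> L2" "L2_norm f \<le> 1" by (auto simp: W1_def W_def)
    then show "L2_norm (A f) \<le> K" using K(2)[of f] mult_left_mono[of "L2_norm f" 1 K] K(1) by simp
  qed
  have f0W: "f0 \<in> W1" using f0 by (simp add: W1_def W_def)
  have le: "L2_norm (A f) \<le> \<mu>" if "f \<in> W1" for f unfolding \<mu>_def by (rule cSUP_upper[OF that bdd])
  have \<mu>: "\<delta> < \<mu>" using le[OF f0W] \<delta> by simp
  then have \<mu>0: "0 < \<mu>" using \<delta> by simp
  have W: "L2_norm (A f) \<le> \<mu> * L2_norm f" if f: "f \<in> W" for f
  proof (cases "L2_norm f = 0")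
    case True
    then show ?thesis using K(2)[of f] f by (simp add: W_def)
  next
    case False
    then have pos: "0 < L2_norm f" using L2_norm_nonneg[of f] by linarith
    define c where "c = complex_of_real (1 / L2_norm f)"
    have c: "cmod c = 1 / L2_norm f" by (simp add: c_def norm_divide)
    have fL: "f \<in> L2" using f by (simp add: W_def)
    have "(\<lambda>x. c * f x) \<in> W1"
      using f False by (simp add: W1_def W_def L2_cmult L2_inner_cmult_left L2_norm_cmult c)
    from le[OF this] have "1 / L2_norm f * L2_norm (A f) \<le> \<mu>"
      unfolding bounded_op_norm_cmult[OF bA fL] c .
    then show ?thesis using pos by (simp add: field_simps)
  qed
  define T where "T = (\<lambda>f. C (A f))"
  have TL: "T f \<in> L2" if "f \<in> L2" for f unfolding T_def by (intro CL AL that)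
  have TW: "T f \<in> W" if f: "f \<in> W" for f
  proof -
    have fL: "f \<in> L2" using f by (simp add: W_def)
    have "L2_inner (T f) (e i) = 0" if i: "i \<in> I" for i
    proof -
      have "L2_inner (T f) (e i) = L2_inner (A f) (A (e i))"
        unfolding T_def by (rule is_adjointD(2)[OF C eL[OF i] AL[OF fL]])
      also have "\<dots> = cnj (complex_of_real ((\<sigma> i)\<^sup>2) * L2_inner (e i) f)"
        using singular_inner[OF bA B e[OF i] fL] by (simp only: L2_inner_commute[of "A f"])
      also have "\<dots> = complex_of_real ((\<sigma> i)\<^sup>2) * L2_inner f (e i)"
        by (simp only: complex_cnj_mult L2_inner_cnj complex_cnj_complex_of_real)
      finally show ?thesis using f i by (simp add: W_def)
    qed
    then show ?thesis using TL[OF fL] by (simp add: W_def)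
  qed
  \<comment> \<open>T maps W to itself, so \<parallel>A (T f)\<parallel> \<le> \<mu> \<parallel>T
    f\<parallel>, and Cauchy--Schwarz gives \<parallel>T f\<parallel> \<le> \<mu> \<parallel>A
    f\<parallel>. Expanding the square then shows that a nearly maximizing f is nearly an
    eigenvector for \<mu>^2.\<close>
  have TN: "(L2_norm (\<lambda>x. T f x - complex_of_real (\<mu>\<^sup>2) * f x))\<^sup>2 \<le> \<mu>\<^sup>2 * (\<mu>\<^sup>2 - (L2_norm (A f))\<^sup>2)" if f: "f \<in> W1" for f
  proof -
    have fW: "f \<in> W" "L2_norm f \<le> 1" and fL: "f \<in> L2" using f by (auto simp: W1_def W_def)
    have 1: "L2_inner (T f) f = complex_of_real ((L2_norm (A f))\<^sup>2)"
      unfolding T_def is_adjointD(2)[OF C fL AL[OF fL]] by (rule L2_inner_self)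
    have "complex_of_real ((L2_norm (T f))\<^sup>2) = L2_inner (A f) (A (T f))"
      unfolding L2_inner_self[symmetric] by (subst T_def) (rule is_adjointD(2)[OF C TL[OF fL] AL[OF fL]])
    then have "(L2_norm (T f))\<^sup>2 = cmod (L2_inner (A f) (A (T f)))"
      by (metis norm_of_real abs_power2)
    also have "\<dots> \<le> L2_norm (A f) * L2_norm (A (T f))" by (intro L2_cauchy_schwarz AL TL fL)
    also have "\<dots> \<le> L2_norm (A f) * (\<mu> * L2_norm (T f))" by (intro mult_left_mono W TW fW) simp
    finally have "L2_norm (T f) * L2_norm (T f) \<le> (\<mu> * L2_norm (A f)) * L2_norm (T f)" by (simp add: power2_eq_square mult_ac)
    then have "L2_norm (T f) \<le> \<mu> * L2_norm (A f)"
      using \<mu>0 L2_norm_nonneg[of "T f"] L2_norm_nonneg[of "A f"] by (cases "L2_norm (T f) = 0") (auto simp: mult_le_cancel_right)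
    then have 2: "(L2_norm (T f))\<^sup>2 \<le> \<mu>\<^sup>2 * (L2_norm (A f))\<^sup>2"
      using power_mono[of "L2_norm (T f)" "\<mu> * L2_norm (A f)" 2] by (simp add: power_mult_distrib)
    have "(L2_norm (\<lambda>x. T f x - complex_of_real (\<mu>\<^sup>2) * f x))\<^sup>2 = (L2_norm (T f))\<^sup>2 - 2 * Re (L2_inner (T f) (\<lambda>x. complex_of_real (\<mu>\<^sup>2) * f x)) + (L2_norm (\<lambda>x. complex_of_real (\<mu>\<^sup>2) * f x))\<^sup>2"
      by (rule L2_pythagoras[OF TL[OF fL] L2_cmult[OF fL]])
    also have "L2_inner (T f) (\<lambda>x. complex_of_real (\<mu>\<^sup>2) * f x) = complex_of_real (\<mu>\<^sup>2 * (L2_norm (A f))\<^sup>2)"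
    proof -
      have "L2_inner (T f) (\<lambda>x. complex_of_real (\<mu>\<^sup>2) * f x) = cnj (complex_of_real (\<mu>\<^sup>2) * L2_inner f (T f))"
        unfolding L2_inner_cmult_left[symmetric] by (rule L2_inner_commute)
      then show ?thesis
        unfolding complex_cnj_mult L2_inner_cnj 1 complex_cnj_complex_of_real of_real_mult .
    qed
    also have "(L2_norm (\<lambda>x. complex_of_real (\<mu>\<^sup>2) * f x))\<^sup>2 = \<mu>\<^sup>2 * (\<mu>\<^sup>2 * (L2_norm f)\<^sup>2)"
      unfolding L2_norm_cmult norm_of_real by (simp add: power_mult_distrib power2_eq_square)
    also have "\<dots> \<le> \<mu>\<^sup>2 * (\<mu>\<^sup>2 * 1)"
      using fW(2) power_mono[of "L2_norm f" 1 2] by (intro mult_left_mono) auto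
    finally show ?thesis using 2 by (simp add: right_diff_distrib)
  qed
  have "\<exists>f\<in>W1. \<mu> - inverse (real (Suc n)) < L2_norm (A f)" for n
  proof -
    have "\<mu> - inverse (real (Suc n)) < \<mu>" by simp
    then show ?thesis unfolding \<mu>_def using less_cSUP_iff[OF _ bdd] f0W by blast
  qed
  then obtain f where f: "\<And>n. f n \<in> W1" "\<And>n. \<mu> - inverse (real (Suc n)) < L2_norm (A (f n))" by metis
  have fL: "f n \<in> L2" "L2_norm (f n) \<le> 1" "f n \<in> W" for n using f(1)[of n] by (auto simp: W1_def W_def)
  have Af: "(\<lambda>n. L2_norm (A (f n))) \<longlonglongrightarrow> \<mu>"
  proof (rule tendsto_sandwich[where h="\<lambda>_. \<mu>"])
    show "(\<lambda>n. \<mu> - inverse (real (Suc n))) \<longlonglongrightarrow> \<mu>"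
      using tendsto_diff[OF tendsto_const[of \<mu>] LIMSEQ_inverse_real_of_nat] by simp
  qed (use f le in \<open>auto intro!: always_eventually less_imp_le simp del: of_nat_Suc\<close>)
  have Tf: "(\<lambda>n. L2_norm (\<lambda>x. T (f n) x - complex_of_real (\<mu>\<^sup>2) * f n x)) \<longlonglongrightarrow> 0"
  proof (rule Lim_null_comparison)
    show "\<forall>\<^sub>F n in sequentially. norm (L2_norm (\<lambda>x. T (f n) x - complex_of_real (\<mu>\<^sup>2) * f n x)) \<le> sqrt (\<mu>\<^sup>2 * (\<mu>\<^sup>2 - (L2_norm (A (f n)))\<^sup>2))"
      using TN[OF f(1)] by (intro always_eventually allI) (auto intro: real_le_rsqrt)
    have "(\<lambda>n. sqrt (\<mu>\<^sup>2 * (\<mu>\<^sup>2 - (L2_norm (A (f n)))\<^sup>2))) \<longlonglongrightarrow> sqrt (\<mu>\<^sup>2 * (\<mu>\<^sup>2 - \<mu>\<^sup>2))"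
      by (intro tendsto_intros Af)
    then show "(\<lambda>n. sqrt (\<mu>\<^sup>2 * (\<mu>\<^sup>2 - (L2_norm (A (f n)))\<^sup>2))) \<longlonglongrightarrow> 0" by simp
  qed
  obtain h r where h: "h \<in> L2" and r: "strict_mono (r :: nat \<Rightarrow> nat)" and conv: "(\<lambda>n. L2_norm (\<lambda>x. A (f (r n)) x - h x)) \<longlonglongrightarrow> 0"
    using A fL unfolding L2_compact_op_def by blast
  define m where "m = complex_of_real (1 / \<mu>\<^sup>2)"
  have m: "m * complex_of_real (\<mu>\<^sup>2) = 1" "complex_of_real (\<mu>\<^sup>2) * m = 1" "cmod m = 1 / \<mu>\<^sup>2"
    using \<mu>0 unfolding m_def of_real_mult[symmetric] by (auto simp: norm_divide norm_power)
  \<comment> \<open>Along r, A (f n) tends to h while T (f n) - \<mu>^2 f n tends to 0, so f n must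
    tend to C h / \<mu>^2. Compactness of A thus makes the maximizing sequence itself
    converge.\<close>
  define g where "g = (\<lambda>x. m * C h x)"
  have gL: "g \<in> L2" unfolding g_def by (intro L2_cmult CL h)
  have fg: "(\<lambda>n. L2_norm (\<lambda>x. f (r n) x - g x)) \<longlonglongrightarrow> 0"
  proof (rule Lim_null_comparison)
    let ?b = "\<lambda>n. 1 / \<mu>\<^sup>2 * (L2_norm (\<lambda>x. T (f (r n)) x - complex_of_real (\<mu>\<^sup>2) * f (r n) x) + K' * L2_norm (\<lambda>x. A (f (r n)) x - h x))"
    show "\<forall>\<^sub>F n in sequentially. norm (L2_norm (\<lambda>x. f (r n) x - g x)) \<le> ?b n"
    proof (intro always_eventually allI)
      fix n
      let ?f = "f (r n)"
      have "L2_norm (\<lambda>x. ?f x - g x) = L2_norm (\<lambda>x. m * (complex_of_real (\<mu>\<^sup>2) * ?f x - C h x))"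
        unfolding g_def right_diff_distrib mult.assoc[symmetric] m(1) by simp
      also have "\<dots> = 1 / \<mu>\<^sup>2 * L2_norm (\<lambda>x. complex_of_real (\<mu>\<^sup>2) * ?f x - C h x)"
        unfolding L2_norm_cmult m(3) ..
      also have "\<dots> \<le> 1 / \<mu>\<^sup>2 * (L2_norm (\<lambda>x. complex_of_real (\<mu>\<^sup>2) * ?f x - T ?f x) + L2_norm (\<lambda>x. T ?f x - C h x))"
        by (intro mult_left_mono L2_triangle_dist L2_cmult TL CL fL h) auto
      also have "L2_norm (\<lambda>x. complex_of_real (\<mu>\<^sup>2) * ?f x - T ?f x) = L2_norm (\<lambda>x. T ?f x - complex_of_real (\<mu>\<^sup>2) * ?f x)"
        by (rule L2_norm_minus_commute)
      also have "L2_norm (\<lambda>x. T ?f x - C h x) = L2_norm (C (\<lambda>x. A ?f x - h x))"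
        unfolding T_def by (rule bounded_op_norm_diff[OF bC AL[OF fL(1)] h, symmetric])
      also have "\<dots> \<le> K' * L2_norm (\<lambda>x. A ?f x - h x)"
        by (intro K' L2_diff AL fL h)
      finally show "norm (L2_norm (\<lambda>x. ?f x - g x)) \<le> ?b n"
        using \<mu>0 by (simp add: divide_right_mono)
    qed
    have "?b \<longlonglongrightarrow> 1 / \<mu>\<^sup>2 * (0 + K' * 0)"
      using LIMSEQ_subseq_LIMSEQ[OF Tf r] by (intro tendsto_intros conv) (simp add: o_def)
    then show "?b \<longlonglongrightarrow> 0" by simp
  qed
  have lim0: "a = 0" if "\<And>n. \<bar>a\<bar> \<le> c * L2_norm (\<lambda>x. f (r n) x - g x)" for a c :: real
  proof -
    have "(\<lambda>n. c * L2_norm (\<lambda>x. f (r n) x - g x)) \<longlonglongrightarrow> c * 0" by (intro tendsto_mult tendsto_const fg)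
    then have "\<bar>a\<bar> \<le> c * 0" by (rule LIMSEQ_le_const) (use that in auto)
    then show ?thesis by simp
  qed
  have gI: "L2_inner g (e i) = 0" if i: "i \<in> I" for i
  proof -
    have "cmod (L2_inner g (e i)) = 0"
    proof (rule lim0)
      fix n
      have "L2_inner (\<lambda>x. f (r n) x - g x) (e i) = - L2_inner g (e i)"
        using fL(3)[of "r n"] i by (subst L2_inner_diff_left[OF fL(1) gL eL[OF i]]) (simp add: W_def)
      then show "\<bar>cmod (L2_inner g (e i))\<bar> \<le> L2_norm (e i) * L2_norm (\<lambda>x. f (r n) x - g x)"
        using L2_cauchy_schwarz[OF L2_diff[OF fL(1) gL] eL[OF i], of "r n"] by (simp add: mult.commute)
    qed
    then show ?thesis by simp
  qed
  have gW: "g \<in> W" using gL gI by (simp add: W_def)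
  have g1: "L2_norm g \<le> 1"
  proof -
    have "(\<lambda>n. 1 + L2_norm (\<lambda>x. f (r n) x - g x)) \<longlonglongrightarrow> 1 + 0" by (intro tendsto_intros fg)
    then have "L2_norm g \<le> 1 + 0"
    proof (rule LIMSEQ_le_const, intro exI allI impI)
      fix n
      show "L2_norm g \<le> 1 + L2_norm (\<lambda>x. f (r n) x - g x)"
        using L2_norm_le_dist[OF gL fL(1), of "r n"] fL(2)[of "r n"] L2_norm_minus_commute[of g "f (r n)"] by linarith
    qed
    then show ?thesis by simp
  qed
  have Ag: "\<mu> \<le> L2_norm (A g)"
  proof -
    have "(\<lambda>n. L2_norm (A g) + K * L2_norm (\<lambda>x. f (r n) x - g x)) \<longlonglongrightarrow> L2_norm (A g) + K * 0"
      by (intro tendsto_intros fg)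
    moreover have "(\<lambda>n. L2_norm (A (f (r n)))) \<longlonglongrightarrow> \<mu>" using LIMSEQ_subseq_LIMSEQ[OF Af r] by (simp add: o_def)
    moreover have "L2_norm (A (f (r n))) \<le> L2_norm (A g) + K * L2_norm (\<lambda>x. f (r n) x - g x)" for n
    proof -
      have "L2_norm (A (f (r n))) \<le> L2_norm (A g) + L2_norm (\<lambda>x. A (f (r n)) x - A g x)"
        by (intro L2_norm_le_dist AL fL gL)
      also have "L2_norm (\<lambda>x. A (f (r n)) x - A g x) = L2_norm (A (\<lambda>x. f (r n) x - g x))"
        by (rule bounded_op_norm_diff[OF bA fL(1) gL, symmetric])
      also have "\<dots> \<le> K * L2_norm (\<lambda>x. f (r n) x - g x)" by (intro K L2_diff fL gL)
      finally show ?thesis by simp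
    qed
    ultimately have "\<mu> \<le> L2_norm (A g) + K * 0" by (intro LIMSEQ_le) auto
    then show ?thesis by simp
  qed
  \<comment> \<open>From \<mu> \<le> \<parallel>A g\<parallel> \<le> \<mu> \<parallel>g\<parallel>:
    no norm is lost in the limit.\<close>
  have g_norm: "L2_norm g = 1"
    using Ag W[OF gW] g1 \<mu>0 by (intro antisym) (auto simp: mult_le_cancel_left1 dest: order_trans)
  have "L2_norm (\<lambda>x. T g x - complex_of_real (\<mu>\<^sup>2) * g x) = 0"
  proof -
    have "g \<in> W1" using gW g1 by (simp add: W1_def)
    from TN[OF this] le[OF this] Ag have "(L2_norm (\<lambda>x. T g x - complex_of_real (\<mu>\<^sup>2) * g x))\<^sup>2 \<le> 0" by simp
    then show ?thesis by simp
  qed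
  then have "AE x in lborel. T g x - complex_of_real (\<mu>\<^sup>2) * g x = 0"
    by (intro L2_norm_eq_0 L2_diff TL L2_cmult gL)
  then have "g \<in> singular_space A \<mu>"
    unfolding singular_space_def using gL by (simp add: T_def C_def)
  then show ?thesis using that \<mu> g_norm gI by blast
qed

text \<open>Energy counting. If A were bounded by \<delta> on the complement of m singular vectors,
  splitting every \<phi> j along them would give at most 2 M^2 m from the projections and 2
  \<delta>^2 per vector from the remainders. Larger energy forces one more singular value above
  \<delta>, so in total m + 1 of them are found.\<close>

lemma many_singular_vectors:
  fixes A :: "'a::euclidean_space operator" and \<phi> :: "'j \<Rightarrow> 'a \<Rightarrow> complex"
  assumes A: "L2_compact_op A" and B: "is_adjoint A B"
    and M: "\<And>f. f \<in> L2 \<Longrightarrow> L2_norm (A f) \<le> M * L2_norm f"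
    and J: "finite J" "orthonormal J \<phi>" and \<delta>: "0 \<le> \<delta>"
  shows "2 * M\<^sup>2 * real m + 2 * \<delta>\<^sup>2 * real (card J) < (\<Sum>j\<in>J. (L2_norm (A (\<phi> j)))\<^sup>2) \<Longrightarrow>
    \<exists>e \<sigma>. orthonormal {..<Suc m} e \<and> (\<forall>i<Suc m. e i \<in> singular_space A (\<sigma> i) \<and> \<delta> < \<sigma> i)"
proof -
  have bA: "L2_bounded_op A" using A by (simp add: L2_compact_op_def)
  note AL = bounded_op_L2[OF bA]
  have \<phi>L: "\<phi> j \<in> L2" if "j \<in> J" for j using J that by (simp add: orthonormal_def)
  have step: "\<exists>e \<sigma>. orthonormal {..<Suc m} e \<and> (\<forall>i<Suc m. e i \<in> singular_space A (\<sigma> i) \<and> \<delta> < \<sigma> i)"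
    if big: "2 * M\<^sup>2 * real m + 2 * \<delta>\<^sup>2 * real (card J) < (\<Sum>j\<in>J. (L2_norm (A (\<phi> j)))\<^sup>2)"
      and e: "orthonormal {..<m} e" "\<And>i. i < m \<Longrightarrow> e i \<in> singular_space A (\<sigma> i) \<and> \<delta> < \<sigma> i" for m e \<sigma>
  proof -
    let ?P = "orth_proj {..<m} e"
    have eL: "e i \<in> L2" if "i < m" for i using e(1) that by (simp add: orthonormal_def)
    have "\<exists>f0\<in>L2. L2_norm f0 \<le> 1 \<and> (\<forall>i<m. L2_inner f0 (e i) = 0) \<and> \<delta> < L2_norm (A f0)"
    proof (rule ccontr)
      assume "\<not> ?thesis"
      then have no: "L2_norm (A f) \<le> \<delta>" if "f \<in> L2" "L2_norm f \<le> 1" "\<And>i. i < m \<Longrightarrow> L2_inner f (e i) = 0" for f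
        using that by (meson not_less)
      have "(L2_norm (A (\<phi> j)))\<^sup>2 \<le> 2 * M\<^sup>2 * (\<Sum>i<m. (cmod (L2_inner (\<phi> j) (e i)))\<^sup>2) + 2 * \<delta>\<^sup>2" if j: "j \<in> J" for j
      proof -
        let ?u = "?P (\<phi> j)" and ?v = "\<lambda>x. \<phi> j x - ?P (\<phi> j) x"
        have u: "?u \<in> L2" by (rule orth_proj_L2[OF _ e(1) \<phi>L[OF j]]) simp
        have v: "?v \<in> L2" by (intro L2_diff \<phi>L j u)
        have "(L2_norm ?v)\<^sup>2 \<le> 1\<^sup>2"
          using orth_proj_norm_diff[OF _ e(1) \<phi>L[OF j]] orthonormal_norm[OF J(2) j] by (simp add: sum_nonneg)
        then have v1: "L2_norm ?v \<le> 1" by (rule power2_le_imp_le) simp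
        have "L2_norm (A ?v) \<le> \<delta>"
          by (rule no[OF v v1]) (use orth_proj_inner[OF _ e(1) \<phi>L[OF j]] L2_inner_diff_left[OF \<phi>L[OF j] u eL] in simp)
        then have Av: "(L2_norm (A ?v))\<^sup>2 \<le> \<delta>\<^sup>2" by (intro power_mono) auto
        have "(L2_norm (A ?u))\<^sup>2 \<le> (M * L2_norm ?u)\<^sup>2" by (intro power_mono M u) auto
        then have Au: "(L2_norm (A ?u))\<^sup>2 \<le> M\<^sup>2 * (\<Sum>i<m. (cmod (L2_inner (\<phi> j) (e i)))\<^sup>2)"
          using orth_proj_norm[OF _ e(1) \<phi>L[OF j]] by (simp add: power_mult_distrib)
        have "L2_norm (A (\<phi> j)) \<le> L2_norm (A ?u) + L2_norm (\<lambda>x. A (\<phi> j) x - A ?u x)"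
          by (intro L2_norm_le_dist AL \<phi>L j u)
        also have "L2_norm (\<lambda>x. A (\<phi> j) x - A ?u x) = L2_norm (A ?v)"
          by (rule bounded_op_norm_diff[OF bA \<phi>L[OF j] u, symmetric])
        finally have "(L2_norm (A (\<phi> j)))\<^sup>2 \<le> (L2_norm (A ?u) + L2_norm (A ?v))\<^sup>2" by (intro power_mono) auto
        also have "\<dots> \<le> 2 * (L2_norm (A ?u))\<^sup>2 + 2 * (L2_norm (A ?v))\<^sup>2"
          using sum_squares_bound[of "L2_norm (A ?u)" "L2_norm (A ?v)"] by (simp add: power2_sum)
        finally show ?thesis using Au Av by linarith
      qed
      then have "(\<Sum>j\<in>J. (L2_norm (A (\<phi> j)))\<^sup>2) \<le> (\<Sum>j\<in>J. 2 * M\<^sup>2 * (\<Sum>i<m. (cmod (L2_inner (\<phi> j) (e i)))\<^sup>2) + 2 * \<delta>\<^sup>2)"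
        by (rule sum_mono)
      also have "\<dots> = 2 * M\<^sup>2 * (\<Sum>j\<in>J. \<Sum>i<m. (cmod (L2_inner (\<phi> j) (e i)))\<^sup>2) + 2 * \<delta>\<^sup>2 * real (card J)"
        by (simp add: sum.distrib sum_distrib_left mult.commute)
      \<comment> \<open>The roles are exchanged: Bessel is applied to each e i with respect to the
        family \<phi>, so the total is at most m however large J is.\<close>
      also have "(\<Sum>j\<in>J. \<Sum>i<m. (cmod (L2_inner (\<phi> j) (e i)))\<^sup>2) = (\<Sum>i<m. \<Sum>j\<in>J. (cmod (L2_inner (e i) (\<phi> j)))\<^sup>2)"
        unfolding L2_inner_commute[of "e _" "\<phi> _"] complex_mod_cnj by (rule sum.swap)
      also have "2 * M\<^sup>2 * \<dots> \<le> 2 * M\<^sup>2 * (\<Sum>i<m. 1)"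
      proof (intro mult_left_mono sum_mono)
        fix i assume "i \<in> {..<m}"
        then show "(\<Sum>j\<in>J. (cmod (L2_inner (e i) (\<phi> j)))\<^sup>2) \<le> 1"
          using bessel[OF J eL, of i] orthonormal_norm[OF e(1), of i] by simp
      qed simp
      finally show False using big by simp
    qed
    then obtain f0 where f0: "f0 \<in> L2" "L2_norm f0 \<le> 1" "\<And>i. i < m \<Longrightarrow> L2_inner f0 (e i) = 0" "\<delta> < L2_norm (A f0)" by blast
    obtain g \<mu> where g: "\<delta> < \<mu>" "g \<in> singular_space A \<mu>" "L2_norm g = 1" "\<And>i. i < m \<Longrightarrow> L2_inner g (e i) = 0"
      using next_singular_vector[OF A B, of "{..<m}" e \<sigma> f0 \<delta>] e(2) f0 \<delta> by (metis lessThan_iff)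
    have g': "L2_inner (e i) g = 0" if "i < m" for i
      using g(4)[OF that] L2_inner_commute[of "e i" g] by simp
    have "orthonormal {..<Suc m} (e(m := g))"
      using e(1) g(2,3,4) g' singular_space_L2[OF g(2)] unfolding orthonormal_def
      by (auto simp: less_Suc_eq L2_inner_self[of g])
    moreover have "\<forall>i<Suc m. (e(m := g)) i \<in> singular_space A ((\<sigma>(m := \<mu>)) i) \<and> \<delta> < (\<sigma>(m := \<mu>)) i"
      using e(2) g(1,2) by (auto simp: less_Suc_eq)
    ultimately show ?thesis by blast
  qed
  show "2 * M\<^sup>2 * real m + 2 * \<delta>\<^sup>2 * real (card J) < (\<Sum>j\<in>J. (L2_norm (A (\<phi> j)))\<^sup>2) \<Longrightarrow> ?thesis"
  proof (induction m)
    case 0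
    show ?case by (rule step[OF 0, of undefined undefined]) (auto simp: orthonormal_def)
  next
    case (Suc m)
    have "2 * M\<^sup>2 * real m + 2 * \<delta>\<^sup>2 * real (card J) < (\<Sum>j\<in>J. (L2_norm (A (\<phi> j)))\<^sup>2)"
      using Suc.prems mult_left_mono[of "real m" "real (Suc m)" "2 * M\<^sup>2"] by simp
    then obtain e \<sigma> where "orthonormal {..<Suc m} e" "\<forall>i<Suc m. e i \<in> singular_space A (\<sigma> i) \<and> \<delta> < \<sigma> i"
      using Suc.IH by blast
    then show ?case using step[OF Suc.prems] by blast
  qed
qed

section \<open>Transfer of lower bounds to every extension\<close>

lemma extends_to_AE_adjoint:
  assumes k: "band_kernel \<rho> k" and A: "L2_bounded_op A" and eq: "\<And>f. f \<in> L2 \<Longrightarrow> AE x in lborel. A f x = kernel_op k f x"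
  shows "is_adjoint A (kernel_op (\<lambda>x t. cnj (k t x)))"
  unfolding is_adjoint_def
proof (intro conjI ballI)
  show "L2_bounded_op (kernel_op (\<lambda>x t. cnj (k t x)))" by (rule kernel_op_bounded[OF band_kernel_adjoint[OF k]])
  fix f g :: "'a \<Rightarrow> complex" assume f: "f \<in> L2" and g: "g \<in> L2"
  have "L2_inner (A f) g = L2_inner (kernel_op k f) g"
    by (intro L2_inner_cong_AE eq f g bounded_op_L2[OF A] kernel_op_L2[OF k])
  then show "L2_inner (A f) g = L2_inner f (kernel_op (\<lambda>x t. cnj (k t x)) g)"
    using is_adjointD(1)[OF kernel_op_adjoint[OF k] f g] by simp
qed

text \<open>Every extension agrees almost everywhere with the kernel operator and so has the same
  bound and the same energies. A compact one is covered by \<open>many_singular_vectors\<close>, any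
  other one has norm \<open>top\<close>.\<close>

theorem schatten_norm_ext_ge:
  fixes k :: "'a::euclidean_space \<Rightarrow> 'a \<Rightarrow> complex" and \<phi> :: "'j \<Rightarrow> 'a \<Rightarrow> complex"
  assumes k: "band_kernel \<rho> k" and T: "extends_to T (kernel_op k)" and r: "0 < r"
    and M: "\<And>f. f \<in> L2 \<Longrightarrow> L2_norm (kernel_op k f) \<le> M * L2_norm f"
    and J: "finite J" "orthonormal J \<phi>" and \<delta>: "0 \<le> \<delta>"
    and big: "2 * M\<^sup>2 * real m + 2 * \<delta>\<^sup>2 * real (card J) < (\<Sum>j\<in>J. (L2_norm (kernel_op k (\<phi> j)))\<^sup>2)"
  shows "ennreal ((real (Suc m) * \<delta> powr r) powr (1 / r)) \<le> schatten_norm_ext (ennreal r) T"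
  unfolding schatten_norm_ext_def
proof (rule INF_greatest)
  fix A assume "A \<in> {A. extends_to T A}"
  then have A: "extends_to T A" by simp
  then have bA: "L2_bounded_op A" by (simp add: extends_to_def)
  have eq: "AE x in lborel. A f x = kernel_op k f x" if "f \<in> L2" for f
    by (rule extension_unique[OF A T that])
  have nrm: "L2_norm (A f) = L2_norm (kernel_op k f)" if "f \<in> L2" for f
    by (intro L2_norm_cong_AE eq that bounded_op_L2[OF bA] kernel_op_L2[OF k])
  have \<phi>L: "\<phi> j \<in> L2" if "j \<in> J" for j using J that by (simp add: orthonormal_def)
  show "ennreal ((real (Suc m) * \<delta> powr r) powr (1 / r)) \<le> schatten_norm (ennreal r) A"
  proof (cases "L2_compact_op A")
    case True
    have "(\<Sum>j\<in>J. (L2_norm (A (\<phi> j)))\<^sup>2) = (\<Sum>j\<in>J. (L2_norm (kernel_op k (\<phi> j)))\<^sup>2)"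
      using nrm \<phi>L by (intro sum.cong) auto
    then obtain e \<sigma> where e: "orthonormal {..<Suc m} e" "\<forall>i<Suc m. e i \<in> singular_space A (\<sigma> i) \<and> \<delta> < \<sigma> i"
      using many_singular_vectors[OF True extends_to_AE_adjoint[OF k bA eq] _ J \<delta>, of M m] M nrm big by auto
    show ?thesis by (rule schatten_norm_ge[OF e(1) _ _ \<delta> r]) (use e(2) in blast)+
  next
    case False
    then show ?thesis by (simp add: schatten_norm_def)
  qed
qed

section \<open>Upper bounds for kernel operators\<close>

lemma schatten_norm_ext_le: "extends_to T A \<Longrightarrow> schatten_norm_ext p T \<le> schatten_norm p A"
  unfolding schatten_norm_ext_def by (rule INF_lower) simp

text \<open>Interpolation between the operator norm and the Hilbert--Schmidt norm: \<sigma>^r \<le>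
  M^(r - 2) \<sigma>^2, and the squares sum to at most H by Bessel.\<close>

theorem schatten_norm_kernel_ge2:
  assumes k: "band_kernel \<rho> k" and M: "\<And>f. f \<in> L2 \<Longrightarrow> L2_norm (kernel_op k f) \<le> M * L2_norm f" and M0: "0 \<le> M"
    and H: "hs_square k \<le> ennreal H" "0 \<le> H" and r: "2 \<le> r"
  shows "schatten_norm (ennreal r) (kernel_op k) \<le> ennreal ((M powr (r - 2) * H) powr (1 / r))"
proof (rule schatten_norm_le[OF kernel_op_compact[OF k] kernel_op_adjoint[OF k]])
  fix I :: "(real \<times> nat) set" and e \<sigma>
  assume I: "finite I" "orthonormal I e" and s: "\<And>i. i \<in> I \<Longrightarrow> 0 < \<sigma> i \<and> e i \<in> singular_space (kernel_op k) (\<sigma> i)"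
  have eL: "e i \<in> L2" if "i \<in> I" for i using I that by (simp add: orthonormal_def)
  have n: "L2_norm (kernel_op k (e i)) = \<sigma> i" if "i \<in> I" for i
    using singular_norm[OF kernel_op_bounded[OF k] kernel_op_adjoint[OF k], of "e i" "\<sigma> i"] s[OF that] orthonormal_norm[OF I(2) that] by simp
  have sM: "\<sigma> i \<le> M" if "i \<in> I" for i
    using M[OF eL[OF that]] n[OF that] orthonormal_norm[OF I(2) that] by simp
  have "ennreal (\<Sum>i\<in>I. (\<sigma> i)\<^sup>2) = (\<Sum>i\<in>I. \<integral>\<^sup>+t. ennreal ((cmod (kernel_op k (e i) t))\<^sup>2) \<partial>lborel)"
  proof (subst sum_ennreal[symmetric], simp, intro sum.cong refl)
    fix i assume i: "i \<in> I"
    have "(\<integral>\<^sup>+t. ennreal ((cmod (kernel_op k (e i) t))\<^sup>2) \<partial>lborel) = ennreal ((L2_norm (kernel_op k (e i)))\<^sup>2)"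
      unfolding L2_norm_square by (intro nn_integral_eq_integral L2_square_integrable kernel_op_L2[OF k] eL i) auto
    then show "ennreal ((\<sigma> i)\<^sup>2) = (\<integral>\<^sup>+t. ennreal ((cmod (kernel_op k (e i) t))\<^sup>2) \<partial>lborel)"
      unfolding n[OF i] by simp
  qed
  also have "\<dots> \<le> hs_square k" by (rule hilbert_schmidt_bessel[OF band_kernel_measurable[OF k] I])
  also note H(1)
  finally have S: "(\<Sum>i\<in>I. (\<sigma> i)\<^sup>2) \<le> H" using H(2) by simp
  have "(\<Sum>i\<in>I. \<sigma> i powr r) \<le> (\<Sum>i\<in>I. M powr (r - 2) * (\<sigma> i)\<^sup>2)"
  proof (rule sum_mono)
    fix i assume i: "i \<in> I"
    have "\<sigma> i powr r = \<sigma> i powr (r - 2) * \<sigma> i powr 2"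
      unfolding powr_add[symmetric] by simp
    also have "\<dots> \<le> M powr (r - 2) * \<sigma> i powr 2"
      using s[OF i] sM[OF i] r by (intro mult_right_mono powr_mono2) auto
    also have "\<sigma> i powr 2 = (\<sigma> i)\<^sup>2" using s[OF i] by simp
    finally show "\<sigma> i powr r \<le> M powr (r - 2) * (\<sigma> i)\<^sup>2" .
  qed
  also have "\<dots> \<le> M powr (r - 2) * H"
    unfolding sum_distrib_left[symmetric] by (intro mult_left_mono S) simp
  finally show "(\<Sum>i\<in>I. \<sigma> i powr r) \<le> M powr (r - 2) * H" .
qed (use r in simp)

text \<open>Trace duality. The vectors f i = A (e i) / \<sigma> i are orthonormal by the eigenvalue
  equation, and their pairings with A (e i) are exactly the singular values. A bound for the sum of
  the \<sigma> i bounds each of them, hence also the sums of r-th powers.\<close>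

theorem schatten_norm_kernel_trace:
  assumes k: "band_kernel \<rho> k" and K0: "0 \<le> K" and r: "1 \<le> r"
    and K: "\<And>(I :: (real \<times> nat) set) e f. finite I \<Longrightarrow> orthonormal I e \<Longrightarrow> orthonormal I f \<Longrightarrow>
      (\<Sum>i\<in>I. cmod (L2_inner (kernel_op k (e i)) (f i))) \<le> K"
  shows "schatten_norm (ennreal r) (kernel_op k) \<le> ennreal K"
proof -
  have "schatten_norm (ennreal r) (kernel_op k) \<le> ennreal ((K powr r) powr (1 / r))"
  proof (rule schatten_norm_le[OF kernel_op_compact[OF k] kernel_op_adjoint[OF k]])
    fix I :: "(real \<times> nat) set" and e \<sigma>
    assume I: "finite I" "orthonormal I e" and s: "\<And>i. i \<in> I \<Longrightarrow> 0 < \<sigma> i \<and> e i \<in> singular_space (kernel_op k) (\<sigma> i)"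
    have eL: "e i \<in> L2" if "i \<in> I" for i using I that by (simp add: orthonormal_def)
    define c where "c = (\<lambda>i. complex_of_real (1 / \<sigma> i))"
    define f where "f = (\<lambda>i x. c i * kernel_op k (e i) x)"
    have inn: "L2_inner (kernel_op k (e i)) (f j) = complex_of_real (if i = j then \<sigma> i else 0)" if i: "i \<in> I" and j: "j \<in> I" for i j
    proof -
      have "L2_inner (kernel_op k (e i)) (f j) = cnj (c j) * L2_inner (kernel_op k (e i)) (kernel_op k (e j))"
      proof -
        have "L2_inner (kernel_op k (e i)) (f j) = cnj (c j * L2_inner (kernel_op k (e j)) (kernel_op k (e i)))"
          unfolding L2_inner_cmult_left[symmetric] f_def by (rule L2_inner_commute)
        then show ?thesis unfolding complex_cnj_mult L2_inner_cnj .
      qed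
      also have "L2_inner (kernel_op k (e i)) (kernel_op k (e j)) = complex_of_real ((\<sigma> i)\<^sup>2) * L2_inner (e i) (e j)"
        using s[OF i] by (intro singular_inner[OF kernel_op_bounded[OF k] kernel_op_adjoint[OF k]] eL j) auto
      finally show ?thesis
        using I(2) i j s[OF i] by (simp add: orthonormal_def c_def power2_eq_square)
    qed
    have "orthonormal I f"
      unfolding orthonormal_def
    proof (intro conjI ballI)
      fix i assume i: "i \<in> I"
      show "f i \<in> L2" unfolding f_def by (intro L2_cmult kernel_op_L2[OF k] eL i)
      fix j assume j: "j \<in> I"
      have "L2_inner (f i) (f j) = c i * L2_inner (kernel_op k (e i)) (f j)"
        unfolding f_def[of] L2_inner_cmult_left ..
      then show "L2_inner (f i) (f j) = (if i = j then 1 else 0)"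
        using s[OF i] by (auto simp: inn[OF i j] c_def)
    qed
    from K[OF I this] have "(\<Sum>i\<in>I. cmod (L2_inner (kernel_op k (e i)) (f i))) \<le> K" .
    also have "(\<Sum>i\<in>I. cmod (L2_inner (kernel_op k (e i)) (f i))) = (\<Sum>i\<in>I. \<sigma> i)"
      using s by (intro sum.cong refl) (simp add: inn abs_of_pos)
    finally have S: "(\<Sum>i\<in>I. \<sigma> i) \<le> K" .
    have sK: "\<sigma> i \<le> K" if "i \<in> I" for i
      using member_le_sum[OF that _ I(1), of \<sigma>] s S by force
    have "(\<Sum>i\<in>I. \<sigma> i powr r) \<le> (\<Sum>i\<in>I. K powr (r - 1) * \<sigma> i)"
    proof (rule sum_mono)
      fix i assume i: "i \<in> I"
      have "\<sigma> i powr r = \<sigma> i powr (r - 1) * \<sigma> i powr 1"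
        unfolding powr_add[symmetric] by simp
      also have "\<dots> \<le> K powr (r - 1) * \<sigma> i powr 1"
        using s[OF i] sK[OF i] r by (intro mult_right_mono powr_mono2) auto
      finally show "\<sigma> i powr r \<le> K powr (r - 1) * \<sigma> i" using s[OF i] by simp
    qed
    also have "\<dots> \<le> K powr (r - 1) * K"
      unfolding sum_distrib_left[symmetric] by (intro mult_left_mono S) simp
    also have "\<dots> = K powr r"
      using K0 powr_add[of K "r - 1" 1] by (cases "K = 0") auto
    finally show "(\<Sum>i\<in>I. \<sigma> i powr r) \<le> K powr r" .
  qed (use r in simp)
  also have "(K powr r) powr (1 / r) = K" using K0 r by (simp add: powr_powr)
  finally show ?thesis .
qed

lemma schatten_norm_top_le:
  assumes k: "band_kernel \<rho> k" and M: "\<And>f. f \<in> L2 \<Longrightarrow> L2_norm (kernel_op k f) \<le> M * L2_norm f" and M0: "0 \<le> M"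
  shows "schatten_norm top (kernel_op k) \<le> ennreal M"
proof -
  have "L2_norm (kernel_op k f) \<le> M" if "f \<in> L2" "L2_norm f \<le> 1" for f
    using M[OF that(1)] mult_left_mono[OF that(2) M0] by simp
  then show ?thesis
    using kernel_op_bounded[OF k] by (auto simp: schatten_norm_def L2_op_norm_def intro!: SUP_least ennreal_leI)
qed

lemma schatten_norm_ext_top_ge:
  assumes k: "band_kernel \<rho> k" and T: "extends_to T (kernel_op k)" and f: "f \<in> L2" "L2_norm f \<le> 1"
  shows "ennreal (L2_norm (kernel_op k f)) \<le> schatten_norm_ext top T"
  unfolding schatten_norm_ext_def
proof (rule INF_greatest)
  fix A assume "A \<in> {A. extends_to T A}"
  then have A: "extends_to T A" by simp
  then have bA: "L2_bounded_op A" by (simp add: extends_to_def)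
  have "L2_norm (kernel_op k f) = L2_norm (A f)"
    by (intro L2_norm_cong_AE extension_unique[OF T A] f bounded_op_L2[OF bA] kernel_op_L2[OF k])
  then show "ennreal (L2_norm (kernel_op k f)) \<le> schatten_norm top A"
    using f bA by (auto simp: schatten_norm_def L2_op_norm_def intro!: SUP_upper)
qed

text \<open>Cauchy--Schwarz with |k| split into two square roots: the rows supply one factor M and,
  after Fubini, the columns supply the other.\<close>

lemma schur_test:
  fixes k :: "'a::euclidean_space \<Rightarrow> 'a \<Rightarrow> complex"
  assumes k: "band_kernel \<rho> k" and M0: "0 \<le> M"
    and row: "\<And>t. (\<integral>\<^sup>+x. ennreal (cmod (k t x)) \<partial>lborel) \<le> ennreal M"
    and col: "\<And>x. (\<integral>\<^sup>+t. ennreal (cmod (k t x)) \<partial>lborel) \<le> ennreal M" and f: "f \<in> L2"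
  shows "L2_norm (kernel_op k f) \<le> M * L2_norm f"
proof -
  note [measurable] = band_kernel_measurable[OF k] L2_measurable[OF f]
  have kt [measurable]: "k t \<in> borel_measurable borel" for t by (rule L2_measurable[OF band_kernel_L2[OF k]])
  have pt: "ennreal ((cmod (kernel_op k f t))\<^sup>2) \<le> ennreal M * (\<integral>\<^sup>+x. ennreal (cmod (k t x) * (cmod (f x))\<^sup>2) \<partial>lborel)" for t
  proof (cases "(\<integral>\<^sup>+x. ennreal (cmod (k t x) * (cmod (f x))\<^sup>2) \<partial>lborel) < \<infinity>")
    case True
    let ?a = "\<lambda>x. complex_of_real (sqrt (cmod (k t x)))" and ?b = "\<lambda>x. complex_of_real (sqrt (cmod (k t x)) * cmod (f x))"
    have ik: "integrable lborel (\<lambda>x. cmod (k t x))"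
      using row[of t] by (intro integrableI_bounded) (auto intro: le_less_trans)
    have ikf: "integrable lborel (\<lambda>x. cmod (k t x) * (cmod (f x))\<^sup>2)"
      using True by (intro integrableI_bounded) auto
    have a: "?a \<in> L2" by (rule L2_I) (use ik in \<open>auto simp: abs_of_nonneg\<close>)
    have b: "?b \<in> L2" by (rule L2_I) (use ikf in \<open>auto simp: norm_mult power_mult_distrib abs_of_nonneg\<close>)
    have "integrable lborel (\<lambda>x. k t x * f x)" by (rule L2_mult_integrable[OF band_kernel_L2[OF k] f])
    then have "cmod (kernel_op k f t) \<le> (LINT x|lborel. cmod (k t x) * cmod (f x))"
      unfolding kernel_op_def by (intro Bochner_Integration.integral_norm_bound_integral) (auto simp: norm_mult dest: integrable_norm)
    also have "\<dots> = cmod (L2_inner ?a ?b)"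
    proof -
      have "L2_inner ?a ?b = (LINT x|lborel. complex_of_real (cmod (k t x) * cmod (f x)))"
        unfolding L2_inner_def by (intro Bochner_Integration.integral_cong refl) (simp add: mult.assoc[symmetric] flip: of_real_mult)
      then show ?thesis by (simp only: integral_complex_of_real norm_of_real) (simp add: abs_of_nonneg)
    qed
    also have "\<dots> \<le> L2_norm ?a * L2_norm ?b" by (rule L2_cauchy_schwarz[OF a b])
    finally have "(cmod (kernel_op k f t))\<^sup>2 \<le> (L2_norm ?a * L2_norm ?b)\<^sup>2" by (intro power_mono) auto
    also have "\<dots> = (LINT x|lborel. cmod (k t x)) * (LINT x|lborel. cmod (k t x) * (cmod (f x))\<^sup>2)"
      unfolding power_mult_distrib L2_norm_square by (simp add: norm_mult power_mult_distrib abs_of_nonneg)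
    also have "\<dots> \<le> M * (LINT x|lborel. cmod (k t x) * (cmod (f x))\<^sup>2)"
    proof (intro mult_right_mono integral_nonneg)
      have "ennreal (LINT x|lborel. cmod (k t x)) \<le> ennreal M"
        using row[of t] nn_integral_eq_integral[OF ik] by simp
      then show "(LINT x|lborel. cmod (k t x)) \<le> M" using M0 by simp
    qed auto
    finally have "ennreal ((cmod (kernel_op k f t))\<^sup>2) \<le> ennreal (M * (LINT x|lborel. cmod (k t x) * (cmod (f x))\<^sup>2))"
      by (rule ennreal_leI)
    then show ?thesis
      using nn_integral_eq_integral[OF ikf] M0 by (simp add: ennreal_mult)
  next
    case False
    then have top: "(\<integral>\<^sup>+x. ennreal (cmod (k t x) * (cmod (f x))\<^sup>2) \<partial>lborel) = \<top>" by (simp add: not_less top_unique)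
    show ?thesis
    \<comment> \<open>An infinite integral makes the bound trivial unless M = 0, where 0 times
      \<open>top\<close> is 0. In that case the row vanishes almost everywhere, so the integral
      cannot be infinite.\<close>
    proof (cases "M = 0")
      case True
      then have "AE x in lborel. k t x = 0"
        using row[of t] by (simp add: nn_integral_0_iff_AE)
      then have "AE x in lborel. ennreal (cmod (k t x) * (cmod (f x))\<^sup>2) = 0"
        by eventually_elim simp
      then have "(\<integral>\<^sup>+x. ennreal (cmod (k t x) * (cmod (f x))\<^sup>2) \<partial>lborel) = 0"
        by (subst nn_integral_0_iff_AE) auto
      then show ?thesis using top by simp
    next
      case False
      then show ?thesis using M0 top by (simp add: ennreal_mult_top)
    qed
  qed
  have "ennreal ((L2_norm (kernel_op k f))\<^sup>2) = (\<integral>\<^sup>+t. ennreal ((cmod (kernel_op k f t))\<^sup>2) \<partial>lborel)"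
    unfolding L2_norm_square by (intro nn_integral_eq_integral[symmetric] L2_square_integrable kernel_op_L2[OF k] f) auto
  also have "\<dots> \<le> (\<integral>\<^sup>+t. ennreal M * (\<integral>\<^sup>+x. ennreal (cmod (k t x) * (cmod (f x))\<^sup>2) \<partial>lborel) \<partial>lborel)"
    by (intro nn_integral_mono pt)
  also have "\<dots> = ennreal M * (\<integral>\<^sup>+t. \<integral>\<^sup>+x. ennreal (cmod (k t x) * (cmod (f x))\<^sup>2) \<partial>lborel \<partial>lborel)"
    by (rule nn_integral_cmult) measurable
  also have "(\<integral>\<^sup>+t. \<integral>\<^sup>+x. ennreal (cmod (k t x) * (cmod (f x))\<^sup>2) \<partial>lborel \<partial>lborel) = (\<integral>\<^sup>+x. \<integral>\<^sup>+t. ennreal (cmod (k t x) * (cmod (f x))\<^sup>2) \<partial>lborel \<partial>lborel)"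
    by (rule lborel_pair.Fubini'[symmetric]) measurable
  also have "\<dots> = (\<integral>\<^sup>+x. (\<integral>\<^sup>+t. ennreal (cmod (k t x)) \<partial>lborel) * ennreal ((cmod (f x))\<^sup>2) \<partial>lborel)"
    by (intro nn_integral_cong) (simp add: ennreal_mult nn_integral_multc)
  also have "\<dots> \<le> (\<integral>\<^sup>+x. ennreal M * ennreal ((cmod (f x))\<^sup>2) \<partial>lborel)"
    by (intro nn_integral_mono mult_right_mono col) auto
  also have "\<dots> = ennreal M * ennreal ((L2_norm f)\<^sup>2)"
    unfolding L2_norm_square by (subst nn_integral_cmult) (auto intro!: arg_cong2[where f="(*)"] nn_integral_eq_integral L2_square_integrable[OF f])
  also have "ennreal M * (ennreal M * ennreal ((L2_norm f)\<^sup>2)) = ennreal ((M * L2_norm f)\<^sup>2)"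
    using M0 by (simp add: ennreal_mult[symmetric] power_mult_distrib power2_eq_square mult.assoc)
  finally have "ennreal ((L2_norm (kernel_op k f))\<^sup>2) \<le> ennreal ((M * L2_norm f)\<^sup>2)" by (simp add: mult_left_mono)
  then have "(L2_norm (kernel_op k f))\<^sup>2 \<le> (M * L2_norm f)\<^sup>2" by simp
  then show ?thesis by (rule power2_le_imp_le) (use M0 in simp)
qed

subsection \<open>Tents and their Fourier transforms\<close>

definition tent :: "real \<Rightarrow> real" where
  "tent x = max 0 (1 - \<bar>x\<bar>)"

text \<open>The Fourier transform of \<open>unit_ind\<close>, continued to the origin by its
  limit.\<close>

definition half_sinc :: "real \<Rightarrow> real" where
  "half_sinc w = (if w = 0 then 1 else 2 * sin (w / 2) / w)"

definition unit_ind :: "real \<Rightarrow> real" where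
  "unit_ind x = indicator {-1/2..1/2} x"

lemma measurable_unit_ind [measurable]: "unit_ind \<in> borel_measurable borel"
  unfolding unit_ind_def[abs_def] by measurable

lemma unit_ind_nonneg [simp]: "0 \<le> unit_ind x" "\<bar>unit_ind x\<bar> = unit_ind x"
  by (auto simp: unit_ind_def)

lemma continuous_on_tent [continuous_intros]: "continuous_on S f \<Longrightarrow> continuous_on S (\<lambda>x. tent (f x))"
  unfolding tent_def by (intro continuous_intros)

lemma tent_bounds: "0 \<le> tent x" "tent x \<le> 1"
  by (auto simp: tent_def)

lemma unit_ind_convolution:
  "integrable lborel (\<lambda>s. unit_ind (a - s) * unit_ind (c - s))"
  "(LINT s|lborel. unit_ind (a - s) * unit_ind (c - s)) = tent (a - c)"
proof -
  have eq: "unit_ind (a - s) * unit_ind (c - s) = indicator {max a c - 1/2..min a c + 1/2} s" for s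
    by (auto simp: unit_ind_def indicator_def)
  show "integrable lborel (\<lambda>s. unit_ind (a - s) * unit_ind (c - s))"
    unfolding eq by (rule integrable_real_indicator) (auto simp: emeasure_lborel_Icc_eq)
  show "(LINT s|lborel. unit_ind (a - s) * unit_ind (c - s)) = tent (a - c)"
    unfolding eq by (auto simp: tent_def measure_def emeasure_lborel_Icc_eq)
qed

lemma unit_ind_FT:
  "integrable lborel (\<lambda>x. complex_of_real (unit_ind x))"
  "(LINT x|lborel. complex_of_real (unit_ind x) * exp (- (\<i> * complex_of_real (w * x)))) = complex_of_real (half_sinc w)"
proof -
  show "integrable lborel (\<lambda>x. complex_of_real (unit_ind x))"
    unfolding unit_ind_def by (intro integrable_of_real integrable_real_indicator) auto
  show "(LINT x|lborel. complex_of_real (unit_ind x) * exp (- (\<i> * complex_of_real (w * x)))) = complex_of_real (half_sinc w)"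
  proof (cases "w = 0")
    case True
    have "(LINT x|lborel. unit_ind x) = 1"
      unfolding unit_ind_def by (simp add: measure_def)
    then show ?thesis using True by (simp add: half_sinc_def integral_complex_of_real)
  next
    case False
    let ?F = "\<lambda>x. exp (- (\<i> * complex_of_real (w * x))) / (- (\<i> * complex_of_real w))"
    have "(LINT x|lborel. indicator {-1/2..1/2} x *\<^sub>R exp (- (\<i> * complex_of_real (w * x)))) = ?F (1/2) - ?F (-1/2)"
    proof (rule integral_FTC_atLeastAtMost)
      fix x :: real
      have "((\<lambda>x. exp (- (\<i> * complex_of_real (w * x)))) has_vector_derivative (- (\<i> * complex_of_real w)) * exp (- (\<i> * complex_of_real (w * x)))) (at x within {-1/2..1/2})"
      proof -
        have "((\<lambda>x. - (\<i> * complex_of_real (w * x))) has_vector_derivative - (\<i> * complex_of_real w)) (at x within {-1/2..1/2})"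
          unfolding has_vector_derivative_def by (auto intro!: derivative_eq_intros simp: scaleR_conv_of_real)
        from field_vector_diff_chain_within[OF this, of exp "exp (- (\<i> * complex_of_real (w * x)))"]
        show ?thesis by (simp add: o_def DERIV_exp has_field_derivative_at_within)
      qed
      from has_vector_derivative_divide[OF this, of "- (\<i> * complex_of_real w)"]
      show "(?F has_vector_derivative exp (- (\<i> * complex_of_real (w * x)))) (at x within {-1/2..1/2})"
        using False by simp
    qed (auto intro!: continuous_intros)
    also have "?F (1/2) - ?F (-1/2) = complex_of_real (half_sinc w)"
    proof -
      have "exp (- (\<i> * complex_of_real (w * (1/2)))) = cis (- (w / 2))" "exp (- (\<i> * complex_of_real (w * (-1/2)))) = cis (w / 2)"
        by (simp_all add: cis_conv_exp)
      then show ?thesis using False by (simp add: half_sinc_def complex_eq_iff Re_divide Im_divide power2_eq_square field_simps)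
    qed
    finally show ?thesis
      by (simp add: unit_ind_def scaleR_conv_of_real)
  qed
qed

text \<open>The tent is the convolution of \<open>unit_ind\<close> with itself, so its transform is
  the square of that of \<open>unit_ind\<close>.\<close>

lemma tent_FT:
  "integrable lborel (\<lambda>x. complex_of_real (tent x))"
  "(LINT x|lborel. complex_of_real (tent x) * exp (- (\<i> * complex_of_real (w * x)))) = complex_of_real ((half_sinc w)\<^sup>2)"
proof -
  let ?u = "\<lambda>x. complex_of_real (unit_ind x)" and ?e = "\<lambda>x. exp (- (\<i> * complex_of_real (w * x)))"
  let ?H = "\<lambda>(s, x). ?u (- s) * ?u (x - s) * ?e x"
  have ev: "unit_ind (- s) = unit_ind s" for s by (auto simp: unit_ind_def indicator_def)
  have ie: "integrable lborel (\<lambda>x. ?u x * ?e x)"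
    by (intro integrable_mult_exp_i unit_ind_FT) measurable
  have sx: "(LINT x|lborel. ?u (x - s) * ?e x) = ?e s * complex_of_real (half_sinc w)" for s
  proof -
    have "(LINT x|lborel. ?u (x - s) * ?e x) = (LINT x|lborel. ?e s * (?u x * ?e x))"
      using integral_lborel_translate[of "\<lambda>x. ?u (x - s) * ?e x" s]
      by (simp add: distrib_left exp_add mult_ac exp_diff exp_minus divide_inverse)
    also have "\<dots> = ?e s * (LINT x|lborel. ?u x * ?e x)" by (rule integral_mult_right_zero)
    finally show ?thesis by (simp only: unit_ind_FT(2))
  qed
  have H: "integrable (lborel \<Otimes>\<^sub>M lborel) ?H"
  proof (rule lborel_pair.Fubini_integrable)
    have "integrable lborel (\<lambda>x. ?u (x - s))" for s
      using unit_ind_FT(1) integrable_lborel_translate[of ?u "- s"] by simp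
    then have "integrable lborel (\<lambda>x. ?u (- s) * (?u (x - s) * ?e x))" for s
      by (intro integrable_mult_right integrable_mult_exp_i) measurable
    then show "AE s in lborel. integrable lborel (\<lambda>x. ?H (s, x))" by (simp add: mult.assoc)
    have "(LINT x|lborel. norm (?H (s, x))) = unit_ind s * (LINT x|lborel. unit_ind x)" for s
      using integral_lborel_translate[of unit_ind "- s"] by (simp add: norm_mult ev unit_ind_nonneg)
    then show "integrable lborel (\<lambda>s. LINT x|lborel. norm (?H (s, x)))"
      by (simp only:) (use unit_ind_FT(1) in \<open>simp only: complex_of_real_integrable_eq, simp\<close>)
  qed measurable
  show "integrable lborel (\<lambda>x. complex_of_real (tent x))"
  proof -
    have "integrable lborel (\<lambda>x. indicator {-1..1} x *\<^sub>R complex_of_real (tent x))"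
      by (intro borel_integrable_compact continuous_intros) auto
    moreover have "(\<lambda>x. indicator {-1..1} x *\<^sub>R complex_of_real (tent x)) = (\<lambda>x. complex_of_real (tent x))"
      by (auto simp: fun_eq_iff indicator_def tent_def)
    ultimately show ?thesis by simp
  qed
  have "(LINT x|lborel. complex_of_real (tent x) * ?e x) = (LINT x|lborel. LINT s|lborel. ?H (s, x))"
  proof (intro Bochner_Integration.integral_cong refl)
    fix x
    have "(LINT s|lborel. ?H (s, x)) = (LINT s|lborel. complex_of_real (unit_ind (x - s) * unit_ind (0 - s))) * ?e x"
      by (simp add: mult.commute)
    then show "complex_of_real (tent x) * ?e x = (LINT s|lborel. ?H (s, x))"
      using unit_ind_convolution(2)[of x 0] by (simp only: integral_complex_of_real) simp
  qed
  also have "\<dots> = (LINT s|lborel. LINT x|lborel. ?H (s, x))"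
    using lborel_pair.Fubini_integral[of "\<lambda>s x. ?H (s, x)"] H by simp
  also have "\<dots> = (LINT s|lborel. ?u s * ?e s * complex_of_real (half_sinc w))"
  proof (intro Bochner_Integration.integral_cong refl)
    fix s
    have "(LINT x|lborel. ?H (s, x)) = (LINT x|lborel. ?u s * (?u (x - s) * ?e x))" by (simp only: case_prod_conv ev mult.assoc)
    also have "\<dots> = ?u s * (LINT x|lborel. ?u (x - s) * ?e x)" by (rule integral_mult_right_zero)
    finally show "(LINT x|lborel. ?H (s, x)) = ?u s * ?e s * complex_of_real (half_sinc w)"
      by (simp only: sx mult.assoc)
  qed
  also have "\<dots> = (LINT s|lborel. ?u s * ?e s) * complex_of_real (half_sinc w)" by (rule integral_mult_left_zero)
  also have "\<dots> = complex_of_real ((half_sinc w)\<^sup>2)"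
    by (simp only: unit_ind_FT(2)) (simp add: power2_eq_square)
  finally show "(LINT x|lborel. complex_of_real (tent x) * ?e x) = complex_of_real ((half_sinc w)\<^sup>2)" .
qed

lemma half_sinc_square_le: "(half_sinc w)\<^sup>2 \<le> 1" "(half_sinc w)\<^sup>2 \<le> 5 / (1 + w\<^sup>2)"
proof -
  show 1: "(half_sinc w)\<^sup>2 \<le> 1"
  proof (cases "w = 0")
    case False
    have "\<bar>sin (w / 2)\<bar> \<le> \<bar>w / 2\<bar>" by (rule abs_sin_x_le_abs_x)
    then have "\<bar>half_sinc w\<bar> \<le> 1" using False by (simp add: half_sinc_def abs_mult divide_le_eq)
    then show ?thesis by (simp add: abs_square_le_1)
  qed (simp add: half_sinc_def)
  show "(half_sinc w)\<^sup>2 \<le> 5 / (1 + w\<^sup>2)"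
  \<comment> \<open>The bounds 1 and 4 / w^2 meet at w^2 = 4, where 5 / (1 + w^2) equals 1; this
    fixes the constant 5.\<close>
  proof (cases "w\<^sup>2 \<le> 4")
    case True
    then have "1 \<le> 5 / (1 + w\<^sup>2)" by (subst le_divide_eq_1_pos) (auto intro: add_pos_nonneg)
    then show ?thesis using 1 by linarith
  next
    case False
    then have w: "w \<noteq> 0" by auto
    have "(sin (w / 2))\<^sup>2 \<le> 1" by (simp add: abs_square_le_1)
    then have "(half_sinc w)\<^sup>2 \<le> 4 / w\<^sup>2" using w by (simp add: half_sinc_def power_divide power_mult_distrib divide_right_mono)
    also have "\<dots> \<le> 5 / (1 + w\<^sup>2)"
      using False by (subst frac_le_eq) (auto simp: divide_le_0_iff add_pos_nonneg add_nonneg_eq_0_iff)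
    finally show ?thesis .
  qed
qed

text \<open>By the mean value theorem \<open>half_sinc w\<close> is cos z for some z below 1/2, and
  1/2 < \<pi>/3.\<close>

lemma half_sinc_square_ge:
  assumes "\<bar>w\<bar> \<le> 1" shows "1/4 \<le> (half_sinc w)\<^sup>2"
proof -
  have pos: "1/2 \<le> half_sinc w" if w: "0 < w" "w \<le> 1" for w
  proof -
    obtain z where z: "0 < z" "z < w / 2" "sin (w / 2) - sin 0 = (w / 2 - 0) * cos z"
      using MVT2[of 0 "w / 2" sin cos] w by (auto intro!: derivative_eq_intros)
    have "cos (pi / 3) \<le> cos z"
      using z w pi_gt3 by (intro cos_monotone_0_pi_le) auto
    then have "1/2 \<le> cos z" by (simp add: cos_60)
    moreover have "half_sinc w = cos z"
    proof -
      have "sin (w / 2) = (w / 2) * cos z" using z(3) by simp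
      then have "2 * sin (w / 2) = w * cos z" by simp
      then show ?thesis using w by (simp add: half_sinc_def del: times_divide_eq_right)
    qed
    ultimately show ?thesis by simp
  qed
  have "1/2 \<le> half_sinc w"
  proof (cases "w = 0")
    case False
    have "half_sinc w = half_sinc \<bar>w\<bar>" by (simp add: half_sinc_def abs_if)
    then show ?thesis using pos[of "\<bar>w\<bar>"] False assms by simp
  qed (simp add: half_sinc_def)
  then have "(1/2)\<^sup>2 \<le> (half_sinc w)\<^sup>2" by (intro power_mono) auto
  then show ?thesis by (simp add: power2_eq_square)
qed

section \<open>Tensor products of tents\<close>

definition tau :: "'a::euclidean_space \<Rightarrow> real" where
  "tau x = (\<Prod>b\<in>Basis. tent (x \<bullet> b))"

definition Tau :: "'a::euclidean_space \<Rightarrow> real" where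
  "Tau x = (\<Prod>b\<in>Basis. (half_sinc (x \<bullet> b))\<^sup>2)"

definition unit_cube :: "'a::euclidean_space \<Rightarrow> real" where
  "unit_cube x = (\<Prod>b\<in>Basis. unit_ind (x \<bullet> b))"

lemma continuous_on_tau [continuous_intros]: "continuous_on S f \<Longrightarrow> continuous_on S (\<lambda>x. tau (f x))"
  unfolding tau_def by (intro continuous_intros)

lemma measurable_tau [measurable]: "tau \<in> borel_measurable borel"
  by (intro borel_measurable_continuous_onI continuous_intros)

lemma measurable_unit_cube [measurable]: "unit_cube \<in> borel_measurable borel"
  unfolding unit_cube_def[abs_def] by measurable

lemma tau_bounds: "0 \<le> tau x" "tau x \<le> 1"
  unfolding tau_def using tent_bounds by (auto intro: prod_nonneg prod_le_1)

lemma unit_cube_bounds: "0 \<le> unit_cube x" "unit_cube x \<le> 1"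
  unfolding unit_cube_def unit_ind_def by (auto intro!: prod_nonneg prod_le_1)

lemma Tau_nonneg: "0 \<le> Tau x"
  unfolding Tau_def by (intro prod_nonneg) auto

lemma Tau_le_1: "Tau x \<le> 1"
  unfolding Tau_def using half_sinc_square_le by (intro prod_le_1) auto

lemma Tau_le_weight: "Tau x \<le> 5 ^ DIM('a) / cauchy_weight x" for x :: "'a::euclidean_space"
proof -
  have "Tau x \<le> (\<Prod>b\<in>(Basis :: 'a set). 5 / (1 + (x \<bullet> b)\<^sup>2))"
    unfolding Tau_def using half_sinc_square_le by (intro prod_mono) auto
  then show ?thesis by (simp add: prod_dividef cauchy_weight_def)
qed

lemma tau_ge: "(\<And>b. b \<in> Basis \<Longrightarrow> \<bar>x \<bullet> b\<bar> \<le> 1/2) \<Longrightarrow> (1/2) ^ DIM('a) \<le> tau x" for x :: "'a::euclidean_space"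
  unfolding tau_def prod_constant[symmetric]
proof (intro prod_mono conjI)
  fix b :: 'a assume b: "b \<in> Basis" and "\<And>b. b \<in> Basis \<Longrightarrow> \<bar>x \<bullet> b\<bar> \<le> 1/2"
  then have "\<bar>x \<bullet> b\<bar> \<le> 1/2" by blast
  then show "1/2 \<le> tent (x \<bullet> b)" by (simp add: tent_def)
qed simp

lemma Tau_ge: "(\<And>b. b \<in> Basis \<Longrightarrow> \<bar>x \<bullet> b\<bar> \<le> 1) \<Longrightarrow> (1/4) ^ DIM('a) \<le> Tau x" for x :: "'a::euclidean_space"
  unfolding Tau_def prod_constant[symmetric] using half_sinc_square_ge by (intro prod_mono) auto

text \<open>The norm is at most the l1 norm, so the cube [-1, 1]^d lies in the ball of radius
  d.\<close>

lemma tau_support: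
  fixes x :: "'a::euclidean_space"
  assumes "real DIM('a) < norm x" shows "tau x = 0"
proof -
  have "\<exists>b\<in>Basis. 1 < \<bar>x \<bullet> b\<bar>"
  proof (rule ccontr)
    assume "\<not> ?thesis"
    then have "(\<Sum>b\<in>Basis. \<bar>x \<bullet> b\<bar>) \<le> (\<Sum>b\<in>(Basis :: 'a set). 1)" by (intro sum_mono) (auto simp: not_less)
    then show False using norm_le_l1[of x] assms by simp
  qed
  then obtain b where b: "b \<in> Basis" "1 < \<bar>x \<bullet> b\<bar>" by blast
  then have "tent (x \<bullet> b) = 0" by (simp add: tent_def)
  then show ?thesis unfolding tau_def using b(1) by (intro prod_zero) auto
qed

lemma Tau_minus: "Tau (- x) = Tau x"
proof -
  have "half_sinc (- w) = half_sinc w" for w by (simp add: half_sinc_def)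
  then show ?thesis by (simp add: Tau_def)
qed

lemma tau_minus: "tau (- x) = tau x"
  by (simp add: tau_def tent_def)

lemma
  shows integrable_tau: "integrable lborel (\<lambda>x::'a::euclidean_space. complex_of_real (tau x))"
    and FT_tau: "FT (\<lambda>x::'a. complex_of_real (tau x)) w = complex_of_real (Tau w)"
proof -
  show "integrable lborel (\<lambda>x::'a. complex_of_real (tau x))"
    unfolding tau_def of_real_prod using tent_FT(1) by (intro integrable_lborel_prod)
  have e: "exp (- (\<i> * complex_of_real (w \<bullet> x))) = (\<Prod>b\<in>Basis. exp (- (\<i> * complex_of_real ((w \<bullet> b) * (x \<bullet> b)))))" for x
    by (subst euclidean_inner) (simp add: sum_distrib_left exp_sum flip: sum_negf)
  have "FT (\<lambda>x::'a. complex_of_real (tau x)) w = (LINT x|lborel. (\<Prod>b\<in>Basis. complex_of_real (tent (x \<bullet> b)) * exp (- (\<i> * complex_of_real ((w \<bullet> b) * (x \<bullet> b))))))"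
    unfolding FT_def tau_def e of_real_prod prod.distrib ..
  also have "\<dots> = (\<Prod>b\<in>Basis. complex_of_real ((half_sinc (w \<bullet> b))\<^sup>2))"
    by (subst integral_lborel_prod[of "\<lambda>b x. complex_of_real (tent x) * exp (- (\<i> * complex_of_real ((w \<bullet> b) * x)))"])
       (auto simp only: tent_FT(2) intro!: integrable_mult_exp_i tent_FT(1), measurable)
  finally show "FT (\<lambda>x::'a. complex_of_real (tau x)) w = complex_of_real (Tau w)"
    by (simp add: Tau_def)
qed

lemma measurable_Tau [measurable]: "Tau \<in> borel_measurable borel"
proof -
  have [measurable]: "half_sinc \<in> borel_measurable borel" unfolding half_sinc_def[abs_def] by measurable
  show ?thesis unfolding Tau_def[abs_def] by measurable
qed

lemma continuous_on_Tau [continuous_intros]: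
  fixes f :: "'b::topological_space \<Rightarrow> 'a::euclidean_space"
  assumes "continuous_on S f" shows "continuous_on S (\<lambda>x. Tau (f x))"
proof -
  have "isCont half_sinc w" for w
  proof (cases "w = 0")
    case True
    have "(\<lambda>w::real. 2 * sin (w / 2) / w) \<midarrow>0\<rightarrow> 1" by real_asymp
    then have "half_sinc \<midarrow>0\<rightarrow> 1"
      by (rule Lim_transform_eventually) (auto simp: eventually_at_filter half_sinc_def)
    then show ?thesis using True by (simp add: isCont_def half_sinc_def)
  next
    case False
    have "isCont (\<lambda>w. 2 * sin (w / 2) / w) w" using False by (intro continuous_intros) auto
    moreover have "\<forall>\<^sub>F u in nhds w. half_sinc u = 2 * sin (u / 2) / u"
      using t1_space_nhds[OF False] by eventually_elim (simp add: half_sinc_def)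
    from isCont_cong[OF this] have "isCont half_sinc w = isCont (\<lambda>w. 2 * sin (w / 2) / w) w" .
    ultimately show ?thesis by (simp only:)
  qed
  then have "continuous_on UNIV half_sinc" by (simp add: continuous_on_eq_continuous_at)
  then have c: "continuous_on UNIV (Tau :: 'a \<Rightarrow> real)"
    unfolding Tau_def[abs_def]
  proof (intro continuous_on_prod continuous_on_power)
    fix b :: 'a
    have "continuous_on UNIV (\<lambda>x::'a. x \<bullet> b)" by (intro continuous_intros)
    from continuous_on_compose2[OF \<open>continuous_on UNIV half_sinc\<close> this]
    show "continuous_on UNIV (\<lambda>x::'a. half_sinc (x \<bullet> b))" by simp
  qed
  show ?thesis by (rule continuous_on_compose2[OF c assms]) auto
qed

lemma integrable_Tau_powr:
  assumes r: "1 \<le> r" shows "integrable lborel (\<lambda>x::'a::euclidean_space. Tau x powr r)"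
proof (rule Bochner_Integration.integrable_bound[OF integrable_mult_right[OF integrable_inverse_cauchy_weight, of "5 ^ DIM('a)"]])
  show "AE x in lborel. norm (Tau (x::'a) powr r) \<le> norm (5 ^ DIM('a) * (1 / cauchy_weight x))"
  proof (intro AE_I2)
    fix x :: 'a
    have "Tau x powr r \<le> Tau x powr 1"
      using Tau_nonneg[of x] Tau_le_1[of x] r by (intro powr_mono') auto
    also have "\<dots> = Tau x" using Tau_nonneg[of x] by simp
    also have "\<dots> \<le> 5 ^ DIM('a) / cauchy_weight x" by (rule Tau_le_weight)
    finally show "norm (Tau x powr r) \<le> norm (5 ^ DIM('a) * (1 / cauchy_weight x))" by simp
  qed
qed measurable

lemma integrable_Tau: "integrable lborel (Tau :: 'a::euclidean_space \<Rightarrow> real)"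
proof -
  have "Tau x powr 1 = Tau x" for x :: 'a using Tau_nonneg[of x] by simp
  then show ?thesis using integrable_Tau_powr[of 1, where 'a='a] by (simp only:)
qed

text \<open>Integrability of \<open>Tau\<close> is the point. The sharp cube would fail here, its
  transform being a product of sinc functions, which is not integrable.\<close>

lemma Tau_inversion: "(LINT w|lborel. complex_of_real (Tau w) * exp (\<i> * complex_of_real (z \<bullet> w))) = complex_of_real ((2 * pi) ^ DIM('a) * tau z)"
  for z :: "'a::euclidean_space"
proof -
  have eq: "FT (\<lambda>x::'a. complex_of_real (tau x)) = (\<lambda>w. complex_of_real (Tau w))"
    by (simp add: FT_tau fun_eq_iff)
  have "isCont (\<lambda>x::'a. complex_of_real (tau x)) z"
  proof -
    have "continuous_on UNIV (\<lambda>x::'a. complex_of_real (tau x))" by (intro continuous_intros)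
    then show ?thesis by (simp add: continuous_on_eq_continuous_at)
  qed
  from FT_inversion[OF integrable_tau _ this] show ?thesis
    unfolding eq using integrable_of_real[OF integrable_Tau] by (simp only: of_real_mult)
qed

section \<open>Convolution of cubes, comparison of weights, and explicit masses\<close>

lemma unit_cube_convolution:
  fixes a c :: "'a::euclidean_space"
  shows "integrable lborel (\<lambda>s. unit_cube (a - s) * unit_cube (c - s))"
    and "(LINT s|lborel. unit_cube (a - s) * unit_cube (c - s)) = tau (a - c)"
proof -
  have eq: "unit_cube (a - s) * unit_cube (c - s) = (\<Prod>b\<in>Basis. unit_ind (a \<bullet> b - s \<bullet> b) * unit_ind (c \<bullet> b - s \<bullet> b))" for s
    by (simp add: unit_cube_def prod.distrib inner_diff_left)
  show "integrable lborel (\<lambda>s. unit_cube (a - s) * unit_cube (c - s))"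
    unfolding eq using unit_ind_convolution(1) by (intro integrable_lborel_prod[of "\<lambda>b s. unit_ind (a \<bullet> b - s) * unit_ind (c \<bullet> b - s)"])
  show "(LINT s|lborel. unit_cube (a - s) * unit_cube (c - s)) = tau (a - c)"
    unfolding eq using unit_ind_convolution
    by (subst integral_lborel_prod[of "\<lambda>b s. unit_ind (a \<bullet> b - s) * unit_ind (c \<bullet> b - s)"]) (auto simp: tau_def inner_diff_left)
qed

lemma unit_cube_integral: "(\<integral>\<^sup>+x. ennreal (unit_cube (x::'a::euclidean_space)) \<partial>lborel) = 1"
proof -
  have "(\<integral>\<^sup>+x. ennreal (unit_cube (x::'a)) \<partial>lborel) = (\<integral>\<^sup>+x. (\<Prod>b\<in>Basis. ennreal (unit_ind ((x::'a) \<bullet> b))) \<partial>lborel)"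
    unfolding unit_cube_def by (intro nn_integral_cong prod_ennreal[symmetric]) simp
  also have "\<dots> = (\<Prod>b\<in>(Basis :: 'a set). \<integral>\<^sup>+x. ennreal (unit_ind x) \<partial>lborel)"
    by (rule nn_integral_lborel_prod) auto
  also have "(\<integral>\<^sup>+x. ennreal (unit_ind x) \<partial>lborel) = 1"
    unfolding unit_ind_def by (simp add: ennreal_indicator)
  finally show ?thesis by simp
qed

text \<open>In each coordinate (z + h)^2 \<le> 2 z^2 + 2 h^2, and 2 h^2 \<le> 1 for a displacement h
  of at most 1/2, which costs one factor 2.\<close>

lemma cauchy_weight_cube:
  fixes u z :: "'a::euclidean_space"
  assumes "unit_cube (u - z) \<noteq> 0" shows "cauchy_weight u \<le> 2 ^ DIM('a) * cauchy_weight z"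
proof -
  have "1 + (u \<bullet> b)\<^sup>2 \<le> 2 * (1 + (z \<bullet> b)\<^sup>2)" if b: "b \<in> Basis" for b
  proof -
    have "unit_ind ((u - z) \<bullet> b) \<noteq> 0" using assms b unfolding unit_cube_def by (meson finite_Basis prod_zero)
    then have "(u - z) \<bullet> b \<in> {-1/2..1/2}" unfolding unit_ind_def indicator_def by (simp split: if_splits)
    then have "- (1/2) \<le> u \<bullet> b - z \<bullet> b" "u \<bullet> b - z \<bullet> b \<le> 1/2" by (simp_all add: inner_diff_left)
    then have d: "\<bar>u \<bullet> b - z \<bullet> b\<bar> \<le> 1/2" by (intro abs_leI) linarith+
    have "(u \<bullet> b)\<^sup>2 \<le> 2 * (z \<bullet> b)\<^sup>2 + 2 * (u \<bullet> b - z \<bullet> b)\<^sup>2"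
      using sum_squares_bound[of "z \<bullet> b" "u \<bullet> b - z \<bullet> b"] power2_sum[of "z \<bullet> b" "u \<bullet> b - z \<bullet> b"] by simp
    moreover have "(u \<bullet> b - z \<bullet> b)\<^sup>2 \<le> (1/2)\<^sup>2" using d power_mono[of "\<bar>u \<bullet> b - z \<bullet> b\<bar>" "1/2" 2] by simp
    ultimately show ?thesis by (simp add: power2_eq_square)
  qed
  then have "cauchy_weight u \<le> (\<Prod>b\<in>(Basis :: 'a set). 2 * (1 + (z \<bullet> b)\<^sup>2))"
    unfolding cauchy_weight_def by (intro prod_mono) (auto intro: add_nonneg_nonneg)
  then show ?thesis unfolding cauchy_weight_def prod.distrib prod_constant .
qed

lemma tau_Tau_zero [simp]: "tau 0 = 1" "Tau 0 = 1"
  by (simp_all add: tau_def Tau_def tent_def half_sinc_def)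

lemma integrable_tau_real: "integrable lborel (tau :: 'a::euclidean_space \<Rightarrow> real)"
  using integrable_tau[where 'a='a] by (simp add: complex_of_real_integrable_eq)

lemma nn_integral_tau: "(\<integral>\<^sup>+x. ennreal (tau x) \<partial>lborel) = 1"
proof -
  have "complex_of_real (LINT x|lborel. tau (x :: 'a)) = 1"
    using FT_tau[where 'a='a, of 0] by (simp add: FT_def)
  then have "(LINT x|lborel. tau (x :: 'a)) = 1" using of_real_eq_1_iff by blast
  then show ?thesis
    using nn_integral_eq_integral[OF integrable_tau_real[where 'a='a] AE_I2[OF tau_bounds(1)]] by simp
qed

lemma nn_integral_Tau: "(\<integral>\<^sup>+x. ennreal (Tau (x :: 'a::euclidean_space)) \<partial>lborel) = ennreal ((2 * pi) ^ DIM('a))"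
proof -
  have "complex_of_real (LINT x|lborel. Tau (x :: 'a)) = complex_of_real ((2 * pi) ^ DIM('a))"
    using Tau_inversion[where 'a='a, of 0] by simp
  then have "(LINT x|lborel. Tau (x :: 'a)) = (2 * pi) ^ DIM('a)" using of_real_eq_iff by blast
  then show ?thesis
    using nn_integral_eq_integral[OF integrable_Tau[where 'a='a] AE_I2[OF Tau_nonneg]] by simp
qed

lemma nn_integral_tau_scaled:
  assumes "0 < R" shows "(\<integral>\<^sup>+x. ennreal (tau ((1/R) *\<^sub>R (x :: 'a::euclidean_space))) \<partial>lborel) = ennreal (R ^ DIM('a))"
  using nn_integral_affine[of "1/R" "\<lambda>x::'a. ennreal (tau x)" 0] assms by (simp add: nn_integral_tau power_divide)

lemma nn_integral_lborel_pair:
  fixes f :: "'a::euclidean_space \<times> 'b::euclidean_space \<Rightarrow> ennreal"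
  assumes "f \<in> borel_measurable borel"
  shows "(\<integral>\<^sup>+z. f z \<partial>lborel) = (\<integral>\<^sup>+x. \<integral>\<^sup>+y. f (x, y) \<partial>lborel \<partial>lborel)"
  using lborel.nn_integral_fst[of f lborel] assms by (simp add: lborel_prod)

text \<open>The set where f is at most its essential supremum is closed and of full measure, hence
  everything. This lets a single value bound an essential supremum from below.\<close>

lemma continuous_le_esssup:
  fixes f :: "'a::euclidean_space \<Rightarrow> real"
  assumes c: "continuous_on UNIV f"
  shows "ennreal (f z) \<le> esssup lborel (\<lambda>z. ennreal (f z))"
proof (cases "esssup lborel (\<lambda>z. ennreal (f z))")
  case (real e)
  have "AE z in lborel. ennreal (f z) \<le> ennreal e"
    using esssup_AE[where M=lborel and f="\<lambda>z. ennreal (f z)"] real by simp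
  then have "AE z in lborel. z \<in> {z. f z \<le> e}"
    by eventually_elim (use real in \<open>auto simp: ennreal_le_iff2\<close>)
  then have "AE z in lebesgue. z \<in> {z. f z \<le> e}" by (rule AE_completion)
  moreover have "closed {z. f z \<le> e}" using c by (intro closed_Collect_le) auto
  ultimately have "z \<in> {z. f z \<le> e}" by (intro mem_closed_if_AE_lebesgue)
  then show ?thesis using real by (simp add: ennreal_leI)
qed simp

subsection \<open>The test distributions\<close>

definition chirp :: "real \<Rightarrow> real \<Rightarrow> 'd::finite phase_space \<Rightarrow> complex" where
  "chirp \<theta> R z = complex_of_real (tau ((1/R) *\<^sub>R fst z) * tau (snd z)) * exp (- (\<i> * complex_of_real (\<theta> * (fst z \<bullet> snd z))))"

definition chirp_kernel :: "real \<Rightarrow> real \<Rightarrow> real^'d::finite \<Rightarrow> real^'d \<Rightarrow> complex" where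
  "chirp_kernel \<theta> R t x = complex_of_real (tau ((1/R) *\<^sub>R (t - x)) * Tau ((1/2) *\<^sub>R (t + x) - \<theta> *\<^sub>R (t - x)) / (2 * pi) ^ CARD('d))"

lemma cts_supported_chirp:
  fixes R :: real
  assumes R: "1 \<le> R"
  shows "cts_supported (2 * real CARD('d) * R) (chirp \<theta> R :: 'd::finite phase_space \<Rightarrow> complex)"
  unfolding cts_supported_def
proof (intro conjI allI impI)
  show "continuous_on UNIV (chirp \<theta> R :: 'd phase_space \<Rightarrow> complex)"
    unfolding chirp_def[abs_def] by (intro continuous_intros)
  fix z :: "'d phase_space" assume z: "2 * real CARD('d) * R < norm z"
  show "chirp \<theta> R z = 0"
  proof (cases "real CARD('d) < norm (snd z)")
    case True
    then show ?thesis by (simp add: chirp_def tau_support)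
  next
    case False
    have "real CARD('d) * 1 \<le> real CARD('d) * R" using R by (intro mult_left_mono) auto
    moreover have "norm z \<le> norm (fst z) + norm (snd z)" by (metis norm_Pair_le prod.collapse)
    ultimately have "real CARD('d) * R < norm (fst z)" using z False by linarith
    then have "real CARD('d) < norm ((1/R) *\<^sub>R fst z)" using R by (simp add: field_simps)
    then have "tau ((1/R) *\<^sub>R fst z) = 0" by (intro tau_support) simp
    then show ?thesis by (simp add: chirp_def)
  qed
qed

text \<open>The chirp only shifts the frequency by \<theta> y, so the \<xi>-integral is the
  transform of \<open>tau\<close> at a displaced point.\<close>

lemma partial_FT_chirp:
  fixes y \<eta> :: "real^'d::finite"
  shows "partial_FT (chirp \<theta> R) y \<eta> = complex_of_real (tau ((1/R) *\<^sub>R y) * Tau (\<eta> + \<theta> *\<^sub>R y))"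
proof -
  have "partial_FT (chirp \<theta> R) y \<eta> =
     (LINT \<xi>|lborel. complex_of_real (tau ((1/R) *\<^sub>R y)) * (complex_of_real (tau \<xi>) * exp (- (\<i> * complex_of_real ((\<eta> + \<theta> *\<^sub>R y) \<bullet> \<xi>)))))"
    unfolding partial_FT_def FT_def chirp_def
    by (intro Bochner_Integration.integral_cong refl)
       (simp add: inner_add_left distrib_left exp_add exp_minus exp_diff divide_inverse algebra_simps)
  also have "\<dots> = complex_of_real (tau ((1/R) *\<^sub>R y)) * complex_of_real (Tau (\<eta> + \<theta> *\<^sub>R y))"
    unfolding integral_mult_right_zero using FT_tau[of "\<eta> + \<theta> *\<^sub>R y"] by (simp only: FT_def)
  finally show ?thesis by simp
qed

lemma chirp_symbol:
  fixes x \<eta> :: "real^'d::finite"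
  assumes R: "1 \<le> R"
  shows "sympl_fourier (chirp \<theta> R) (x, \<eta>) =
    FT (\<lambda>y. complex_of_real (tau ((1/R) *\<^sub>R y) * Tau (\<theta> *\<^sub>R y - x))) \<eta> / of_real ((2 * pi) ^ CARD('d))"
proof -
  let ?H = "\<lambda>z. chirp \<theta> R z * exp (- (\<i> * complex_of_real (sympl (x, \<eta>) z)))"
  have "integrable lborel ?H"
    by (rule integrable_mult_exp_i(1)[OF cts_supported_integrable[OF cts_supported_chirp[OF R]]]) measurable
  then have "(LINT z|lborel. ?H z) = (LINT y|lborel. LINT \<xi>|lborel. ?H (y, \<xi>))"
    using lborel_pair.integral_fst[of "\<lambda>y \<xi>. ?H (y, \<xi>)"] by (simp add: lborel_prod split_beta')
  also have "\<dots> = (LINT y|lborel. complex_of_real (tau ((1/R) *\<^sub>R y) * Tau (\<theta> *\<^sub>R y - x)) * exp (- (\<i> * complex_of_real (\<eta> \<bullet> y))))"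
  proof (intro Bochner_Integration.integral_cong refl)
    fix y
    have "(LINT \<xi>|lborel. ?H (y, \<xi>)) = (LINT \<xi>|lborel. (chirp \<theta> R (y, \<xi>) * exp (- (\<i> * complex_of_real ((- x) \<bullet> \<xi>)))) * exp (- (\<i> * complex_of_real (\<eta> \<bullet> y))))"
      by (intro Bochner_Integration.integral_cong refl)
         (simp add: sympl_def inner_commute right_diff_distrib exp_diff exp_minus divide_inverse mult_ac)
    also have "\<dots> = partial_FT (chirp \<theta> R) y (- x) * exp (- (\<i> * complex_of_real (\<eta> \<bullet> y)))"
      unfolding integral_mult_left_zero partial_FT_def FT_def ..
    finally show "(LINT \<xi>|lborel. ?H (y, \<xi>)) = complex_of_real (tau ((1/R) *\<^sub>R y) * Tau (\<theta> *\<^sub>R y - x)) * exp (- (\<i> * complex_of_real (\<eta> \<bullet> y)))"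
      by (simp add: partial_FT_chirp)
  qed
  finally show ?thesis
    unfolding sympl_fourier_eq sympl_int_def FT_def by simp
qed

lemma chirp_kernel_bounds:
  "0 \<le> tau ((1/R) *\<^sub>R (t - x)) * Tau ((1/2) *\<^sub>R (t + x) - \<theta> *\<^sub>R (t - x)) / (2 * pi) ^ CARD('d)" for t x :: "real^'d::finite"
  by (intro divide_nonneg_nonneg mult_nonneg_nonneg tau_bounds Tau_nonneg) simp

lemma cmod_chirp_kernel:
  fixes t x :: "real^'d::finite"
  shows "cmod (chirp_kernel \<theta> R t x) = tau ((1/R) *\<^sub>R (t - x)) * Tau ((1/2) *\<^sub>R (t + x) - \<theta> *\<^sub>R (t - x)) / (2 * pi) ^ CARD('d)"
  unfolding chirp_kernel_def norm_of_real using chirp_kernel_bounds by (rule abs_of_nonneg)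

text \<open>The kernel takes values in [0, 1], so its square is at most itself. In the variables t
  and y = t - x the t-integral of \<open>Tau\<close> cancels the normalisation for each y, whatever
  \<theta> is, and the y-integral of \<open>tau\<close> gives R^d.\<close>

lemma hs_square_chirp_kernel:
  fixes R :: real
  assumes R: "1 \<le> R"
  shows "hs_square (chirp_kernel \<theta> R :: real^'d::finite \<Rightarrow> _) \<le> ennreal (R ^ CARD('d))"
proof -
  let ?T = "\<lambda>t y::real^'d. ennreal (tau ((1/R) *\<^sub>R y)) * (ennreal (1 / (2 * pi) ^ CARD('d)) * ennreal (Tau (t - (\<theta> + 1/2) *\<^sub>R y)))"
  have pi1: "1 \<le> (2 * pi) ^ CARD('d)" using pi_gt3 by (intro one_le_power) linarith
  have le: "ennreal ((cmod (chirp_kernel \<theta> R t (t - y)))\<^sup>2) \<le> ?T t y" for t y :: "real^'d"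
  proof -
    let ?c = "1 / (2 * pi) ^ CARD('d)"
    have arg: "(1/2) *\<^sub>R (t + (t - y)) - \<theta> *\<^sub>R (t - (t - y)) = t - (\<theta> + 1/2) *\<^sub>R y"
      by (simp add: vec_eq_iff field_simps)
    define p q where "p = tau ((1/R) *\<^sub>R y)" and "q = Tau (t - (\<theta> + 1/2) *\<^sub>R y)"
    have pq: "0 \<le> p" "p \<le> 1" "0 \<le> q" "q \<le> 1" unfolding p_def q_def using tau_bounds Tau_nonneg Tau_le_1 by blast+
    have v: "cmod (chirp_kernel \<theta> R t (t - y)) = p * (?c * q)"
      unfolding cmod_chirp_kernel arg p_def q_def by simp
    have c: "0 \<le> ?c" "?c \<le> 1" using pi1 by simp_all
    then have cq: "0 \<le> ?c * q" "?c * q \<le> 1" using pq mult_le_one[of ?c q] by (blast intro: mult_nonneg_nonneg)+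
    have v1: "0 \<le> p * (?c * q)" using pq(1) cq(1) by (rule mult_nonneg_nonneg)
    moreover have "p * (?c * q) \<le> 1" using pq(2) cq by (rule mult_le_one)
    ultimately have "(p * (?c * q))\<^sup>2 \<le> p * (?c * q)" unfolding power2_eq_square by (rule mult_left_le[rotated])
    then have "ennreal ((p * (?c * q))\<^sup>2) \<le> ennreal (p * (?c * q))" by (rule ennreal_leI)
    also have "\<dots> = ennreal p * (ennreal ?c * ennreal q)" using pq cq c by (simp only: ennreal_mult)
    finally show ?thesis unfolding v p_def q_def .
  qed
  have m: "(\<lambda>x. ennreal ((cmod (chirp_kernel \<theta> R t x))\<^sup>2)) \<in> borel_measurable borel" for t :: "real^'d"
    unfolding chirp_kernel_def by measurable
  have "hs_square (chirp_kernel \<theta> R :: real^'d \<Rightarrow> _) = (\<integral>\<^sup>+t. \<integral>\<^sup>+y. ennreal ((cmod (chirp_kernel \<theta> R t (t - y :: real^'d)))\<^sup>2) \<partial>lborel \<partial>lborel)"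
    unfolding hs_square_def using nn_integral_lborel_reflect[OF m] by simp
  also have "\<dots> \<le> (\<integral>\<^sup>+t. \<integral>\<^sup>+y. ?T t y \<partial>lborel \<partial>lborel)"
    by (intro nn_integral_mono le)
  also have "\<dots> = (\<integral>\<^sup>+y. \<integral>\<^sup>+t. ?T t y \<partial>lborel \<partial>lborel)"
    by (intro lborel_pair.Fubini') measurable
  also have "\<dots> = (\<integral>\<^sup>+y. ennreal (tau ((1/R) *\<^sub>R (y :: real^'d))) \<partial>lborel)"
  proof (intro nn_integral_cong)
    fix y :: "real^'d"
    have "(\<integral>\<^sup>+t. ennreal (Tau (t - (\<theta> + 1/2) *\<^sub>R y)) \<partial>lborel) = ennreal ((2 * pi) ^ CARD('d))"
      using nn_integral_lborel_translate[of "\<lambda>t::real^'d. ennreal (Tau t)" "- ((\<theta> + 1/2) *\<^sub>R y)"] nn_integral_Tau[where 'a="real^'d"] by simp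
    then show "(\<integral>\<^sup>+t. ?T t y \<partial>lborel) = ennreal (tau ((1/R) *\<^sub>R y))"
      by (simp add: nn_integral_cmult flip: ennreal_mult)
  qed
  also have "\<dots> = ennreal (R ^ CARD('d))"
    using nn_integral_tau_scaled[of R, where 'a="real^'d"] R by simp
  finally show ?thesis .
qed

lemma band_kernel_chirp_kernel:
  fixes R :: real
  assumes R: "1 \<le> R"
  shows "band_kernel (real CARD('d) * R) (chirp_kernel \<theta> R :: real^'d::finite \<Rightarrow> _)"
  unfolding band_kernel_def
proof (intro conjI allI impI)
  show "continuous_on UNIV (\<lambda>z. chirp_kernel \<theta> R (fst z) (snd z :: real^'d))"
    unfolding chirp_kernel_def by (intro continuous_intros) auto
  show "hs_square (chirp_kernel \<theta> R :: real^'d \<Rightarrow> _) < \<infinity>"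
    using hs_square_chirp_kernel[OF R, of \<theta>, where 'd='d] by (rule le_less_trans) simp
  fix t x :: "real^'d" assume "real CARD('d) * R < norm (t - x)"
  then have "real CARD('d) < norm ((1/R) *\<^sub>R (t - x))" using R unfolding norm_scaleR by (simp add: field_simps)
  then have "tau ((1/R) *\<^sub>R (t - x)) = 0" by (intro tau_support) simp
  then show "chirp_kernel \<theta> R t x = 0" by (simp add: chirp_kernel_def)
qed

lemma extends_to_chirp_kernel:
  fixes R :: real
  assumes R: "1 \<le> R"
  shows "extends_to (weyl (sympl_fourier_dist (int_dist (chirp \<theta> R :: 'd::finite phase_space \<Rightarrow> complex)))) (kernel_op (chirp_kernel \<theta> R))"
  unfolding extends_to_def
proof (intro conjI ballI)
  show "L2_bounded_op (kernel_op (chirp_kernel \<theta> R :: real^'d \<Rightarrow> _))"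
    by (rule kernel_op_bounded[OF band_kernel_chirp_kernel[OF R]])
  fix \<psi> \<phi> :: "real^'d \<Rightarrow> complex" assume S: "\<psi> \<in> schwartz" "\<phi> \<in> schwartz"
  have "partial_FT (chirp \<theta> R) (t - x) (- (1/2) *\<^sub>R (t + x)) / of_real ((2 * pi) ^ CARD('d)) = chirp_kernel \<theta> R t x" for t x :: "real^'d"
  proof -
    have "- (1/2) *\<^sub>R (t + x) + \<theta> *\<^sub>R (t - x) = - ((1/2) *\<^sub>R (t + x) - \<theta> *\<^sub>R (t - x))" by simp
    then show ?thesis unfolding partial_FT_chirp chirp_kernel_def by (simp only: Tau_minus of_real_divide)
  qed
  then show "weyl (sympl_fourier_dist (int_dist (chirp \<theta> R))) \<psi> \<phi> = (LINT t|lborel. kernel_op (chirp_kernel \<theta> R) \<psi> t * \<phi> t)"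
    unfolding weyl_int_dist[OF cts_supported_chirp[OF R] S(2,1)] kernel_op_def by simp
qed

text \<open>The supports lie in balls about \<open>0\<close> of radius comparable to \<open>R\<close>, so any estimate uniform in
  the radius applies to all \<open>R \<ge> 1\<close>.\<close>

lemma chirp_admissible:
  fixes R :: real
  assumes R: "1 \<le> R" and P: "\<forall>R\<ge>1. \<forall>z0 :: 'd::finite phase_space. \<forall>u. compactly_supported_dist u \<and> dist_supp u \<subseteq> cball z0 R \<longrightarrow> P u"
  shows "P (int_dist (chirp \<theta> R :: 'd phase_space \<Rightarrow> complex))"
proof -
  have "1 \<le> real CARD('d)" by (simp add: Suc_leI)
  then have "1 * 1 \<le> (2 * real CARD('d)) * R" using R by (intro mult_mono) linarith+
  moreover have "dist_supp (int_dist (chirp \<theta> R :: 'd phase_space \<Rightarrow> complex)) \<subseteq> cball 0 (2 * real CARD('d) * R)"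
    using cts_supported_chirp[OF R, of \<theta>, where 'd='d] by (intro dist_supp_int_dist) (auto simp: cts_supported_def)
  ultimately show ?thesis
    using P[rule_format, of "2 * real CARD('d) * R" "int_dist (chirp \<theta> R)" 0] compactly_supported_int_dist[OF cts_supported_chirp[OF R, of \<theta>, where 'd='d]] by simp
qed

subsection \<open>Comparing powers of the radius\<close>

lemma power_growth_contradiction:
  assumes a: "0 < a" and K: "0 < K1" and le: "\<And>n::nat. 1 \<le> n \<Longrightarrow> K1 * real n powr a \<le> K2"
  shows False
proof -
  have "filterlim (\<lambda>n. K1 * real n powr a) at_top sequentially"
    using a K by real_asymp
  then have "eventually (\<lambda>n. K2 < K1 * real n powr a) sequentially"
    by (simp add: filterlim_at_top_dense)
  then have "eventually (\<lambda>n. False) sequentially"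
    using eventually_ge_at_top[of 1] by eventually_elim (use le in fastforce)
  then show False by simp
qed

text \<open>Carries the assumed estimate over to the reals: a lower bound for its left side and an
  upper bound for its right side are compared through the finite constant.\<close>

lemma ennreal_le_cmultD:
  assumes "C < top" "x \<le> C * y" "ennreal a \<le> x" "y \<le> ennreal b" "0 \<le> b"
  shows "a \<le> enn2real C * b"
proof -
  have "ennreal a \<le> C * ennreal b"
    using assms(2,3) mult_left_mono[OF assms(4), of C] by (meson order_trans zero_le)
  also have "\<dots> = ennreal (enn2real C * b)"
    using assms(1,5) by (simp add: ennreal_mult)
  finally show ?thesis using assms(5) by (subst (asm) ennreal_le_iff) auto
qed

lemma powr_inverse_leD:
  assumes "0 < r" "0 \<le> X" "0 \<le> Y" "0 \<le> c" "X powr (1/r) \<le> c * Y powr (1/r)"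
  shows "X \<le> c powr r * (Y :: real)"
proof -
  have "(X powr (1/r)) powr r \<le> (c * Y powr (1/r)) powr r"
    using assms by (intro powr_mono2) auto
  then show ?thesis using assms by (simp add: powr_mult powr_powr)
qed

subsection \<open>Cubes as test functions\<close>

definition corner :: "real \<Rightarrow> 'a::euclidean_space" where
  "corner c = (\<Sum>b\<in>Basis. c *\<^sub>R b)"

definition cube_ind :: "'a::euclidean_space \<Rightarrow> 'a \<Rightarrow> complex" where
  "cube_ind v = (\<lambda>x. indicator (box v (v + corner 1)) x)"

lemma corner_inner [simp]: "b \<in> Basis \<Longrightarrow> corner c \<bullet> b = c"
  by (simp add: corner_def)

lemma mem_box_corner: "x \<in> box v (v + corner c) \<longleftrightarrow> (\<forall>b\<in>Basis. v \<bullet> b < x \<bullet> b \<and> x \<bullet> b < v \<bullet> b + c)"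
  by (auto simp: mem_box inner_add_left)

lemma emeasure_box_corner:
  fixes v :: "'a::euclidean_space"
  assumes "0 \<le> c" shows "emeasure lborel (box v (v + corner c)) = ennreal (c ^ DIM('a))"
  using assms by (subst emeasure_lborel_box) (auto simp: inner_add_left)

lemma cube_ind_L2: "cube_ind v \<in> L2"
  unfolding cube_ind_def by (rule indicator_L2) (auto simp: emeasure_box_corner)

lemma L2_norm_cube_ind: "L2_norm (cube_ind v) = 1"
proof -
  have "(cmod (cube_ind v x))\<^sup>2 = indicator (box v (v + corner 1)) x" for x
    by (simp add: cube_ind_def indicator_def)
  then show ?thesis
    by (simp add: L2_norm_def measure_def emeasure_box_corner)
qed

text \<open>A nonnegative kernel admits no cancellation: on the box of side L the image of the
  indicator is at least \<kappa>, because the cube has volume 1.\<close>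

lemma kernel_op_cube_ind:
  fixes k :: "'a::euclidean_space \<Rightarrow> 'a \<Rightarrow> complex"
  assumes k: "band_kernel \<rho> k" and nn: "\<And>t x. k t x = complex_of_real (cmod (k t x))"
    and L: "0 \<le> L" and \<kappa>: "0 \<le> \<kappa>"
    and ge: "\<And>t x. t \<in> box a (a + corner L) \<Longrightarrow> x \<in> box v (v + corner 1) \<Longrightarrow> \<kappa> \<le> cmod (k t x)"
  shows "\<kappa>\<^sup>2 * L ^ DIM('a) \<le> (L2_norm (kernel_op k (cube_ind v)))\<^sup>2"
proof -
  let ?B = "box v (v + corner 1)" and ?A = "box a (a + corner L)"
  have pt: "\<kappa>\<^sup>2 * indicator ?A t \<le> (cmod (kernel_op k (cube_ind v) t))\<^sup>2" for t
  proof (cases "t \<in> ?A")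
    case True
    have i: "integrable lborel (\<lambda>x. k t x * cube_ind v x)"
      by (rule L2_mult_integrable[OF band_kernel_L2[OF k] cube_ind_L2])
    have eq: "k t x * cube_ind v x = complex_of_real (cmod (k t x) * indicator ?B x)" for x
      by (subst nn) (simp add: cube_ind_def indicator_def)
    have "\<kappa> = (LINT x|lborel. \<kappa> * indicator ?B x)"
      by (simp add: measure_def emeasure_box_corner)
    also have "\<dots> \<le> (LINT x|lborel. cmod (k t x) * indicator ?B x)"
    proof (rule Bochner_Integration.integral_mono)
      show "integrable lborel (\<lambda>x. \<kappa> * indicator ?B x)"
        by (intro integrable_mult_right integrable_real_indicator) (auto simp: emeasure_box_corner)
      show "integrable lborel (\<lambda>x. cmod (k t x) * indicator ?B x)"
        using i unfolding eq complex_of_real_integrable_eq .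
      show "\<kappa> * indicator ?B x \<le> cmod (k t x) * indicator ?B x" for x
        using ge[OF True, of x] by (auto simp: indicator_def)
    qed
    also have "\<dots> \<le> cmod (kernel_op k (cube_ind v) t)"
      unfolding kernel_op_def eq integral_complex_of_real norm_of_real by (rule abs_ge_self)
    finally show ?thesis using \<kappa> True by (simp add: power_mono)
  qed simp
  have "\<kappa>\<^sup>2 * L ^ DIM('a) = (LINT t|lborel. \<kappa>\<^sup>2 * indicator ?A t)"
    using L by (simp add: measure_def emeasure_box_corner)
  also have "\<dots> \<le> (LINT t|lborel. (cmod (kernel_op k (cube_ind v) t))\<^sup>2)"
  proof (rule Bochner_Integration.integral_mono[OF _ _ pt])
    show "integrable lborel (\<lambda>x. \<kappa>\<^sup>2 * indicator ?A x)"
      using L by (intro integrable_mult_right integrable_real_indicator) (auto simp: emeasure_box_corner)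
    show "integrable lborel (\<lambda>t. (cmod (kernel_op k (cube_ind v) t))\<^sup>2)"
      by (rule L2_square_integrable[OF kernel_op_L2[OF k cube_ind_L2]])
  qed
  finally show ?thesis by (simp add: L2_norm_square)
qed

definition grid_point :: "('a \<Rightarrow> nat) \<Rightarrow> 'a::euclidean_space" where
  "grid_point f = (\<Sum>b\<in>Basis. real (f b) *\<^sub>R b)"

text \<open>Extensional functions on the basis, so that the number of corners is exactly
  \<open>n ^ DIM('a)\<close>.\<close>

definition grid :: "nat \<Rightarrow> ('a::euclidean_space \<Rightarrow> nat) set" where
  "grid n = PiE Basis (\<lambda>_. {..<n})"

lemma grid_point_inner [simp]: "b \<in> Basis \<Longrightarrow> grid_point f \<bullet> b = real (f b)"
  by (simp add: grid_point_def)

lemma grid_card: "finite (grid n :: ('a::euclidean_space \<Rightarrow> nat) set)" "card (grid n :: ('a \<Rightarrow> nat) set) = n ^ DIM('a)"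
  unfolding grid_def by (auto intro: finite_PiE simp: card_PiE)

lemma orthonormal_grid: "orthonormal (grid n) (\<lambda>f. cube_ind (grid_point f :: 'a::euclidean_space))"
  unfolding orthonormal_def
proof (intro conjI ballI)
  show "cube_ind (grid_point f :: 'a) \<in> L2" for f by (rule cube_ind_L2)
  fix f g :: "'a \<Rightarrow> nat" assume fg: "f \<in> grid n" "g \<in> grid n"
  show "L2_inner (cube_ind (grid_point f)) (cube_ind (grid_point g)) = (if f = g then 1 else 0)"
  proof (cases "f = g")
    case True
    then show ?thesis by (simp add: L2_inner_self L2_norm_cube_ind)
  next
    case False
    then obtain b where b: "b \<in> Basis" "f b \<noteq> g b"
      using fg unfolding grid_def by (meson PiE_ext)
    have "cube_ind (grid_point f) x * cnj (cube_ind (grid_point g) x) = 0" for x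
    proof (rule ccontr)
      assume "\<not> ?thesis"
      then have "x \<in> box (grid_point f) (grid_point f + corner 1)" "x \<in> box (grid_point g) (grid_point g + corner 1)"
        by (auto simp: cube_ind_def indicator_def split: if_splits)
      then have "real (f b) < real (g b) + 1" "real (g b) < real (f b) + 1"
        using b(1) unfolding mem_box_corner by (force simp: grid_point_inner)+
      then show False using b(2) by linarith
    qed
    then show ?thesis using False unfolding L2_inner_def by (simp only:) simp
  qed
qed

subsection \<open>The case \<open>\<theta> = 0\<close>\<close>

text \<open>The type argument fixes the space, which the real value alone would leave open.\<close>

definition Tau_mass :: "real \<Rightarrow> 'a::euclidean_space itself \<Rightarrow> real" where
  "Tau_mass r _ = (LINT x|lborel. Tau (x::'a) powr r)"

lemma Tau_mass_pos:
  assumes r: "1 \<le> r" shows "0 < Tau_mass r TYPE('a::euclidean_space)"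
proof -
  let ?B = "box (corner (-1)) (corner (-1) + corner 2) :: 'a set" and ?c = "((1/4) ^ DIM('a)) powr r"
  have "?c * 2 ^ DIM('a) = (LINT x|lborel. ?c * indicator ?B x)"
    by (simp add: measure_def emeasure_box_corner)
  also have "\<dots> \<le> Tau_mass r TYPE('a)"
    unfolding Tau_mass_def
  proof (rule Bochner_Integration.integral_mono[OF _ integrable_Tau_powr[OF r]])
    show "integrable lborel (\<lambda>x. ?c * indicator ?B x)"
      by (intro integrable_mult_right integrable_real_indicator) (auto simp: emeasure_box_corner)
    fix x :: 'a
    show "?c * indicator ?B x \<le> Tau x powr r"
    proof (cases "x \<in> ?B")
      case True
      then have "\<bar>x \<bullet> b\<bar> \<le> 1" if "b \<in> Basis" for b
        using that unfolding mem_box_corner by (force simp: abs_le_iff)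
      then have "(1/4) ^ DIM('a) \<le> Tau x" by (rule Tau_ge)
      then show ?thesis using r True by (simp add: powr_mono2)
    qed simp
  qed
  finally show ?thesis by (rule less_le_trans[rotated]) simp
qed

lemma flat_symbol:
  fixes x \<eta> :: "real^'d::finite"
  assumes R: "1 \<le> R"
  shows "sympl_fourier (chirp 0 R) (x, \<eta>) = complex_of_real (Tau x * (R ^ CARD('d) / (2 * pi) ^ CARD('d)) * Tau (R *\<^sub>R \<eta>))"
proof -
  let ?f = "\<lambda>y::real^'d. complex_of_real (tau y) * exp (- (\<i> * complex_of_real ((R *\<^sub>R \<eta>) \<bullet> y)))"
  have "FT (\<lambda>y. complex_of_real (tau ((1/R) *\<^sub>R y) * Tau (0 *\<^sub>R y - x))) \<eta> = (LINT y|lborel. complex_of_real (Tau x) * ?f (0 + (1/R) *\<^sub>R y))"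
    unfolding FT_def using R by (intro Bochner_Integration.integral_cong refl) (simp add: Tau_minus mult_ac)
  also have "\<dots> = complex_of_real (Tau x) * ((LINT y|lborel. ?f y) /\<^sub>R \<bar>1/R\<bar> ^ CARD('d))"
    unfolding integral_mult_right_zero using integral_affine[of "1/R" ?f 0] R by simp
  also have "(LINT y|lborel. ?f y) = complex_of_real (Tau (R *\<^sub>R \<eta>))"
    using FT_tau[of "R *\<^sub>R \<eta>"] by (simp only: FT_def)
  finally show ?thesis
    unfolding chirp_symbol[OF R] using R by (simp add: power_divide scaleR_conv_of_real)
qed

text \<open>The symbol is a tensor product, so the norm is exact: the amplitude contributes R^(d r)
  to the integral and the contraction in \<eta> contributes R^(-d).\<close>

lemma flat_Lp_norm:
  fixes R r :: real
  assumes R: "1 \<le> R" and r: "1 \<le> r"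
  shows "Lp_norm (ennreal r) (sympl_fourier (chirp 0 R :: 'd::finite phase_space \<Rightarrow> complex)) =
    ennreal (((R ^ CARD('d) / (2 * pi) ^ CARD('d)) powr r / R ^ CARD('d) * (Tau_mass r TYPE(real^'d))\<^sup>2) powr (1/r))"
proof -
  let ?D = "CARD('d)" and ?j = "Tau_mass r TYPE(real^'d)"
  let ?q = "(R ^ ?D / (2 * pi) ^ ?D) powr r"
  have j0: "0 \<le> ?j" using Tau_mass_pos[OF r, where 'a="real^'d"] by simp
  have j: "(\<integral>\<^sup>+x. ennreal (Tau (x :: real^'d) powr r) \<partial>lborel) = ennreal ?j"
    unfolding Tau_mass_def by (rule nn_integral_eq_integral[OF integrable_Tau_powr[OF r] AE_I2]) simp
  have m: "(\<lambda>z. ennreal (cmod (sympl_fourier (chirp 0 R) z) powr r)) \<in> borel_measurable (borel :: 'd phase_space measure)"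
    using smooth_continuous[OF smooth_sympl_fourier[OF cts_supported_chirp[OF R, of 0]], THEN borel_measurable_continuous_onI]
    by measurable
  have pt: "ennreal (cmod (sympl_fourier (chirp 0 R) (x, \<eta>)) powr r) = ennreal (Tau x powr r) * (ennreal ?q * ennreal (Tau (R *\<^sub>R \<eta>) powr r))" for x \<eta> :: "real^'d"
  proof -
    have "cmod (sympl_fourier (chirp 0 R) (x, \<eta>)) = Tau x * (R ^ ?D / (2 * pi) ^ ?D) * Tau (R *\<^sub>R \<eta>)"
      unfolding flat_symbol[OF R] norm_of_real using R Tau_nonneg[of x] Tau_nonneg[of "R *\<^sub>R \<eta>"] by (intro abs_of_nonneg mult_nonneg_nonneg) auto
    moreover have "0 \<le> R ^ ?D / (2 * pi) ^ ?D" using R by simp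
    ultimately have "cmod (sympl_fourier (chirp 0 R) (x, \<eta>)) powr r = Tau x powr r * (?q * Tau (R *\<^sub>R \<eta>) powr r)"
      using Tau_nonneg by (simp only: powr_mult mult_nonneg_nonneg mult.assoc)
    then show ?thesis by (simp only: ennreal_mult powr_ge_zero mult_nonneg_nonneg)
  qed
  have s: "(\<integral>\<^sup>+\<eta>. ennreal (Tau (R *\<^sub>R (\<eta> :: real^'d)) powr r) \<partial>lborel) = ennreal (1 / R ^ ?D * ?j)"
    using nn_integral_affine[of R "\<lambda>\<eta>::real^'d. ennreal (Tau \<eta> powr r)" 0] R j j0 by (simp flip: ennreal_mult)
  have "(\<integral>\<^sup>+z. ennreal (cmod (sympl_fourier (chirp 0 R :: 'd phase_space \<Rightarrow> complex) z) powr r) \<partial>lborel) = ennreal ?j * (ennreal ?q * ennreal (1 / R ^ ?D * ?j))"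
    unfolding nn_integral_lborel_pair[OF m] pt by (simp add: nn_integral_cmult nn_integral_multc s j)
  also have "\<dots> = ennreal (?q / R ^ ?D * ?j\<^sup>2)"
    using j0 R by (simp add: power2_eq_square mult_ac flip: ennreal_mult)
  finally show ?thesis
    using r R by (simp add: Lp_norm_def epowr_ennreal)
qed

text \<open>With \<open>tau\<close> bounded by 1, rows and columns are dominated by
  \<open>Tau\<close> at half scale. The normalisation cancels its mass and leaves the Jacobian 2^d,
  independent of R.\<close>

lemma flat_op_bound:
  fixes R :: real and f :: "real^'d::finite \<Rightarrow> complex"
  assumes R: "1 \<le> R" and f: "f \<in> L2"
  shows "L2_norm (kernel_op (chirp_kernel 0 R) f) \<le> 2 ^ CARD('d) * L2_norm f"
proof (rule schur_test[OF band_kernel_chirp_kernel[OF R] _ _ _ f])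
  let ?c = "1 / (2 * pi) ^ CARD('d)"
  have le: "ennreal (cmod (chirp_kernel 0 R t x)) \<le> ennreal ?c * ennreal (Tau ((1/2) *\<^sub>R t + (1/2) *\<^sub>R x))" for t x :: "real^'d"
  proof -
    have "cmod (chirp_kernel 0 R t x) \<le> 1 * Tau ((1/2) *\<^sub>R t + (1/2) *\<^sub>R x) / (2 * pi) ^ CARD('d)"
      unfolding cmod_chirp_kernel using tau_bounds[of "(1/R) *\<^sub>R (t - x)"] Tau_nonneg
      by (intro divide_right_mono mult_mono) (auto simp: scaleR_add_right)
    then have "cmod (chirp_kernel 0 R t x) \<le> ?c * Tau ((1/2) *\<^sub>R t + (1/2) *\<^sub>R x)" by simp
    then have "ennreal (cmod (chirp_kernel 0 R t x)) \<le> ennreal (?c * Tau ((1/2) *\<^sub>R t + (1/2) *\<^sub>R x))" by (rule ennreal_leI)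
    also have "\<dots> = ennreal ?c * ennreal (Tau ((1/2) *\<^sub>R t + (1/2) *\<^sub>R x))" using Tau_nonneg by (intro ennreal_mult) auto
    finally show ?thesis .
  qed
  have half: "(\<integral>\<^sup>+x. ennreal ?c * ennreal (Tau ((1/2) *\<^sub>R t + (1/2) *\<^sub>R x)) \<partial>lborel) = ennreal (2 ^ CARD('d))" for t :: "real^'d"
    using nn_integral_affine[of "1/2" "\<lambda>x::real^'d. ennreal (Tau x)" "(1/2) *\<^sub>R t"]
    by (simp add: nn_integral_cmult nn_integral_Tau power_divide flip: ennreal_mult)
  show "(\<integral>\<^sup>+x. ennreal (cmod (chirp_kernel 0 R t x)) \<partial>lborel) \<le> ennreal (2 ^ CARD('d))" for t :: "real^'d"
    unfolding half[of t, symmetric] by (intro nn_integral_mono le)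
  show "(\<integral>\<^sup>+t. ennreal (cmod (chirp_kernel 0 R t x)) \<partial>lborel) \<le> ennreal (2 ^ CARD('d))" for x :: "real^'d"
    unfolding half[of x, symmetric] using le by (intro nn_integral_mono) (simp add: add.commute)
qed simp

lemma chirp_kernel_of_real: "chirp_kernel \<theta> R t x = complex_of_real (cmod (chirp_kernel \<theta> R t x))"
  unfolding cmod_chirp_kernel by (rule chirp_kernel_def)

text \<open>The base 1 / (16 pi) is (1/2) (1/4) / (2 pi), made of the lower bounds for one factor of
  \<open>tau\<close> and of \<open>Tau\<close> and the normalisation.\<close>

lemma chirp_kernel_ge:
  fixes t x :: "real^'d::finite"
  assumes "\<And>b. b \<in> Basis \<Longrightarrow> \<bar>((1/R) *\<^sub>R (t - x)) \<bullet> b\<bar> \<le> 1/2"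
    and "\<And>b. b \<in> Basis \<Longrightarrow> \<bar>((1/2) *\<^sub>R (t + x) - \<theta> *\<^sub>R (t - x)) \<bullet> b\<bar> \<le> 1"
  shows "(1 / (16 * pi)) ^ CARD('d) \<le> cmod (chirp_kernel \<theta> R t x)"
proof -
  have "(1/2) ^ CARD('d) \<le> tau ((1/R) *\<^sub>R (t - x))" using tau_ge[OF assms(1)] by simp
  moreover have "(1/4) ^ CARD('d) \<le> Tau ((1/2) *\<^sub>R (t + x) - \<theta> *\<^sub>R (t - x))" using Tau_ge[OF assms(2)] by simp
  ultimately have "(1/2) ^ CARD('d) * (1/4) ^ CARD('d) / (2 * pi) ^ CARD('d) \<le> cmod (chirp_kernel \<theta> R t x)"
    unfolding cmod_chirp_kernel by (intro divide_right_mono mult_mono) (auto simp: tau_bounds)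
  also have "(1/2) ^ CARD('d) * (1/4) ^ CARD('d) / (2 * pi) ^ CARD('d) = (1 / (16 * pi)) ^ CARD('d)"
    unfolding power_mult_distrib[symmetric] power_divide[symmetric] by simp
  finally show ?thesis .
qed

lemma flat_op_cube:
  fixes f :: "real^'d::finite \<Rightarrow> nat"
  assumes f: "f \<in> grid n" and n: "1 \<le> n"
  shows "((1 / (16 * pi)) ^ CARD('d))\<^sup>2 \<le> (L2_norm (kernel_op (chirp_kernel 0 (4 * real n)) (cube_ind (grid_point f :: real^'d))))\<^sup>2"
proof -
  have R: "1 \<le> 4 * real n" using n by linarith
  \<comment> \<open>The kernel concentrates near t = -x, so the cube at a grid point is compared
    with the reflected cube, where the coordinates of t + x are at most 1. With R = 4n the
    distances, at most 2n, stay in the range where \<open>tau\<close> is bounded below.\<close>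
  have "(1 / (16 * pi)) ^ CARD('d) \<le> cmod (chirp_kernel 0 (4 * real n) t x)"
    if t: "t \<in> box (- grid_point f - corner 1) (- grid_point f - corner 1 + corner 1)" and x: "x \<in> box (grid_point f) (grid_point f + corner 1)" for t x :: "real^'d"
  proof (rule chirp_kernel_ge)
    fix b :: "real^'d" assume b: "b \<in> Basis"
    have tb: "- real (f b) - 1 < t \<bullet> b" "t \<bullet> b < - real (f b)"
      using t b unfolding mem_box_corner by (auto simp: inner_diff_left)
    have xb: "real (f b) < x \<bullet> b" "x \<bullet> b < real (f b) + 1"
      using x b unfolding mem_box_corner by auto
    have "f b < n" using f b unfolding grid_def by (auto simp: PiE_def Pi_def)
    then have fn: "real (f b) + 1 \<le> real n" by linarith
    have "\<bar>(t - x) \<bullet> b\<bar> \<le> 2 * real n" using tb xb fn unfolding inner_diff_left by linarith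
    then show "\<bar>((1 / (4 * real n)) *\<^sub>R (t - x)) \<bullet> b\<bar> \<le> 1/2"
      using n unfolding inner_scaleR_left by (simp add: abs_mult divide_simps)
    have "\<bar>(t + x) \<bullet> b\<bar> \<le> 1" using tb xb unfolding inner_add_left by linarith
    then show "\<bar>((1/2) *\<^sub>R (t + x) - 0 *\<^sub>R (t - x)) \<bullet> b\<bar> \<le> 1"
      by (simp add: inner_add_left abs_le_iff field_simps)
  qed
  then show ?thesis
    using kernel_op_cube_ind[OF band_kernel_chirp_kernel[OF R] chirp_kernel_of_real zero_le_one, of "(1 / (16 * pi)) ^ CARD('d)" "- grid_point f - corner 1" "grid_point f :: real^'d" 0] by simp
qed

section \<open>Growth of both sides at \<theta> = 0\<close>

abbreviation chirp_op :: "real \<Rightarrow> real \<Rightarrow> (real^'d::finite \<Rightarrow> complex) \<Rightarrow> (real^'d \<Rightarrow> complex) \<Rightarrow> complex" where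
  "chirp_op \<theta> R \<equiv> weyl (sympl_fourier_dist (int_dist (chirp \<theta> R)))"

text \<open>In r-th powers the symbol side is of order R^(d r - d), while interpolation bounds the
  operator side by a constant times R^d. The quotient grows like R^(d (r - 2)).\<close>

lemma flat_symbol_unbounded:
  assumes C: "C < top" and r: "2 < r"
    and est: "\<And>R. 1 \<le> R \<Longrightarrow> Lp_norm (ennreal r) (sympl_fourier (chirp 0 R :: 'd::finite phase_space \<Rightarrow> complex))
      \<le> C * schatten_norm_ext (ennreal r) (chirp_op 0 R :: (real^'d \<Rightarrow> complex) \<Rightarrow> _)"
  shows False
proof (rule power_growth_contradiction)
  define D where "D = CARD('d)"
  define c where "c = enn2real C"
  define j where "j = Tau_mass r TYPE(real^'d)"
  define M where "M = (2::real) ^ D"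
  have j: "0 < j" unfolding j_def using r by (intro Tau_mass_pos) simp
  have c: "0 \<le> c" by (simp add: c_def)
  show "0 < real D * (r - 2)" using r by (simp add: D_def)
  show "0 < j\<^sup>2 / ((2 * pi) ^ D) powr r" using j by simp
  fix n :: nat assume n: "1 \<le> n"
  define R where "R = real n"
  have R: "1 \<le> R" using n by (simp add: R_def)
  let ?X = "(R ^ D / (2 * pi) ^ D) powr r / R ^ D * j\<^sup>2" and ?Y = "M powr (r - 2) * R ^ D"
  have "?X powr (1/r) \<le> c * ?Y powr (1/r)"
    unfolding c_def
  proof (rule ennreal_le_cmultD[OF C est[OF R]])
    show "ennreal (?X powr (1/r)) \<le> Lp_norm (ennreal r) (sympl_fourier (chirp 0 R :: 'd phase_space \<Rightarrow> complex))"
      using flat_Lp_norm[OF R, of r, where 'd='d] r by (simp add: D_def j_def)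
    show "schatten_norm_ext (ennreal r) (chirp_op 0 R :: (real^'d \<Rightarrow> complex) \<Rightarrow> _) \<le> ennreal (?Y powr (1/r))"
      unfolding M_def D_def using r R flat_op_bound[OF R]
      by (intro order_trans[OF schatten_norm_ext_le[OF extends_to_chirp_kernel[OF R]]]
          schatten_norm_kernel_ge2[OF band_kernel_chirp_kernel[OF R] _ _ hs_square_chirp_kernel[OF R]]) auto
  qed simp
  then have XY: "?X \<le> c powr r * ?Y"
    using r R c by (intro powr_inverse_leD) (auto simp: M_def intro!: mult_nonneg_nonneg)
  have p: "R ^ D = R powr real D" using R by (simp add: powr_realpow)
  have "(R ^ D / (2 * pi) ^ D) powr r = R powr (real D * r) / ((2 * pi) ^ D) powr r"
    using R by (simp only: p powr_powr powr_divide)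
  then have "j\<^sup>2 / ((2 * pi) ^ D) powr r * (R powr (real D * r) / R powr real D / R powr real D) = ?X / R powr real D"
    by (simp add: p mult_ac)
  also have "\<dots> \<le> c powr r * ?Y / R powr real D"
    using XY by (intro divide_right_mono) auto
  also have "\<dots> = c powr r * M powr (r - 2)" using R by (simp add: p)
  also have "R powr (real D * r) / R powr real D / R powr real D = R powr (real D * (r - 2))"
    by (simp add: algebra_simps flip: powr_diff)
  finally show "j\<^sup>2 / ((2 * pi) ^ D) powr r * real n powr (real D * (r - 2)) \<le> c powr r * M powr (r - 2)"
    by (simp add: R_def)
qed

text \<open>The symbol at the origin is of order R^d, against an operator norm of at most
  2^d.\<close>

lemma flat_symbol_unbounded_top:
  assumes C: "C < top"
    and est: "\<And>R. 1 \<le> R \<Longrightarrow> Lp_norm top (sympl_fourier (chirp 0 R :: 'd::finite phase_space \<Rightarrow> complex))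
      \<le> C * schatten_norm_ext top (chirp_op 0 R :: (real^'d \<Rightarrow> complex) \<Rightarrow> _)"
  shows False
proof (rule power_growth_contradiction)
  define D where "D = CARD('d)"
  define c where "c = enn2real C"
  show "0 < real D" by (simp add: D_def)
  show "0 < 1 / (2 * pi) ^ D" by simp
  fix n :: nat assume n: "1 \<le> n"
  define R where "R = real n"
  have R: "1 \<le> R" using n by (simp add: R_def)
  have "R ^ D / (2 * pi) ^ D \<le> c * 2 ^ D"
    unfolding c_def
  proof (rule ennreal_le_cmultD[OF C est[OF R]])
    have "R ^ D / (2 * pi) ^ D = cmod (sympl_fourier (chirp 0 R) ((0, 0) :: 'd phase_space))"
      unfolding flat_symbol[OF R] norm_of_real D_def using R by simp
    also have "ennreal \<dots> \<le> Lp_norm top (sympl_fourier (chirp 0 R :: 'd phase_space \<Rightarrow> complex))"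
      unfolding Lp_norm_def
      using continuous_le_esssup[OF continuous_on_norm[OF smooth_continuous[OF smooth_sympl_fourier[OF cts_supported_chirp[OF R, of 0, where 'd='d]]]], of "(0, 0)"]
      by simp
    finally show "ennreal (R ^ D / (2 * pi) ^ D) \<le> Lp_norm top (sympl_fourier (chirp 0 R :: 'd phase_space \<Rightarrow> complex))" .
    show "schatten_norm_ext top (chirp_op 0 R :: (real^'d \<Rightarrow> complex) \<Rightarrow> _) \<le> ennreal (2 ^ D)"
      unfolding D_def using flat_op_bound[OF R]
      by (intro order_trans[OF schatten_norm_ext_le[OF extends_to_chirp_kernel[OF R]]]
          schatten_norm_top_le[OF band_kernel_chirp_kernel[OF R]]) auto
  qed simp
  then show "1 / (2 * pi) ^ D * real n powr real D \<le> c * 2 ^ D"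
    using n by (simp add: R_def powr_realpow)
qed

text \<open>A number of singular values proportional to R^d stays above a fixed \<delta>. In r-th
  powers this is at least of order R^d, against R^(d r - d) for the symbol, so the quotient grows
  like R^(d (2 - r)).\<close>

lemma flat_operator_unbounded:
  assumes C: "C < top" and r: "1 \<le> r" "r < 2"
    and est: "\<And>R. 1 \<le> R \<Longrightarrow> schatten_norm_ext (ennreal r) (chirp_op 0 R :: (real^'d::finite \<Rightarrow> complex) \<Rightarrow> _)
      \<le> C * Lp_norm (ennreal r) (sympl_fourier (chirp 0 R :: 'd phase_space \<Rightarrow> complex))"
  shows False
proof (rule power_growth_contradiction)
  define D where "D = CARD('d)"
  define c where "c = enn2real C"
  define j where "j = Tau_mass r TYPE(real^'d)"
  define M where "M = (2::real) ^ D"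
  define \<kappa> where "\<kappa> = (1 / (16 * pi)) ^ D"
  define \<delta> where "\<delta> = \<kappa> / 2"
  have c: "0 \<le> c" by (simp add: c_def)
  have \<kappa>: "0 < \<kappa>" by (simp add: \<kappa>_def)
  have M: "0 < M" by (simp add: M_def)
  define K1 where "K1 = \<kappa>\<^sup>2 / (8 * M\<^sup>2) * \<delta> powr r"
  show "0 < real D * (2 - r)" using r by (simp add: D_def)
  show "0 < K1" using \<kappa> M by (simp add: K1_def \<delta>_def)
  fix n :: nat assume n: "1 \<le> n"
  define R where "R = 4 * real n"
  have R: "1 \<le> R" using n by (simp add: R_def)
  define N where "N = real (n ^ D)"
  have N: "1 \<le> N" using n by (simp add: N_def)
  \<comment> \<open>The budget for the energy criterion: 2 M^2 m \<le> \<kappa>^2 N / 4 by this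
    choice, and 2 \<delta>^2 N = \<kappa>^2 N / 2, together less than the energy \<kappa>^2 N of the
    N cubes. Rounding down is harmless, since m + 1 singular vectors result.\<close>
  define m where "m = nat \<lfloor>\<kappa>\<^sup>2 * N / (8 * M\<^sup>2)\<rfloor>"
  have x0: "0 \<le> \<kappa>\<^sup>2 * N / (8 * M\<^sup>2)" using N by simp
  have m: "real m \<le> \<kappa>\<^sup>2 * N / (8 * M\<^sup>2)" "\<kappa>\<^sup>2 * N / (8 * M\<^sup>2) \<le> real (Suc m)"
    unfolding m_def using x0 by linarith+
  let ?X = "real (Suc m) * \<delta> powr r" and ?Y = "(R ^ D / (2 * pi) ^ D) powr r / R ^ D * j\<^sup>2"
  have "?X powr (1/r) \<le> c * ?Y powr (1/r)"
    unfolding c_def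
  proof (rule ennreal_le_cmultD[OF C est[OF R]])
    show "Lp_norm (ennreal r) (sympl_fourier (chirp 0 R :: 'd phase_space \<Rightarrow> complex)) \<le> ennreal (?Y powr (1/r))"
      using flat_Lp_norm[OF R, of r, where 'd='d] r by (simp add: D_def j_def)
    show "ennreal (?X powr (1/r)) \<le> schatten_norm_ext (ennreal r) (chirp_op 0 R :: (real^'d \<Rightarrow> complex) \<Rightarrow> _)"
    proof (rule schatten_norm_ext_ge[OF band_kernel_chirp_kernel[OF R] extends_to_chirp_kernel[OF R] _ _ grid_card(1) orthonormal_grid])
      show "L2_norm (kernel_op (chirp_kernel 0 R) f) \<le> M * L2_norm f" if "f \<in> L2" for f :: "real^'d \<Rightarrow> complex"
        unfolding M_def D_def by (rule flat_op_bound[OF R that])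
      have "M\<^sup>2 * real m \<le> M\<^sup>2 * (\<kappa>\<^sup>2 * N / (8 * M\<^sup>2))" using m(1) by (intro mult_left_mono) auto
      also have "\<dots> = \<kappa>\<^sup>2 * N / 8" using M by simp
      finally have "2 * M\<^sup>2 * real m + 2 * \<delta>\<^sup>2 * N \<le> \<kappa>\<^sup>2 * N / 4 + \<kappa>\<^sup>2 * N / 2"
        by (simp add: \<delta>_def power_divide mult_ac)
      also have "\<dots> < \<kappa>\<^sup>2 * N"
        using mult_pos_pos[of "\<kappa>\<^sup>2" N] \<kappa> N by simp
      also have "\<dots> = (\<Sum>f\<in>(grid n :: (real^'d \<Rightarrow> nat) set). \<kappa>\<^sup>2)"
        by (simp add: N_def grid_card D_def)
      also have "\<dots> \<le> (\<Sum>f\<in>grid n. (L2_norm (kernel_op (chirp_kernel 0 R) (cube_ind (grid_point f :: real^'d))))\<^sup>2)"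
        using flat_op_cube[OF _ n, where 'd='d] unfolding R_def \<kappa>_def D_def by (intro sum_mono) blast
      finally show "2 * M\<^sup>2 * real m + 2 * \<delta>\<^sup>2 * real (card (grid n :: (real^'d \<Rightarrow> nat) set))
        < (\<Sum>f\<in>grid n. (L2_norm (kernel_op (chirp_kernel 0 R) (cube_ind (grid_point f :: real^'d))))\<^sup>2)"
        by (simp add: N_def grid_card D_def)
    qed (use r \<kappa> in \<open>auto simp: \<delta>_def\<close>)
  qed simp
  then have XY: "?X \<le> c powr r * ?Y"
    using r R c by (intro powr_inverse_leD) auto
  have "K1 * N \<le> ?X"
    unfolding K1_def using mult_right_mono[OF m(2), of "\<delta> powr r"] by (simp add: mult_ac)
  with XY have KY: "K1 * N \<le> c powr r * ?Y" by linarith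
  have p: "R ^ D = R powr real D" using R by (simp add: powr_realpow)
  have n0: "0 < real n" using n by simp
  have pN: "N = real n powr real D" using n by (simp add: N_def powr_realpow)
  have Y: "?Y = R powr (real D * r) / R powr real D * (j\<^sup>2 / ((2 * pi) ^ D) powr r)"
    using R by (simp add: p powr_powr powr_divide)
  have Rn: "R powr (real D * r) / R powr real D = 4 powr (real D * (r - 1)) * real n powr (real D * (r - 1))"
  proof -
    have "real D * (r - 1) = real D * r - real D" by (simp add: algebra_simps)
    then show ?thesis by (simp only: R_def powr_mult powr_diff) simp
  qed
  have "K1 * N / real n powr (real D * (r - 1)) \<le> c powr r * ?Y / real n powr (real D * (r - 1))"
    using KY by (intro divide_right_mono) auto
  also have "\<dots> = c powr r * (4 powr (real D * (r - 1)) * (j\<^sup>2 / ((2 * pi) ^ D) powr r))"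
    unfolding Y Rn using n0 by simp
  also have "K1 * N / real n powr (real D * (r - 1)) = K1 * real n powr (real D * (2 - r))"
  proof -
    have "real D * (2 - r) = real D - real D * (r - 1)" by (simp add: algebra_simps)
    then show ?thesis by (simp only: pN powr_diff times_divide_eq_right)
  qed
  finally show "K1 * real n powr (real D * (2 - r)) \<le> c powr r * (4 powr (real D * (r - 1)) * (j\<^sup>2 / ((2 * pi) ^ D) powr r))" .
qed

subsection \<open>The case \<open>\<theta> = 1/2\<close>\<close>

text \<open>Bounding \<open>tau\<close> by 1 removes R from the L1 estimate; the factor 2^d is the
  Jacobian of y / 2.\<close>

lemma
  fixes R :: real and x :: "real^'d::finite"
  assumes R: "1 \<le> R"
  shows steep_integrable: "integrable lborel (\<lambda>y. complex_of_real (tau ((1/R) *\<^sub>R y) * Tau ((1/2) *\<^sub>R y - x)))"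
    and steep_L1: "(LINT y|lborel. cmod (complex_of_real (tau ((1/R) *\<^sub>R y) * Tau ((1/2) *\<^sub>R y - x)))) \<le> 2 ^ CARD('d) * (2 * pi) ^ CARD('d)"
    and steep_square: "integrable lborel (\<lambda>y. (cmod (complex_of_real (tau ((1/R) *\<^sub>R y) * Tau ((1/2) *\<^sub>R y - x))))\<^sup>2)"
proof -
  let ?f = "\<lambda>y. complex_of_real (tau ((1/R) *\<^sub>R y) * Tau ((1/2) *\<^sub>R y - x))"
  have T: "integrable lborel (\<lambda>y. Tau (- x + (1/2) *\<^sub>R y))"
    using integrable_affine[of "1/2" Tau "- x"] integrable_Tau by simp
  have le: "cmod (?f y) \<le> Tau (- x + (1/2) *\<^sub>R y)" for y
    using tau_bounds[of "(1/R) *\<^sub>R y"] Tau_nonneg[of "- x + (1/2) *\<^sub>R y"]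
    by (simp add: norm_mult mult_left_le_one_le del: of_real_mult)
  show i: "integrable lborel ?f"
  proof (rule Bochner_Integration.integrable_bound[OF T])
    show "AE y in lborel. norm (?f y) \<le> norm (Tau (- x + (1/2) *\<^sub>R y))"
      by (intro AE_I2 order_trans[OF le]) simp
  qed measurable
  have le1: "cmod (?f y) \<le> 1" for y using le[of y] Tau_le_1 order_trans by blast
  have "(cmod (?f y))\<^sup>2 \<le> cmod (?f y)" for y
    unfolding power2_eq_square by (rule mult_left_le[OF le1 norm_ge_zero])
  then show "integrable lborel (\<lambda>y. (cmod (?f y))\<^sup>2)"
    by (intro Bochner_Integration.integrable_bound[OF integrable_norm[OF i]]) (auto simp del: of_real_mult)
  have "(LINT y|lborel. cmod (?f y)) \<le> (LINT y|lborel. Tau (- x + (1/2) *\<^sub>R y))"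
    by (intro Bochner_Integration.integral_mono integrable_norm i T le)
  also have "\<dots> = (LINT y|lborel. Tau (y :: real^'d)) /\<^sub>R \<bar>1/2\<bar> ^ CARD('d)"
    using integral_affine[of "1/2" "Tau :: real^'d \<Rightarrow> real" "- x"] by simp
  also have "(LINT y|lborel. Tau (y :: real^'d)) = (2 * pi) ^ CARD('d)"
    using nn_integral_Tau[where 'a="real^'d"] nn_integral_eq_integral[OF integrable_Tau[where 'a="real^'d"] AE_I2[OF Tau_nonneg]]
    by (simp add: integral_nonneg_AE Tau_nonneg)
  finally show "(LINT y|lborel. cmod (?f y)) \<le> 2 ^ CARD('d) * (2 * pi) ^ CARD('d)"
    by (simp add: power_divide power_one_over inverse_eq_divide)
qed

lemma steep_symbol_bound:
  fixes R :: real and z :: "'d::finite phase_space"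
  assumes R: "1 \<le> R"
  shows "cmod (sympl_fourier (chirp (1/2) R) z) \<le> 2 ^ CARD('d)"
proof (cases z)
  case (Pair x \<eta>)
  show ?thesis
    unfolding Pair chirp_symbol[OF R] norm_divide
    using order_trans[OF FT_bound[OF steep_integrable[OF R]] steep_L1[OF R], of x \<eta>]
    by (simp add: divide_le_eq norm_power norm_mult power_mult_distrib)
qed

text \<open>For fixed x the symbol is a Fourier transform in y, so the Plancherel inequality applies
  in \<eta>. Integrating \<open>Tau\<close> over x next cancels the remaining constant and leaves
  the integral of the scaled \<open>tau\<close>, which is R^d.\<close>

lemma steep_symbol_square:
  fixes R :: real
  assumes R: "1 \<le> R"
  shows "(\<integral>\<^sup>+z. ennreal ((cmod (sympl_fourier (chirp (1/2) R) (z :: 'd::finite phase_space)))\<^sup>2) \<partial>lborel) \<le> ennreal (R ^ CARD('d))"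
proof -
  let ?D = "CARD('d)"
  let ?f = "\<lambda>(x::real^'d) y. complex_of_real (tau ((1/R) *\<^sub>R y) * Tau ((1/2) *\<^sub>R y - x))"
  let ?q = "(2 * pi) ^ ?D"
  have q: "0 < ?q" by simp
  have m: "(\<lambda>z. ennreal ((cmod (sympl_fourier (chirp (1/2) R) z))\<^sup>2)) \<in> borel_measurable (borel :: 'd phase_space measure)"
    using smooth_continuous[OF smooth_sympl_fourier[OF cts_supported_chirp[OF R, of "1/2"]], THEN borel_measurable_continuous_onI]
    by measurable
  have sq: "ennreal ((cmod (sympl_fourier (chirp (1/2) R) (x, \<eta>)))\<^sup>2) = ennreal (1 / ?q\<^sup>2) * ennreal ((cmod (FT (?f x) \<eta>))\<^sup>2)" for x \<eta>
  proof -
    have "cmod (sympl_fourier (chirp (1/2) R) (x, \<eta>)) = cmod (FT (?f x) \<eta>) / ?q"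
      unfolding chirp_symbol[OF R] norm_divide by (simp add: norm_power norm_mult power_mult_distrib)
    then show ?thesis by (simp add: power_divide flip: ennreal_mult)
  qed
  have pt: "ennreal ((cmod (?f x y))\<^sup>2) \<le> ennreal (tau ((1/R) *\<^sub>R y)) * ennreal (Tau ((1/2) *\<^sub>R y - x))" for x y
  proof -
    define p where "p = tau ((1/R) *\<^sub>R y) * Tau ((1/2) *\<^sub>R y - x)"
    have p: "0 \<le> p" "p \<le> 1"
      unfolding p_def using tau_bounds[of "(1/R) *\<^sub>R y"] Tau_nonneg Tau_le_1 by (auto intro: mult_le_one mult_nonneg_nonneg)
    then have "p\<^sup>2 \<le> p" by (simp add: power2_eq_square mult_left_le)
    then have "ennreal ((cmod (?f x y))\<^sup>2) \<le> ennreal p"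
      unfolding p_def[symmetric] norm_of_real using p by (intro ennreal_leI) simp
    also have "\<dots> = ennreal (tau ((1/R) *\<^sub>R y)) * ennreal (Tau ((1/2) *\<^sub>R y - x))"
      unfolding p_def by (intro ennreal_mult tau_bounds Tau_nonneg)
    finally show ?thesis .
  qed
  have mF: "(\<lambda>\<eta>. ennreal ((cmod (FT (?f x) \<eta>))\<^sup>2)) \<in> borel_measurable borel" for x
  proof -
    have "FT (?f x) \<in> borel_measurable borel" by (rule measurable_FT) measurable
    then show ?thesis by measurable
  qed
  have inner: "(\<integral>\<^sup>+\<eta>. ennreal ((cmod (sympl_fourier (chirp (1/2) R) (x, \<eta>)))\<^sup>2) \<partial>lborel)
      \<le> ennreal (1 / ?q) * (\<integral>\<^sup>+y. ennreal (tau ((1/R) *\<^sub>R y)) * ennreal (Tau ((1/2) *\<^sub>R y - x)) \<partial>lborel)" for x :: "real^'d"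
  proof -
    have "(\<integral>\<^sup>+\<eta>. ennreal ((cmod (sympl_fourier (chirp (1/2) R) (x, \<eta>)))\<^sup>2) \<partial>lborel) = ennreal (1 / ?q\<^sup>2) * (\<integral>\<^sup>+\<eta>. ennreal ((cmod (FT (?f x) \<eta>))\<^sup>2) \<partial>lborel)"
      unfolding sq using mF by (simp add: nn_integral_cmult)
    also have "\<dots> \<le> ennreal (1 / ?q\<^sup>2) * ennreal (?q * (LINT y|lborel. (cmod (?f x y))\<^sup>2))"
      using FT_L2_bound[OF steep_integrable[OF R] steep_square[OF R], of x] by (intro mult_left_mono) auto
    also have "\<dots> = ennreal (1 / ?q) * ennreal (LINT y|lborel. (cmod (?f x y))\<^sup>2)"
    proof -
      have "0 \<le> (LINT y|lborel. (cmod (?f x y))\<^sup>2)" by (intro integral_nonneg_AE) simp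
      then show ?thesis using q by (simp add: power2_eq_square flip: ennreal_mult)
    qed
    also have "ennreal (LINT y|lborel. (cmod (?f x y))\<^sup>2) = (\<integral>\<^sup>+y. ennreal ((cmod (?f x y))\<^sup>2) \<partial>lborel)"
      by (rule nn_integral_eq_integral[OF steep_square[OF R] AE_I2, symmetric]) simp
    also have "\<dots> \<le> (\<integral>\<^sup>+y. ennreal (tau ((1/R) *\<^sub>R y)) * ennreal (Tau ((1/2) *\<^sub>R y - x)) \<partial>lborel)"
      by (intro nn_integral_mono pt)
    finally show ?thesis by (simp add: mult_left_mono)
  qed
  have "(\<integral>\<^sup>+z. ennreal ((cmod (sympl_fourier (chirp (1/2) R) (z :: 'd phase_space)))\<^sup>2) \<partial>lborel)
      \<le> (\<integral>\<^sup>+x. ennreal (1 / ?q) * (\<integral>\<^sup>+y. ennreal (tau ((1/R) *\<^sub>R y)) * ennreal (Tau ((1/2) *\<^sub>R y - x)) \<partial>lborel) \<partial>(lborel :: (real^'d) measure))"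
    unfolding nn_integral_lborel_pair[OF m] by (intro nn_integral_mono inner)
  also have "\<dots> = ennreal (1 / ?q) * (\<integral>\<^sup>+x. \<integral>\<^sup>+y. ennreal (tau ((1/R) *\<^sub>R y)) * ennreal (Tau ((1/2) *\<^sub>R y - x)) \<partial>lborel \<partial>(lborel :: (real^'d) measure))"
    by (rule nn_integral_cmult) measurable
  also have "(\<integral>\<^sup>+x. \<integral>\<^sup>+y. ennreal (tau ((1/R) *\<^sub>R y)) * ennreal (Tau ((1/2) *\<^sub>R y - x)) \<partial>lborel \<partial>(lborel :: (real^'d) measure))
      = (\<integral>\<^sup>+y. \<integral>\<^sup>+x. ennreal (tau ((1/R) *\<^sub>R y)) * ennreal (Tau ((1/2) *\<^sub>R y - x)) \<partial>lborel \<partial>(lborel :: (real^'d) measure))"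
    by (intro lborel_pair.Fubini') measurable
  also have "\<dots> = (\<integral>\<^sup>+y. ennreal (tau ((1/R) *\<^sub>R y)) * ennreal ?q \<partial>(lborel :: (real^'d) measure))"
  proof (intro nn_integral_cong)
    fix y :: "real^'d"
    have "(\<integral>\<^sup>+x. ennreal (Tau ((1/2) *\<^sub>R y - x)) \<partial>lborel) = ennreal ?q"
      using nn_integral_lborel_reflect[of "\<lambda>x::real^'d. ennreal (Tau x)" "(1/2) *\<^sub>R y"] by (simp add: nn_integral_Tau)
    then show "(\<integral>\<^sup>+x. ennreal (tau ((1/R) *\<^sub>R y)) * ennreal (Tau ((1/2) *\<^sub>R y - x)) \<partial>lborel) = ennreal (tau ((1/R) *\<^sub>R y)) * ennreal ?q"
      by (subst nn_integral_cmult) auto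
  qed
  also have "\<dots> = ennreal (R ^ ?D) * ennreal ?q"
    using nn_integral_tau_scaled[of R, where 'a="real^'d"] R by (subst nn_integral_multc) auto
  also have "ennreal (1 / ?q) * (ennreal (R ^ ?D) * ennreal ?q) = ennreal (R ^ ?D)"
    using R q by (simp flip: ennreal_mult)
  finally show ?thesis .
qed

text \<open>Interpolation between the uniform bound 2^d and the mean-square bound, the counterpart
  for symbols of \<open>schatten_norm_kernel_ge2\<close>.\<close>

lemma steep_Lp_norm:
  fixes R r :: real
  assumes R: "1 \<le> R" and r: "2 \<le> r"
  shows "Lp_norm (ennreal r) (sympl_fourier (chirp (1/2) R :: 'd::finite phase_space \<Rightarrow> complex))
    \<le> ennreal (((2 ^ CARD('d)) powr (r - 2) * R ^ CARD('d)) powr (1/r))"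
proof -
  let ?D = "CARD('d)" and ?F = "sympl_fourier (chirp (1/2) R :: 'd phase_space \<Rightarrow> complex)"
  have m: "?F \<in> borel_measurable borel"
    using smooth_continuous[OF smooth_sympl_fourier[OF cts_supported_chirp[OF R, of "1/2"]], THEN borel_measurable_continuous_onI] .
  have pt: "ennreal (cmod (?F z) powr r) \<le> ennreal ((2 ^ ?D) powr (r - 2)) * ennreal ((cmod (?F z))\<^sup>2)" for z
  proof (cases "?F z = 0")
    case False
    have "cmod (?F z) powr r = cmod (?F z) powr (r - 2) * (cmod (?F z))\<^sup>2"
      using False powr_add[of "cmod (?F z)" "r - 2" 2] by simp
    also have "\<dots> \<le> (2 ^ ?D) powr (r - 2) * (cmod (?F z))\<^sup>2"
      using steep_symbol_bound[OF R, of z] r by (intro mult_right_mono powr_mono2) auto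
    finally show ?thesis by (simp add: ennreal_leI flip: ennreal_mult)
  qed simp
  have "(\<integral>\<^sup>+z. ennreal (cmod (?F z) powr r) \<partial>lborel) \<le> (\<integral>\<^sup>+z. ennreal ((2 ^ ?D) powr (r - 2)) * ennreal ((cmod (?F z))\<^sup>2) \<partial>lborel)"
    by (intro nn_integral_mono pt)
  also have "\<dots> = ennreal ((2 ^ ?D) powr (r - 2)) * (\<integral>\<^sup>+z. ennreal ((cmod (?F z))\<^sup>2) \<partial>lborel)"
    using m by (intro nn_integral_cmult) measurable
  also have "\<dots> \<le> ennreal ((2 ^ ?D) powr (r - 2)) * ennreal (R ^ ?D)"
    by (intro mult_left_mono steep_symbol_square[OF R]) simp
  also have "\<dots> = ennreal ((2 ^ ?D) powr (r - 2) * R ^ ?D)"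
    using R by (simp flip: ennreal_mult)
  finally have "epowr (\<integral>\<^sup>+z. ennreal (cmod (?F z) powr r) \<partial>lborel) (1/r) \<le> epowr (ennreal ((2 ^ ?D) powr (r - 2) * R ^ ?D)) (1/r)"
    using r by (intro epowr_mono) auto
  then show ?thesis
    using r R by (simp add: Lp_norm_def epowr_ennreal)
qed

text \<open>Since the argument of \<open>Tau\<close> is x alone, the unit cube at the origin is
  spread over a box of side R / 2 without loss of height. This single vector already shows an
  operator norm of order R^(d/2).\<close>

lemma steep_op_cube:
  fixes R :: real
  assumes R: "2 \<le> R"
  shows "((1 / (16 * pi)) ^ CARD('d))\<^sup>2 * (R / 2) ^ CARD('d) \<le> (L2_norm (kernel_op (chirp_kernel (1/2) R) (cube_ind (0 :: real^'d::finite))))\<^sup>2"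
proof -
  have R1: "1 \<le> R" using R by simp
  have "(1 / (16 * pi)) ^ CARD('d) \<le> cmod (chirp_kernel (1/2) R t x)"
    if t: "t \<in> box 0 (0 + corner (R/2))" and x: "x \<in> box 0 (0 + corner 1)" for t x :: "real^'d"
  proof (rule chirp_kernel_ge)
    fix b :: "real^'d" assume b: "b \<in> Basis"
    have tx: "0 < t \<bullet> b" "t \<bullet> b < R / 2" "0 < x \<bullet> b" "x \<bullet> b < 1"
      using t x b unfolding mem_box_corner by auto
    have "\<bar>(t - x) \<bullet> b\<bar> \<le> R / 2" using tx R unfolding inner_diff_left by linarith
    then show "\<bar>((1/R) *\<^sub>R (t - x)) \<bullet> b\<bar> \<le> 1/2"
      using R unfolding inner_scaleR_left by (simp add: abs_mult divide_simps)
    have "((1/2) *\<^sub>R (t + x) - (1/2) *\<^sub>R (t - x)) \<bullet> b = x \<bullet> b"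
      by (simp add: inner_add_left inner_diff_left scaleR_add_right scaleR_diff_right)
    then show "\<bar>((1/2) *\<^sub>R (t + x) - (1/2) *\<^sub>R (t - x)) \<bullet> b\<bar> \<le> 1" using tx by linarith
  qed
  then show ?thesis
    using kernel_op_cube_ind[OF band_kernel_chirp_kernel[OF R1] chirp_kernel_of_real, of "R/2" "(1 / (16 * pi)) ^ CARD('d)" 0 "0 :: real^'d" "1/2"] R by simp
qed

text \<open>One singular value of order R^(d/2) is enough, so the energy criterion is used with m =
  0 and a single test vector; whatever operator bound M is chosen then enters multiplied by 0. In
  r-th powers R^(d r / 2) is set against R^d.\<close>

lemma steep_operator_unbounded:
  assumes C: "C < top" and r: "2 < r"
    and est: "\<And>R. 1 \<le> R \<Longrightarrow> schatten_norm_ext (ennreal r) (chirp_op (1/2) R :: (real^'d::finite \<Rightarrow> complex) \<Rightarrow> _)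
      \<le> C * Lp_norm (ennreal r) (sympl_fourier (chirp (1/2) R :: 'd phase_space \<Rightarrow> complex))"
  shows False
proof (rule power_growth_contradiction)
  define D where "D = CARD('d)"
  define c where "c = enn2real C"
  define \<kappa> where "\<kappa> = (1 / (16 * pi)) ^ D"
  have c: "0 \<le> c" by (simp add: c_def)
  have \<kappa>: "0 < \<kappa>" by (simp add: \<kappa>_def)
  show "0 < real D * (r - 2) / 2" using r by (simp add: D_def)
  show "0 < (\<kappa> / 2) powr r" using \<kappa> by simp
  fix n :: nat assume n: "1 \<le> n"
  define R where "R = 2 * real n"
  have R: "1 \<le> R" "2 \<le> R" using n by (auto simp: R_def)
  \<comment> \<open>The factor 1/2 leaves 2 \<delta>^2 = \<kappa>^2 n^D / 2, strictly below the
    energy \<open>\<kappa>\<^sup>2 * (R / 2) ^ D\<close> of the cube.\<close>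
  define \<delta> where "\<delta> = \<kappa> / 2 * real n powr (real D / 2)"
  let ?Y = "(2 ^ D) powr (r - 2) * R ^ D"
  have n0: "0 < real n" using n by simp
  have nD: "(real n powr (real D / 2))\<^sup>2 = real n ^ D"
    using n0 powr_realpow[OF n0, of D] by (simp add: power2_eq_square flip: powr_add)
  have \<delta>2: "2 * \<delta>\<^sup>2 < \<kappa>\<^sup>2 * (R / 2) ^ D"
    unfolding \<delta>_def power_mult_distrib nD R_def using \<kappa> n by (simp add: power_divide)
  obtain M where M: "\<And>f :: real^'d \<Rightarrow> complex. f \<in> L2 \<Longrightarrow> L2_norm (kernel_op (chirp_kernel (1/2) R) f) \<le> M * L2_norm f"
    using bounded_op_bound[OF kernel_op_bounded[OF band_kernel_chirp_kernel[OF R(1)]]] by blast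
  have "(real (Suc 0) * \<delta> powr r) powr (1/r) \<le> c * ?Y powr (1/r)"
    unfolding c_def
  proof (rule ennreal_le_cmultD[OF C est[OF R(1)]])
    show "Lp_norm (ennreal r) (sympl_fourier (chirp (1/2) R :: 'd phase_space \<Rightarrow> complex)) \<le> ennreal (?Y powr (1/r))"
      unfolding D_def using r by (intro steep_Lp_norm R) simp
    show "ennreal ((real (Suc 0) * \<delta> powr r) powr (1/r)) \<le> schatten_norm_ext (ennreal r) (chirp_op (1/2) R :: (real^'d \<Rightarrow> complex) \<Rightarrow> _)"
    proof (rule schatten_norm_ext_ge[OF band_kernel_chirp_kernel[OF R(1)] extends_to_chirp_kernel[OF R(1)] _ M, where J="{()}" and \<phi>="\<lambda>_. cube_ind 0"])
      show "orthonormal {()} (\<lambda>_. cube_ind (0 :: real^'d))"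
        by (simp add: orthonormal_def cube_ind_L2 L2_inner_self L2_norm_cube_ind)
      show "2 * M\<^sup>2 * real 0 + 2 * \<delta>\<^sup>2 * real (card {()}) < (\<Sum>j\<in>{()}. (L2_norm (kernel_op (chirp_kernel (1/2) R) (cube_ind (0 :: real^'d))))\<^sup>2)"
        using less_le_trans[OF \<delta>2 steep_op_cube[OF R(2), where 'd='d, folded D_def, folded \<kappa>_def]] by simp
    qed (use r \<kappa> in \<open>auto simp: \<delta>_def\<close>)
  qed simp
  then have "real (Suc 0) * \<delta> powr r \<le> c powr r * ?Y"
    using r R c by (intro powr_inverse_leD) auto
  moreover have "\<delta> powr r = (\<kappa> / 2) powr r * real n powr (real D / 2 * r)"
    unfolding \<delta>_def using \<kappa> by (simp add: powr_mult[of "\<kappa> / 2"] powr_powr del: times_divide_eq_left times_divide_eq_right)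
  ultimately have le: "(\<kappa> / 2) powr r * real n powr (real D / 2 * r) \<le> c powr r * ?Y" by simp
  have Y: "?Y = (2 ^ D) powr (r - 2) * 2 ^ D * real n powr real D"
    unfolding R_def using n0 by (simp add: power_mult_distrib powr_realpow)
  have "(\<kappa> / 2) powr r * real n powr (real D / 2 * r) / real n powr real D \<le> c powr r * ?Y / real n powr real D"
    using le by (intro divide_right_mono) auto
  also have "\<dots> = c powr r * ((2 ^ D) powr (r - 2) * 2 ^ D)" unfolding Y using n0 by simp
  also have "(\<kappa> / 2) powr r * real n powr (real D / 2 * r) / real n powr real D = (\<kappa> / 2) powr r * real n powr (real D * (r - 2) / 2)"
  proof -
    have "real D * (r - 2) / 2 = real D / 2 * r - real D" by (simp add: field_simps)
    then show ?thesis by (simp only: powr_diff times_divide_eq_right)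
  qed
  finally show "(\<kappa> / 2) powr r * real n powr (real D * (r - 2) / 2) \<le> c powr r * ((2 ^ D) powr (r - 2) * 2 ^ D)" .
qed

lemma steep_operator_unbounded_top:
  assumes C: "C < top"
    and est: "\<And>R. 1 \<le> R \<Longrightarrow> schatten_norm_ext top (chirp_op (1/2) R :: (real^'d::finite \<Rightarrow> complex) \<Rightarrow> _)
      \<le> C * Lp_norm top (sympl_fourier (chirp (1/2) R :: 'd phase_space \<Rightarrow> complex))"
  shows False
proof (rule power_growth_contradiction)
  define D where "D = CARD('d)"
  define c where "c = enn2real C"
  define \<kappa> where "\<kappa> = (1 / (16 * pi)) ^ D"
  show "0 < real D" by (simp add: D_def)
  show "0 < \<kappa>\<^sup>2" by (simp add: \<kappa>_def)
  fix n :: nat assume n: "1 \<le> n"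
  define R where "R = 2 * real n"
  have R: "1 \<le> R" "2 \<le> R" using n by (auto simp: R_def)
  let ?l = "L2_norm (kernel_op (chirp_kernel (1/2) R) (cube_ind (0 :: real^'d)))"
  have "?l \<le> c * 2 ^ D"
    unfolding c_def
  proof (rule ennreal_le_cmultD[OF C est[OF R(1)]])
    have m: "sympl_fourier (chirp (1/2) R :: 'd phase_space \<Rightarrow> complex) \<in> borel_measurable borel"
      using smooth_continuous[OF smooth_sympl_fourier[OF cts_supported_chirp[OF R(1), of "1/2"]], THEN borel_measurable_continuous_onI] .
    then have "(\<lambda>z. ennreal (cmod (sympl_fourier (chirp (1/2) R :: 'd phase_space \<Rightarrow> complex) z))) \<in> borel_measurable lborel" by measurable
    then show "Lp_norm top (sympl_fourier (chirp (1/2) R :: 'd phase_space \<Rightarrow> complex)) \<le> ennreal (2 ^ D)"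
      unfolding Lp_norm_def D_def using steep_symbol_bound[OF R(1)] by (auto intro!: esssup_I AE_I2 ennreal_leI)
    show "ennreal ?l \<le> schatten_norm_ext top (chirp_op (1/2) R :: (real^'d \<Rightarrow> complex) \<Rightarrow> _)"
      by (rule schatten_norm_ext_top_ge[OF band_kernel_chirp_kernel[OF R(1)] extends_to_chirp_kernel[OF R(1)] cube_ind_L2])
         (simp add: L2_norm_cube_ind)
  qed simp
  moreover have "0 \<le> ?l" by (simp add: L2_norm_def)
  ultimately have "?l\<^sup>2 \<le> (c * 2 ^ D)\<^sup>2" by (intro power_mono)
  with steep_op_cube[OF R(2), where 'd='d, folded D_def, folded \<kappa>_def]
  have "\<kappa>\<^sup>2 * (R / 2) ^ D \<le> (c * 2 ^ D)\<^sup>2" by (rule order_trans)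
  then show "\<kappa>\<^sup>2 * real n powr real D \<le> (c * 2 ^ D)\<^sup>2"
    using n by (simp add: R_def powr_realpow)
qed

section \<open>The trace norm at \<theta> = 1/2\<close>

lemma abs_test_functions [simp]: "\<bar>tau x\<bar> = tau x" "\<bar>Tau x\<bar> = Tau x" "\<bar>unit_cube x\<bar> = unit_cube x"
  using tau_bounds(1) Tau_nonneg unit_cube_bounds(1) by (auto intro: abs_of_nonneg)

lemma unit_cube_square: "(unit_cube x)\<^sup>2 = unit_cube x"
proof -
  have "(unit_ind y)\<^sup>2 = unit_ind y" for y by (simp add: unit_ind_def indicator_def)
  then show ?thesis by (simp add: unit_cube_def prod_power_distrib)
qed

lemma unit_cube_minus: "unit_cube (- x) = unit_cube x"
proof -
  have "unit_ind (- y) = unit_ind y" for y by (auto simp: unit_ind_def indicator_def)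
  then show ?thesis by (simp add: unit_cube_def)
qed

lemma nn_integral_unit_cube_scaled:
  fixes s :: "'a::euclidean_space"
  assumes "0 < R" shows "(\<integral>\<^sup>+x. ennreal (unit_cube ((1/R) *\<^sub>R x - s)) \<partial>lborel) = ennreal (R ^ DIM('a))"
  using nn_integral_affine[of "1/R" "\<lambda>x::'a. ennreal (unit_cube x)" "- s"] assms by (simp add: unit_cube_integral power_divide)

lemma unit_cube_scaled_L2:
  fixes s :: "'a::euclidean_space"
  assumes "0 < R" shows "(\<lambda>x. complex_of_real (unit_cube ((1/R) *\<^sub>R x - s))) \<in> L2"
proof (rule L2_I)
  have "integrable lborel (\<lambda>x. unit_cube ((1/R) *\<^sub>R x - s))"
    using nn_integral_unit_cube_scaled[OF assms, of s] unit_cube_bounds by (intro integrableI_nonneg) auto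
  then show "integrable lborel (\<lambda>x. (cmod (complex_of_real (unit_cube ((1/R) *\<^sub>R x - s))))\<^sup>2)"
    by (simp add: unit_cube_square)
qed measurable

lemma Tau_L2: "(\<lambda>x::'a::euclidean_space. complex_of_real (Tau x)) \<in> L2"
proof (rule L2_dominated[OF integrable_Tau])
  show "AE x in lborel. (cmod (complex_of_real (Tau (x :: 'a))))\<^sup>2 \<le> Tau x"
  proof (intro AE_I2)
    show "(cmod (complex_of_real (Tau x)))\<^sup>2 \<le> Tau x" for x :: 'a
      using mult_left_le[OF Tau_le_1[of x] Tau_nonneg[of x]] by (simp add: power2_eq_square)
  qed
qed measurable

lemma ennreal_norm_integral_le:
  fixes f :: "'a \<Rightarrow> complex"
  shows "ennreal (cmod (integral\<^sup>L M f)) \<le> (\<integral>\<^sup>+x. ennreal (cmod (f x)) \<partial>M)"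
  by (cases "integrable M f") (auto simp: integral_norm_bound_ennreal not_integrable_integral_eq)

text \<open>Writing the tent as a convolution of cubes factors the kernel through \<open>L\<^sup>2\<close>; the weight
  \<open>cauchy_weight s\<close> makes both factors Hilbert--Schmidt.\<close>

definition left_factor :: "real \<Rightarrow> 'a::euclidean_space \<Rightarrow> 'a \<Rightarrow> complex" where
  "left_factor R s t = complex_of_real (unit_cube ((1/R) *\<^sub>R t - s) / sqrt (cauchy_weight s))"

definition right_factor :: "real \<Rightarrow> 'a::euclidean_space \<Rightarrow> 'a \<Rightarrow> complex" where
  "right_factor R s x = complex_of_real (sqrt (cauchy_weight s) * (unit_cube ((1/R) *\<^sub>R x - s) * Tau x))"

lemma measurable_factors [measurable]:
  "(\<lambda>(s, t). left_factor R s t) \<in> borel_measurable (borel \<Otimes>\<^sub>M borel)"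
  "(\<lambda>(s, x). right_factor R s x) \<in> borel_measurable (borel \<Otimes>\<^sub>M borel)"
  unfolding left_factor_def right_factor_def by measurable

lemma hs_square_left_factor:
  assumes R: "1 \<le> R"
  shows "hs_square (left_factor R :: 'a::euclidean_space \<Rightarrow> _) \<le> ennreal (R ^ DIM('a) * pi ^ DIM('a))"
proof -
  have pt: "ennreal ((cmod (left_factor R s t))\<^sup>2) = ennreal (1 / cauchy_weight s) * ennreal (unit_cube ((1/R) *\<^sub>R t - s))" for s t :: 'a
    unfolding left_factor_def norm_of_real power2_abs power_divide unit_cube_square
    using unit_cube_bounds by (subst ennreal_mult[symmetric]) simp_all
  have "hs_square (left_factor R :: 'a \<Rightarrow> _) = (\<integral>\<^sup>+s. ennreal (1 / cauchy_weight (s :: 'a)) * ennreal (R ^ DIM('a)) \<partial>lborel)"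
    unfolding hs_square_def pt using nn_integral_unit_cube_scaled[of R, where 'a='a] R by (simp add: nn_integral_cmult)
  also have "\<dots> = ennreal (pi ^ DIM('a)) * ennreal (R ^ DIM('a))"
    using nn_integral_eq_integral[OF integrable_inverse_cauchy_weight[where 'a='a] AE_I2]
    by (simp add: nn_integral_multc integral_inverse_cauchy_weight)
  finally show ?thesis using R by (simp add: mult.commute flip: ennreal_mult)
qed

text \<open>On the support s is within 1/2 of x / R in each coordinate, so its weight is at most 2^d
  times that of x, and one factor \<open>Tau x\<close> absorbs this at the price of 5^d. The other
  factor \<open>Tau x\<close> keeps the integral finite, uniformly in R.\<close>

lemma hs_square_right_factor:
  assumes R: "1 \<le> R"
  shows "hs_square (right_factor R :: 'a::euclidean_space \<Rightarrow> _) \<le> ennreal (10 ^ DIM('a) * (2 * pi) ^ DIM('a))"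
proof -
  let ?T = "\<lambda>s x::'a. ennreal (unit_cube ((1/R) *\<^sub>R x - s)) * (ennreal (10 ^ DIM('a)) * ennreal (Tau x))"
  have pt: "ennreal ((cmod (right_factor R s x))\<^sup>2) \<le> ?T s x" for s x :: 'a
  proof (cases "unit_cube ((1/R) *\<^sub>R x - s) = 0")
    case True
    then show ?thesis by (simp add: right_factor_def)
  next
    case False
    then have "unit_cube (s - (1/R) *\<^sub>R x) \<noteq> 0" using unit_cube_minus[of "(1/R) *\<^sub>R x - s"] by simp
    from cauchy_weight_cube[OF this]
    have "cauchy_weight s \<le> 2 ^ DIM('a) * cauchy_weight ((1/R) *\<^sub>R x)" .
    also have "cauchy_weight ((1/R) *\<^sub>R x) \<le> cauchy_weight x"
      unfolding cauchy_weight_def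
    proof (intro prod_mono conjI)
      fix b :: 'a
      have "\<bar>x \<bullet> b / R\<bar> \<le> \<bar>x \<bullet> b\<bar>" using R mult_right_mono[of 1 R "\<bar>x \<bullet> b\<bar>"] by (simp add: divide_le_eq mult.commute)
      from power_mono[OF this, of 2] have "(x \<bullet> b / R)\<^sup>2 \<le> (x \<bullet> b)\<^sup>2" by (simp only: power2_abs abs_ge_zero)
      then show "1 + (((1/R) *\<^sub>R x) \<bullet> b)\<^sup>2 \<le> 1 + (x \<bullet> b)\<^sup>2" by simp
    qed (auto intro: add_nonneg_nonneg)
    finally have w: "cauchy_weight s \<le> 2 ^ DIM('a) * cauchy_weight x" by simp
    have wT: "cauchy_weight x * Tau x \<le> 5 ^ DIM('a)"
      using Tau_le_weight[of x] by (simp add: le_divide_eq mult.commute)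
    have "cauchy_weight s * (Tau x * Tau x) \<le> (2 ^ DIM('a) * cauchy_weight x) * (Tau x * Tau x)"
      using w Tau_nonneg[of x] by (intro mult_right_mono) auto
    also have "\<dots> = 2 ^ DIM('a) * ((cauchy_weight x * Tau x) * Tau x)" by simp
    also have "\<dots> \<le> 2 ^ DIM('a) * (5 ^ DIM('a) * Tau x)"
      using wT Tau_nonneg[of x] by (intro mult_left_mono mult_right_mono) auto
    also have "\<dots> = 10 ^ DIM('a) * Tau x"
      using power_mult_distrib[of "2::real" 5 "DIM('a)"] by (simp add: mult.assoc[symmetric])
    finally have le: "cauchy_weight s * (Tau x * Tau x) \<le> 10 ^ DIM('a) * Tau x" .
    have "(cmod (right_factor R s x))\<^sup>2 = unit_cube ((1/R) *\<^sub>R x - s) * (cauchy_weight s * (Tau x * Tau x))"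
      unfolding right_factor_def norm_of_real power2_abs power_mult_distrib unit_cube_square
      by (simp add: power2_eq_square)
    also have "\<dots> \<le> unit_cube ((1/R) *\<^sub>R x - s) * (10 ^ DIM('a) * Tau x)"
      by (intro mult_left_mono le unit_cube_bounds)
    finally have "ennreal ((cmod (right_factor R s x))\<^sup>2) \<le> ennreal (unit_cube ((1/R) *\<^sub>R x - s) * (10 ^ DIM('a) * Tau x))" by (rule ennreal_leI)
    also have "\<dots> = ?T s x" by (simp only: ennreal_mult mult_nonneg_nonneg zero_le_power zero_le_numeral unit_cube_bounds(1) Tau_nonneg)
    finally show ?thesis .
  qed
  have "hs_square (right_factor R :: 'a \<Rightarrow> _) \<le> (\<integral>\<^sup>+s. \<integral>\<^sup>+x. ?T s x \<partial>lborel \<partial>lborel)"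
    unfolding hs_square_def by (intro nn_integral_mono pt)
  also have "\<dots> = (\<integral>\<^sup>+x. \<integral>\<^sup>+s. ?T s x \<partial>lborel \<partial>lborel)"
    by (intro lborel_pair.Fubini') measurable
  also have "\<dots> = (\<integral>\<^sup>+x. ennreal (10 ^ DIM('a)) * ennreal (Tau (x :: 'a)) \<partial>lborel)"
  proof (intro nn_integral_cong)
    fix x :: 'a
    have "(\<integral>\<^sup>+s. ennreal (unit_cube ((1/R) *\<^sub>R x - s)) \<partial>lborel) = 1"
      using nn_integral_lborel_reflect[of "\<lambda>s::'a. ennreal (unit_cube s)" "(1/R) *\<^sub>R x"] by (simp add: unit_cube_integral)
    then show "(\<integral>\<^sup>+s. ?T s x \<partial>lborel) = ennreal (10 ^ DIM('a)) * ennreal (Tau x)"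
      by (subst nn_integral_multc) auto
  qed
  also have "\<dots> = ennreal (10 ^ DIM('a)) * ennreal ((2 * pi) ^ DIM('a))"
    by (subst nn_integral_cmult) (auto simp: nn_integral_Tau)
  finally show ?thesis by (simp add: ennreal_mult)
qed

text \<open>The tent is an integral over s of cubes around t / R and x / R, after which the
  integrals in t and x separate and the two square roots of weights cancel. Integrability of the
  triple integral comes from its s-integral in absolute value, which is again the kernel
  pairing.\<close>

lemma steep_inner:
  fixes e f :: "real^'d::finite \<Rightarrow> complex"
  assumes R: "1 \<le> R" and e: "e \<in> L2" and f: "f \<in> L2"
  shows "L2_inner (kernel_op (chirp_kernel (1/2) R) e) f =
    (LINT s|lborel. kernel_op (left_factor R) (\<lambda>t. cnj (f t)) s * kernel_op (right_factor R) e s) / of_real ((2 * pi) ^ CARD('d))"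
proof -
  let ?c = "complex_of_real ((2 * pi) ^ CARD('d))"
  let ?q = "\<lambda>(s::real^'d) x. complex_of_real (unit_cube ((1/R) *\<^sub>R x - s))"
  let ?T = "\<lambda>x. complex_of_real (Tau (x :: real^'d))"
  let ?G = "\<lambda>t x. cnj (f t) * (?T x * e x)"
  let ?F = "\<lambda>(z, s). (?q s (fst z) * ?q s (snd z)) * ?G (fst z) (snd z)"
  have R0: "0 < R" using R by simp
  have [measurable]: "e \<in> borel_measurable borel" "f \<in> borel_measurable borel" using e f L2_measurable by auto
  have ker: "chirp_kernel (1/2) R t x * ?c = complex_of_real (tau ((1/R) *\<^sub>R (t - x))) * ?T x" for t x :: "real^'d"
  proof -
    have "(1/2) *\<^sub>R (t + x) - (1/2) *\<^sub>R (t - x) = x" by (simp add: vec_eq_iff field_simps)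
    then show ?thesis by (simp add: chirp_kernel_def)
  qed
  have conv: "(LINT s|lborel. ?F ((t, x), s)) = complex_of_real (tau ((1/R) *\<^sub>R (t - x))) * ?G t x"
    "integrable lborel (\<lambda>s. ?F ((t, x), s))"
    "(LINT s|lborel. norm (?F ((t, x), s))) = cmod (complex_of_real (tau ((1/R) *\<^sub>R (t - x))) * ?G t x)" for t x
  proof -
    let ?u = "\<lambda>s. unit_cube ((1/R) *\<^sub>R t - s) * unit_cube ((1/R) *\<^sub>R x - s)"
    have F: "?F ((t, x), s) = complex_of_real (?u s) * ?G t x" for s by simp
    have u: "integrable lborel ?u" "(LINT s|lborel. ?u s) = tau ((1/R) *\<^sub>R (t - x))"
      using unit_cube_convolution[of "(1/R) *\<^sub>R t" "(1/R) *\<^sub>R x"] by (simp_all add: scaleR_diff_right)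
    show "(LINT s|lborel. ?F ((t, x), s)) = complex_of_real (tau ((1/R) *\<^sub>R (t - x))) * ?G t x"
      unfolding F integral_mult_left_zero integral_complex_of_real u(2) ..
    show "integrable lborel (\<lambda>s. ?F ((t, x), s))"
      unfolding F by (intro integrable_mult_left integrable_of_real u(1))
    have "norm (?F ((t, x), s)) = ?u s * cmod (?G t x)" for s
      unfolding F norm_mult norm_of_real using unit_cube_bounds by (simp add: abs_mult)
    then show "(LINT s|lborel. norm (?F ((t, x), s))) = cmod (complex_of_real (tau ((1/R) *\<^sub>R (t - x))) * ?G t x)"
      by (simp only: integral_mult_left_zero u(2) norm_mult[of "complex_of_real _"] norm_of_real abs_of_nonneg[OF tau_bounds(1)])
  qed
  have pairint: "integrable lborel (\<lambda>z::(real^'d) \<times> (real^'d). complex_of_real (tau ((1/R) *\<^sub>R (fst z - snd z))) * ?G (fst z) (snd z))"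
  proof -
    have "integrable lborel (\<lambda>z. (chirp_kernel (1/2) R (fst z) (snd z) * (cnj (f (fst z)) * cnj (cnj (e (snd z))))) * ?c)"
      by (intro integrable_mult_left L2_mult_integrable band_kernel_pair_L2[OF band_kernel_chirp_kernel[OF R]] pair_L2 L2_cnj e f)
    moreover have "(chirp_kernel (1/2) R t x * (cnj (f t) * cnj (cnj (e x)))) * ?c = complex_of_real (tau ((1/R) *\<^sub>R (t - x))) * ?G t x" for t x
    proof -
      have "(chirp_kernel (1/2) R t x * (cnj (f t) * cnj (cnj (e x)))) * ?c = (chirp_kernel (1/2) R t x * ?c) * (cnj (f t) * e x)" by (simp only: mult_ac complex_cnj_cnj)
      then show ?thesis unfolding ker by (simp only: mult_ac)
    qed
    ultimately show ?thesis by (simp only:)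
  qed
  have Fm: "?F \<in> borel_measurable (lborel \<Otimes>\<^sub>M lborel)"
    by measurable
  have Fint: "integrable (lborel \<Otimes>\<^sub>M lborel) ?F"
  proof (rule lborel_pair.Fubini_integrable[OF Fm])
    show "AE z in lborel. integrable lborel (\<lambda>s. ?F (z, s))"
    proof (intro AE_I2)
      show "integrable lborel (\<lambda>s. ?F (z, s))" for z using conv(2)[of "fst z" "snd z"] by simp
    qed
    have "(LINT s|lborel. norm (?F (z, s))) = norm (complex_of_real (tau ((1/R) *\<^sub>R (fst z - snd z))) * ?G (fst z) (snd z))" for z
      using conv(3)[of "fst z" "snd z"] by simp
    then show "integrable lborel (\<lambda>z. LINT s|lborel. norm (?F (z, s)))"
      by (simp only:) (rule integrable_norm[OF pairint])
  qed
  have "L2_inner (kernel_op (chirp_kernel (1/2) R) e) f * ?c = (LINT t|lborel. LINT x|lborel. complex_of_real (tau ((1/R) *\<^sub>R (t - x))) * ?G t x)"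
  proof -
    have "kernel_op (chirp_kernel (1/2) R) e t * cnj (f t) * ?c = (LINT x|lborel. complex_of_real (tau ((1/R) *\<^sub>R (t - x))) * ?G t x)" for t
    proof -
      have "complex_of_real (tau ((1/R) *\<^sub>R (t - x))) * ?G t x = (chirp_kernel (1/2) R t x * e x) * (cnj (f t) * ?c)" for x
      proof -
        have "(chirp_kernel (1/2) R t x * e x) * (cnj (f t) * ?c) = (chirp_kernel (1/2) R t x * ?c) * (cnj (f t) * e x)" by (simp only: mult_ac)
        then show ?thesis unfolding ker by (simp only: mult_ac)
      qed
      then show ?thesis unfolding kernel_op_def by (simp only: mult.assoc[of "LINT x|lborel. _ x"] integral_mult_left_zero)
    qed
    then show ?thesis unfolding L2_inner_def by (simp only: integral_mult_left_zero[symmetric])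
  qed
  also have "\<dots> = (LINT z|lborel. complex_of_real (tau ((1/R) *\<^sub>R (fst z - snd z))) * ?G (fst z) (snd z))"
    using lborel_pair.integral_fst[of "\<lambda>t x. complex_of_real (tau ((1/R) *\<^sub>R (t - x))) * ?G t x"] pairint by (simp add: lborel_prod split_beta')
  also have "\<dots> = (LINT z|lborel. LINT s|lborel. ?F (z, s))"
  proof (intro Bochner_Integration.integral_cong refl)
    show "complex_of_real (tau ((1/R) *\<^sub>R (fst z - snd z))) * ?G (fst z) (snd z) = (LINT s|lborel. ?F (z, s))" for z
      using conv(1)[of "fst z" "snd z"] by (simp only: prod.collapse)
  qed
  also have "\<dots> = (LINT s|lborel. LINT z|lborel. ?F (z, s))"
    using lborel_pair.Fubini_integral[of "\<lambda>z s. ?F (z, s)"] Fint by simp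
  also have "\<dots> = (LINT s|lborel. kernel_op (left_factor R) (\<lambda>t. cnj (f t)) s * kernel_op (right_factor R) e s)"
  proof (intro Bochner_Integration.integral_cong refl)
    fix s :: "real^'d"
    have ia: "integrable lborel (\<lambda>t. ?q s t * cnj (f t))"
      by (intro L2_mult_integrable unit_cube_scaled_L2 R0 L2_cnj f)
    have ib: "integrable lborel (\<lambda>x. ?q s x * (?T x * e x))"
    proof (rule Bochner_Integration.integrable_bound[OF L2_mult_integrable[OF Tau_L2 e]])
      show "AE x in lborel. norm (?q s x * (?T x * e x)) \<le> norm (?T x * e x)"
        using unit_cube_bounds Tau_nonneg by (intro AE_I2) (auto simp: norm_mult intro!: mult_left_le_one_le mult_nonneg_nonneg)
    qed measurable
    have "(LINT z|lborel. ?F (z, s)) = (LINT z|lborel. (\<lambda>(t, x). (?q s t * cnj (f t)) * (?q s x * (?T x * e x))) z)"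
      by (intro Bochner_Integration.integral_cong refl) (simp add: split_beta' mult_ac)
    also have "\<dots> = (LINT t|lborel. LINT x|lborel. (?q s t * cnj (f t)) * (?q s x * (?T x * e x)))"
      using lborel_pair.integral_fst[OF integrable_mult_pair[OF ia ib]] by (simp add: lborel_prod)
    also have "\<dots> = (LINT t|lborel. ?q s t * cnj (f t)) * (LINT x|lborel. ?q s x * (?T x * e x))"
      by simp
    also have "(LINT t|lborel. ?q s t * cnj (f t)) = kernel_op (left_factor R) (\<lambda>t. cnj (f t)) s * complex_of_real (sqrt (cauchy_weight s))"
      unfolding kernel_op_def left_factor_def integral_mult_left_zero[symmetric] by simp
    also have "(LINT x|lborel. ?q s x * (?T x * e x)) = kernel_op (right_factor R) e s / complex_of_real (sqrt (cauchy_weight s))"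
      unfolding kernel_op_def right_factor_def by (simp add: mult_ac flip: integral_divide_zero)
    finally show "(LINT z|lborel. ?F (z, s)) = kernel_op (left_factor R) (\<lambda>t. cnj (f t)) s * kernel_op (right_factor R) e s"
      by simp
  qed
  finally show ?thesis by (simp add: eq_divide_eq)
qed

text \<open>Trace duality for the factorisation: by Bessel the sum of the pairings is controlled by
  the Hilbert--Schmidt norms of the two factors, of orders R^(d/2) and 1.\<close>

lemma steep_schatten:
  fixes R r :: real
  assumes R: "1 \<le> R" and r: "1 \<le> r"
  shows "schatten_norm (ennreal r) (kernel_op (chirp_kernel (1/2) R :: real^'d::finite \<Rightarrow> _)) \<le> ennreal (20 ^ CARD('d) * R powr (real CARD('d) / 2))"
proof (rule schatten_norm_kernel_trace[OF band_kernel_chirp_kernel[OF R] _ r])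
  define D where "D = CARD('d)"
  \<comment> \<open>The parameter in ab \<le> a^2 / (2 lam) + lam b^2 / 2 that balances the squared
    Hilbert--Schmidt norms, of orders R^d and 1.\<close>
  define lam where "lam = R powr (real D / 2)"
  have l: "1 \<le> lam" "lam * lam = R ^ D"
    unfolding lam_def using R powr_realpow[of R D] by (auto intro!: ge_one_powr_ge_zero simp flip: powr_add)
  let ?c = "(2 * pi) ^ D"
  have c: "0 < ?c" by simp
  fix I :: "(real \<times> nat) set" and e f :: "real \<times> nat \<Rightarrow> real^'d \<Rightarrow> complex"
  assume I: "finite I" and e: "orthonormal I e" and f: "orthonormal I f"
  let ?a = "\<lambda>i s. cmod (kernel_op (left_factor R) (\<lambda>t. cnj (f i t)) s)" and ?b = "\<lambda>i s. cmod (kernel_op (right_factor R) (e i) s)"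
  have eL: "e i \<in> L2" "f i \<in> L2" if "i \<in> I" for i using e f that by (auto simp: orthonormal_def)
  have f': "orthonormal I (\<lambda>i t. cnj (f i t))"
  proof -
    have "L2_inner (\<lambda>t. cnj (g t)) (\<lambda>t. cnj (h t)) = cnj (L2_inner g h)" for g h :: "real^'d \<Rightarrow> complex"
      unfolding L2_inner_def Bochner_Integration.integral_cnj[symmetric] by simp
    then show ?thesis using f by (auto simp: orthonormal_def L2_cnj)
  qed
  have ma: "kernel_op (left_factor R) (\<lambda>t. cnj (f i t)) \<in> borel_measurable borel" "kernel_op (right_factor R) (e i) \<in> borel_measurable borel" if "i \<in> I" for i
    using L2_measurable[OF L2_cnj[OF eL(2)[OF that]]] L2_measurable[OF eL(1)[OF that]] by (auto intro!: kernel_op_measurable measurable_factors)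
  have one: "ennreal (?c * cmod (L2_inner (kernel_op (chirp_kernel (1/2) R) (e i)) (f i))) \<le>
      ennreal (1 / (2 * lam)) * (\<integral>\<^sup>+s. ennreal ((?a i s)\<^sup>2) \<partial>lborel) + ennreal (lam / 2) * (\<integral>\<^sup>+s. ennreal ((?b i s)\<^sup>2) \<partial>lborel)" if i: "i \<in> I" for i
  proof -
    have "?c * cmod (L2_inner (kernel_op (chirp_kernel (1/2) R) (e i)) (f i)) =
        cmod (LINT s|lborel. kernel_op (left_factor R) (\<lambda>t. cnj (f i t)) s * kernel_op (right_factor R) (e i) s)"
      unfolding steep_inner[OF R eL[OF i]] norm_divide norm_of_real D_def[symmetric] using c by simp
    also have "ennreal \<dots> \<le> (\<integral>\<^sup>+s. ennreal (cmod (kernel_op (left_factor R) (\<lambda>t. cnj (f i t)) s * kernel_op (right_factor R) (e i) s)) \<partial>lborel)"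
      by (rule ennreal_norm_integral_le)
    also have "\<dots> \<le> (\<integral>\<^sup>+s. ennreal (1 / (2 * lam)) * ennreal ((?a i s)\<^sup>2) + ennreal (lam / 2) * ennreal ((?b i s)\<^sup>2) \<partial>lborel)"
    proof (intro nn_integral_mono)
      fix s
      have "0 \<le> (?a i s - lam * ?b i s)\<^sup>2 / (2 * lam)" using l by simp
      also have "\<dots> = 1 / (2 * lam) * (?a i s)\<^sup>2 + lam / 2 * (?b i s)\<^sup>2 - ?a i s * ?b i s"
        using l by (simp add: field_simps power2_eq_square)
      finally show "ennreal (cmod (kernel_op (left_factor R) (\<lambda>t. cnj (f i t)) s * kernel_op (right_factor R) (e i) s))
          \<le> ennreal (1 / (2 * lam)) * ennreal ((?a i s)\<^sup>2) + ennreal (lam / 2) * ennreal ((?b i s)\<^sup>2)"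
        unfolding norm_mult using l by (simp add: ennreal_leI flip: ennreal_mult ennreal_plus)
    qed
    also have "\<dots> = ennreal (1 / (2 * lam)) * (\<integral>\<^sup>+s. ennreal ((?a i s)\<^sup>2) \<partial>lborel) + ennreal (lam / 2) * (\<integral>\<^sup>+s. ennreal ((?b i s)\<^sup>2) \<partial>lborel)"
      using ma[OF i] by (simp add: nn_integral_add nn_integral_cmult)
    finally show ?thesis .
  qed
  have "ennreal (?c * (\<Sum>i\<in>I. cmod (L2_inner (kernel_op (chirp_kernel (1/2) R) (e i)) (f i)))) =
      (\<Sum>i\<in>I. ennreal (?c * cmod (L2_inner (kernel_op (chirp_kernel (1/2) R) (e i)) (f i))))"
    unfolding sum_distrib_left by (rule sum_ennreal[symmetric]) simp
  also have "\<dots> \<le> (\<Sum>i\<in>I. ennreal (1 / (2 * lam)) * (\<integral>\<^sup>+s. ennreal ((?a i s)\<^sup>2) \<partial>lborel) + ennreal (lam / 2) * (\<integral>\<^sup>+s. ennreal ((?b i s)\<^sup>2) \<partial>lborel))"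
    by (intro sum_mono one)
  also have "\<dots> = ennreal (1 / (2 * lam)) * (\<Sum>i\<in>I. \<integral>\<^sup>+s. ennreal ((?a i s)\<^sup>2) \<partial>lborel) + ennreal (lam / 2) * (\<Sum>i\<in>I. \<integral>\<^sup>+s. ennreal ((?b i s)\<^sup>2) \<partial>lborel)"
    by (simp add: sum.distrib sum_distrib_left)
  also have "\<dots> \<le> ennreal (1 / (2 * lam)) * ennreal (R ^ D * pi ^ D) + ennreal (lam / 2) * ennreal (10 ^ D * ?c)"
    using order_trans[OF hilbert_schmidt_bessel[OF measurable_factors(1) I f'] hs_square_left_factor[OF R]]
      order_trans[OF hilbert_schmidt_bessel[OF measurable_factors(2) I e] hs_square_right_factor[OF R]]
    by (intro add_mono mult_left_mono) (auto simp: D_def)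
  also have "\<dots> = ennreal (lam / 2 * (pi ^ D + 10 ^ D * ?c))"
  proof -
    have "1 / (2 * lam) * (R ^ D * pi ^ D) = lam / 2 * pi ^ D" using l(1) unfolding l(2)[symmetric] by simp
    then show ?thesis using l R by (simp add: distrib_left flip: ennreal_mult ennreal_plus)
  qed
  also have "\<dots> \<le> ennreal (?c * (20 ^ D * lam))"
  proof (rule ennreal_leI)
    have "pi ^ D \<le> ?c" by (intro power_mono) auto
    moreover have "(1::real) \<le> 10 ^ D" by simp
    ultimately have "1 * pi ^ D \<le> 10 ^ D * ?c" by (intro mult_mono) auto
    then have "pi ^ D \<le> 10 ^ D * ?c" by (simp only: mult_1)
    then have "pi ^ D + 10 ^ D * ?c \<le> 2 * (10 ^ D * ?c)" by linarith
    also have "\<dots> \<le> 2 * (20 ^ D * ?c)" by (intro mult_left_mono mult_right_mono power_mono) auto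
    finally have "lam / 2 * (pi ^ D + 10 ^ D * ?c) \<le> lam / 2 * (2 * (20 ^ D * ?c))" using l by (intro mult_left_mono) auto
    then show "lam / 2 * (pi ^ D + 10 ^ D * ?c) \<le> ?c * (20 ^ D * lam)" by (simp add: mult_ac)
  qed
  finally have "?c * (\<Sum>i\<in>I. cmod (L2_inner (kernel_op (chirp_kernel (1/2) R) (e i)) (f i))) \<le> ?c * (20 ^ D * lam)"
    using l by (subst (asm) ennreal_le_iff) auto
  then show "(\<Sum>i\<in>I. cmod (L2_inner (kernel_op (chirp_kernel (1/2) R) (e i)) (f i))) \<le> 20 ^ CARD('d) * R powr (real CARD('d) / 2)"
    using c unfolding D_def[symmetric] lam_def[symmetric] by (subst (asm) mult_le_cancel_left_pos)
qed simp

section \<open>Lower bound for the symbol at \<theta> = 1/2 when p < 2\<close>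

lemma epowr_le_ennrealD:
  assumes "epowr x (1/r) \<le> ennreal B" "0 \<le> B" "0 < r"
  shows "x \<le> ennreal (B powr r)"
proof (cases x)
  case (real y)
  then have "y powr (1/r) \<le> B" using assms by (simp add: epowr_ennreal ennreal_le_iff)
  then have "(y powr (1/r)) powr r \<le> B powr r" using assms by (intro powr_mono2) auto
  then show ?thesis using real assms by (simp add: powr_powr ennreal_leI)
qed (use assms in \<open>simp add: epowr_def top_unique\<close>)

text \<open>Recentring y at 2 R x freezes the slowly varying \<open>tau\<close> at 2 x, and what
  remains is the inverse transform of \<open>Tau\<close> at half scale. The limit in the scaled
  variable exhibits a symbol of bounded height over a range of size R in x.\<close>

lemma steep_symbol_limit:
  fixes x \<eta> :: "real^'d::finite"
  shows "(\<lambda>n. cmod (sympl_fourier (chirp (1/2) (real (Suc n))) (real (Suc n) *\<^sub>R x, \<eta>))) \<longlonglongrightarrow> 2 ^ CARD('d) * (tau (2 *\<^sub>R x) * tau (2 *\<^sub>R \<eta>))"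
proof -
  let ?q = "(2 * pi) ^ CARD('d)"
  let ?e = "\<lambda>v. exp (- (\<i> * complex_of_real (\<eta> \<bullet> v)))"
  let ?T = "\<lambda>v. Tau ((1/2) *\<^sub>R v :: real^'d)"
  define g where "g n v = complex_of_real (tau (2 *\<^sub>R x + (1 / real (Suc n)) *\<^sub>R v) * ?T v) * ?e v" for n and v :: "real^'d"
  have mod: "cmod (sympl_fourier (chirp (1/2) (real (Suc n))) (real (Suc n) *\<^sub>R x, \<eta>)) = cmod (LINT v|lborel. g n v) / ?q" for n
  proof -
    define R where "R = real (Suc n)"
    have R: "1 \<le> R" by (simp add: R_def)
    let ?f = "\<lambda>y. complex_of_real (tau ((1/R) *\<^sub>R y) * Tau ((1/2) *\<^sub>R y - R *\<^sub>R x)) * ?e y"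
    have "?f (v + (2 * R) *\<^sub>R x) = ?e ((2 * R) *\<^sub>R x) * g n v" for v
    proof -
      have "(1/R) *\<^sub>R (v + (2 * R) *\<^sub>R x) = 2 *\<^sub>R x + (1/R) *\<^sub>R v" using R by (simp add: scaleR_add_right)
      moreover have "(1/2) *\<^sub>R (v + (2 * R) *\<^sub>R x) - R *\<^sub>R x = (1/2) *\<^sub>R v" by (simp add: scaleR_add_right)
      moreover have "?e (v + (2 * R) *\<^sub>R x) = ?e ((2 * R) *\<^sub>R x) * ?e v" unfolding exp_add[symmetric] by (simp add: inner_add_right distrib_left add.commute del: add_uminus_conv_diff)
      ultimately show ?thesis unfolding g_def R_def[symmetric] by (simp only: mult_ac)
    qed
    then have "FT (\<lambda>y. complex_of_real (tau ((1/R) *\<^sub>R y) * Tau ((1/2) *\<^sub>R y - R *\<^sub>R x))) \<eta> = ?e ((2 * R) *\<^sub>R x) * (LINT v|lborel. g n v)"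
      using integral_lborel_translate[of ?f "(2 * R) *\<^sub>R x"] unfolding FT_def by (simp only: integral_mult_right_zero)
    then show ?thesis
      unfolding R_def[symmetric] chirp_symbol[OF R] by (simp add: norm_divide norm_mult norm_power power_mult_distrib)
  qed
  have T: "integrable lborel (\<lambda>v. ?T v)"
    using integrable_affine[of "1/2" "Tau :: real^'d \<Rightarrow> real" 0] integrable_Tau by simp
  have "(\<lambda>n. LINT v|lborel. g n v) \<longlonglongrightarrow> (LINT v|lborel. complex_of_real (tau (2 *\<^sub>R x) * ?T v) * ?e v)"
  proof (rule integral_dominated_convergence[OF _ _ T])
    show "AE v in lborel. (\<lambda>n. g n v) \<longlonglongrightarrow> complex_of_real (tau (2 *\<^sub>R x) * ?T v) * ?e v"
    proof (intro AE_I2)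
      fix v :: "real^'d"
      have c: "isCont (tau :: real^'d \<Rightarrow> real) (2 *\<^sub>R x)"
        using continuous_on_tau[OF continuous_on_id, of "UNIV :: (real^'d) set"] by (simp add: continuous_on_eq_continuous_at)
      have "(\<lambda>n. 2 *\<^sub>R x + (1 / real (Suc n)) *\<^sub>R v) \<longlonglongrightarrow> 2 *\<^sub>R x + 0 *\<^sub>R v"
        using LIMSEQ_inverse_real_of_nat by (intro tendsto_intros) (simp add: inverse_eq_divide)
      then have "(\<lambda>n. tau (2 *\<^sub>R x + (1 / real (Suc n)) *\<^sub>R v)) \<longlonglongrightarrow> tau (2 *\<^sub>R x)"
        using isCont_tendsto_compose[OF c] by simp
      then show "(\<lambda>n. g n v) \<longlonglongrightarrow> complex_of_real (tau (2 *\<^sub>R x) * ?T v) * ?e v"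
        unfolding g_def by (intro tendsto_intros)
    qed
    show "AE v in lborel. norm (g n v) \<le> ?T v" for n
    proof (intro AE_I2)
      fix v :: "real^'d"
      show "norm (g n v) \<le> ?T v"
        unfolding g_def norm_mult norm_exp_minus_i norm_of_real abs_mult
        using tau_bounds[of "2 *\<^sub>R x + (1 / real (Suc n)) *\<^sub>R v"] Tau_nonneg[of "(1/2) *\<^sub>R v"] by (simp add: mult_left_le_one_le)
    qed
  qed (auto simp: g_def[abs_def])
  moreover have "(LINT v|lborel. complex_of_real (tau (2 *\<^sub>R x) * ?T v) * ?e v) = complex_of_real (?q * (2 ^ CARD('d) * (tau (2 *\<^sub>R x) * tau (2 *\<^sub>R \<eta>))))"
  proof -
    let ?h = "\<lambda>w. complex_of_real (Tau w) * exp (\<i> * complex_of_real (- (2 *\<^sub>R \<eta>) \<bullet> w))"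
    have "(LINT v|lborel. complex_of_real (tau (2 *\<^sub>R x) * ?T v) * ?e v) = (LINT v|lborel. complex_of_real (tau (2 *\<^sub>R x)) * ?h (0 + (1/2) *\<^sub>R v))"
      by (intro Bochner_Integration.integral_cong refl) (simp add: mult_ac)
    also have "\<dots> = complex_of_real (tau (2 *\<^sub>R x)) * ((LINT w|lborel. ?h w) /\<^sub>R \<bar>1/2\<bar> ^ CARD('d))"
      unfolding integral_mult_right_zero using integral_affine[of "1/2" ?h 0] by simp
    also have "(LINT w|lborel. ?h w) = complex_of_real (?q * tau (2 *\<^sub>R \<eta>))"
      using Tau_inversion[of "- (2 *\<^sub>R \<eta>)"] by (simp add: tau_minus)
    finally show ?thesis by (simp add: power_divide scaleR_conv_of_real mult_ac)
  qed
  ultimately have "(\<lambda>n. cmod (LINT v|lborel. g n v) / ?q) \<longlonglongrightarrow> cmod (complex_of_real (?q * (2 ^ CARD('d) * (tau (2 *\<^sub>R x) * tau (2 *\<^sub>R \<eta>))))) / ?q"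
    by (intro tendsto_intros) auto
  moreover have "cmod (complex_of_real (?q * (2 ^ CARD('d) * (tau (2 *\<^sub>R x) * tau (2 *\<^sub>R \<eta>))))) / ?q = 2 ^ CARD('d) * (tau (2 *\<^sub>R x) * tau (2 *\<^sub>R \<eta>))"
    unfolding norm_of_real using tau_bounds by (simp add: abs_mult)
  ultimately show ?thesis by (simp only: mod)
qed

text \<open>Fatou takes the place of a pointwise lower bound. Under the estimate the r-th power of
  the rescaled symbol has an integral of order at most R^(-d) R^(d r / 2), which tends to 0 for r <
  2, whereas its pointwise limit is continuous and positive at the origin.\<close>

lemma steep_symbol_unbounded:
  assumes C: "C < top" and r: "1 \<le> r" "r < 2"
    and est: "\<And>R. 1 \<le> R \<Longrightarrow> Lp_norm (ennreal r) (sympl_fourier (chirp (1/2) R :: 'd::finite phase_space \<Rightarrow> complex))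
      \<le> C * schatten_norm_ext (ennreal r) (chirp_op (1/2) R :: (real^'d \<Rightarrow> complex) \<Rightarrow> _)"
  shows False
proof -
  define D where "D = CARD('d)"
  define c where "c = enn2real C"
  let ?a = "\<lambda>n (z :: 'd phase_space). cmod (sympl_fourier (chirp (1/2) (real (Suc n))) (real (Suc n) *\<^sub>R fst z, snd z))"
  let ?g = "\<lambda>z :: 'd phase_space. (2 ^ D * (tau (2 *\<^sub>R fst z) * tau (2 *\<^sub>R snd z))) powr r"
  define K where "K = (c * 20 ^ D) powr r"
  have m: "sympl_fourier (chirp (1/2) (real (Suc n))) \<in> borel_measurable (borel :: 'd phase_space measure)" for n
    using smooth_continuous[OF smooth_sympl_fourier[OF cts_supported_chirp[of "real (Suc n)" "1/2"]], THEN borel_measurable_continuous_onI] by simp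
  have c2: "continuous_on UNIV (\<lambda>z :: 'd phase_space. ?a n z powr r)" for n
  proof (rule continuous_on_powr')
    have F: "continuous_on UNIV (sympl_fourier (chirp (1/2) (real (Suc n))) :: 'd phase_space \<Rightarrow> complex)"
      using smooth_continuous[OF smooth_sympl_fourier[OF cts_supported_chirp[of "real (Suc n)" "1/2"]]] by simp
    have "continuous_on UNIV (\<lambda>z :: 'd phase_space. (real (Suc n) *\<^sub>R fst z, snd z))" by (intro continuous_intros)
    from continuous_on_norm[OF continuous_on_compose2[OF F this subset_UNIV]]
    show "continuous_on UNIV (?a n)" .
  qed (use r in auto)
  then have m2: "(\<lambda>z. ennreal (?a n z powr r)) \<in> borel_measurable borel" for n
    using measurable_compose[OF borel_measurable_continuous_onI[OF c2] measurable_ennreal] by simp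
  have up: "(\<integral>\<^sup>+z. ennreal (?a n z powr r) \<partial>lborel) \<le> ennreal (K * real (Suc n) powr (- (real D * (2 - r) / 2)))" for n
  proof -
    define R where "R = real (Suc n)"
    have R: "1 \<le> R" by (simp add: R_def)
    let ?F = "sympl_fourier (chirp (1/2) R) :: 'd phase_space \<Rightarrow> complex"
    let ?B = "20 ^ D * R powr (real D / 2)"
    have "Lp_norm (ennreal r) ?F \<le> C * ennreal ?B"
      using order_trans[OF schatten_norm_ext_le[OF extends_to_chirp_kernel[OF R]] steep_schatten[OF R r(1)], where 'd1='d]
      unfolding D_def by (intro order_trans[OF est[OF R]] mult_left_mono) auto
    also have "\<dots> = ennreal (c * ?B)" using C by (simp add: c_def ennreal_mult)
    finally have "(\<integral>\<^sup>+z. ennreal (cmod (?F z) powr r) \<partial>lborel) \<le> ennreal ((c * ?B) powr r)"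
      using r by (intro epowr_le_ennrealD) (auto simp: Lp_norm_def c_def)
    \<comment> \<open>Only the first variable is rescaled, hence the Jacobian R^(-d) and not
      R^(-2d).\<close>
    moreover have "(\<integral>\<^sup>+z. ennreal (?a n z powr r) \<partial>lborel) = ennreal (1 / R ^ D) * (\<integral>\<^sup>+z. ennreal (cmod (?F z) powr r) \<partial>lborel)"
    proof -
      have mF: "(\<lambda>z. ennreal (cmod (?F z) powr r)) \<in> borel_measurable borel" using m[of n] unfolding R_def by measurable
      have sec: "(\<lambda>x. \<integral>\<^sup>+\<eta>. ennreal (cmod (?F (x, \<eta>)) powr r) \<partial>lborel) \<in> borel_measurable borel"
        using lborel.borel_measurable_nn_integral_fst[of "\<lambda>z. ennreal (cmod (?F z) powr r)" lborel] mF by (simp add: lborel_prod)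
      have "(\<integral>\<^sup>+z. ennreal (?a n z powr r) \<partial>lborel) = (\<integral>\<^sup>+x. \<integral>\<^sup>+\<eta>. ennreal (cmod (?F (0 + R *\<^sub>R x, \<eta>)) powr r) \<partial>lborel \<partial>lborel)"
        unfolding nn_integral_lborel_pair[OF m2] by (simp add: R_def)
      also have "\<dots> = ennreal (1 / R ^ D) * (\<integral>\<^sup>+x. \<integral>\<^sup>+\<eta>. ennreal (cmod (?F (x, \<eta>)) powr r) \<partial>lborel \<partial>lborel)"
        using nn_integral_affine[OF _ sec, of R 0] R by (simp add: D_def)
      finally show ?thesis unfolding nn_integral_lborel_pair[OF mF] .
    qed
    ultimately have "(\<integral>\<^sup>+z. ennreal (?a n z powr r) \<partial>lborel) \<le> ennreal (1 / R ^ D) * ennreal ((c * ?B) powr r)"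
      by (simp add: mult_left_mono)
    also have "\<dots> = ennreal (K * R powr (- (real D * (2 - r) / 2)))"
    proof -
      have "(c * ?B) powr r = K * R powr (real D / 2 * r)"
        unfolding K_def mult.assoc[symmetric] by (simp only: powr_mult[of "c * 20 ^ D"] powr_powr)
      moreover have "1 / R ^ D * R powr (real D / 2 * r) = R powr (- (real D * (2 - r) / 2))"
      proof -
        have "- (real D * (2 - r) / 2) = real D / 2 * r - real D" by (simp add: field_simps)
        then show ?thesis using R powr_realpow[of R D] by (simp add: powr_diff)
      qed
      ultimately have "1 / R ^ D * (c * ?B) powr r = K * R powr (- (real D * (2 - r) / 2))" by (simp only: mult.left_commute)
      then show ?thesis using R by (simp flip: ennreal_mult)
    qed
    finally show ?thesis by (simp add: R_def)
  qed
  have lim: "(\<lambda>n. ennreal (?a n z powr r)) \<longlonglongrightarrow> ennreal (?g z)" for z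
    using steep_symbol_limit[of "fst z" "snd z", folded D_def] r by (intro tendsto_ennrealI tendsto_powr' tendsto_const) auto
  have "(\<integral>\<^sup>+z. ennreal (?g z) \<partial>lborel) = (\<integral>\<^sup>+z. liminf (\<lambda>n. ennreal (?a n z powr r)) \<partial>lborel)"
  proof (intro nn_integral_cong)
    show "ennreal (?g z) = liminf (\<lambda>n. ennreal (?a n z powr r))" for z
      by (rule lim_imp_Liminf[OF _ lim, symmetric]) simp
  qed
  also have "\<dots> \<le> liminf (\<lambda>n. \<integral>\<^sup>+z. ennreal (?a n z powr r) \<partial>lborel)"
    using m2 by (intro nn_integral_liminf) simp
  also have "\<dots> \<le> liminf (\<lambda>n. ennreal (K * real (Suc n) powr (- (real D * (2 - r) / 2))))"
    by (intro Liminf_mono always_eventually allI up)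
  also have "\<dots> = 0"
  proof -
    have "0 < real D * (2 - r) / 2" using r by (simp add: D_def)
    then have "(\<lambda>n. K * real (Suc n) powr (- (real D * (2 - r) / 2))) \<longlonglongrightarrow> 0" by real_asymp
    from tendsto_ennrealI[OF this] show ?thesis by (intro lim_imp_Liminf) auto
  qed
  finally have "(\<integral>\<^sup>+z. ennreal (?g z) \<partial>lborel) = 0" by simp
  moreover have gc: "continuous_on UNIV ?g"
    using r by (intro continuous_on_powr' continuous_intros) (auto intro!: mult_nonneg_nonneg tau_bounds)
  moreover have "(\<lambda>z. ennreal (?g z)) \<in> borel_measurable lborel"
    using borel_measurable_continuous_onI[OF gc] by measurable
  ultimately have "AE z in lborel. ennreal (?g z) = 0" by (simp add: nn_integral_0_iff_AE)
  \<comment> \<open>The zero set of the limit is closed and of full measure, hence contains the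
    origin, where \<open>tau\<close> is 1.\<close>
  then have "AE z in lborel. z \<in> {z. ?g z \<le> 0}" by eventually_elim (simp add: ennreal_eq_0_iff)
  then have "AE z in lebesgue. z \<in> {z. ?g z \<le> 0}" by (rule AE_completion)
  moreover have "closed {z. ?g z \<le> 0}" using gc by (intro closed_Collect_le) auto
  ultimately have "(0, 0) \<in> {z. ?g z \<le> 0}" by (intro mem_closed_if_AE_lebesgue)
  then show False by simp
qed

section \<open>Assembly over the ranges of exponents\<close>

lemma sympl_fourier_fun_chirp:
  fixes R :: real
  assumes "1 \<le> R"
  shows "sympl_fourier_fun (int_dist (chirp \<theta> R :: 'd::finite phase_space \<Rightarrow> complex)) = sympl_fourier (chirp \<theta> R)"
  by (rule sympl_fourier_fun_int_dist[OF cts_supported_chirp[OF assms]])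

theorem corollary1p3:
  assumes "CARD('d::finite) \<ge> 2"
  shows
    "(\<forall>p \<in> {1..<2} \<union> {ennreal (2 + 1 / (real CARD('d) - 1))<..top}.
        \<not> (\<exists>C<top. \<forall>R\<ge>(1::real). \<forall>z0 :: 'd phase_space. \<forall>u.
              compactly_supported_dist u \<and> dist_supp u \<subseteq> cball z0 R \<longrightarrow>
              Lp_norm p (sympl_fourier_fun u)
                \<le> C * schatten_norm_ext p (weyl (sympl_fourier_dist u))))
     \<and>
     (\<forall>p \<in> {1..<ennreal (2 - 1 / real CARD('d))} \<union> {2<..top}.
        \<not> (\<exists>C<top. \<forall>R\<ge>(1::real). \<forall>z0 :: 'd phase_space. \<forall>u.
              compactly_supported_dist u \<and> dist_supp u \<subseteq> cball z0 R \<longrightarrow>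
              schatten_norm_ext p (weyl (sympl_fourier_dist u))
                \<le> C * Lp_norm p (sympl_fourier_fun u)))"
proof (intro conjI ballI notI)
  fix p :: ennreal
  assume p: "p \<in> {1..<2} \<union> {ennreal (2 + 1 / (real CARD('d) - 1))<..top}"
  assume "\<exists>C<top. \<forall>R\<ge>(1::real). \<forall>z0 :: 'd phase_space. \<forall>u.
      compactly_supported_dist u \<and> dist_supp u \<subseteq> cball z0 R \<longrightarrow>
      Lp_norm p (sympl_fourier_fun u) \<le> C * schatten_norm_ext p (weyl (sympl_fourier_dist u))"
  then obtain C where C: "C < top" and adm: "\<forall>R\<ge>(1::real). \<forall>z0 :: 'd phase_space. \<forall>u.
      compactly_supported_dist u \<and> dist_supp u \<subseteq> cball z0 R \<longrightarrow>
      Lp_norm p (sympl_fourier_fun u) \<le> C * schatten_norm_ext p (weyl (sympl_fourier_dist u))" by blast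
  \<comment> \<open>The assumed constant serves both values of \<theta>; the exponent decides which
    of them leads to the contradiction.\<close>
  have est: "Lp_norm p (sympl_fourier (chirp \<theta> R :: 'd phase_space \<Rightarrow> complex)) \<le> C * schatten_norm_ext p (chirp_op \<theta> R :: (real^'d \<Rightarrow> complex) \<Rightarrow> _)" if "1 \<le> R" for \<theta> R
    using chirp_admissible[OF that adm, of \<theta>] unfolding sympl_fourier_fun_chirp[OF that] .
  show False
  proof (cases p)
    case top
    then show False using flat_symbol_unbounded_top[OF C] est by blast
  next
    case (real r)
    show False
    proof (cases "p < 2")
      case True
      \<comment> \<open>The upper range begins no lower than 2, so an exponent below 2 can only come
        from the first interval.\<close>
      have "ennreal 2 \<le> ennreal (2 + 1 / (real CARD('d) - 1))" using assms by (intro ennreal_leI) simp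
      then have "\<not> ennreal (2 + 1 / (real CARD('d) - 1)) < p"
        using True less_le_trans[of p 2] by (simp add: not_less less_imp_le del: ennreal_plus)
      then have "1 \<le> p" using p by simp
      then have "1 \<le> r" "r < 2" using True real by (simp_all add: ennreal_less_iff flip: ennreal_1 ennreal_numeral)
      then show False using steep_symbol_unbounded[OF C, of r] est unfolding real by blast
    next
      case False
      then have "ennreal (2 + 1 / (real CARD('d) - 1)) < ennreal r" using p real by auto
      then have "2 + 1 / (real CARD('d) - 1) < r" using assms by (subst (asm) ennreal_less_iff) auto
      moreover have "0 \<le> 1 / (real CARD('d) - 1)" using assms by simp
      ultimately have "2 < r" by linarith
      then show False using flat_symbol_unbounded[OF C, of r] est unfolding real by blast
    qed
  qed
next
  fix p :: ennreal
  assume p: "p \<in> {1..<ennreal (2 - 1 / real CARD('d))} \<union> {2<..top}"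
  assume "\<exists>C<top. \<forall>R\<ge>(1::real). \<forall>z0 :: 'd phase_space. \<forall>u.
      compactly_supported_dist u \<and> dist_supp u \<subseteq> cball z0 R \<longrightarrow>
      schatten_norm_ext p (weyl (sympl_fourier_dist u)) \<le> C * Lp_norm p (sympl_fourier_fun u)"
  then obtain C where C: "C < top" and adm: "\<forall>R\<ge>(1::real). \<forall>z0 :: 'd phase_space. \<forall>u.
      compactly_supported_dist u \<and> dist_supp u \<subseteq> cball z0 R \<longrightarrow>
      schatten_norm_ext p (weyl (sympl_fourier_dist u)) \<le> C * Lp_norm p (sympl_fourier_fun u)" by blast
  have est: "schatten_norm_ext p (chirp_op \<theta> R :: (real^'d \<Rightarrow> complex) \<Rightarrow> _) \<le> C * Lp_norm p (sympl_fourier (chirp \<theta> R :: 'd phase_space \<Rightarrow> complex))" if "1 \<le> R" for \<theta> R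
    using chirp_admissible[OF that adm, of \<theta>] unfolding sympl_fourier_fun_chirp[OF that] .
  show False
  proof (cases p)
    case top
    then show False using steep_operator_unbounded_top[OF C] est by blast
  next
    case (real r)
    show False
    proof (cases "2 < p")
      case True
      then have "2 < r" using real by (simp add: ennreal_less_iff flip: ennreal_numeral)
      then show False using steep_operator_unbounded[OF C, of r] est unfolding real by blast
    next
      case False
      then have "1 \<le> p" "p < ennreal (2 - 1 / real CARD('d))" using p by auto
      then have "1 \<le> r" "r < 2 - 1 / real CARD('d)" using real by (simp_all add: ennreal_less_iff flip: ennreal_1)
      moreover have "0 < 1 / real CARD('d)" by simp
      ultimately have "1 \<le> r" "r < 2" by linarith+
      then show False using flat_operator_unbounded[OF C, of r] est unfolding real by blast
    qed
  qed
qed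

end
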